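(* For any $T>0$, $$\{(u^f(\cdot,T),u^f_t(\cdot,T)) : f\in L^2(0,T)\}\subset W_0\times W_{-1}.$$
   Context: Setting. $N\ge 1$, $\ell>0$, $0=a_0<a_1<\cdots<a_N<a_{N+1}=\ell$, masses $M_j>0$ ($1\le j\le N$). Real potentials $q_j$ on $(a_j,a_{j+1})$, $j=0,\dots,N$, where $q_j$ extends to $C[a_j,a_{j+1}]$ for $j=0,1,2$ and to $C^{j-2}[a_j,a_{j+1}]$ for $j>2$; $q$ is the function equal to $q_j$ on $(a_j,a_{j+1})$. $H^j$ is the usual Sobolev space, $H^0=L^2$. System (S) with control $f$: $u_j(x,t)$ on $(a_j,a_{j+1})$ and $h_j(t)$ satisfy $\partial_t^2u_j-\partial_x^2u_j+q_ju_j=0$ for $x\in(a_j,a_{j+1})$, $j=0,\dots,N$; $u_j=0$ for $t\le 0$ ($j=0,\dots,N$), $h_j=0$ for $t\le 0$ ($j=1,\dots,N$); $u_{j-1}(a_j^-,t)=h_j(t)=u_j(a_j^+,t)$ and $M_jh_j''(t)=\partial_xu_j(a_j^+,t)-\partial_xu_{j-1}(a_j^-,t)$ for $j=1,\dots,N$; $u_N(\ell^-,t)=0$; $u_0(0^+,t)=f(t)$. The tuple $(u_0,\dots,u_N)$ of string displacements (the masses being disregarded) is denoted $u^f$, and $u^f_t$ is its time derivative. For $f\in L^2(0,T)$ the solution is the unique weak solution: writing $u$ for the function equal to $u_j$ on $(a_j,a_{j+1})$, $u\in C([0,T];L^2(0,\ell))$, $h_j\in L^2(0,T)$, and for every $w$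 continuous on $[0,\ell]\times[0,T]$, $C^2$ on each $[a_j,a_{j+1}]\times[0,T]$, with $w(0,t)=w(\ell,t)=0$ and $w(\cdot,T)=w_t(\cdot,T)=0$, $$\int_0^T\!\!\int_0^\ell u\,(w_{tt}-w_{xx}+qw)\,dx\,dt+\sum_{j=1}^N\int_0^T h_j(t)\big(M_jw_{tt}(a_j,t)-w_x(a_j^+,t)+w_x(a_j^-,t)\big)dt=\int_0^Tf(t)\,w_x(0,t)\,dt .$$ Spaces. $\theta^{-1}(0,a_1)=\{v\in H^1(0,a_1):v(0)=0\}'$ (dual space), $$\tilde W_0=\bigoplus_{j=0}^NH^j(a_j,a_{j+1}),\qquad \tilde W_{-1}=\theta^{-1}(0,a_1)\oplus\Big(\bigoplus_{j=1}^NH^{j-1}(a_j,a_{j+1})\Big).$$ Let $L=\frac{d^2}{dx^2}-q(x)$, acting on distributions on $(0,a_1)\cup\dots\cup(a_N,\ell)$. For $1\le j\le N$, $\phi$ satisfies Condition $\mathcal C^i$ at $x=a_j$ if $\frac{\partial}{\partial x}L^n\phi(a_j^-)=\frac{\partial}{\partial x}L^n\phi(a_j^+)-M_jL^{n+1}\phi(a_j^+)$ for $0\le n\le\lceil i/2\rceil-2$, and $L^n\phi(a_j^-)=L^n\phi(a_j^+)$ for $0\le n\le\lceil i/2\rceil-1$. $\phi$ satisfies Condition $\mathcal C^i$ at $x=\ell$ if $L^n\phi(\ell)=0$ for $0\le n\le\lceil i/2\rceil-1$. For $i\le0$ Condition $\mathcal C^i$ is vacuous. $\phi$ satisfies Condition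 $\mathcal C^i_*$ if it satisfies Condition $\mathcal C^{j-1+i}$ at $x=a_j$ for all $j=1,\dots,N+1$. For $i=0,-1$, $W_i=\{\phi\in\tilde W_i:\phi\text{ satisfies Condition }\mathcal C^i_*\}$. *)

theory Defs
  imports "HOL-Analysis.Analysis"
begin

section \<open>Function spaces on a bounded open interval\<close>

definition L2 :: "real \<Rightarrow> real \<Rightarrow> (real \<Rightarrow> real) set" where
  "L2 a b = {g. g \<in> borel_measurable (lebesgue_on {a<..<b}) \<and>
                integrable (lebesgue_on {a<..<b}) (\<lambda>x. (g x)\<^sup>2)}"

definition locally_integrable :: "real \<Rightarrow> real \<Rightarrow> (real \<Rightarrow> real) \<Rightarrow> bool" where
  "locally_integrable a b g \<longleftrightarrow>
     (\<forall>c d. a < c \<and> d < b \<longrightarrow> integrable (lebesgue_on {c..d}) g)"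

definition test_functions :: "real \<Rightarrow> real \<Rightarrow> (real \<Rightarrow> real) set" where
  "test_functions a b =
     {\<eta>. (\<forall>k. (deriv ^^ k) \<eta> differentiable_on UNIV) \<and> closure {x. \<eta> x \<noteq> 0} \<subseteq> {a<..<b}}"

definition weak_derivative :: "real \<Rightarrow> real \<Rightarrow> (real \<Rightarrow> real) \<Rightarrow> (real \<Rightarrow> real) \<Rightarrow> bool" where
  "weak_derivative a b g g' \<longleftrightarrow>
     locally_integrable a b g \<and> locally_integrable a b g' \<and>
     (\<forall>\<eta>\<in>test_functions a b.
        (LINT x|lebesgue_on {a<..<b}. g x * deriv \<eta> x) =
        - (LINT x|lebesgue_on {a<..<b}. g' x * \<eta> x))"

definition sobolev :: "nat \<Rightarrow> real \<Rightarrow> real \<Rightarrow> (real \<Rightarrow> real) set" where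
  "sobolev k a b =
     {g. \<exists>D :: nat \<Rightarrow> real \<Rightarrow> real. D 0 = g \<and> (\<forall>i\<le>k. D i \<in> L2 a b) \<and>
           (\<forall>i<k. weak_derivative a b (D i) (D (Suc i)))}"

text \<open>\<open>has_trace a b g p c\<close>: the continuous representative on \<open>[a, b]\<close> of the class of \<open>g\<close>
  exists and takes the value \<open>c\<close> at \<open>p\<close>. For \<open>p = a\<close> this is \<open>g(a\<^sup>+) = c\<close>, for \<open>p = b\<close> it is
  \<open>g(b\<^sup>-) = c\<close>.\<close>

definition has_trace :: "real \<Rightarrow> real \<Rightarrow> (real \<Rightarrow> real) \<Rightarrow> real \<Rightarrow> real \<Rightarrow> bool" where
  "has_trace a b g p c \<longleftrightarrow>
     (\<exists>G. continuous_on {a..b} G \<and> (AE x in lebesgue_on {a<..<b}. G x = g x) \<and> G p = c)"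

text \<open>\<open>C\<^sup>k\<close> on a compact interval, with one-sided derivatives at the end points.\<close>

definition Ck_on :: "nat \<Rightarrow> real \<Rightarrow> real \<Rightarrow> (real \<Rightarrow> real) \<Rightarrow> bool" where
  "Ck_on k a b g \<longleftrightarrow>
     (\<exists>D :: nat \<Rightarrow> real \<Rightarrow> real. D 0 = g \<and> (\<forall>i\<le>k. continuous_on {a..b} (D i)) \<and>
        (\<forall>i<k. \<forall>x\<in>{a..b}. (D i has_real_derivative D (Suc i) x) (at x within {a..b})))"

section \<open>Distributions on an interval\<close>

text \<open>A distribution on \<open>(a, b)\<close> is given by its values on test functions; its values on other
  arguments are irrelevant and never used.\<close>

type_synonym distr = "(real \<Rightarrow> real) \<Rightarrow> real"

definition regular_distr :: "real \<Rightarrow> real \<Rightarrow> (real \<Rightarrow> real) \<Rightarrow> distr" where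
  "regular_distr a b g = (\<lambda>\<eta>. LINT x|lebesgue_on {a<..<b}. g x * \<eta> x)"

definition represents :: "real \<Rightarrow> real \<Rightarrow> (real \<Rightarrow> real) \<Rightarrow> distr \<Rightarrow> bool" where
  "represents a b g \<Lambda> \<longleftrightarrow>
     locally_integrable a b g \<and> (\<forall>\<eta>\<in>test_functions a b. \<Lambda> \<eta> = regular_distr a b g \<eta>)"

definition sobolev_distr :: "nat \<Rightarrow> real \<Rightarrow> real \<Rightarrow> distr set" where
  "sobolev_distr k a b = {\<Lambda>. \<exists>g\<in>sobolev k a b. represents a b g \<Lambda>}"

definition H1_left :: "real \<Rightarrow> real \<Rightarrow> (real \<Rightarrow> real) set" where
  "H1_left a b = {v \<in> sobolev 1 a b. has_trace a b v a 0}"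

definition H1_left_dual :: "real \<Rightarrow> real \<Rightarrow> ((real \<Rightarrow> real) \<Rightarrow> real) set" where
  "H1_left_dual a b =
     {F. (\<forall>v\<in>H1_left a b. \<forall>w\<in>H1_left a b. F (\<lambda>x. v x + w x) = F v + F w) \<and>
         (\<forall>c. \<forall>v\<in>H1_left a b. F (\<lambda>x. c * v x) = c * F v) \<and>
         (\<exists>C. \<forall>v\<in>H1_left a b. \<forall>v'\<in>L2 a b. weak_derivative a b v v' \<longrightarrow>
            \<bar>F v\<bar> \<le> C * sqrt ((LINT x|lebesgue_on {a<..<b}. (v x)\<^sup>2) +
                               (LINT x|lebesgue_on {a<..<b}. (v' x)\<^sup>2)))}"

text \<open>Distributions induced by the elements of the dual space \<open>{v \<in> H\<^sup>1(a,b). v(a) = 0}'\<close>.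
  Test functions vanish near \<open>b\<close>, so functionals differing by a multiple of \<open>v \<mapsto> v(b)\<close> induce
  the same distribution.\<close>

definition theta_neg1 :: "real \<Rightarrow> real \<Rightarrow> distr set" where
  "theta_neg1 a b = {\<Lambda>. \<exists>F\<in>H1_left_dual a b. \<forall>\<eta>\<in>test_functions a b. \<Lambda> \<eta> = F \<eta>}"

section \<open>The operator \<open>L = d\<^sup>2/dx\<^sup>2 - q\<close> and the compatibility conditions\<close>

text \<open>\<open>k = L g\<close> in the sense of distributions on \<open>(a, b)\<close>. Boundary values are only ever taken of
  powers \<open>L\<^sup>n \<phi>\<close> that are regular distributions, so a relation between functions suffices.\<close>

definition is_L :: "(real \<Rightarrow> real) \<Rightarrow> real \<Rightarrow> real \<Rightarrow> (real \<Rightarrow> real) \<Rightarrow> (real \<Rightarrow> real) \<Rightarrow> bool" where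
  "is_L q a b g k \<longleftrightarrow>
     locally_integrable a b g \<and> locally_integrable a b (\<lambda>x. q x * g x) \<and>
     locally_integrable a b k \<and>
     (\<forall>\<eta>\<in>test_functions a b.
        (LINT x|lebesgue_on {a<..<b}. k x * \<eta> x) =
        (LINT x|lebesgue_on {a<..<b}. g x * deriv (deriv \<eta>) x) -
        (LINT x|lebesgue_on {a<..<b}. q x * g x * \<eta> x))"

definition is_L_pow ::
  "(real \<Rightarrow> real) \<Rightarrow> real \<Rightarrow> real \<Rightarrow> nat \<Rightarrow> distr \<Rightarrow> (real \<Rightarrow> real) \<Rightarrow> bool" where
  "is_L_pow q a b n \<Lambda> k \<longleftrightarrow>
     (\<exists>g :: nat \<Rightarrow> real \<Rightarrow> real. represents a b (g 0) \<Lambda> \<and>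
        (\<forall>i<n. is_L q a b (g i) (g (Suc i))) \<and> g n = k)"

text \<open>\<open>(L\<^sup>n \<Lambda>)(p) = c\<close> and \<open>(\<partial>\<^sub>x L\<^sup>n \<Lambda>)(p) = c\<close> at an end point \<open>p\<close> of \<open>(a, b)\<close>, including the
  assertion that these boundary values exist.\<close>

definition L_pow_value ::
  "(real \<Rightarrow> real) \<Rightarrow> real \<Rightarrow> real \<Rightarrow> nat \<Rightarrow> distr \<Rightarrow> real \<Rightarrow> real \<Rightarrow> bool" where
  "L_pow_value q a b n \<Lambda> p c \<longleftrightarrow> (\<exists>k. is_L_pow q a b n \<Lambda> k \<and> has_trace a b k p c)"

definition L_pow_deriv_value ::
  "(real \<Rightarrow> real) \<Rightarrow> real \<Rightarrow> real \<Rightarrow> nat \<Rightarrow> distr \<Rightarrow> real \<Rightarrow> real \<Rightarrow> bool" where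
  "L_pow_deriv_value q a b n \<Lambda> p c \<longleftrightarrow>
     (\<exists>k k'. is_L_pow q a b n \<Lambda> k \<and> weak_derivative a b k k' \<and> has_trace a b k' p c)"

text \<open>A tuple \<open>\<phi>\<close> has the component \<open>\<phi> j\<close> on \<open>(a j, a (j + 1))\<close>, \<open>j = 0, \<dots>, N\<close>.\<close>

definition cond_C_mass ::
  "(nat \<Rightarrow> real) \<Rightarrow> (nat \<Rightarrow> real) \<Rightarrow> (real \<Rightarrow> real) \<Rightarrow> int \<Rightarrow> nat \<Rightarrow> (nat \<Rightarrow> distr) \<Rightarrow> bool" where
  "cond_C_mass a M q i j \<phi> \<longleftrightarrow>
     (\<forall>n::nat. int n \<le> \<lceil>real_of_int i / 2\<rceil> - 2 \<longrightarrow>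
        (\<exists>\<alpha> \<beta> \<gamma>. L_pow_deriv_value q (a (j - 1)) (a j) n (\<phi> (j - 1)) (a j) \<alpha> \<and>
                 L_pow_deriv_value q (a j) (a (j + 1)) n (\<phi> j) (a j) \<beta> \<and>
                 L_pow_value q (a j) (a (j + 1)) (n + 1) (\<phi> j) (a j) \<gamma> \<and>
                 \<alpha> = \<beta> - M j * \<gamma>)) \<and>
     (\<forall>n::nat. int n \<le> \<lceil>real_of_int i / 2\<rceil> - 1 \<longrightarrow>
        (\<exists>\<alpha>. L_pow_value q (a (j - 1)) (a j) n (\<phi> (j - 1)) (a j) \<alpha> \<and>
             L_pow_value q (a j) (a (j + 1)) n (\<phi> j) (a j) \<alpha>))"

definition cond_C_end ::
  "nat \<Rightarrow> (nat \<Rightarrow> real) \<Rightarrow> (real \<Rightarrow> real) \<Rightarrow> int \<Rightarrow> (nat \<Rightarrow> distr) \<Rightarrow> bool" where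
  "cond_C_end N a q i \<phi> \<longleftrightarrow>
     (\<forall>n::nat. int n \<le> \<lceil>real_of_int i / 2\<rceil> - 1 \<longrightarrow>
        L_pow_value q (a N) (a (N + 1)) n (\<phi> N) (a (N + 1)) 0)"

definition cond_C_star ::
  "nat \<Rightarrow> (nat \<Rightarrow> real) \<Rightarrow> (nat \<Rightarrow> real) \<Rightarrow> (real \<Rightarrow> real) \<Rightarrow> int \<Rightarrow> (nat \<Rightarrow> distr) \<Rightarrow> bool" where
  "cond_C_star N a M q i \<phi> \<longleftrightarrow>
     (\<forall>j\<in>{1..N}. cond_C_mass a M q (int j - 1 + i) j \<phi>) \<and>
     cond_C_end N a q (int (N + 1) - 1 + i) \<phi>"

definition W0_tilde :: "nat \<Rightarrow> (nat \<Rightarrow> real) \<Rightarrow> (nat \<Rightarrow> distr) set" where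
  "W0_tilde N a = {\<phi>. \<forall>j\<le>N. \<phi> j \<in> sobolev_distr j (a j) (a (j + 1))}"

definition Wneg1_tilde :: "nat \<Rightarrow> (nat \<Rightarrow> real) \<Rightarrow> (nat \<Rightarrow> distr) set" where
  "Wneg1_tilde N a =
     {\<phi>. \<phi> 0 \<in> theta_neg1 (a 0) (a 1) \<and>
         (\<forall>j\<in>{1..N}. \<phi> j \<in> sobolev_distr (j - 1) (a j) (a (j + 1)))}"

definition W0 ::
  "nat \<Rightarrow> (nat \<Rightarrow> real) \<Rightarrow> (nat \<Rightarrow> real) \<Rightarrow> (real \<Rightarrow> real) \<Rightarrow> (nat \<Rightarrow> distr) set" where
  "W0 N a M q = {\<phi> \<in> W0_tilde N a. cond_C_star N a M q 0 \<phi>}"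

definition Wneg1 ::
  "nat \<Rightarrow> (nat \<Rightarrow> real) \<Rightarrow> (nat \<Rightarrow> real) \<Rightarrow> (real \<Rightarrow> real) \<Rightarrow> (nat \<Rightarrow> distr) set" where
  "Wneg1 N a M q = {\<phi> \<in> Wneg1_tilde N a. cond_C_star N a M q (- 1) \<phi>}"

section \<open>The string with attached masses\<close>

text \<open>In \<open>potential\<close> the truncated difference \<open>j - 2\<close> is \<open>0\<close> for \<open>j = 0, 1, 2\<close>, as required.\<close>

definition potential :: "nat \<Rightarrow> (nat \<Rightarrow> real) \<Rightarrow> (real \<Rightarrow> real) \<Rightarrow> bool" where
  "potential N a q \<longleftrightarrow>
     (\<forall>j\<le>N. \<exists>Q. Ck_on (j - 2) (a j) (a (j + 1)) Q \<and> (\<forall>x\<in>{a j<..<a (j + 1)}. q x = Q x))"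

definition string_with_masses ::
  "nat \<Rightarrow> real \<Rightarrow> (nat \<Rightarrow> real) \<Rightarrow> (nat \<Rightarrow> real) \<Rightarrow> (real \<Rightarrow> real) \<Rightarrow> bool" where
  "string_with_masses N l a M q \<longleftrightarrow>
     N \<ge> 1 \<and> l > 0 \<and> a 0 = 0 \<and> a (N + 1) = l \<and> (\<forall>j\<le>N. a j < a (j + 1)) \<and>
     (\<forall>j\<in>{1..N}. M j > 0) \<and> potential N a q"

text \<open>\<open>w\<close> is \<open>C\<^sup>2\<close> on the closed rectangle \<open>X \<times> I\<close> with the listed partial derivatives
  (one-sided on the boundary).\<close>

definition C2_rect ::
  "real set \<Rightarrow> real set \<Rightarrow> (real \<Rightarrow> real \<Rightarrow> real) \<Rightarrow> (real \<Rightarrow> real \<Rightarrow> real) \<Rightarrow> (real \<Rightarrow> real \<Rightarrow> real) \<Rightarrow>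
   (real \<Rightarrow> real \<Rightarrow> real) \<Rightarrow> (real \<Rightarrow> real \<Rightarrow> real) \<Rightarrow> (real \<Rightarrow> real \<Rightarrow> real) \<Rightarrow> bool" where
  "C2_rect X I w wx wt wxx wxt wtt \<longleftrightarrow>
     (\<forall>g\<in>{w, wx, wt, wxx, wxt, wtt}. continuous_on (X \<times> I) (\<lambda>(x, t). g x t)) \<and>
     (\<forall>x\<in>X. \<forall>t\<in>I.
        ((\<lambda>y. w y t) has_real_derivative wx x t) (at x within X) \<and>
        ((\<lambda>s. w x s) has_real_derivative wt x t) (at t within I) \<and>
        ((\<lambda>y. wx y t) has_real_derivative wxx x t) (at x within X) \<and>
        ((\<lambda>s. wx x s) has_real_derivative wxt x t) (at t within I) \<and>
        ((\<lambda>y. wt y t) has_real_derivative wxt x t) (at x within X) \<and>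
        ((\<lambda>s. wt x s) has_real_derivative wtt x t) (at t within I))"

text \<open>The partial derivatives carry an index \<open>j\<close>: they are the derivatives of the restriction of
  \<open>w\<close> to \<open>[a j, a (j + 1)] \<times> [0, T]\<close>. Thus \<open>w\<^sub>x(a\<^sub>j\<^sup>+, t)\<close> is \<open>wx j (a j) t\<close> and
  \<open>w\<^sub>x(a\<^sub>j\<^sup>-, t)\<close> is \<open>wx (j - 1) (a j) t\<close>.\<close>

definition test_field ::
  "nat \<Rightarrow> real \<Rightarrow> (nat \<Rightarrow> real) \<Rightarrow> real \<Rightarrow> (real \<Rightarrow> real \<Rightarrow> real) \<Rightarrow>
   (nat \<Rightarrow> real \<Rightarrow> real \<Rightarrow> real) \<Rightarrow> (nat \<Rightarrow> real \<Rightarrow> real \<Rightarrow> real) \<Rightarrow> (nat \<Rightarrow> real \<Rightarrow> real \<Rightarrow> real) \<Rightarrow>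
   (nat \<Rightarrow> real \<Rightarrow> real \<Rightarrow> real) \<Rightarrow> (nat \<Rightarrow> real \<Rightarrow> real \<Rightarrow> real) \<Rightarrow> bool" where
  "test_field N l a T w wx wt wxx wxt wtt \<longleftrightarrow>
     continuous_on ({0..l} \<times> {0..T}) (\<lambda>(x, t). w x t) \<and>
     (\<forall>j\<le>N. C2_rect {a j..a (j + 1)} {0..T} w (wx j) (wt j) (wxx j) (wxt j) (wtt j)) \<and>
     (\<forall>t\<in>{0..T}. w 0 t = 0 \<and> w l t = 0) \<and>
     (\<forall>x\<in>{0..l}. w x T = 0) \<and> (\<forall>j\<le>N. \<forall>x\<in>{a j..a (j + 1)}. wt j x T = 0)"

text \<open>\<open>(u, h)\<close> is the weak solution on \<open>[0, T]\<close> with control \<open>f\<close>; \<open>u t x\<close> is the displacement at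
  the point \<open>x\<close> and time \<open>t\<close>, so that \<open>u t\<close> is an element of \<open>L\<^sup>2(0, l)\<close>.\<close>

definition weak_solution ::
  "nat \<Rightarrow> real \<Rightarrow> (nat \<Rightarrow> real) \<Rightarrow> (nat \<Rightarrow> real) \<Rightarrow> (real \<Rightarrow> real) \<Rightarrow> real \<Rightarrow>
   (real \<Rightarrow> real) \<Rightarrow> (real \<Rightarrow> real \<Rightarrow> real) \<Rightarrow> (nat \<Rightarrow> real \<Rightarrow> real) \<Rightarrow> bool" where
  "weak_solution N l a M q T f u h \<longleftrightarrow>
     (\<forall>t\<in>{0..T}. u t \<in> L2 0 l) \<and>
     (\<forall>t\<in>{0..T}.
        ((\<lambda>s. LINT x|lebesgue_on {0<..<l}. (u s x - u t x)\<^sup>2) \<longlongrightarrow> 0) (at t within {0..T})) \<and>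
     (\<forall>j\<in>{1..N}. h j \<in> L2 0 T) \<and>
     (\<forall>w wx wt wxx wxt wtt. test_field N l a T w wx wt wxx wxt wtt \<longrightarrow>
        (LINT t|lebesgue_on {0<..<T}.
           (\<Sum>j\<le>N. (LINT x|lebesgue_on {a j<..<a (j + 1)}.
             u t x * (wtt j x t - wxx j x t + q x * w x t)))) +
        (\<Sum>j=1..N. (LINT t|lebesgue_on {0<..<T}.
             h j t * (M j * wtt j (a j) t - wx j (a j) t + wx (j - 1) (a j) t))) =
        (LINT t|lebesgue_on {0<..<T}. f t * wx 0 0 t))"

text \<open>The tuple of string displacements at time \<open>t\<close>.\<close>

definition displacement :: "(nat \<Rightarrow> real) \<Rightarrow> (real \<Rightarrow> real \<Rightarrow> real) \<Rightarrow> real \<Rightarrow> nat \<Rightarrow> distr" where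
  "displacement a u t = (\<lambda>j. regular_distr (a j) (a (j + 1)) (u t))"

text \<open>\<open>v\<close> is the time derivative \<open>u\<^sub>t(\<cdot>, T)\<close> of the distribution valued function \<open>t \<mapsto> u(\<cdot>, t)\<close>
  on \<open>[0, T]\<close>.\<close>

definition is_velocity ::
  "nat \<Rightarrow> (nat \<Rightarrow> real) \<Rightarrow> real \<Rightarrow> (real \<Rightarrow> real \<Rightarrow> real) \<Rightarrow> (nat \<Rightarrow> distr) \<Rightarrow> bool" where
  "is_velocity N a T u v \<longleftrightarrow>
     (\<forall>j\<le>N. \<forall>\<eta>\<in>test_functions (a j) (a (j + 1)).
        ((\<lambda>t. displacement a u t j \<eta>) has_real_derivative v j \<eta>) (at T within {0..T}))"

end

theory Submission
  imports Defs
begin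

text \<open>Let \<open>J\<close> be integration from \<open>0\<close> in time. On one interval \<open>(\<alpha>, \<beta>)\<close> the weak equation, tested with
 kernels built from \<open>max 0 (\<sigma> \<plusminus> x - t) ^ 3\<close>, becomes d'Alembert's formula
 \<open>2 u(z, t) = A (t - (z - \<alpha>)) + B (t - (\<beta> - z)) - J \<integral> q u(x, t - |x - z|) dx\<close> with square integrable waves
 \<open>A\<close>, \<open>B\<close>. The fluxes at the ends are then \<open>J u\<^sub>x(\<alpha>) = h - A\<close> and \<open>J u\<^sub>x(\<beta>) = B - h\<close>, so the motion of a
 mass reads \<open>M\<^sub>j h\<^sub>j = J (h\<^sub>j - A\<^sub>j) - J (B\<^sub>j\<^sub>-\<^sub>1 - h\<^sub>j)\<close>: every mass gains one integration in time. By induction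
 \<open>u\<^sub>j = J\<^sup>j v\<^sub>j\<close> and \<open>h\<^sub>j = J\<^sup>j \<eta>\<^sub>j\<close> with \<open>v\<^sub>j\<close>, \<open>\<eta>\<^sub>j\<close> square integrable. Differentiating d'Alembert's formula in
 space trades one \<open>J\<close> for one derivative, whence \<open>u\<^sub>j(T)\<close> is in \<open>H\<^sup>j\<close>, \<open>L\<close> removes \<open>J\<^sup>2\<close>, and the compatibility
 conditions are the continuity of \<open>u\<close> and the motion of the masses with powers of \<open>J\<close> removed.\<close>

text \<open>The solution is known only weakly: \<open>f\<close> and \<open>h\<close> are merely
  square integrable, the displacement is a class in x for each t, and no trace of its derivative is
  given. So fluxes are used through primitives in time, and identities are first proved after
  several integrations. As \<open>Jt\<close> is injective on causal functions, the surplus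
  integrations can be cancelled. Test fields vanish at time T, hence all relations hold for t < T up
  to null sets; one remaining integration is what permits evaluation at T, because
  \<open>Jt g T\<close> only depends on g below T.

  The waves at the two ends of an interval are coupled with a delay equal to its length. The delay
  is positive, so the coupling is resolved in finitely many steps.

  Raising an interval by one integration needs its neighbours across the masses at the current
  level. The control keeps interval 0 at level 0, and the attainable level grows by one per mass.
  The orders of the compatibility conditions and the smoothness of the potential count the same
  integrations, two of them for each L.\<close>

lemmas LBINT_cong = Bochner_Integration.integral_cong[OF refl]

section \<open>Causal functions of time\<close>

text \<open>Borel rather than Lebesgue measurability keeps compositions with delays measurable in
  both variables. Squares are integrable only up to each finite time, so no final time enters the
  class and it is stable under delays and under \<open>Jt\<close>.\<close>

definition L2c :: "(real \<Rightarrow> real) set" where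
 "L2c = {g. g \<in> borel_measurable borel \<and> (\<forall>t\<le>0. g t = 0) \<and>
   (\<forall>n::real. (\<integral>\<^sup>+t. ennreal (indicator {..n} t * (g t)\<^sup>2) \<partial>lborel) < \<infinity>)}"

definition Jt :: "(real \<Rightarrow> real) \<Rightarrow> real \<Rightarrow> real" where
 "Jt g t = (LBINT s:{..t}. g s)"

lemma L2cD:
 assumes "g \<in> L2c"
 shows "g \<in> borel_measurable borel" "\<And>t. t \<le> 0 \<Longrightarrow> g t = 0"
  "\<And>n. (\<integral>\<^sup>+t. ennreal (indicator {..n} t * (g t)\<^sup>2) \<partial>lborel) < \<infinity>"
 using assms by (auto simp: L2c_def)

lemma L2c_mono:
 assumes "g \<in> L2c" "f \<in> borel_measurable borel" "\<And>t. \<bar>f t\<bar> \<le> C * \<bar>g t\<bar>"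
 shows "f \<in> L2c"
proof -
 note [measurable] = L2cD(1)[OF assms(1)] assms(2)
 have "f t = 0" if "t \<le> 0" for t
  using assms(3)[of t] L2cD(2)[OF assms(1) that] by simp
 moreover have "(\<integral>\<^sup>+t. ennreal (indicator {..n} t * (f t)\<^sup>2) \<partial>lborel) < \<infinity>" for n
 proof -
  have le: "(f t)\<^sup>2 \<le> C\<^sup>2 * (g t)\<^sup>2" for t
   using power_mono[OF assms(3)[of t], of 2] by (simp add: power_mult_distrib)
  have "(\<integral>\<^sup>+t. ennreal (indicator {..n} t * (f t)\<^sup>2) \<partial>lborel)
    \<le> (\<integral>\<^sup>+t. ennreal (C\<^sup>2 * (indicator {..n} t * (g t)\<^sup>2)) \<partial>lborel)"
   by (intro nn_integral_mono ennreal_leI) (use le in \<open>auto simp: indicator_def\<close>)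
  also have "\<dots> = (\<integral>\<^sup>+t. ennreal (C\<^sup>2) * ennreal (indicator {..n} t * (g t)\<^sup>2) \<partial>lborel)"
   by (subst ennreal_mult') auto
  also have "\<dots> = ennreal (C\<^sup>2) * (\<integral>\<^sup>+t. ennreal (indicator {..n} t * (g t)\<^sup>2) \<partial>lborel)"
   by (intro nn_integral_cmult) measurable
  also have "\<dots> < \<infinity>"
   using L2cD(3)[OF assms(1), of n] by (auto simp: ennreal_mult_less_top)
  finally show ?thesis .
 qed
 ultimately show ?thesis using assms(2) by (auto simp: L2c_def)
qed

lemma L2c_zero [simp]: "(\<lambda>t. 0) \<in> L2c"
 by (auto simp: L2c_def)

lemma L2c_cmult: "g \<in> L2c \<Longrightarrow> (\<lambda>t. c * g t) \<in> L2c"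
 by (rule L2c_mono[of g _ "\<bar>c\<bar>"]) (auto simp: abs_mult dest: L2cD(1))

lemma L2c_add:
 assumes "f \<in> L2c" "g \<in> L2c"
 shows "(\<lambda>t. f t + g t) \<in> L2c"
proof -
 note [measurable] = L2cD(1)[OF assms(1)] L2cD(1)[OF assms(2)]
 have "(\<integral>\<^sup>+t. ennreal (indicator {..n} t * (f t + g t)\<^sup>2) \<partial>lborel) < \<infinity>" for n
 proof -
  have le: "(f t + g t)\<^sup>2 \<le> 2 * (f t)\<^sup>2 + 2 * (g t)\<^sup>2" for t
   using sum_squares_ge_zero[of "f t - g t" 0] by (simp add: power2_eq_square algebra_simps)
  have "(\<integral>\<^sup>+t. ennreal (indicator {..n} t * (f t + g t)\<^sup>2) \<partial>lborel)
    \<le> (\<integral>\<^sup>+t. ennreal (2 * (indicator {..n} t * (f t)\<^sup>2) + 2 * (indicator {..n} t * (g t)\<^sup>2)) \<partial>lborel)"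
   by (intro nn_integral_mono ennreal_leI) (use le in \<open>auto simp: indicator_def\<close>)
  also have "\<dots> = (\<integral>\<^sup>+t. ennreal 2 * ennreal (indicator {..n} t * (f t)\<^sup>2) + ennreal 2 * ennreal (indicator {..n} t * (g t)\<^sup>2) \<partial>lborel)"
   by (intro nn_integral_cong) (simp add: ennreal_plus ennreal_mult' del: ennreal_numeral)
  also have "\<dots> = ennreal 2 * (\<integral>\<^sup>+t. ennreal (indicator {..n} t * (f t)\<^sup>2) \<partial>lborel)
     + ennreal 2 * (\<integral>\<^sup>+t. ennreal (indicator {..n} t * (g t)\<^sup>2) \<partial>lborel)"
   by (simp add: nn_integral_add nn_integral_cmult del: ennreal_numeral)
  also have "\<dots> < \<infinity>"
   using L2cD(3)[OF assms(1), of n] L2cD(3)[OF assms(2), of n]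
   by (auto simp: ennreal_mult_less_top simp del: ennreal_numeral)
  finally show ?thesis .
 qed
 then show ?thesis using L2cD(2)[OF assms(1)] L2cD(2)[OF assms(2)] by (auto simp: L2c_def)
qed

lemma L2c_diff: "f \<in> L2c \<Longrightarrow> g \<in> L2c \<Longrightarrow> (\<lambda>t. f t - g t) \<in> L2c"
 using L2c_add[OF _ L2c_cmult[of g "-1"], of f] by simp

lemma L2c_uminus: "g \<in> L2c \<Longrightarrow> (\<lambda>t. - g t) \<in> L2c"
 using L2c_cmult[of g "-1"] by simp

lemma L2c_divide: "g \<in> L2c \<Longrightarrow> (\<lambda>t. g t / c) \<in> L2c"
 using L2c_cmult[of g "1/c"] by simp

lemma L2c_shift:
 assumes "g \<in> L2c" "c \<ge> 0"
 shows "(\<lambda>t. g (t - c)) \<in> L2c"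
proof -
 note [measurable] = L2cD(1)[OF assms(1)]
 have "(\<integral>\<^sup>+t. ennreal (indicator {..n} t * (g (t - c))\<^sup>2) \<partial>lborel) < \<infinity>" for n
 proof -
  have "(\<integral>\<^sup>+t. ennreal (indicator {..n - c} t * (g t)\<^sup>2) \<partial>lborel)
   = (\<integral>\<^sup>+t. ennreal (indicator {..n - c} (- c + 1 * t) * (g (- c + 1 * t))\<^sup>2) \<partial>lborel)"
   by (subst nn_integral_real_affine[where c=1 and t="- c"]) auto
  also have "\<dots> = (\<integral>\<^sup>+t. ennreal (indicator {..n} t * (g (t - c))\<^sup>2) \<partial>lborel)"
   by (intro nn_integral_cong) (auto simp: indicator_def)
  finally show ?thesis using L2cD(3)[OF assms(1), of "n - c"] by simp
 qed
 then show ?thesis using assms(2) L2cD(2)[OF assms(1)] by (auto simp: L2c_def)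
qed

text \<open>Cauchy-Schwarz against the indicator of \<open>{0..t}\<close>: by causality the
  half-line counts as an interval of length t.\<close>

lemma nn_integral_L2c_le:
 assumes "g \<in> L2c"
 shows "(\<integral>\<^sup>+s. ennreal (indicator {..t} s * \<bar>g s\<bar>) \<partial>lborel)\<^sup>2
   \<le> ennreal t * (\<integral>\<^sup>+s. ennreal (indicator {..t} s * (g s)\<^sup>2) \<partial>lborel)"
proof (cases "t \<le> 0")
 case True
 have z: "indicator {..t} s * \<bar>g s\<bar> = 0" for s
  using L2cD(2)[OF assms, of s] True by (auto simp: indicator_def)
 show ?thesis by (simp add: z)
next
 case False
 note [measurable] = L2cD(1)[OF assms(1)]
 have "(\<integral>\<^sup>+s. ennreal (indicator {..t} s * \<bar>g s\<bar>) \<partial>lborel)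
   = (\<integral>\<^sup>+s. ennreal (indicator {0..t} s) * ennreal (indicator {..t} s * \<bar>g s\<bar>) \<partial>lborel)"
  using L2cD(2)[OF assms] by (intro nn_integral_cong) (auto simp: indicator_def)
 also have "\<dots>\<^sup>2 \<le> (\<integral>\<^sup>+s. (ennreal (indicator {0..t} s))\<^sup>2 \<partial>lborel) * (\<integral>\<^sup>+s. (ennreal (indicator {..t} s * \<bar>g s\<bar>))\<^sup>2 \<partial>lborel)"
  by (intro Cauchy_Schwarz_nn_integral) auto
 also have "(\<integral>\<^sup>+s. (ennreal (indicator {0..t} s))\<^sup>2 \<partial>lborel) = (\<integral>\<^sup>+s. indicator {0..t} s \<partial>lborel)"
  by (intro nn_integral_cong) (auto simp: indicator_def)
 also have "\<dots> = ennreal t" using False by simp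
 also have "(\<integral>\<^sup>+s. (ennreal (indicator {..t} s * \<bar>g s\<bar>))\<^sup>2 \<partial>lborel) = (\<integral>\<^sup>+s. ennreal (indicator {..t} s * (g s)\<^sup>2) \<partial>lborel)"
  by (intro nn_integral_cong) (auto simp: indicator_def ennreal_power)
 finally show ?thesis .
qed

lemma L2c_set_integrable:
 assumes "g \<in> L2c"
 shows "set_integrable lborel {..t} g"
proof -
 note [measurable] = L2cD(1)[OF assms(1)]
 have "(\<integral>\<^sup>+s. ennreal (indicator {..t} s * \<bar>g s\<bar>) \<partial>lborel)\<^sup>2 < \<infinity>"
  by (rule le_less_trans[OF nn_integral_L2c_le[OF assms]])
   (use L2cD(3)[OF assms, of t] in \<open>simp add: ennreal_mult_less_top\<close>)
 then have "(\<integral>\<^sup>+s. ennreal (indicator {..t} s * \<bar>g s\<bar>) \<partial>lborel) < \<infinity>"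
  by (simp add: power_less_top_ennreal)
 then show ?thesis
  unfolding set_integrable_def by (subst integrable_iff_bounded) (auto simp: abs_mult)
qed

lemma L2c_set_integrable':
 assumes "g \<in> L2c" "A \<in> sets borel" "\<And>x. x \<in> A \<Longrightarrow> x \<le> t"
 shows "set_integrable lborel A g"
 by (rule set_integrable_subset[OF L2c_set_integrable[OF assms(1), of t]]) (use assms in auto)

lemma Jt_nonpos: "g \<in> L2c \<Longrightarrow> t \<le> 0 \<Longrightarrow> Jt g t = 0"
 unfolding Jt_def set_lebesgue_integral_def
 by (rule integral_eq_zero_AE) (auto simp: indicator_def L2cD(2))

lemma Jt_eq_Icc:
 assumes "g \<in> L2c" "a \<le> 0" shows "Jt g t = (LBINT s:{a..t}. g s)"
 unfolding Jt_def set_lebesgue_integral_def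
 by (intro Bochner_Integration.integral_cong) (use assms L2cD(2)[OF assms(1)] in \<open>auto simp: indicator_def\<close>)

lemma Jt_add: "f \<in> L2c \<Longrightarrow> g \<in> L2c \<Longrightarrow> Jt (\<lambda>t. f t + g t) t = Jt f t + Jt g t"
 unfolding Jt_def by (intro set_integral_add L2c_set_integrable)

lemma Jt_diff: "f \<in> L2c \<Longrightarrow> g \<in> L2c \<Longrightarrow> Jt (\<lambda>t. f t - g t) t = Jt f t - Jt g t"
 unfolding Jt_def by (intro set_integral_diff L2c_set_integrable)

lemma Jt_cmult: "Jt (\<lambda>t. c * g t) t = c * Jt g t"
 unfolding Jt_def by simp

lemma Jt_divide: "Jt (\<lambda>t. g t / c) t = Jt g t / c"
 unfolding Jt_def by simp

lemma Jt_zero [simp]: "Jt (\<lambda>t. 0) t = 0"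
 unfolding Jt_def by simp

text \<open>The integral runs over \<open>{..t}\<close>, so this is translation invariance of the
  measure; for causal functions the same integral starts at 0.\<close>

lemma Jt_shift: "Jt (\<lambda>t. g (t - c)) t = Jt g (t - c)"
proof -
 have "Jt g (t - c) = (LBINT s. indicator {..t - c} s *\<^sub>R g s)"
  by (simp add: Jt_def set_lebesgue_integral_def)
 also have "\<dots> = (LBINT s. indicator {..t - c} (- c + 1 * s) *\<^sub>R g (- c + 1 * s))"
  by (subst lborel_integral_real_affine[where c=1 and t="- c"]) auto
 also have "\<dots> = Jt (\<lambda>t. g (t - c)) t"
  unfolding Jt_def set_lebesgue_integral_def
  by (intro Bochner_Integration.integral_cong) (auto simp: indicator_def)
 finally show ?thesis by simp
qed

lemma Jt_diff_Ioc:
 assumes "g \<in> L2c" "a \<le> b"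
 shows "Jt g b - Jt g a = (LBINT s:{a<..b}. g s)"
proof -
 have "{..b} = {..a} \<union> {a<..b}" using assms by auto
 then have "Jt g b = Jt g a + (LBINT s:{a<..b}. g s)"
  unfolding Jt_def by (simp, intro set_integral_Un L2c_set_integrable L2c_set_integrable'[where t=b] assms) auto
 then show ?thesis by simp
qed

lemma Jt_continuous:
 assumes "g \<in> L2c"
 shows "continuous_on UNIV (Jt g)"
proof -
 have "isCont (Jt g) x" for x
 proof -
  define a where "a = min (-1) (x - 1)"
  have "continuous_on {a..x+1} (\<lambda>y. integral {a..y} g)"
   by (rule indefinite_integral_continuous_1)
    (rule set_borel_integral_eq_integral(1), rule L2c_set_integrable'[OF assms, where t="x+1"], auto)
  moreover have "integral {a..y} g = Jt g y" for y
  proof -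
   have "set_integrable lborel {a..y} g"
    by (rule L2c_set_integrable'[OF assms, where t=y]) auto
   then show ?thesis
    using Jt_eq_Icc[OF assms, of a y] by (simp add: set_borel_integral_eq_integral(2) a_def)
  qed
  ultimately have "continuous_on {a..x+1} (Jt g)" by simp
  moreover have "x \<in> interior {a..x+1}" by (simp add: a_def)
  ultimately show ?thesis by (rule continuous_on_interior)
 qed
 then show ?thesis by (simp add: continuous_at_imp_continuous_on)
qed

lemma Jt_sq_le:
 assumes "g \<in> L2c"
 shows "ennreal ((Jt g t)\<^sup>2) \<le> ennreal t * (\<integral>\<^sup>+s. ennreal (indicator {..t} s * (g s)\<^sup>2) \<partial>lborel)"
proof -
 note [measurable] = L2cD(1)[OF assms(1)]
 have "ennreal \<bar>Jt g t\<bar> \<le> (\<integral>\<^sup>+s. ennreal (indicator {..t} s * \<bar>g s\<bar>) \<partial>lborel)"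
  using integral_norm_bound_ennreal[OF L2c_set_integrable[OF assms, of t, unfolded set_integrable_def]]
  by (simp add: Jt_def set_lebesgue_integral_def abs_mult)
 then have "(ennreal \<bar>Jt g t\<bar>)\<^sup>2 \<le> (\<integral>\<^sup>+s. ennreal (indicator {..t} s * \<bar>g s\<bar>) \<partial>lborel)\<^sup>2"
  by (rule power_mono) simp
 also note nn_integral_L2c_le[OF assms]
 finally show ?thesis by (simp add: ennreal_power)
qed

lemma L2c_bounded:
 assumes "f \<in> borel_measurable borel" "\<And>t. t \<le> 0 \<Longrightarrow> f t = 0" "\<And>n. \<exists>C. \<forall>t\<le>n. \<bar>f t\<bar> \<le> C"
 shows "f \<in> L2c"
proof -
 note [measurable] = assms(1)
 have "(\<integral>\<^sup>+t. ennreal (indicator {..n} t * (f t)\<^sup>2) \<partial>lborel) < \<infinity>" for n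
 proof -
  obtain C where C: "\<And>t. t \<le> n \<Longrightarrow> \<bar>f t\<bar> \<le> C" using assms(3) by blast
  have "(f t)\<^sup>2 \<le> C\<^sup>2" if "t \<le> n" for t using C[OF that]
   by (metis abs_ge_zero power2_abs power_mono)
  then have "(\<integral>\<^sup>+t. ennreal (indicator {..n} t * (f t)\<^sup>2) \<partial>lborel) \<le> (\<integral>\<^sup>+t. ennreal (C\<^sup>2) * indicator {0..n} t \<partial>lborel)"
   by (intro nn_integral_mono) (use assms(2) in \<open>auto simp: indicator_def\<close>)
  also have "\<dots> = ennreal (C\<^sup>2) * emeasure lborel {0..n}"
   by (rule nn_integral_cmult_indicator) simp
  also have "\<dots> < \<infinity>"
   by (simp add: ennreal_mult_less_top emeasure_lborel_Icc_eq)
  finally show ?thesis .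
 qed
 then show ?thesis using assms by (auto simp: L2c_def)
qed

lemma continuous_L2c:
 assumes "continuous_on UNIV f" "\<And>t. t \<le> 0 \<Longrightarrow> f t = 0"
 shows "f \<in> L2c"
proof (rule L2c_bounded[OF _ assms(2)])
 show "f \<in> borel_measurable borel" using assms(1) by (rule borel_measurable_continuous_onI)
 fix n :: real
 have "compact (f ` {0..n})"
  by (intro compact_continuous_image continuous_on_subset[OF assms(1)]) auto
 then have "bounded (f ` {0..n})" by (rule compact_imp_bounded)
 then obtain C where C: "\<And>t. t \<in> {0..n} \<Longrightarrow> \<bar>f t\<bar> \<le> C" unfolding bounded_iff by fastforce
 have "\<bar>f t\<bar> \<le> max C 0" if "t \<le> n" for t
  using C[of t] assms(2)[of t] that by (cases "t \<le> 0") auto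
 then show "\<exists>C. \<forall>t\<le>n. \<bar>f t\<bar> \<le> C" by blast
qed

lemma Jt_L2c: "g \<in> L2c \<Longrightarrow> Jt g \<in> L2c"
 by (rule continuous_L2c) (auto intro: Jt_continuous Jt_nonpos)

lemma Jt_pow_L2c: "g \<in> L2c \<Longrightarrow> (Jt ^^ k) g \<in> L2c"
 by (induction k) (auto intro: Jt_L2c)

text \<open>The end point is a null set, so equality below T suffices for \<open>t = T\<close>. This
  is the passage from relations for t < T to the final time.\<close>

lemma Jt_cong_AE:
 assumes "f \<in> L2c" "g \<in> L2c" "AE t in lborel. t < T \<longrightarrow> f t = g t" "t \<le> T"
 shows "Jt f t = Jt g t"
proof -
 note [measurable] = L2cD(1)[OF assms(1)] L2cD(1)[OF assms(2)]
 have "AE x in lborel. x \<noteq> T" by (rule AE_lborel_singleton)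
 with assms(3) have "AE x in lborel. indicator {..t} x *\<^sub>R f x = indicator {..t} x *\<^sub>R g x"
  by eventually_elim (use assms(4) in \<open>auto simp: indicator_def\<close>)
 then show ?thesis
  unfolding Jt_def set_lebesgue_integral_def by (intro integral_cong_AE) auto
qed

text \<open>Half-open intervals are stable under intersection and generate the Borel sets. Hence the
  finite measures whose densities are the positive and the negative part of \<open>f\<close>
  coincide, and so do the densities.\<close>

lemma AE_zero_of_Ioc_integrals:
 fixes f :: "real \<Rightarrow> real"
 assumes f: "integrable lborel f" and z: "\<And>a b. a \<le> b \<Longrightarrow> (LBINT x:{a<..b}. f x) = 0"
 shows "AE x in lborel. f x = 0"
proof -
 note [measurable] = borel_measurable_integrable[OF f]
 have fm [measurable]: "f \<in> borel_measurable borel" using f by auto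
 have fin: "(\<integral>\<^sup>+x. ennreal (f x) \<partial>lborel) < \<infinity>" "(\<integral>\<^sup>+x. ennreal (- f x) \<partial>lborel) < \<infinity>"
  using integrableD[OF f] by (auto simp: less_top)
 have eq: "density lborel (\<lambda>x. ennreal (f x)) = density lborel (\<lambda>x. ennreal (- f x))"
 proof (rule measure_eqI_generator_eq[where E="range (\<lambda>(a::real, b). {a<..b})" and \<Omega>=UNIV and A="\<lambda>n. {- real n<..real n}"])
  show "Int_stable (range (\<lambda>(a::real, b). {a<..b}))"
  proof (rule Int_stableI)
   fix A B assume "A \<in> range (\<lambda>(a::real, b). {a<..b})" "B \<in> range (\<lambda>(a::real, b). {a<..b})"
   then obtain a b c d where "A = {a<..b}" "B = {c<..d}" by auto
   then have "A \<inter> B = {max a c<..min b d}" by auto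
   then show "A \<inter> B \<in> range (\<lambda>(a::real, b). {a<..b})" by auto
  qed
  fix X assume "X \<in> range (\<lambda>(a::real, b). {a<..b})"
  then obtain a b where X: "X = {a<..b}" by auto
  have i: "integrable lborel (\<lambda>x. indicator X x *\<^sub>R f x)"
   using f by (intro integrable_mult_indicator) (auto simp: X)
  have "(LBINT x. indicator X x *\<^sub>R f x) = 0"
  proof (cases "a \<le> b")
   case True with z[OF True] X show ?thesis by (simp add: set_lebesgue_integral_def)
  next
   case False with X show ?thesis by simp
  qed
  then have "enn2real (\<integral>\<^sup>+x. ennreal (indicator X x *\<^sub>R f x) \<partial>lborel) = enn2real (\<integral>\<^sup>+x. ennreal (- (indicator X x *\<^sub>R f x)) \<partial>lborel)"
   using real_lebesgue_integral_def[OF i] by simp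
  then have "(\<integral>\<^sup>+x. ennreal (indicator X x *\<^sub>R f x) \<partial>lborel) = (\<integral>\<^sup>+x. ennreal (- (indicator X x *\<^sub>R f x)) \<partial>lborel)"
   using ennreal_enn2real[of "\<integral>\<^sup>+x. ennreal (indicator X x *\<^sub>R f x) \<partial>lborel"]
    ennreal_enn2real[of "\<integral>\<^sup>+x. ennreal (- (indicator X x *\<^sub>R f x)) \<partial>lborel"] integrableD(2,3)[OF i]
   by (simp add: less_top)
  moreover have "(\<integral>\<^sup>+x. ennreal (indicator X x *\<^sub>R f x) \<partial>lborel) = (\<integral>\<^sup>+x. ennreal (f x) * indicator X x \<partial>lborel)"
   "(\<integral>\<^sup>+x. ennreal (- (indicator X x *\<^sub>R f x)) \<partial>lborel) = (\<integral>\<^sup>+x. ennreal (- f x) * indicator X x \<partial>lborel)"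
   by (auto intro!: nn_integral_cong simp: indicator_def)
  ultimately show "emeasure (density lborel (\<lambda>x. ennreal (f x))) X = emeasure (density lborel (\<lambda>x. ennreal (- f x))) X"
   using X by (subst (1 2) emeasure_density) auto
 next
  show "sets (density lborel (\<lambda>x. ennreal (f x))) = sigma_sets UNIV (range (\<lambda>(a::real, b). {a<..b}))"
   "sets (density lborel (\<lambda>x. ennreal (- f x))) = sigma_sets UNIV (range (\<lambda>(a::real, b). {a<..b}))"
   by (simp_all add: borel_sigma_sets_Ioc)
  show "(\<Union>i. {- real i<..real i}) = UNIV"
  proof (intro equalityI subsetI UNIV_I)
   fix x :: real obtain n where "\<bar>x\<bar> < real n" using reals_Archimedean2 by blast
   then show "x \<in> (\<Union>i. {- real i<..real i})" by (auto intro!: exI[of _ n])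
  qed
  fix i :: nat
  have "emeasure (density lborel (\<lambda>x. ennreal (f x))) {- real i<..real i} = (\<integral>\<^sup>+x. ennreal (f x) * indicator {- real i<..real i} x \<partial>lborel)"
   by (subst emeasure_density) auto
  also have "\<dots> \<le> (\<integral>\<^sup>+x. ennreal (f x) \<partial>lborel)"
   by (intro nn_integral_mono) (auto simp: indicator_def)
  finally show "emeasure (density lborel (\<lambda>x. ennreal (f x))) {- real i<..real i} \<noteq> \<infinity>"
   using fin(1) by (auto simp: top_unique)
 qed auto
 have ae: "AE x in lborel. ennreal (f x) = ennreal (- f x)"
  by (rule sigma_finite_measure.density_unique[OF _ _ _ eq]) (auto intro: sigma_finite_lborel)
 \<comment> \<open>\<open>ennreal\<close> cuts off negative values, so one of the two sides is
   0.\<close>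
 have z: "f x = 0" if "ennreal (f x) = ennreal (- f x)" for x
 proof (cases "f x \<ge> 0")
  case True
  then have "ennreal (f x) = 0" using that by (simp add: ennreal_neg)
  then show ?thesis using True by simp
 next
  case False
  then have "ennreal (- f x) = 0" using that by (simp add: ennreal_neg)
  then show ?thesis using False by simp
 qed
 show ?thesis using ae by eventually_elim (rule z)
qed

text \<open>Injectivity of \<open>Jt\<close> below T. The primitive of the difference is continuous,
  so it vanishes at every time up to T and not only at almost every one; its increments are the
  integrals of the difference over intervals.\<close>

lemma Jt_strip:
 assumes f: "f \<in> L2c" and g: "g \<in> L2c" and eq: "AE t in lborel. t < T \<longrightarrow> Jt f t = Jt g t"
 shows "AE t in lborel. t < T \<longrightarrow> f t = g t"
proof -
 define h where "h = (\<lambda>t. f t - g t)"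
 have h: "h \<in> L2c" unfolding h_def by (intro L2c_diff f g)
 have Jh: "Jt h t = Jt f t - Jt g t" for t unfolding h_def by (intro Jt_diff f g)
 have "Jt h t = 0" if "t < T" for t
 proof (rule ccontr)
  assume ne: "Jt h t \<noteq> 0"
  have "isCont (Jt h) t" using Jt_continuous[OF h] by (simp add: continuous_on_eq_continuous_at)
  then have "\<forall>\<^sub>F s in at t. Jt h s \<noteq> 0"
   using ne tendsto_imp_eventually_ne isCont_def by blast
  then obtain d where d: "d > 0" "\<And>s. s \<noteq> t \<Longrightarrow> dist s t < d \<Longrightarrow> Jt h s \<noteq> 0"
   by (auto simp: eventually_at)
  have "{t<..<min (t + d) T} \<subseteq> {s. s < T \<and> Jt f s \<noteq> Jt g s}"
   using d(2) by (auto simp: Jh dist_real_def)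
  moreover obtain N where N: "N \<in> null_sets lborel" "{s. s < T \<and> Jt f s \<noteq> Jt g s} \<subseteq> N"
   using eq by (auto simp: eventually_ae_filter)
  ultimately have "{t<..<min (t + d) T} \<in> null_sets lborel"
   by (intro null_sets_subset[OF N(1)]) auto
  then show False using d(1) that by (auto simp: null_sets_def emeasure_lborel_Ioo)
 qed
 then have J0: "Jt h t = 0" if "t \<le> T" for t
 proof (cases "t < T")
  case False
  with that have "t = T" by simp
  have "((Jt h) \<longlongrightarrow> Jt h T) (at_left T)"
   using Jt_continuous[OF h] by (metis UNIV_I continuous_on_eq_continuous_at filterlim_at_split isCont_def open_UNIV)
  moreover have "((Jt h) \<longlongrightarrow> 0) (at_left T)"
   by (rule tendsto_eventually) (use \<open>\<And>t. t < T \<Longrightarrow> Jt h t = 0\<close> in \<open>auto simp: eventually_at_filter\<close>)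
  ultimately show ?thesis using tendsto_unique[of "at_left T"] \<open>t = T\<close> by auto
 qed auto
 have "AE x in lborel. indicator {..T} x *\<^sub>R h x = 0"
 proof (rule AE_zero_of_Ioc_integrals)
  show "integrable lborel (\<lambda>x. indicator {..T} x *\<^sub>R h x)"
   using L2c_set_integrable[OF h, of T] by (simp add: set_integrable_def)
  fix a b :: real assume "a \<le> b"
  have "(LBINT x:{a<..b}. indicator {..T} x *\<^sub>R h x) = (LBINT x:{min a T<..min b T}. h x)"
   unfolding set_lebesgue_integral_def
   by (intro Bochner_Integration.integral_cong) (auto simp: indicator_def)
  also have "\<dots> = Jt h (min b T) - Jt h (min a T)"
   using \<open>a \<le> b\<close> by (intro Jt_diff_Ioc[symmetric] h) auto
  also have "\<dots> = 0" using J0[of "min b T"] J0[of "min a T"] by simp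
  finally show "(LBINT x:{a<..b}. indicator {..T} x *\<^sub>R h x) = 0" .
 qed
 then show ?thesis
  by eventually_elim (auto simp: indicator_def h_def split: if_splits)
qed

lemma Jt_pow_strip:
 assumes "f \<in> L2c" "g \<in> L2c" "AE t in lborel. t < T \<longrightarrow> (Jt ^^ k) f t = (Jt ^^ k) g t"
 shows "AE t in lborel. t < T \<longrightarrow> f t = g t"
 using assms(3)
proof (induction k)
 case (Suc k)
 show ?case by (rule Suc.IH, rule Jt_strip) (use Suc.prems assms in \<open>auto intro: Jt_pow_L2c\<close>)
qed simp

lemma Jt_pow_add: "f \<in> L2c \<Longrightarrow> g \<in> L2c \<Longrightarrow> (Jt ^^ k) (\<lambda>t. f t + g t) = (\<lambda>t. (Jt ^^ k) f t + (Jt ^^ k) g t)"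
 by (induction k) (auto simp: Jt_add Jt_pow_L2c)

lemma Jt_pow_diff: "f \<in> L2c \<Longrightarrow> g \<in> L2c \<Longrightarrow> (Jt ^^ k) (\<lambda>t. f t - g t) = (\<lambda>t. (Jt ^^ k) f t - (Jt ^^ k) g t)"
 by (induction k) (auto simp: Jt_diff Jt_pow_L2c)

lemma Jt_pow_cmult: "(Jt ^^ k) (\<lambda>t. c * f t) = (\<lambda>t. c * (Jt ^^ k) f t)"
 by (induction k) (auto simp: Jt_cmult)

lemma Jt_pow_shift: "(Jt ^^ k) (\<lambda>t. f (t - c)) = (\<lambda>t. (Jt ^^ k) f (t - c))"
 by (induction k) (auto simp: Jt_shift)

lemma Jt_pow_Suc: "(Jt ^^ k) (Jt g) = Jt ((Jt ^^ k) g)"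
 by (simp add: funpow_swap1)

lemma Jt_pow_cong_AE:
 assumes "f \<in> L2c" "g \<in> L2c" "AE t in lborel. t < T \<longrightarrow> f t = g t"
 shows "AE t in lborel. t < T \<longrightarrow> (Jt ^^ k) f t = (Jt ^^ k) g t"
proof (cases k)
 case (Suc m)
 have "Jt f t = Jt g t" if "t \<le> T" for t by (rule Jt_cong_AE[OF assms that])
 then have "(Jt ^^ Suc m) f t = (Jt ^^ Suc m) g t" if "t \<le> T" for t
  using that
 proof (induction m arbitrary: t)
  case (Suc m)
  have "AE t in lborel. t < T \<longrightarrow> (Jt ^^ Suc m) f t = (Jt ^^ Suc m) g t"
   using Suc.IH[OF Suc.prems(1)] by (intro AE_I2) (simp del: funpow.simps)
  then have "Jt ((Jt ^^ Suc m) f) t = Jt ((Jt ^^ Suc m) g) t"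
   by (rule Jt_cong_AE[OF Jt_pow_L2c[OF assms(1)] Jt_pow_L2c[OF assms(2)] _ Suc.prems(2)])
  then show ?case by (simp only: funpow.simps(2)[of "Suc m"] o_apply)
 qed simp
 then show ?thesis unfolding Suc by (intro AE_I2) (simp del: funpow.simps)
qed (use assms in auto)

lemma AE_shift:
 fixes P :: "real \<Rightarrow> bool"
 assumes "AE t in lborel. P t"
 shows "AE t in lborel. P (t - c)"
proof -
 obtain N where N: "N \<in> null_sets lborel" "{t. \<not> P t} \<subseteq> N"
  using assms by (auto simp: eventually_ae_filter)
 have [measurable]: "N \<in> sets borel" using N(1) by auto
 have "AE t in lborel. t \<notin> N" using N(1) by (rule AE_not_in)
 then have "AE t in lborel. - c + 1 * t \<notin> N"
  by (intro AE_borel_affine) auto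
 then show ?thesis by eventually_elim (use N(2) in auto)
qed

section \<open>Fubini and integration by parts against a primitive\<close>

lemma fubini_real:
 fixes f :: "real \<Rightarrow> real \<Rightarrow> real"
 assumes m: "(\<lambda>(x, y). f x y) \<in> borel_measurable (lborel \<Otimes>\<^sub>M lborel)"
  and fin: "(\<integral>\<^sup>+x. \<integral>\<^sup>+y. ennreal \<bar>f x y\<bar> \<partial>lborel \<partial>lborel) < \<infinity>"
 shows "integrable (lborel \<Otimes>\<^sub>M lborel) (\<lambda>(x, y). f x y)"
  and "(LBINT x. LBINT y. f x y) = (LBINT y. LBINT x. f x y)"
proof -
 have "(\<integral>\<^sup>+x. \<integral>\<^sup>+y. ennreal (norm (case (x, y) of (x, y) \<Rightarrow> f x y)) \<partial>lborel \<partial>lborel)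
   = (\<integral>\<^sup>+z. ennreal (norm (case z of (x, y) \<Rightarrow> f x y)) \<partial>(lborel \<Otimes>\<^sub>M lborel))"
  by (rule lborel.nn_integral_fst) (use m in measurable)
 then have "(\<integral>\<^sup>+z. ennreal (norm (case z of (x, y) \<Rightarrow> f x y)) \<partial>(lborel \<Otimes>\<^sub>M lborel)) < \<infinity>"
  using fin by simp
 then show i: "integrable (lborel \<Otimes>\<^sub>M lborel) (\<lambda>(x, y). f x y)"
  using m by (simp add: integrable_iff_bounded)
 show "(LBINT x. LBINT y. f x y) = (LBINT y. LBINT x. f x y)"
  using lborel_pair.Fubini_integral[OF i] by simp
qed

lemma Lint_FTC:
 fixes F :: "real \<Rightarrow> real"
 assumes "a \<le> b" "\<And>x. x \<in> {a..b} \<Longrightarrow> (F has_real_derivative f x) (at x within {a..b})" "continuous_on {a..b} f"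
 shows "(LBINT x:{a..b}. f x) = F b - F a"
 unfolding set_lebesgue_integral_def
 by (rule integral_FTC_atLeastAtMost)
  (use assms in \<open>auto simp: has_real_derivative_iff_has_vector_derivative\<close>)

lemma set_integrable_mult_continuous:
 fixes f :: "real \<Rightarrow> real"
 assumes f: "set_integrable lborel {a..b} f" and Q: "continuous_on {a..b} Q"
 shows "set_integrable lborel {a..b} (\<lambda>x. f x * Q x)"
proof -
 have "bounded (Q ` {a..b})" using Q by (intro compact_imp_bounded compact_continuous_image) auto
 then obtain C where C: "\<And>x. x \<in> {a..b} \<Longrightarrow> \<bar>Q x\<bar> \<le> C" unfolding bounded_iff by fastforce
 have [measurable]: "(\<lambda>x. indicator {a..b} x *\<^sub>R Q x) \<in> borel_measurable borel"
  by (intro borel_measurable_continuous_on_indicator Q) auto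
 have fm [measurable]: "(\<lambda>x. indicator {a..b} x *\<^sub>R f x) \<in> borel_measurable borel"
  using borel_measurable_integrable[OF f[unfolded set_integrable_def]] by simp
 have e: "indicator {a..b} x *\<^sub>R (f x * Q x) = (indicator {a..b} x *\<^sub>R f x) * (indicator {a..b} x *\<^sub>R Q x)" for x
  by (auto simp: indicator_def)
 show ?thesis
  unfolding set_integrable_def e
 proof (rule Bochner_Integration.integrable_bound)
  show "integrable lborel (\<lambda>x. C * (indicator {a..b} x *\<^sub>R f x))"
   using f by (simp add: set_integrable_def)
  show "AE x in lborel. norm ((indicator {a..b} x *\<^sub>R f x) * (indicator {a..b} x *\<^sub>R Q x)) \<le> norm (C * (indicator {a..b} x *\<^sub>R f x))"
  proof (rule AE_I2)
   fix x show "norm ((indicator {a..b} x *\<^sub>R f x) * (indicator {a..b} x *\<^sub>R Q x)) \<le> norm (C * (indicator {a..b} x *\<^sub>R f x))"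
   proof (cases "x \<in> {a..b}")
    case True
    from C[OF True] have "\<bar>Q x\<bar> \<le> \<bar>C\<bar>" by simp
    then have "\<bar>f x\<bar> * \<bar>Q x\<bar> \<le> \<bar>f x\<bar> * \<bar>C\<bar>" by (rule mult_left_mono) simp
    then show ?thesis using True by (simp add: abs_mult mult.commute)
   qed auto
  qed
 qed measurable
qed

text \<open>The factor \<open>f\<close> is merely integrable, so there is no product rule to
  integrate. Fubini on the triangle y <= x turns the integral of the primitive times
  \<open>Q'\<close> into that of \<open>f y * (Q b - Q y)\<close>.\<close>

lemma integration_by_parts_AC:
 fixes f Q Q' :: "real \<Rightarrow> real"
 assumes f: "set_integrable lborel {a..b} f" and ab: "a \<le> b"
  and Q: "\<And>x. x \<in> {a..b} \<Longrightarrow> (Q has_real_derivative Q' x) (at x within {a..b})"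
  and Q': "continuous_on {a..b} Q'"
 shows "(LBINT x:{a..b}. f x * Q x) =
   (LBINT y:{a..b}. f y) * Q b - (LBINT x:{a..b}. (LBINT y:{a..x}. f y) * Q' x)"
proof -
 define fi where "fi = (\<lambda>x. indicator {a..b} x *\<^sub>R f x)"
 define Qi where "Qi = (\<lambda>x. indicator {a..b} x *\<^sub>R Q' x)"
 have [measurable]: "Qi \<in> borel_measurable borel" unfolding Qi_def
  by (intro borel_measurable_continuous_on_indicator Q') auto
 have fi: "integrable lborel fi" using f by (simp add: fi_def set_integrable_def)
 have [measurable]: "fi \<in> borel_measurable borel" using borel_measurable_integrable[OF fi] by simp
 have Qc: "continuous_on {a..b} Q"
  using Q by (meson DERIV_continuous_on)
 have "integrable lborel Qi"
  using borel_integrable_atLeastAtMost'[OF Q'] by (simp add: Qi_def set_integrable_def)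
 then have Qfin: "(\<integral>\<^sup>+x. ennreal \<bar>Qi x\<bar> \<partial>lborel) < \<infinity>" by (simp add: integrable_iff_bounded)
 have ffin: "(\<integral>\<^sup>+x. ennreal \<bar>fi x\<bar> \<partial>lborel) < \<infinity>" using fi by (simp add: integrable_iff_bounded)
 define K where "K = (\<lambda>x y. (if y \<le> x then fi y * Qi x else 0))"
 have Km: "(\<lambda>(x, y). K x y) \<in> borel_measurable (lborel \<Otimes>\<^sub>M lborel)"
  unfolding K_def by measurable
 have "(\<integral>\<^sup>+x. \<integral>\<^sup>+y. ennreal \<bar>K x y\<bar> \<partial>lborel \<partial>lborel) \<le> (\<integral>\<^sup>+x. \<integral>\<^sup>+y. ennreal \<bar>Qi x\<bar> * ennreal \<bar>fi y\<bar> \<partial>lborel \<partial>lborel)"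
  by (intro nn_integral_mono) (auto simp: K_def abs_mult ennreal_mult' mult.commute)
 also have "\<dots> = (\<integral>\<^sup>+x. ennreal \<bar>Qi x\<bar> \<partial>lborel) * (\<integral>\<^sup>+y. ennreal \<bar>fi y\<bar> \<partial>lborel)"
  by (simp add: nn_integral_cmult nn_integral_multc)
 also have "\<dots> < \<infinity>" using Qfin ffin by (simp add: ennreal_mult_less_top)
 finally have Kfin: "(\<integral>\<^sup>+x. \<integral>\<^sup>+y. ennreal \<bar>K x y\<bar> \<partial>lborel \<partial>lborel) < \<infinity>" .
 have "(LBINT x:{a..b}. (LBINT y:{a..x}. f y) * Q' x) = (LBINT x. LBINT y. K x y)"
  unfolding set_lebesgue_integral_def
 proof (intro LBINT_cong)
  fix x
  have "(LBINT y. K x y) = (LBINT y. (indicator {a..x} y *\<^sub>R f y) * Qi x)"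
   by (intro Bochner_Integration.integral_cong) (auto simp: K_def fi_def Qi_def indicator_def)
  also have "\<dots> = (LBINT y. indicator {a..x} y *\<^sub>R f y) * Qi x" by (rule integral_mult_left_zero)
  finally show "indicator {a..b} x *\<^sub>R ((LBINT y. indicator {a..x} y *\<^sub>R f y) * Q' x) = (LBINT y. K x y)"
   by (simp add: Qi_def)
 qed
 also have "\<dots> = (LBINT y. LBINT x. K x y)" by (rule fubini_real(2)[OF Km Kfin])
 also have "\<dots> = (LBINT y. fi y * Q b - fi y * Q y)"
 proof (intro LBINT_cong)
  fix y show "(LBINT x. K x y) = fi y * Q b - fi y * Q y"
  proof (cases "y \<in> {a..b}")
   case True
   have "(LBINT x. K x y) = (LBINT x. fi y * (indicator {y..b} x *\<^sub>R Q' x))"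
    using True by (intro Bochner_Integration.integral_cong) (auto simp: K_def Qi_def indicator_def)
   also have "\<dots> = fi y * (LBINT x:{y..b}. Q' x)" unfolding set_lebesgue_integral_def by simp
   also have "(LBINT x:{y..b}. Q' x) = Q b - Q y"
   proof (rule Lint_FTC)
    show "y \<le> b" using True by simp
    show "(Q has_real_derivative Q' x) (at x within {y..b})" if "x \<in> {y..b}" for x
     by (rule DERIV_subset[OF Q]) (use True that in auto)
    show "continuous_on {y..b} Q'" by (rule continuous_on_subset[OF Q']) (use True in auto)
   qed
   finally show ?thesis by (simp add: algebra_simps)
  next
   case False
   then have "K x y = 0" for x by (auto simp: K_def fi_def Qi_def indicator_def)
   moreover have "fi y = 0" using False by (simp add: fi_def)
   ultimately show ?thesis by simp
  qed
 qed
 also have "\<dots> = (LBINT y. fi y * Q b) - (LBINT y. fi y * Q y)"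
 proof (rule Bochner_Integration.integral_diff)
  show "integrable lborel (\<lambda>y. fi y * Q y)"
   using set_integrable_mult_continuous[OF f Qc] by (simp add: fi_def set_integrable_def mult.assoc)
 qed (use fi in simp)
 also have "(LBINT y. fi y * Q b) = (LBINT y:{a..b}. f y) * Q b"
  unfolding fi_def set_lebesgue_integral_def by (rule integral_mult_left_zero)
 finally show ?thesis by (simp add: fi_def set_lebesgue_integral_def mult.assoc)
qed

lemma Jt_by_parts:
 assumes k: "k \<in> L2c" and T: "0 \<le> T"
  and Q: "\<And>x. x \<in> {0..T} \<Longrightarrow> (Q has_real_derivative Q' x) (at x within {0..T})"
  and Q': "continuous_on {0..T} Q'"
 shows "(LBINT t:{0..T}. k t * Q t) = Jt k T * Q T - (LBINT t:{0..T}. Jt k t * Q' t)"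
proof -
 have "set_integrable lborel {0..T} k" by (rule L2c_set_integrable'[OF k, where t=T]) auto
 from integration_by_parts_AC[OF this T Q Q'] show ?thesis
  by (simp add: Jt_eq_Icc[OF k, of 0])
qed

text \<open>No boundary terms remain: at T they vanish with \<open>Q\<close> and \<open>Q'\<close>,
  at 0 by causality.\<close>

lemma Jt_twice_by_parts:
 assumes k: "k \<in> L2c" and T: "0 \<le> T"
  and Q: "\<And>x. x \<in> {0..T} \<Longrightarrow> (Q has_real_derivative Q' x) (at x within {0..T})"
  and Q': "\<And>x. x \<in> {0..T} \<Longrightarrow> (Q' has_real_derivative Q'' x) (at x within {0..T})"
  and Q'': "continuous_on {0..T} Q''" and 0: "Q T = 0" "Q' T = 0"
 shows "(LBINT t:{0..T}. k t * Q t) = (LBINT t:{0..T}. Jt (Jt k) t * Q'' t)"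
proof -
 have "continuous_on {0..T} Q'" using Q' by (meson DERIV_continuous_on)
 then show ?thesis
  using Jt_by_parts[OF k T Q] Jt_by_parts[OF Jt_L2c[OF k] T Q' Q''] 0 by simp
qed

text \<open>Truncated powers. As a function of t, \<open>pp n (s - t)\<close> is the kernel of n + 1
  integrations in time evaluated at s, and \<open>pp 3\<close> has two continuous derivatives, just
  enough for a test field.\<close>

definition pp :: "nat \<Rightarrow> real \<Rightarrow> real" where
 "pp n s = (max 0 s) ^ n / fact n"

lemma pp_nonpos: "n > 0 \<Longrightarrow> s \<le> 0 \<Longrightarrow> pp n s = 0"
 by (simp add: pp_def)

lemma pp_continuous [continuous_intros]: "continuous_on A f \<Longrightarrow> continuous_on A (\<lambda>x. pp n (f x))"
 unfolding pp_def by (intro continuous_intros) auto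

lemma DERIV_pow_fact:
 "((\<lambda>s::real. s ^ Suc m / fact (Suc m)) has_real_derivative s ^ m / fact m) (at s within A)"
proof -
 have "((\<lambda>s. s ^ Suc m) has_real_derivative (1 + real m) * (1 * s ^ m)) (at s within A)"
  by (rule DERIV_power_Suc[OF DERIV_ident])
 from DERIV_cdivide[OF this, of "fact (Suc m)"]
 have "((\<lambda>s. s ^ Suc m / fact (Suc m)) has_real_derivative (1 + real m) * (1 * s ^ m) / fact (Suc m)) (at s within A)" .
 moreover have "(1 + real m) * (1 * s ^ m) / fact (Suc m) = s ^ m / fact m"
  by (simp add: divide_simps)
 ultimately show ?thesis by (simp only:)
qed

text \<open>The formula starts with \<open>pp 2\<close>: \<open>pp 1\<close> has a corner at 0, and
  \<open>pp 0\<close> is the constant 1 and not a step. At s = 0 the difference quotient is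
  \<open>pp (Suc n) h\<close> divided by n + 2, which tends to 0.\<close>

lemma pp_DERIV: "(pp (Suc (Suc n)) has_real_derivative pp (Suc n) s) (at s)"
proof -
 have eqp: "\<forall>\<^sub>F x in nhds s. pp (Suc (Suc n)) x = x ^ Suc (Suc n) / fact (Suc (Suc n))" if "s > 0"
  using that by (intro eventually_nhds_in_open[of "{0<..}" s, THEN eventually_mono]) (auto simp: pp_def)
 have eqn: "\<forall>\<^sub>F x in nhds s. pp (Suc (Suc n)) x = 0" if "s < 0"
  using that by (intro eventually_nhds_in_open[of "{..<0}" s, THEN eventually_mono]) (auto simp: pp_def)
 consider "s > 0" | "s < 0" | "s = 0" by linarith
 then show ?thesis
 proof cases
  case 1
  have "(pp (Suc (Suc n)) has_real_derivative s ^ Suc n / fact (Suc n)) (at s)"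
   using DERIV_cong_ev[OF refl eqp[OF 1] refl] DERIV_pow_fact[of "Suc n" s] by blast
  with 1 show ?thesis by (simp add: pp_def)
 next
  case 2
  then have "(pp (Suc (Suc n)) has_real_derivative 0) (at s)"
   using DERIV_cong_ev[OF refl eqn[OF 2] refl] DERIV_const by blast
  with 2 show ?thesis by (simp add: pp_def)
 next
  case 3
  have "isCont (\<lambda>h. pp (Suc n) h / real (Suc (Suc n))) 0"
   using pp_continuous[OF continuous_on_id, of UNIV "Suc n"]
   by (intro continuous_intros) (auto simp: continuous_on_eq_continuous_at)
  then have "((\<lambda>h. pp (Suc n) h / real (Suc (Suc n))) \<longlongrightarrow> 0) (at 0)"
   by (simp add: isCont_def pp_def)
  then have "((\<lambda>h. (pp (Suc (Suc n)) h - pp (Suc (Suc n)) 0) / h) \<longlongrightarrow> 0) (at 0)"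
  proof (rule Lim_transform_eventually)
   show "\<forall>\<^sub>F h in at 0. pp (Suc n) h / real (Suc (Suc n)) = (pp (Suc (Suc n)) h - pp (Suc (Suc n)) 0) / h"
    unfolding eventually_at_filter
   proof (intro always_eventually allI impI)
    fix h :: real assume "h \<noteq> 0"
    have "pp (Suc (Suc n)) h = max 0 h * (pp (Suc n) h / real (Suc (Suc n)))"
     by (simp add: pp_def divide_simps)
    then show "pp (Suc n) h / real (Suc (Suc n)) = (pp (Suc (Suc n)) h - pp (Suc (Suc n)) 0) / h"
     using \<open>h \<noteq> 0\<close> by (cases "h > 0") (auto simp: max_def pp_def[of _ 0] pp_nonpos)
   qed
  qed
  then show ?thesis using 3 by (simp add: has_field_derivative_iff pp_def)
 qed
qed

text \<open>Cauchy's formula for repeated integration. Each integration by parts lowers the power by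
  one and puts one \<open>Jt\<close> on \<open>k\<close>.\<close>

lemma Jt_convolution:
 assumes k: "k \<in> L2c" and s: "0 \<le> s"
 shows "(LBINT t:{0..s}. k t * ((s - t) ^ n / fact n)) = (Jt ^^ Suc n) k s"
 using k
proof (induction n arbitrary: k)
 case 0
 then show ?case by (simp add: Jt_eq_Icc[of k 0])
next
 case (Suc n)
 have "(LBINT t:{0..s}. k t * ((s - t) ^ Suc n / fact (Suc n))) =
   - (LBINT t:{0..s}. Jt k t * (- ((s - t) ^ n / fact n)))"
 proof (subst Jt_by_parts[OF Suc.prems s])
  fix x :: real
  show "((\<lambda>t. (s - t) ^ Suc n / fact (Suc n)) has_real_derivative - ((s - x) ^ n / fact n)) (at x within {0..s})"
  proof -
   have "((\<lambda>t. s - t) has_real_derivative - 1) (at x within {0..s})"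
    by (auto intro!: derivative_eq_intros)
   from DERIV_chain2[where f="\<lambda>s. s ^ Suc n / fact (Suc n)", OF DERIV_pow_fact this]
   show ?thesis by simp
  qed
 qed (auto intro!: continuous_intros)
 also have "\<dots> = (LBINT t:{0..s}. Jt k t * ((s - t) ^ n / fact n))"
  unfolding set_lebesgue_integral_def by simp
 also have "\<dots> = (Jt ^^ Suc n) (Jt k) s" by (rule Suc.IH[OF Jt_L2c[OF Suc.prems]])
 also have "\<dots> = (Jt ^^ Suc (Suc n)) k s" by (simp only: funpow_Suc_right o_apply)
 finally show ?case .
qed

lemma Jt_pow_nonpos: "k \<in> L2c \<Longrightarrow> s \<le> 0 \<Longrightarrow> (Jt ^^ n) k s = 0"
 by (intro L2cD(2) Jt_pow_L2c)

text \<open>Truncation reduces the integral over \<open>{0..T}\<close> to one over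
  \<open>{0..s}\<close>. A weak identity on \<open>{0..T}\<close> tested with these kernels thus
  becomes a pointwise identity at every s <= T, and \<open>Jt_pow_strip\<close> can cancel the
  integrations.\<close>

lemma Jt_pp:
 assumes k: "k \<in> L2c" and s: "s \<le> T" and n: "n > 0"
 shows "(LBINT t:{0..T}. k t * pp n (s - t)) = (Jt ^^ Suc n) k s"
proof (cases "s < 0")
 case True
 then have "(\<lambda>t. indicator {0..T} t *\<^sub>R (k t * pp n (s - t))) = (\<lambda>t. 0)"
  using pp_nonpos[OF n] by (intro ext) (auto simp: indicator_def)
 then show ?thesis
  using Jt_pow_nonpos[OF k, of s "Suc n"] True by (simp add: set_lebesgue_integral_def del: scaleR_eq_0_iff)
next
 case False
 have "(LBINT t:{0..T}. k t * pp n (s - t)) = (LBINT t:{0..s}. k t * ((s - t) ^ n / fact n))"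
  unfolding set_lebesgue_integral_def
  by (intro Bochner_Integration.integral_cong) (use s n in \<open>auto simp: indicator_def pp_def\<close>)
 then show ?thesis using Jt_convolution[OF k, of s n] False by simp
qed

section \<open>Test functions\<close>

text \<open>The functions P(1/x) exp(-e/x), extended by 0, are closed under differentiation.
  Smoothness of the bumps then follows without a formula for higher derivatives.\<close>

definition gexp :: "real \<Rightarrow> real poly \<Rightarrow> real \<Rightarrow> real" where
 "gexp e P x = (if x > 0 then poly P (1 / x) * exp (- e / x) else 0)"

text \<open>The extra power of y carries the induction: when the polynomial is written as a + y P,
  it absorbs the factor y.\<close>

lemma tendsto_pow_poly_exp:
 fixes P :: "real poly"
 assumes e: "e > 0"
 shows "((\<lambda>y. y ^ k * poly P y * exp (- e * y)) \<longlongrightarrow> 0) at_top"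
proof (induction P arbitrary: k)
 case 0
 then show ?case by simp
next
 case (pCons a P)
 have f: "filterlim (\<lambda>y. e * y) at_top at_top"
  using e by (intro filterlim_tendsto_pos_mult_at_top[OF tendsto_const]) (auto intro: filterlim_ident)
 have "((\<lambda>y. (e * y) ^ k / exp (e * y)) \<longlongrightarrow> 0) at_top"
  by (rule filterlim_compose[OF tendsto_power_div_exp_0 f])
 then have "((\<lambda>y. a / e ^ k * ((e * y) ^ k / exp (e * y))) \<longlongrightarrow> a / e ^ k * 0) at_top"
  by (rule tendsto_mult_left)
 moreover have "a / e ^ k * ((e * y) ^ k / exp (e * y)) = y ^ k * a * exp (- e * y)" for y
  using e by (simp add: power_mult_distrib exp_minus field_simps)
 ultimately have "((\<lambda>y. y ^ k * a * exp (- e * y)) \<longlongrightarrow> 0) at_top" by simp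
 from tendsto_add[OF this pCons.IH[of "Suc k"]] show ?case
  by (simp add: algebra_simps)
qed

lemma gexp_DERIV:
 assumes e: "e > 0"
 shows "(gexp e P has_real_derivative gexp e (monom 1 2 * (smult e P - pderiv P)) x) (at x)"
proof -
 consider "x > 0" | "x < 0" | "x = 0" by linarith
 then show ?thesis
 proof cases
  case 1
  have "((\<lambda>x. poly P (1 / x) * exp (- e / x)) has_real_derivative
    gexp e (monom 1 2 * (smult e P - pderiv P)) x) (at x)"
   using 1 by (auto intro!: derivative_eq_intros simp: gexp_def poly_monom power2_eq_square field_simps)
  then show ?thesis
  proof (rule has_field_derivative_transform_within_open[where S="{0<..}"])
  qed (use 1 in \<open>auto simp: gexp_def\<close>)
 next
  case 2
  have "((\<lambda>x. 0) has_real_derivative gexp e (monom 1 2 * (smult e P - pderiv P)) x) (at x)"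
   using 2 by (simp add: gexp_def)
  then show ?thesis
  proof (rule has_field_derivative_transform_within_open[where S="{..<0}"])
  qed (use 2 in \<open>auto simp: gexp_def\<close>)
 next
  case 3
  have l: "((\<lambda>h. gexp e P h / h) \<longlongrightarrow> 0) (at_left 0)"
   by (rule tendsto_eventually) (auto simp: gexp_def eventually_at_filter)
  have "((\<lambda>h. inverse h ^ 1 * poly P (inverse h) * exp (- e * inverse h)) \<longlongrightarrow> 0) (at_right 0)"
   by (rule filterlim_compose[OF tendsto_pow_poly_exp[OF e] filterlim_inverse_at_top_right])
  then have r: "((\<lambda>h. gexp e P h / h) \<longlongrightarrow> 0) (at_right 0)"
   by (rule Lim_transform_eventually)
    (auto simp: gexp_def eventually_at_filter field_simps)
  have "((\<lambda>h. gexp e P h / h) \<longlongrightarrow> 0) (at 0)"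
   using l r by (simp add: filterlim_split_at)
  then show ?thesis using 3 by (simp add: has_field_derivative_iff gexp_def)
 qed
qed

inductive_set bumps :: "real \<Rightarrow> real \<Rightarrow> real \<Rightarrow> (real \<Rightarrow> real) set" for e c d where
 base: "(\<lambda>x. gexp e P (x - c) * gexp e R (d - x)) \<in> bumps e c d"
| add: "f \<in> bumps e c d \<Longrightarrow> g \<in> bumps e c d \<Longrightarrow> (\<lambda>x. f x + g x) \<in> bumps e c d"

lemma bumps_DERIV:
 assumes "f \<in> bumps e c d" "e > 0"
 shows "\<exists>g\<in>bumps e c d. \<forall>x. (f has_real_derivative g x) (at x)"
 using assms(1)
proof induction
 case (base P R)
 define D where "D = (\<lambda>P. monom 1 2 * (smult e P - pderiv P))"
 have m: "gexp e (- P) x = - gexp e P x" for P x by (simp add: gexp_def)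
 have 1: "((\<lambda>x. gexp e P (x - c)) has_real_derivative gexp e (D P) (x - c)) (at x)" for P x
 proof -
  have "((\<lambda>x. x - c) has_real_derivative 1) (at x)" by (auto intro!: derivative_eq_intros)
  from DERIV_chain2[where f="gexp e P", OF gexp_DERIV[OF assms(2)] this] show ?thesis by (simp add: D_def)
 qed
 have "((\<lambda>x. d - x) has_real_derivative - 1) (at x)" for x
  by (auto intro!: derivative_eq_intros)
 then have 2: "((\<lambda>x. gexp e P (d - x)) has_real_derivative gexp e (- D P) (d - x)) (at x)" for P x
  using DERIV_chain2[where f="gexp e P", OF gexp_DERIV[OF assms(2)], of "\<lambda>x. d - x" "-1" x UNIV]
  by (auto simp: D_def m)
 have "((\<lambda>x. gexp e P (x - c) * gexp e R (d - x)) has_real_derivative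
   gexp e (D P) (x - c) * gexp e R (d - x) + gexp e P (x - c) * gexp e (- D R) (d - x)) (at x)" for x
  by (rule derivative_eq_intros 1 2 refl | simp)+
 then show ?case by (intro bexI[of _ "\<lambda>x. gexp e (D P) (x - c) * gexp e R (d - x) + gexp e P (x - c) * gexp e (- D R) (d - x)"])
  (auto intro: bumps.intros)
next
 case (add f g)
 then obtain f' g' where "f' \<in> bumps e c d" "g' \<in> bumps e c d"
  "\<And>x. (f has_real_derivative f' x) (at x)" "\<And>x. (g has_real_derivative g' x) (at x)" by blast
 then show ?case by (intro bexI[of _ "\<lambda>x. f' x + g' x"]) (auto intro: bumps.intros derivative_intros)
qed

text \<open>The parameter \<open>e\<close> flattens the bump: as e tends to 0 it tends to 1 inside
  the interval.\<close>

definition bump :: "real \<Rightarrow> real \<Rightarrow> real \<Rightarrow> real \<Rightarrow> real" where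
 "bump e c d x = (if c < x \<and> x < d then exp (- e / (x - c)) * exp (- e / (d - x)) else 0)"

lemma bump_in_bumps: "bump e c d \<in> bumps e c d"
proof -
 have "bump e c d = (\<lambda>x. gexp e 1 (x - c) * gexp e 1 (d - x))"
  by (rule ext) (auto simp: bump_def gexp_def)
 then show ?thesis by (simp add: bumps.base)
qed

lemma deriv_pow_bumps:
 assumes "e > 0" shows "(deriv ^^ k) (bump e c d) \<in> bumps e c d"
proof (induction k)
 case (Suc k)
 obtain g where g: "g \<in> bumps e c d" "\<And>x. ((deriv ^^ k) (bump e c d) has_real_derivative g x) (at x)"
  using bumps_DERIV[OF Suc assms] by blast
 then have "deriv ((deriv ^^ k) (bump e c d)) = g" by (intro ext DERIV_imp_deriv)
 with g show ?case by simp
qed (simp add: bump_in_bumps)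

lemma bump_test:
 assumes "e > 0" "a < c" "d < b"
 shows "bump e c d \<in> test_functions a b"
proof -
 have "(deriv ^^ k) (bump e c d) differentiable_on UNIV" for k
  using bumps_DERIV[OF deriv_pow_bumps[OF assms(1)] assms(1)]
  by (metis differentiable_on_def differentiable_at_withinI real_differentiable_def)
 moreover have "closure {x. bump e c d x \<noteq> 0} \<subseteq> {c..d}"
  by (rule closure_minimal) (auto simp: bump_def split: if_splits)
 ultimately show ?thesis using assms by (fastforce simp: test_functions_def)
qed

lemma test_fn_DERIV:
 assumes "\<eta> \<in> test_functions a b"
 shows "(((deriv ^^ k) \<eta>) has_real_derivative (deriv ^^ Suc k) \<eta> x) (at x)"
proof -
 have "(deriv ^^ k) \<eta> differentiable_on UNIV" using assms by (auto simp: test_functions_def)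
 then have "(deriv ^^ k) \<eta> differentiable (at x)" by (auto simp: differentiable_on_def)
 then show ?thesis by (simp add: DERIV_deriv_iff_real_differentiable)
qed

lemma test_fn_support:
 assumes "\<eta> \<in> test_functions a b"
 obtains c d where "a < c" "d < b" "c \<le> d \<or> b \<le> a" "\<And>k x. x \<notin> {c..d} \<Longrightarrow> (deriv ^^ k) \<eta> x = 0"
proof -
 define S where "S = closure {x. \<eta> x \<noteq> 0}"
 have S: "S \<subseteq> {a<..<b}" "closed S" using assms by (auto simp: test_functions_def S_def)
 have z: "(deriv ^^ k) \<eta> x = 0" if "x \<notin> S" for k x
 proof -
  have "\<forall>x\<in>-S. (deriv ^^ k) \<eta> x = 0"
  proof (induction k)
   case 0
   then show ?case using closure_subset[of "{x. \<eta> x \<noteq> 0}"] by (auto simp: S_def)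
  next
   case (Suc k)
   show ?case
   proof
    fix x assume x: "x \<in> - S"
    have "((\<lambda>x. 0) has_real_derivative 0) (at x)" by simp
    then have "((deriv ^^ k) \<eta> has_real_derivative 0) (at x)"
     by (rule has_field_derivative_transform_within_open[where S="- S"])
      (use Suc x S(2) in \<open>auto simp: open_Compl\<close>)
    then show "(deriv ^^ Suc k) \<eta> x = 0" by (simp add: DERIV_imp_deriv)
   qed
  qed
  then show ?thesis using that by auto
 qed
 show ?thesis
 proof (cases "S = {}")
  case True
  show ?thesis
  \<comment> \<open>For an empty support one interior point serves as \<open>{c..d}\<close>; if
    there is no interior point, an empty interval does.\<close>
  proof (rule that[of "if a < b then (a+b)/2 else a+1" "if a < b then (a+b)/2 else b-1"])
  qed (use z True in \<open>auto split: if_splits\<close>)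
 next
  case False
  have "bounded S" by (rule bounded_subset[OF _ S(1)]) simp
  then have "compact S" using S(2) by (simp add: compact_eq_bounded_closed)
  then obtain c d where "c \<in> S" "d \<in> S" "\<And>x. x \<in> S \<Longrightarrow> c \<le> x \<and> x \<le> d"
   using compact_attains_inf[of S] compact_attains_sup[of S] False by metis
  then show ?thesis using S(1) z by (intro that[of c d]) auto
 qed
qed

lemma test_fn_continuous: "\<eta> \<in> test_functions a b \<Longrightarrow> continuous_on A ((deriv ^^ k) \<eta>)"
 by (meson DERIV_continuous_on DERIV_subset subset_UNIV test_fn_DERIV has_field_derivative_at_within)

lemma test_fn_zero: "\<eta> \<in> test_functions a b \<Longrightarrow> x \<notin> {a<..<b} \<Longrightarrow> (deriv ^^ k) \<eta> x = 0"
 by (rule test_fn_support[of \<eta> a b]) auto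

lemmas test_fn_DERIV01 = test_fn_DERIV[of _ _ _ 0, simplified] test_fn_DERIV[of _ _ _ 1, simplified]
lemmas test_fn_continuous012 = test_fn_continuous[of _ _ _ _ 0, simplified] test_fn_continuous[of _ _ _ _ 1, simplified]
 test_fn_continuous[of _ _ _ _ 2, simplified numeral_2_eq_2 funpow.simps o_apply id_apply]
lemmas test_fn_zero012 = test_fn_zero[of _ _ _ _ 0, simplified] test_fn_zero[of _ _ _ _ 1, simplified]
 test_fn_zero[of _ _ _ _ 2, simplified numeral_2_eq_2 funpow.simps o_apply id_apply]

lemma bump_tendsto:
 assumes "c < x" "x < d"
 shows "(\<lambda>n. bump (1 / real (Suc n)) (c + 1 / real (Suc n)) (d - 1 / real (Suc n)) x) \<longlonglongrightarrow> 1"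
proof -
 have z: "(\<lambda>n. 1 / real (Suc n)) \<longlonglongrightarrow> 0" using LIMSEQ_inverse_real_of_nat by (simp add: inverse_eq_divide)
 have ev: "\<forall>\<^sub>F n in sequentially. 1 / real (Suc n) < x - c" "\<forall>\<^sub>F n in sequentially. 1 / real (Suc n) < d - x"
  using order_tendstoD(2)[OF z] assms by auto
 have "(\<lambda>n. exp (- (1 / real (Suc n)) / (x - (c + 1 / real (Suc n)))) * exp (- (1 / real (Suc n)) / (d - 1 / real (Suc n) - x))) \<longlonglongrightarrow> exp (- 0 / (x - (c + 0))) * exp (- 0 / (d - 0 - x))"
  using assms by (intro tendsto_intros z) auto
 moreover have "\<forall>\<^sub>F n in sequentially. exp (- (1 / real (Suc n)) / (x - (c + 1 / real (Suc n)))) * exp (- (1 / real (Suc n)) / (d - 1 / real (Suc n) - x))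
   = bump (1 / real (Suc n)) (c + 1 / real (Suc n)) (d - 1 / real (Suc n)) x"
  using ev by eventually_elim (auto simp: bump_def)
 ultimately show ?thesis using Lim_transform_eventually by fastforce
qed

text \<open>The fundamental lemma of the calculus of variations: bumps bounded by 1 converge to the
  indicator of an interval, so the hypothesis passes to integrals over intervals.\<close>

lemma AE_zero_of_test_functions:
 fixes g :: "real \<Rightarrow> real"
 assumes g: "integrable lborel g" and out: "\<And>x. x \<notin> {a<..<b} \<Longrightarrow> g x = 0"
  and z: "\<And>\<eta>. \<eta> \<in> test_functions a b \<Longrightarrow> (LBINT x. g x * \<eta> x) = 0"
 shows "AE x in lborel. g x = 0"
proof (rule AE_zero_of_Ioc_integrals[OF g])
 fix c' d' :: real assume "c' \<le> d'"
 \<comment> \<open>Clipping keeps the approximating bumps inside (a, b) and loses nothing, as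
   \<open>g\<close> vanishes outside.\<close>
 define c d where "c = max a c'" and "d = min b d'"
 define \<eta> where "\<eta> = (\<lambda>n::nat. bump (1 / real (Suc n)) (c + 1 / real (Suc n)) (d - 1 / real (Suc n)))"
 have \<eta>: "\<eta> n \<in> test_functions a b" for n
 proof -
  have "1 / real (Suc n) > 0" "a \<le> c" "d \<le> b" by (auto simp: c_def d_def)
  then show ?thesis unfolding \<eta>_def by (intro bump_test) linarith+
 qed
 have [measurable]: "\<eta> n \<in> borel_measurable borel" for n
  using test_fn_continuous[OF \<eta>[of n], of UNIV 0] by (simp add: borel_measurable_continuous_onI)
 have gm [measurable]: "g \<in> borel_measurable borel" using borel_measurable_integrable[OF g] by simp
 have b1: "\<bar>\<eta> n x\<bar> \<le> 1" for n x
 proof -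
  have "exp (- (1 / real (Suc n)) / u) \<le> 1" if "u > 0" for u using that by simp
  then show ?thesis unfolding \<eta>_def bump_def by (auto simp: abs_mult intro!: mult_le_one)
 qed
 have "(\<lambda>n. LBINT x. g x * \<eta> n x) \<longlonglongrightarrow> (LBINT x. g x * indicator {c<..<d} x)"
 proof (rule integral_dominated_convergence[where w="\<lambda>x. \<bar>g x\<bar>"])
  show "AE x in lborel. (\<lambda>n. g x * \<eta> n x) \<longlonglongrightarrow> g x * indicator {c<..<d} x"
  proof (intro AE_I2 tendsto_mult_left)
   fix x show "(\<lambda>n. \<eta> n x) \<longlonglongrightarrow> indicator {c<..<d} x"
   proof (cases "c < x \<and> x < d")
    case True then show ?thesis using bump_tendsto[of c x d] by (simp add: \<eta>_def)
   next
    case False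
    then have "\<eta> n x = 0" for n
    proof -
     have "1 / real (Suc n) > 0" by simp
     then have "\<not> (c + 1 / real (Suc n) < x \<and> x < d - 1 / real (Suc n))" using False by linarith
     then show ?thesis by (simp add: \<eta>_def bump_def)
    qed
    then show ?thesis using False by simp
   qed
  qed
  show "AE x in lborel. norm (g x * \<eta> n x) \<le> \<bar>g x\<bar>" for n
   using b1 by (intro AE_I2) (simp add: abs_mult mult_left_le)
 qed (use g in auto)
 then have "(LBINT x. g x * indicator {c<..<d} x) = 0"
  using z[OF \<eta>] by (simp add: LIMSEQ_const_iff)
 also have "(LBINT x. g x * indicator {c<..<d} x) = (LBINT x:{c'<..d'}. g x)"
  unfolding set_lebesgue_integral_def
 proof (rule integral_cong_AE)
  have "AE x in lborel. x \<noteq> d'" by (rule AE_lborel_singleton)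
  then show "AE x in lborel. g x * indicator {c<..<d} x = indicator {c'<..d'} x *\<^sub>R g x"
   by eventually_elim (use out in \<open>auto simp: c_def d_def indicator_def\<close>)
 qed auto
 finally show "(LBINT x:{c'<..d'}. g x) = 0" .
qed

section \<open>Delay operators\<close>

abbreviation sqn :: "real \<Rightarrow> (real \<Rightarrow> real) \<Rightarrow> ennreal" where
 "sqn n g \<equiv> (\<integral>\<^sup>+t. ennreal (indicator {..n} t * (g t)\<^sup>2) \<partial>lborel)"

text \<open>Every section in time belongs to \<open>L2c\<close>, not only almost every one, so that
  \<open>Jt\<close> applies for each x. Joint measurability is demanded because the delays below
  depend on x.\<close>

definition Qc :: "real \<Rightarrow> real \<Rightarrow> (real \<Rightarrow> real \<Rightarrow> real) set" where
 "Qc \<alpha> \<beta> = {v. (\<lambda>(x, t). v x t) \<in> borel_measurable (borel \<Otimes>\<^sub>M borel) \<and> (\<forall>x. v x \<in> L2c) \<and>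
   (\<forall>x. x \<notin> {\<alpha>..\<beta>} \<longrightarrow> v x = (\<lambda>t. 0)) \<and> (\<forall>n. (\<integral>\<^sup>+x. sqn n (v x) \<partial>lborel) < \<infinity>)}"

text \<open>A superposition of signals with delay \<open>c x\<close>. It covers averages against a
  weight (delay 0) as well as integrals along the characteristics through a point.\<close>

definition Pop :: "(real \<Rightarrow> real) \<Rightarrow> (real \<Rightarrow> real) \<Rightarrow> (real \<Rightarrow> real \<Rightarrow> real) \<Rightarrow> real \<Rightarrow> real" where
 "Pop \<kappa> c v t = (LBINT x. \<kappa> x * v x (t - c x))"

lemma QcD:
 assumes "v \<in> Qc \<alpha> \<beta>"
 shows "\<And>x. v x \<in> L2c" "\<And>x. x \<notin> {\<alpha>..\<beta>} \<Longrightarrow> v x = (\<lambda>t. 0)" "\<And>n. (\<integral>\<^sup>+x. sqn n (v x) \<partial>lborel) < \<infinity>"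
 using assms by (auto simp: Qc_def)

lemma Qc_measurable:
 assumes "v \<in> Qc \<alpha> \<beta>" "f \<in> borel_measurable M" "g \<in> borel_measurable M"
 shows "(\<lambda>z. v (f z) (g z)) \<in> borel_measurable M"
proof -
 have "(\<lambda>(x, t). v x t) \<in> borel_measurable (borel \<Otimes>\<^sub>M borel)" using assms(1) by (simp add: Qc_def)
 from measurable_compose[OF measurable_Pair[OF assms(2,3)] this] show ?thesis by simp
qed

lemma sqn_shift_le:
 assumes [measurable]: "g \<in> borel_measurable borel" and c: "c \<ge> 0"
 shows "sqn n (\<lambda>t. g (t - c)) \<le> sqn n g"
proof -
 have "sqn n g = (\<integral>\<^sup>+t. ennreal (indicator {..n} (- c + 1 * t) * (g (- c + 1 * t))\<^sup>2) \<partial>lborel)"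
  by (subst nn_integral_real_affine[where c=1 and t="- c"]) auto
 also have "\<dots> \<ge> sqn n (\<lambda>t. g (t - c))"
  by (intro nn_integral_mono ennreal_leI) (use c in \<open>auto simp: indicator_def\<close>)
 finally show ?thesis .
qed

lemma Cauchy_Schwarz_Icc:
 assumes [measurable]: "h \<in> borel_measurable borel" and ab: "\<alpha> \<le> \<beta>" and out: "\<And>x. x \<notin> {\<alpha>..\<beta>} \<Longrightarrow> h x = 0"
 shows "(\<integral>\<^sup>+x. h x \<partial>lborel)\<^sup>2 \<le> ennreal (\<beta> - \<alpha>) * (\<integral>\<^sup>+x. (h x)\<^sup>2 \<partial>lborel)"
proof -
 have "(\<integral>\<^sup>+x. h x \<partial>lborel) = (\<integral>\<^sup>+x. indicator {\<alpha>..\<beta>} x * h x \<partial>lborel)"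
  using out by (intro nn_integral_cong) (auto simp: indicator_def)
 also have "\<dots>\<^sup>2 \<le> (\<integral>\<^sup>+x. (indicator {\<alpha>..\<beta>} x)\<^sup>2 \<partial>lborel) * (\<integral>\<^sup>+x. (h x)\<^sup>2 \<partial>lborel)"
  by (intro Cauchy_Schwarz_nn_integral) auto
 also have "(\<integral>\<^sup>+x. (indicator {\<alpha>..\<beta>} x)\<^sup>2 \<partial>lborel) = (\<integral>\<^sup>+x. indicator {\<alpha>..\<beta>} x \<partial>lborel)"
  by (intro nn_integral_cong) (auto simp: indicator_def)
 also have "\<dots> = ennreal (\<beta> - \<alpha>)" using ab by simp
 finally show ?thesis .
qed

lemma Lint_sq_le:
 fixes h :: "real \<Rightarrow> real"
 assumes [measurable]: "h \<in> borel_measurable borel" and ab: "\<alpha> \<le> \<beta>" and out: "\<And>x. x \<notin> {\<alpha>..\<beta>} \<Longrightarrow> h x = 0"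
 shows "ennreal ((LBINT x. h x)\<^sup>2) \<le> ennreal (\<beta> - \<alpha>) * (\<integral>\<^sup>+x. ennreal ((h x)\<^sup>2) \<partial>lborel)"
proof -
 have "ennreal \<bar>LBINT x. h x\<bar> \<le> (\<integral>\<^sup>+x. ennreal \<bar>h x\<bar> \<partial>lborel)"
 proof (cases "integrable lborel h")
  case True
  from integral_norm_bound_ennreal[OF True] show ?thesis by simp
 qed (simp add: not_integrable_integral_eq)
 then have "(ennreal \<bar>LBINT x. h x\<bar>)\<^sup>2 \<le> (\<integral>\<^sup>+x. ennreal \<bar>h x\<bar> \<partial>lborel)\<^sup>2"
  by (rule power_mono) simp
 also have "\<dots> \<le> ennreal (\<beta> - \<alpha>) * (\<integral>\<^sup>+x. (ennreal \<bar>h x\<bar>)\<^sup>2 \<partial>lborel)"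
  by (rule Cauchy_Schwarz_Icc) (use ab out in auto)
 finally show ?thesis by (simp add: ennreal_power)
qed

lemma Jt_measurable:
 assumes v: "v \<in> Qc \<alpha> \<beta>"
 shows "(\<lambda>(x, t). Jt (v x) t) \<in> borel_measurable (borel \<Otimes>\<^sub>M borel)"
proof -
 note Qc_measurable[OF v, measurable (raw)]
 have "(\<lambda>(x, t). LBINT s. (if s \<le> t then v x s else 0)) \<in> borel_measurable (borel \<Otimes>\<^sub>M borel)"
  by measurable
 also have "(\<lambda>(x, t). LBINT s. (if s \<le> t then v x s else 0)) = (\<lambda>(x, t). Jt (v x) t)"
  unfolding Jt_def set_lebesgue_integral_def
  by (intro ext, clarsimp, intro Bochner_Integration.integral_cong) (auto simp: indicator_def)
 finally show ?thesis .
qed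

lemma sqn_measurable:
 assumes v: "v \<in> Qc \<alpha> \<beta>"
 shows "(\<lambda>x. sqn n (v x)) \<in> borel_measurable borel"
proof -
 note Qc_measurable[OF v, measurable (raw)]
 show ?thesis by measurable
qed

lemma sqn_Jt_le:
 assumes g: "g \<in> L2c" and n: "n \<ge> 0"
 shows "sqn n (Jt g) \<le> ennreal (n * n) * sqn n g"
proof -
 have "sqn n (Jt g) \<le> (\<integral>\<^sup>+t. indicator {0..n} t * (ennreal n * sqn n g) \<partial>lborel)"
 proof (rule nn_integral_mono)
  fix t
  show "ennreal (indicator {..n} t * (Jt g t)\<^sup>2) \<le> indicator {0..n} t * (ennreal n * sqn n g)"
  proof (cases "0 \<le> t \<and> t \<le> n")
   case True
   have "sqn t g \<le> sqn n g"
    by (intro nn_integral_mono ennreal_leI) (use True in \<open>auto simp: indicator_def\<close>)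
   then have "ennreal t * sqn t g \<le> ennreal n * sqn n g"
    using True by (intro mult_mono ennreal_leI) auto
   with Jt_sq_le[OF g, of t] have "ennreal ((Jt g t)\<^sup>2) \<le> ennreal n * sqn n g" by (rule order_trans)
   then show ?thesis using True by simp
  next
   case False
   then show ?thesis using Jt_nonpos[OF g, of t] by (auto simp: indicator_def)
  qed
 qed
 also have "\<dots> = (\<integral>\<^sup>+t. indicator {0..n} t \<partial>lborel) * (ennreal n * sqn n g)"
  by (rule nn_integral_multc) auto
 also have "\<dots> = ennreal (n * n) * sqn n g"
  using n by (simp add: ennreal_mult mult.assoc)
 finally show ?thesis .
qed

lemma Qc_mono_n:
 assumes "\<And>n. n \<ge> 0 \<Longrightarrow> (\<integral>\<^sup>+x. sqn n (v x) \<partial>lborel) < \<infinity>"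
 shows "(\<integral>\<^sup>+x. sqn n (v x) \<partial>lborel) < \<infinity>"
proof -
 have "(\<integral>\<^sup>+x. sqn n (v x) \<partial>lborel) \<le> (\<integral>\<^sup>+x. sqn (max n 0) (v x) \<partial>lborel)"
  by (intro nn_integral_mono ennreal_leI) (auto simp: indicator_def)
 also have "\<dots> < \<infinity>" by (rule assms) simp
 finally show ?thesis .
qed

lemma Jt_Qc:
 assumes v: "v \<in> Qc \<alpha> \<beta>"
 shows "(\<lambda>x. Jt (v x)) \<in> Qc \<alpha> \<beta>"
proof -
 have "(\<integral>\<^sup>+x. sqn n (Jt (v x)) \<partial>lborel) < \<infinity>" if n: "n \<ge> 0" for n
 proof -
  have "(\<integral>\<^sup>+x. sqn n (Jt (v x)) \<partial>lborel) \<le> (\<integral>\<^sup>+x. ennreal (n * n) * sqn n (v x) \<partial>lborel)"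
   by (intro nn_integral_mono sqn_Jt_le QcD(1)[OF v] n)
  also have "\<dots> = ennreal (n * n) * (\<integral>\<^sup>+x. sqn n (v x) \<partial>lborel)"
   by (rule nn_integral_cmult) (use sqn_measurable[OF v] in simp)
  also have "\<dots> < \<infinity>" using QcD(3)[OF v, of n] by (simp add: ennreal_mult_less_top)
  finally show ?thesis .
 qed
 then have "(\<integral>\<^sup>+x. sqn n (Jt (v x)) \<partial>lborel) < \<infinity>" for n by (rule Qc_mono_n)
 moreover have "Jt (v x) = (\<lambda>t. 0)" if "x \<notin> {\<alpha>..\<beta>}" for x
  using QcD(2)[OF v that] by (intro ext) simp
 ultimately show ?thesis
  using Jt_measurable[OF v] QcD(1)[OF v] by (auto simp: Qc_def Jt_L2c)
qed

lemma Jt_pow_Qc: "v \<in> Qc \<alpha> \<beta> \<Longrightarrow> (\<lambda>x. (Jt ^^ k) (v x)) \<in> Qc \<alpha> \<beta>"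
 by (induction k) (auto dest: Jt_Qc)

lemma Qc_add:
 assumes v: "v \<in> Qc \<alpha> \<beta>" and w: "w \<in> Qc \<alpha> \<beta>"
 shows "(\<lambda>x t. v x t + w x t) \<in> Qc \<alpha> \<beta>"
proof -
 note Qc_measurable[OF v, measurable (raw)] Qc_measurable[OF w, measurable (raw)]
 have "(\<integral>\<^sup>+x. sqn n (\<lambda>t. v x t + w x t) \<partial>lborel) < \<infinity>" for n
 proof -
  have le: "(v x t + w x t)\<^sup>2 \<le> 2 * (v x t)\<^sup>2 + 2 * (w x t)\<^sup>2" for x t
   using sum_squares_ge_zero[of "v x t - w x t" 0] by (simp add: power2_eq_square algebra_simps)
  have "(\<integral>\<^sup>+x. sqn n (\<lambda>t. v x t + w x t) \<partial>lborel) \<le>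
   (\<integral>\<^sup>+x. (\<integral>\<^sup>+t. ennreal (2 * (indicator {..n} t * (v x t)\<^sup>2) + 2 * (indicator {..n} t * (w x t)\<^sup>2)) \<partial>lborel) \<partial>lborel)"
   by (intro nn_integral_mono ennreal_leI) (use le in \<open>auto simp: indicator_def\<close>)
  also have "\<dots> = (\<integral>\<^sup>+x. (\<integral>\<^sup>+t. ennreal 2 * ennreal (indicator {..n} t * (v x t)\<^sup>2) + ennreal 2 * ennreal (indicator {..n} t * (w x t)\<^sup>2) \<partial>lborel) \<partial>lborel)"
   by (intro nn_integral_cong) (simp add: ennreal_plus ennreal_mult' del: ennreal_numeral)
  also have "\<dots> = ennreal 2 * (\<integral>\<^sup>+x. sqn n (v x) \<partial>lborel) + ennreal 2 * (\<integral>\<^sup>+x. sqn n (w x) \<partial>lborel)"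
   by (simp add: nn_integral_add nn_integral_cmult del: ennreal_numeral)
  also have "\<dots> < \<infinity>"
   using QcD(3)[OF v, of n] QcD(3)[OF w, of n] by (auto simp: ennreal_mult_less_top simp del: ennreal_numeral)
  finally show ?thesis .
 qed
 moreover have "(\<lambda>(x, t). v x t + w x t) \<in> borel_measurable (borel \<Otimes>\<^sub>M borel)" by measurable
 ultimately show ?thesis
  using QcD(1,2)[OF v] QcD(1,2)[OF w] by (auto simp: Qc_def intro: L2c_add)
qed

lemma Qc_mult:
 assumes v: "v \<in> Qc \<alpha> \<beta>" and q: "q \<in> borel_measurable borel" and K: "\<And>x. \<bar>q x\<bar> \<le> K"
 shows "(\<lambda>x t. q x * v x t) \<in> Qc \<alpha> \<beta>"
proof -
 note Qc_measurable[OF v, measurable (raw)] q[measurable]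
 have "(\<integral>\<^sup>+x. sqn n (\<lambda>t. q x * v x t) \<partial>lborel) < \<infinity>" for n
 proof -
  have q2: "(q x)\<^sup>2 \<le> K\<^sup>2" for x using power_mono[OF K[of x], of 2] by simp
  have "(\<integral>\<^sup>+x. sqn n (\<lambda>t. q x * v x t) \<partial>lborel) \<le> (\<integral>\<^sup>+x. (\<integral>\<^sup>+t. ennreal (K\<^sup>2 * (indicator {..n} t * (v x t)\<^sup>2)) \<partial>lborel) \<partial>lborel)"
   by (intro nn_integral_mono ennreal_leI) (use q2 in \<open>auto simp: indicator_def power_mult_distrib mult_right_mono\<close>)
  also have "\<dots> = (\<integral>\<^sup>+x. (\<integral>\<^sup>+t. ennreal (K\<^sup>2) * ennreal (indicator {..n} t * (v x t)\<^sup>2) \<partial>lborel) \<partial>lborel)"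
   by (intro nn_integral_cong) (simp add: ennreal_mult')
  also have "\<dots> = ennreal (K\<^sup>2) * (\<integral>\<^sup>+x. sqn n (v x) \<partial>lborel)"
   by (simp add: nn_integral_cmult)
  also have "\<dots> < \<infinity>"
   using QcD(3)[OF v, of n] by (auto simp: ennreal_mult_less_top)
  finally show ?thesis .
 qed
 moreover have "(\<lambda>(x, t). q x * v x t) \<in> borel_measurable (borel \<Otimes>\<^sub>M borel)" by measurable
 ultimately show ?thesis
  using QcD(1,2)[OF v] by (auto simp: Qc_def intro: L2c_cmult)
qed

lemma Qc_cmult: "v \<in> Qc \<alpha> \<beta> \<Longrightarrow> (\<lambda>x t. k * v x t) \<in> Qc \<alpha> \<beta>"
 by (rule Qc_mult[where q="\<lambda>x. k" and K="\<bar>k\<bar>"]) auto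

lemma Qc_diff: "v \<in> Qc \<alpha> \<beta> \<Longrightarrow> w \<in> Qc \<alpha> \<beta> \<Longrightarrow> (\<lambda>x t. v x t - w x t) \<in> Qc \<alpha> \<beta>"
 using Qc_add[OF _ Qc_cmult[of w \<alpha> \<beta> "-1"], of v] by simp

locale Pop_data =
 fixes \<kappa> c :: "real \<Rightarrow> real" and K :: real
 assumes \<kappa> [measurable]: "\<kappa> \<in> borel_measurable borel" and K: "\<And>x. \<bar>\<kappa> x\<bar> \<le> K"
  and c [measurable]: "c \<in> borel_measurable borel" and c0: "\<And>x. 0 \<le> c x"
begin

text \<open>Absolute integrability, which licenses the exchanges of integrals below. Cauchy-Schwarz
  is used in time and then in space, and a nonnegative delay does not increase the square norm up to
  time t.\<close>

lemma nn_L1: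
 assumes v: "v \<in> Qc \<alpha> \<beta>" and ab: "\<alpha> \<le> \<beta>"
 shows "(\<integral>\<^sup>+x. \<integral>\<^sup>+s. ennreal (indicator {..t} s * \<bar>\<kappa> x * v x (s - c x)\<bar>) \<partial>lborel \<partial>lborel) < \<infinity>"
proof -
 note Qc_measurable[OF v, measurable (raw)]
 define g where "g = (\<lambda>x. \<integral>\<^sup>+s. ennreal (indicator {..t} s * \<bar>v x (s - c x)\<bar>) \<partial>lborel)"
 have g [measurable]: "g \<in> borel_measurable borel" unfolding g_def by measurable
 have L: "(\<lambda>s. v x (s - c x)) \<in> L2c" for x by (intro L2c_shift QcD(1)[OF v] c0)
 have g2: "(g x)\<^sup>2 \<le> ennreal t * sqn t (v x)" for x
 proof -
  have "(g x)\<^sup>2 \<le> ennreal t * sqn t (\<lambda>s. v x (s - c x))"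
   using nn_integral_L2c_le[OF L[of x], of t] by (simp add: g_def)
  also have "\<dots> \<le> ennreal t * sqn t (v x)"
   by (intro mult_left_mono sqn_shift_le c0 L2cD(1) QcD(1)[OF v]) auto
  finally show ?thesis .
 qed
 have "(\<integral>\<^sup>+x. g x \<partial>lborel)\<^sup>2 \<le> ennreal (\<beta> - \<alpha>) * (\<integral>\<^sup>+x. (g x)\<^sup>2 \<partial>lborel)"
 proof (rule Cauchy_Schwarz_Icc[OF g ab])
  fix x assume "x \<notin> {\<alpha>..\<beta>}" then show "g x = 0" using QcD(2)[OF v, of x] by (simp add: g_def)
 qed
 also have "(\<integral>\<^sup>+x. (g x)\<^sup>2 \<partial>lborel) \<le> (\<integral>\<^sup>+x. ennreal t * sqn t (v x) \<partial>lborel)"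
  by (intro nn_integral_mono g2)
 also have "\<dots> = ennreal t * (\<integral>\<^sup>+x. sqn t (v x) \<partial>lborel)"
  by (rule nn_integral_cmult) (use sqn_measurable[OF v] in simp)
 finally have "(\<integral>\<^sup>+x. g x \<partial>lborel)\<^sup>2 \<le> ennreal (\<beta> - \<alpha>) * (ennreal t * (\<integral>\<^sup>+x. sqn t (v x) \<partial>lborel))"
  by (simp add: mult_left_mono)
 also have "\<dots> < \<infinity>" using QcD(3)[OF v, of t] by (simp add: ennreal_mult_less_top)
 finally have fin: "(\<integral>\<^sup>+x. g x \<partial>lborel) < \<infinity>" by (simp add: power_less_top_ennreal)
 have "(\<integral>\<^sup>+x. \<integral>\<^sup>+s. ennreal (indicator {..t} s * \<bar>\<kappa> x * v x (s - c x)\<bar>) \<partial>lborel \<partial>lborel)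
   \<le> (\<integral>\<^sup>+x. \<integral>\<^sup>+s. ennreal (\<bar>K\<bar> * (indicator {..t} s * \<bar>v x (s - c x)\<bar>)) \<partial>lborel \<partial>lborel)"
 proof (intro nn_integral_mono ennreal_leI)
  fix x s
  have "\<bar>\<kappa> x\<bar> * \<bar>v x (s - c x)\<bar> \<le> \<bar>K\<bar> * \<bar>v x (s - c x)\<bar>" using K[of x] by (intro mult_right_mono) auto
  then show "indicator {..t} s * \<bar>\<kappa> x * v x (s - c x)\<bar> \<le> \<bar>K\<bar> * (indicator {..t} s * \<bar>v x (s - c x)\<bar>)"
   by (auto simp: indicator_def abs_mult)
 qed
 also have "\<dots> = (\<integral>\<^sup>+x. \<integral>\<^sup>+s. ennreal \<bar>K\<bar> * ennreal (indicator {..t} s * \<bar>v x (s - c x)\<bar>) \<partial>lborel \<partial>lborel)"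
  by (intro nn_integral_cong) (simp add: ennreal_mult')
 also have "\<dots> = ennreal \<bar>K\<bar> * (\<integral>\<^sup>+x. g x \<partial>lborel)"
  unfolding g_def by (simp add: nn_integral_cmult)
 also have "\<dots> < \<infinity>" using fin by (simp add: ennreal_mult_less_top)
 finally show ?thesis .
qed

lemma Pop_measurable:
 assumes v: "v \<in> Qc \<alpha> \<beta>" shows "Pop \<kappa> c v \<in> borel_measurable borel"
proof -
 note Qc_measurable[OF v, measurable (raw)]
 show ?thesis unfolding Pop_def by measurable
qed

lemma sqn_Pop_le:
 assumes v: "v \<in> Qc \<alpha> \<beta>" and ab: "\<alpha> \<le> \<beta>"
 shows "sqn n (Pop \<kappa> c v) \<le> ennreal (\<beta> - \<alpha>) * (ennreal (K\<^sup>2) * (\<integral>\<^sup>+x. sqn n (v x) \<partial>lborel))"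
proof -
 note Qc_measurable[OF v, measurable (raw)]
 note [measurable] = Pop_measurable[OF v]
 have 1: "ennreal (indicator {..n} t * (Pop \<kappa> c v t)\<^sup>2) \<le>
   ennreal (\<beta> - \<alpha>) * (\<integral>\<^sup>+x. ennreal (K\<^sup>2) * ennreal (indicator {..n} t * (v x (t - c x))\<^sup>2) \<partial>lborel)" for t
 proof (cases "t \<le> n")
  case True
  have "ennreal ((Pop \<kappa> c v t)\<^sup>2) \<le> ennreal (\<beta> - \<alpha>) * (\<integral>\<^sup>+x. ennreal ((\<kappa> x * v x (t - c x))\<^sup>2) \<partial>lborel)"
   unfolding Pop_def by (rule Lint_sq_le) (use ab QcD(2)[OF v] in auto)
  also have "\<dots> \<le> ennreal (\<beta> - \<alpha>) * (\<integral>\<^sup>+x. ennreal (K\<^sup>2 * (v x (t - c x))\<^sup>2) \<partial>lborel)"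
  proof (intro mult_left_mono nn_integral_mono ennreal_leI)
   fix x have "(\<kappa> x)\<^sup>2 \<le> K\<^sup>2" using power_mono[OF K[of x], of 2] by simp
   then show "(\<kappa> x * v x (t - c x))\<^sup>2 \<le> K\<^sup>2 * (v x (t - c x))\<^sup>2"
    by (simp add: power_mult_distrib mult_right_mono)
  qed auto
  finally show ?thesis using True by (simp add: ennreal_mult')
 qed simp
 have "sqn n (Pop \<kappa> c v) \<le> (\<integral>\<^sup>+t. ennreal (\<beta> - \<alpha>) * (\<integral>\<^sup>+x. ennreal (K\<^sup>2) * ennreal (indicator {..n} t * (v x (t - c x))\<^sup>2) \<partial>lborel) \<partial>lborel)"
  by (rule nn_integral_mono) (rule 1)
 also have "\<dots> = ennreal (\<beta> - \<alpha>) * (ennreal (K\<^sup>2) * (\<integral>\<^sup>+t. \<integral>\<^sup>+x. ennreal (indicator {..n} t * (v x (t - c x))\<^sup>2) \<partial>lborel \<partial>lborel))"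
  by (simp add: nn_integral_cmult)
 also have "(\<integral>\<^sup>+t. \<integral>\<^sup>+x. ennreal (indicator {..n} t * (v x (t - c x))\<^sup>2) \<partial>lborel \<partial>lborel)
   = (\<integral>\<^sup>+x. sqn n (\<lambda>t. v x (t - c x)) \<partial>lborel)"
  by (rule lborel_pair.Fubini') measurable
 also have "\<dots> \<le> (\<integral>\<^sup>+x. sqn n (v x) \<partial>lborel)"
  by (intro nn_integral_mono sqn_shift_le c0 L2cD(1) QcD(1)[OF v])
 finally show ?thesis
  by (simp add: mult_left_mono)
qed

lemma Pop_L2c:
 assumes v: "v \<in> Qc \<alpha> \<beta>" and ab: "\<alpha> \<le> \<beta>"
 shows "Pop \<kappa> c v \<in> L2c"
proof -
 have "Pop \<kappa> c v t = 0" if "t \<le> 0" for t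
 proof -
  have "v x (t - c x) = 0" for x
   by (rule L2cD(2)[OF QcD(1)[OF v]]) (use c0[of x] that in simp)
  then show ?thesis by (simp add: Pop_def)
 qed
 moreover have "sqn n (Pop \<kappa> c v) < \<infinity>" for n
  using QcD(3)[OF v, of n] by (intro le_less_trans[OF sqn_Pop_le[OF v ab]]) (simp add: ennreal_mult_less_top)
 ultimately show ?thesis using Pop_measurable[OF v] by (simp add: L2c_def)
qed

lemma Jt_Pop:
 assumes v: "v \<in> Qc \<alpha> \<beta>" and ab: "\<alpha> \<le> \<beta>"
 shows "Jt (Pop \<kappa> c v) = Pop \<kappa> c (\<lambda>x. Jt (v x))"
proof
 fix t
 note Qc_measurable[OF v, measurable (raw)]
 have "Jt (Pop \<kappa> c v) t = (LBINT s. LBINT x. indicator {..t} s * (\<kappa> x * v x (s - c x)))"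
  unfolding Jt_def Pop_def set_lebesgue_integral_def by simp
 also have "\<dots> = (LBINT x. LBINT s. indicator {..t} s * (\<kappa> x * v x (s - c x)))"
 proof (rule fubini_real(2)[symmetric])
  show "(\<lambda>(x, s). indicator {..t} s * (\<kappa> x * v x (s - c x))) \<in> borel_measurable (lborel \<Otimes>\<^sub>M lborel)"
   by measurable
  show "(\<integral>\<^sup>+x. \<integral>\<^sup>+s. ennreal \<bar>indicator {..t} s * (\<kappa> x * v x (s - c x))\<bar> \<partial>lborel \<partial>lborel) < \<infinity>"
   using nn_L1[OF v ab, of t] by (simp add: abs_mult)
 qed
 also have "\<dots> = (LBINT x. \<kappa> x * Jt (\<lambda>s. v x (s - c x)) t)"
 proof (intro LBINT_cong)
  fix x
  have "(LBINT s. indicator {..t} s * (\<kappa> x * v x (s - c x))) = (LBINT s. \<kappa> x * (indicator {..t} s * v x (s - c x)))"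
   by (simp only: mult.left_commute[of _ "\<kappa> x"])
  then show "(LBINT s. indicator {..t} s * (\<kappa> x * v x (s - c x))) = \<kappa> x * Jt (\<lambda>s. v x (s - c x)) t"
   by (simp add: Jt_def set_lebesgue_integral_def)
 qed
 also have "\<dots> = Pop \<kappa> c (\<lambda>x. Jt (v x)) t" by (simp add: Jt_shift Pop_def)
 finally show "Jt (Pop \<kappa> c v) t = Pop \<kappa> c (\<lambda>x. Jt (v x)) t" .
qed

lemma Jt_pow_Pop:
 assumes v: "v \<in> Qc \<alpha> \<beta>" and ab: "\<alpha> \<le> \<beta>"
 shows "(Jt ^^ k) (Pop \<kappa> c v) = Pop \<kappa> c (\<lambda>x. (Jt ^^ k) (v x))"
 by (induction k) (simp_all add: Jt_Pop[OF Jt_pow_Qc[OF v] ab])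

text \<open>The exceptional times depend on x and are moved by the delay \<open>c x\<close>, hence
  Fubini for null sets. As the delay is nonnegative, agreement at times below T is enough.\<close>

lemma Pop_cong_AE:
 assumes v: "v \<in> Qc \<alpha> \<beta>" and w: "w \<in> Qc \<alpha> \<beta>"
  and eq: "AE x in lborel. AE t in lborel. t < T \<longrightarrow> v x t = w x t"
 shows "AE t in lborel. t < T \<longrightarrow> Pop \<kappa> c v t = Pop \<kappa> c w t"
proof -
 note Qc_measurable[OF v, measurable (raw)] Qc_measurable[OF w, measurable (raw)]
 have "AE x in lborel. AE t in lborel. t < T \<longrightarrow> v x (t - c x) = w x (t - c x)"
  using eq
 proof eventually_elim
  case (elim x)
  from AE_shift[OF elim, of "c x"] show ?case
   by eventually_elim (use c0[of x] in auto)
 qed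
 then have "AE t in lborel. AE x in lborel. t < T \<longrightarrow> v x (t - c x) = w x (t - c x)"
  by (subst (asm) lborel_pair.AE_commute) measurable
 then show ?thesis
 proof eventually_elim
  case (elim t)
  show ?case
  proof
   assume "t < T"
   with elim have "AE x in lborel. v x (t - c x) = w x (t - c x)" by simp
   then show "Pop \<kappa> c v t = Pop \<kappa> c w t"
    unfolding Pop_def by (intro integral_cong_AE) auto
  qed
 qed
qed

text \<open>For fixed x the delay moves the vertex of the kernel from \<open>\<sigma>\<close> to
  \<open>\<sigma> - c x\<close>. In this way a test field depending on x and t is converted into
  integrations in time of a single delay integral.\<close>

lemma Pop_pp:
 assumes v: "v \<in> Qc \<alpha> \<beta>" and ab: "\<alpha> \<le> \<beta>" and s: "\<sigma> \<le> T" and n: "n > 0"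
 shows "(LBINT t:{0..T}. LBINT x. \<kappa> x * v x t * pp n (\<sigma> - c x - t)) = (Jt ^^ Suc n) (Pop \<kappa> c v) \<sigma>"
proof -
 note Qc_measurable[OF v, measurable (raw)]
 have [measurable]: "pp n \<in> borel_measurable borel"
  using pp_continuous[OF continuous_on_id, of UNIV n] by (simp add: borel_measurable_continuous_onI)
 interpret Z: Pop_data \<kappa> "\<lambda>x. 0" K by unfold_locales (use K in auto)
 define C where "C = pp n (max \<sigma> 0)"
 have ppC: "0 \<le> pp n (\<sigma> - c x - t) \<and> pp n (\<sigma> - c x - t) \<le> C" if "t \<ge> 0" for x t
  using that c0[of x] by (auto simp: pp_def C_def intro!: divide_right_mono power_mono)
 have "(LBINT t:{0..T}. LBINT x. \<kappa> x * v x t * pp n (\<sigma> - c x - t)) =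
   (LBINT t. LBINT x. indicator {0..T} t * (\<kappa> x * v x t * pp n (\<sigma> - c x - t)))"
  unfolding set_lebesgue_integral_def by simp
 also have "\<dots> = (LBINT x. LBINT t. indicator {0..T} t * (\<kappa> x * v x t * pp n (\<sigma> - c x - t)))"
 proof (rule fubini_real(2)[symmetric])
  show "(\<lambda>(x, t). indicator {0..T} t * (\<kappa> x * v x t * pp n (\<sigma> - c x - t))) \<in> borel_measurable (lborel \<Otimes>\<^sub>M lborel)"
   by measurable
  have "(\<integral>\<^sup>+x. \<integral>\<^sup>+t. ennreal \<bar>indicator {0..T} t * (\<kappa> x * v x t * pp n (\<sigma> - c x - t))\<bar> \<partial>lborel \<partial>lborel)
    \<le> (\<integral>\<^sup>+x. \<integral>\<^sup>+t. ennreal (C * (indicator {..T} t * \<bar>\<kappa> x * v x (t - 0)\<bar>)) \<partial>lborel \<partial>lborel)"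
  proof (intro nn_integral_mono ennreal_leI)
   fix x t
   show "\<bar>indicator {0..T} t * (\<kappa> x * v x t * pp n (\<sigma> - c x - t))\<bar> \<le> C * (indicator {..T} t * \<bar>\<kappa> x * v x (t - 0)\<bar>)"
   proof (cases "0 \<le> t \<and> t \<le> T")
    case True
    then have "\<bar>\<kappa> x * v x t\<bar> * \<bar>pp n (\<sigma> - c x - t)\<bar> \<le> \<bar>\<kappa> x * v x t\<bar> * C"
     using ppC[of t x] by (intro mult_left_mono) auto
    then show ?thesis using True by (simp add: abs_mult mult.commute)
   next
    case False
    have "0 \<le> C" using ppC[of 0 0] by simp
    then show ?thesis using False by (auto simp: indicator_def)
   qed
  qed
  also have "\<dots> = (\<integral>\<^sup>+x. \<integral>\<^sup>+t. ennreal C * ennreal (indicator {..T} t * \<bar>\<kappa> x * v x (t - 0)\<bar>) \<partial>lborel \<partial>lborel)"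
   using ppC[of 0 0] by (intro nn_integral_cong) (simp add: ennreal_mult')
  also have "\<dots> = ennreal C * (\<integral>\<^sup>+x. \<integral>\<^sup>+t. ennreal (indicator {..T} t * \<bar>\<kappa> x * v x (t - 0)\<bar>) \<partial>lborel \<partial>lborel)"
   by (simp add: nn_integral_cmult)
  also have "\<dots> < \<infinity>" using Z.nn_L1[OF v ab, of T] by (simp add: ennreal_mult_less_top)
  finally show "(\<integral>\<^sup>+x. \<integral>\<^sup>+t. ennreal \<bar>indicator {0..T} t * (\<kappa> x * v x t * pp n (\<sigma> - c x - t))\<bar> \<partial>lborel \<partial>lborel) < \<infinity>" .
 qed
 also have "\<dots> = (LBINT x. \<kappa> x * (Jt ^^ Suc n) (v x) (\<sigma> - c x))"
 proof (intro LBINT_cong)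
  fix x
  have "(LBINT t. indicator {0..T} t * (\<kappa> x * v x t * pp n (\<sigma> - c x - t)))
   = \<kappa> x * (LBINT t:{0..T}. v x t * pp n (\<sigma> - c x - t))"
  proof -
   have "(LBINT t. indicator {0..T} t * (\<kappa> x * v x t * pp n (\<sigma> - c x - t))) = (LBINT t. \<kappa> x * (indicator {0..T} t * (v x t * pp n (\<sigma> - c x - t))))"
    by (simp only: mult.left_commute[of _ "\<kappa> x"] mult.assoc)
   then show ?thesis by (simp add: set_lebesgue_integral_def)
  qed
  also have "\<dots> = \<kappa> x * (Jt ^^ Suc n) (v x) (\<sigma> - c x)"
   by (subst Jt_pp[OF QcD(1)[OF v] _ n]) (use s c0[of x] in auto)
  finally show "(LBINT t. indicator {0..T} t * (\<kappa> x * v x t * pp n (\<sigma> - c x - t))) = \<kappa> x * (Jt ^^ Suc n) (v x) (\<sigma> - c x)" .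
 qed
 also have "\<dots> = (Jt ^^ Suc n) (Pop \<kappa> c v) \<sigma>"
  by (subst Jt_pow_Pop[OF v ab]) (simp add: Pop_def)
 finally show ?thesis .
qed

end

section \<open>Measurable versions\<close>

lemma lebesgue_on_borel_version:
 assumes f: "f \<in> borel_measurable (lebesgue_on S)" and S: "S \<in> sets borel"
 obtains g :: "real \<Rightarrow> real" where "g \<in> borel_measurable borel" "\<And>x. x \<notin> S \<Longrightarrow> g x = 0"
  "AE x in lborel. x \<in> S \<longrightarrow> g x = f x"
proof -
 have "(\<lambda>x. if x \<in> S then f x else 0) \<in> borel_measurable lebesgue"
  using f S by (simp add: borel_measurable_if)
 from completion_ex_borel_measurable_real[OF this]
 obtain g where g: "g \<in> borel_measurable lborel" "AE x in lborel. (if x \<in> S then f x else 0) = g x" by blast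
 show ?thesis
 proof (rule that[of "\<lambda>x. indicator S x * g x"])
  show "(\<lambda>x. indicator S x * g x) \<in> borel_measurable borel" using g(1) S by simp
  show "AE x in lborel. x \<in> S \<longrightarrow> indicator S x * g x = f x"
   using g(2) by eventually_elim auto
 qed auto
qed

text \<open>The bridge between two settings: the definitions integrate Lebesgue measurable functions
  over subintervals, the delay calculus works with Borel functions on the line.\<close>

lemma lebesgue_on_conv:
 fixes f f' :: "real \<Rightarrow> real"
 assumes f: "f \<in> borel_measurable (lebesgue_on S)" and S: "S \<in> sets borel"
  and f': "(\<lambda>x. indicator S x * f' x) \<in> borel_measurable borel" and eq: "AE x in lborel. x \<in> S \<longrightarrow> f x = f' x"
 shows "(LINT x|lebesgue_on S. f x) = (LBINT x. indicator S x * f' x)"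
  and "integrable (lebesgue_on S) f \<longleftrightarrow> integrable lborel (\<lambda>x. indicator S x * f' x)"
proof -
 have m: "(\<lambda>x. indicator S x *\<^sub>R f x) \<in> borel_measurable lebesgue"
  using f S by (subst (asm) borel_measurable_restrict_space_iff) auto
 have m': "(\<lambda>x. indicator S x * f' x) \<in> borel_measurable lebesgue"
  using measurable_completion[of "\<lambda>x. indicator S x * f' x" lborel borel] f' by simp
 have ae: "AE x in lebesgue. indicator S x *\<^sub>R f x = indicator S x * f' x"
  using AE_completion[OF eq] by eventually_elim (auto simp: indicator_def)
 have "(LINT x|lebesgue_on S. f x) = (LINT x|lebesgue. indicator S x *\<^sub>R f x)"
  using S by (intro integral_restrict_space) auto
 also have "\<dots> = (LINT x|lebesgue. indicator S x * f' x)" by (rule integral_cong_AE[OF m m' ae])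
 also have "\<dots> = (LBINT x. indicator S x * f' x)" by (rule integral_completion) (use f' in simp)
 finally show "(LINT x|lebesgue_on S. f x) = (LBINT x. indicator S x * f' x)" .
 have "integrable (lebesgue_on S) f \<longleftrightarrow> integrable lebesgue (\<lambda>x. indicator S x *\<^sub>R f x)"
  using S by (intro integrable_restrict_space) auto
 also have "\<dots> \<longleftrightarrow> integrable lebesgue (\<lambda>x. indicator S x * f' x)" by (rule integrable_cong_AE[OF m m' ae])
 also have "\<dots> \<longleftrightarrow> integrable lborel (\<lambda>x. indicator S x * f' x)" by (rule integrable_completion) (use f' in simp)
 finally show "integrable (lebesgue_on S) f \<longleftrightarrow> integrable lborel (\<lambda>x. indicator S x * f' x)" .
qed

lemma L2_borel_version:
 assumes "g \<in> L2 a b"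
 obtains g' where "g' \<in> borel_measurable borel" "\<And>x. x \<notin> {a<..<b} \<Longrightarrow> g' x = 0"
  "AE x in lborel. x \<in> {a<..<b} \<longrightarrow> g' x = g x" "integrable lborel (\<lambda>x. (g' x)\<^sup>2)"
proof -
 have gm: "g \<in> borel_measurable (lebesgue_on {a<..<b})" and gi: "integrable (lebesgue_on {a<..<b}) (\<lambda>x. (g x)\<^sup>2)"
  using assms by (auto simp: L2_def)
 obtain g' where g': "g' \<in> borel_measurable borel" "\<And>x. x \<notin> {a<..<b} \<Longrightarrow> g' x = 0"
  "AE x in lborel. x \<in> {a<..<b} \<longrightarrow> g' x = g x"
  by (rule lebesgue_on_borel_version[OF gm]) auto
 have "integrable lborel (\<lambda>x. indicator {a<..<b} x * (g' x)\<^sup>2)"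
  using gi by (subst (asm) lebesgue_on_conv(2)[where f'="\<lambda>x. (g' x)\<^sup>2"]) (use gm g' in auto)
 also have "(\<lambda>x. indicator {a<..<b} x * (g' x)\<^sup>2) = (\<lambda>x. (g' x)\<^sup>2)"
  using g'(2) by (intro ext) (auto simp: indicator_def)
 finally show ?thesis using g' that by blast
qed

lemma L2_L2c_version:
 assumes "g \<in> L2 0 T"
 obtains g' where "g' \<in> L2c" "AE x in lborel. x \<in> {0<..<T} \<longrightarrow> g' x = g x" "\<And>x. x \<notin> {0<..<T} \<Longrightarrow> g' x = 0"
proof -
 obtain g' where g': "g' \<in> borel_measurable borel" "\<And>x. x \<notin> {0<..<T} \<Longrightarrow> g' x = 0"
  "AE x in lborel. x \<in> {0<..<T} \<longrightarrow> g' x = g x" "integrable lborel (\<lambda>x. (g' x)\<^sup>2)"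
  by (rule L2_borel_version[OF assms]) blast
 note [measurable] = g'(1)
 have "sqn n g' < \<infinity>" for n
 proof -
  have "sqn n g' \<le> (\<integral>\<^sup>+x. ennreal ((g' x)\<^sup>2) \<partial>lborel)"
   by (intro nn_integral_mono ennreal_leI) (auto simp: indicator_def)
  also have "\<dots> < \<infinity>" using g'(4) by (simp add: integrable_iff_bounded)
  finally show ?thesis .
 qed
 then have "g' \<in> L2c" using g' by (auto simp: L2c_def)
 then show ?thesis using g' that by blast
qed

text \<open>For each t only a function of x is given, which says nothing about measurability in both
  variables. Continuity of the path in mean square supplies a jointly measurable version.\<close>

locale L2_path =
 fixes l T :: real and u :: "real \<Rightarrow> real \<Rightarrow> real" and ub :: "real \<Rightarrow> real \<Rightarrow> real"
 assumes T: "T > 0"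
  and ubm: "\<And>t. t \<in> {0..T} \<Longrightarrow> ub t \<in> borel_measurable borel"
  and ub0: "\<And>t x. t \<in> {0..T} \<Longrightarrow> x \<notin> {0<..<l} \<Longrightarrow> ub t x = 0"
  and ubi: "\<And>t. t \<in> {0..T} \<Longrightarrow> integrable lborel (\<lambda>x. (ub t x)\<^sup>2)"
  and cont: "\<And>t. t \<in> {0..T} \<Longrightarrow> ((\<lambda>s. LBINT x. (ub s x - ub t x)\<^sup>2) \<longlongrightarrow> 0) (at t within {0..T})"
begin

definition dd :: "real \<Rightarrow> real \<Rightarrow> real" where "dd s t = (LBINT x. (ub s x - ub t x)\<^sup>2)"

lemma dd_int:
 assumes "s \<in> {0..T}" "t \<in> {0..T}"
 shows "integrable lborel (\<lambda>x. (ub s x - ub t x)\<^sup>2)"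
proof (rule Bochner_Integration.integrable_bound)
 show "integrable lborel (\<lambda>x. 2 * (ub s x)\<^sup>2 + 2 * (ub t x)\<^sup>2)"
  using ubi assms by auto
 show "(\<lambda>x. (ub s x - ub t x)\<^sup>2) \<in> borel_measurable lborel"
  using ubm assms by auto
 have "(ub s x - ub t x)\<^sup>2 \<le> 2 * (ub s x)\<^sup>2 + 2 * (ub t x)\<^sup>2" for x
  using sum_squares_ge_zero[of "ub s x + ub t x" 0] by (simp add: power2_eq_square algebra_simps)
 then show "AE x in lborel. norm ((ub s x - ub t x)\<^sup>2) \<le> norm (2 * (ub s x)\<^sup>2 + 2 * (ub t x)\<^sup>2)"
  by (intro AE_I2) simp
qed

lemma dd_triangle:
 assumes "s \<in> {0..T}" "t \<in> {0..T}" "r \<in> {0..T}"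
 shows "dd s t \<le> 2 * dd s r + 2 * dd t r"
proof -
 have "dd s t \<le> (LBINT x. 2 * (ub s x - ub r x)\<^sup>2 + 2 * (ub t x - ub r x)\<^sup>2)"
  unfolding dd_def
 proof (rule integral_mono)
  fix x show "(ub s x - ub t x)\<^sup>2 \<le> 2 * (ub s x - ub r x)\<^sup>2 + 2 * (ub t x - ub r x)\<^sup>2"
   using sum_squares_ge_zero[of "(ub s x - ub r x) + (ub t x - ub r x)" 0] by (simp add: power2_eq_square algebra_simps)
 qed (use dd_int assms in auto)
 also have "\<dots> = 2 * dd s r + 2 * dd t r"
  unfolding dd_def using dd_int assms by (subst Bochner_Integration.integral_add) auto
 finally show ?thesis .
qed

text \<open>The Heine-Cantor argument by subsequences; the squared distance satisfies the triangle
  inequality up to a factor 2, which does no harm to limits equal to 0.\<close>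

lemma dd_uniform:
 assumes "e > 0"
 obtains d where "d > 0" "\<And>s t. s \<in> {0..T} \<Longrightarrow> t \<in> {0..T} \<Longrightarrow> \<bar>s - t\<bar> < d \<Longrightarrow> dd s t < e"
proof -
 have "\<exists>d>0. \<forall>s\<in>{0..T}. \<forall>t\<in>{0..T}. \<bar>s - t\<bar> < d \<longrightarrow> dd s t < e"
 proof (rule ccontr)
  assume "\<not> ?thesis"
  then have "\<forall>n::nat. \<exists>s t. s \<in> {0..T} \<and> t \<in> {0..T} \<and> \<bar>s - t\<bar> < 1 / real (Suc n) \<and> e \<le> dd s t"
   by (metis not_less of_nat_0_less_iff zero_less_Suc zero_less_divide_1_iff)
  then obtain s t where st: "\<And>n::nat. s n \<in> {0..T} \<and> t n \<in> {0..T} \<and> \<bar>s n - t n\<bar> < 1 / real (Suc n) \<and> e \<le> dd (s n) (t n)"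
   by metis
  obtain r \<phi> where r: "r \<in> {0..T}" "strict_mono \<phi>" "(s \<circ> \<phi>) \<longlonglongrightarrow> r"
   using compact_Icc[of 0 T, unfolded compact_def] st by metis
  have z: "(\<lambda>n. 1 / real (Suc n)) \<longlonglongrightarrow> 0" using LIMSEQ_inverse_real_of_nat by (simp add: inverse_eq_divide)
  have "(\<lambda>n. s n - t n) \<longlonglongrightarrow> 0"
   by (rule Lim_null_comparison[OF _ z]) (use st in \<open>auto intro!: always_eventually less_imp_le\<close>)
  then have "((\<lambda>n. s n - t n) \<circ> \<phi>) \<longlonglongrightarrow> 0" by (rule LIMSEQ_subseq_LIMSEQ[OF _ r(2)])
  from tendsto_diff[OF r(3) this] have r': "(t \<circ> \<phi>) \<longlonglongrightarrow> r" by (simp add: o_def)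
  have c: "((\<lambda>n. dd (x (\<phi> n)) r) \<longlongrightarrow> 0) sequentially" if "(x \<circ> \<phi>) \<longlonglongrightarrow> r" "\<And>n. x n \<in> {0..T}" for x
  proof -
   have "((\<lambda>s. dd s r) \<longlongrightarrow> dd r r) (at r within {0..T})"
    using cont[OF r(1)] by (simp add: dd_def)
   then have "continuous (at r within {0..T}) (\<lambda>s. dd s r)" by (simp add: continuous_within)
   from continuous_within_tendsto_compose[OF this _ that(1)] that(2)
   show ?thesis by (auto simp: o_def dd_def)
  qed
  have "(\<lambda>n. 2 * dd (s (\<phi> n)) r + 2 * dd (t (\<phi> n)) r) \<longlonglongrightarrow> 2 * 0 + 2 * 0"
   by (intro tendsto_intros c r r') (use st in auto)
  moreover have "e \<le> 2 * dd (s (\<phi> n)) r + 2 * dd (t (\<phi> n)) r" for n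
   using dd_triangle[of "s (\<phi> n)" "t (\<phi> n)" r] st[of "\<phi> n"] r(1) by auto
  ultimately have "e \<le> 2 * 0 + 2 * 0" by (intro LIMSEQ_le_const) auto
  then show False using assms by simp
 qed
 then show ?thesis using that by blast
qed

text \<open>Rounds t up to the grid of multiples of T/m. Composed with it, the path takes finitely
  many values on (0, T].\<close>

definition \<tau> :: "nat \<Rightarrow> real \<Rightarrow> real" where
 "\<tau> m t = T * real_of_int \<lceil>t * real m / T\<rceil> / real m"

lemma \<tau>_props:
 assumes "t \<in> {0<..T}" "m > 0"
 shows "\<tau> m t \<in> {0..T}" "\<bar>\<tau> m t - t\<bar> < T / real m \<or> \<bar>\<tau> m t - t\<bar> = 0" "\<tau> m t \<in> (\<lambda>k. T * real k / real m) ` {..m}"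
proof -
 define y where "y = t * real m / T"
 have y: "0 < y" "y \<le> real m" using assms T by (auto simp: y_def divide_simps mult_right_mono)
 have c: "real_of_int \<lceil>y\<rceil> < y + 1" "y \<le> real_of_int \<lceil>y\<rceil>" by linarith+
 have k: "0 < \<lceil>y\<rceil>" "\<lceil>y\<rceil> \<le> int m" using y by (auto simp: ceiling_le_iff)
 show "\<tau> m t \<in> (\<lambda>k. T * real k / real m) ` {..m}"
  by (rule image_eqI[of _ _ "nat \<lceil>y\<rceil>"]) (use k y in \<open>auto simp: \<tau>_def y_def\<close>)
 then obtain k where k: "k \<le> m" "\<tau> m t = T * (real k / real m)" by auto
 have "real k / real m \<le> 1" "0 \<le> real k / real m" using k(1) assms(2) by (auto simp: divide_simps)
 then show "\<tau> m t \<in> {0..T}" 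
  using T mult_left_le[of "real k / real m" T] mult_nonneg_nonneg[of T "real k / real m"] unfolding k(2) by auto
 have ty: "t = T * y / real m" using T assms by (simp add: y_def)
 have "\<tau> m t - t = T / real m * (real_of_int \<lceil>y\<rceil> - y)"
  by (subst ty) (simp add: \<tau>_def y_def algebra_simps diff_divide_distrib)
 moreover have "T / real m * (real_of_int \<lceil>y\<rceil> - y) < T / real m * 1"
  using c T assms by (intro mult_strict_left_mono) auto
 moreover have "0 \<le> T / real m * (real_of_int \<lceil>y\<rceil> - y)" using c T by auto
 ultimately show "\<bar>\<tau> m t - t\<bar> < T / real m \<or> \<bar>\<tau> m t - t\<bar> = 0" by auto
qed

text \<open>Every time is close to one of finitely many grid times, whose norms are bounded by their
  sum.\<close>

lemma norm_bounded: obtains B where "\<And>t. t \<in> {0<..T} \<Longrightarrow> (LBINT x. (ub t x)\<^sup>2) \<le> B"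
proof -
 obtain d where d: "d > 0" "\<And>s t. s \<in> {0..T} \<Longrightarrow> t \<in> {0..T} \<Longrightarrow> \<bar>s - t\<bar> < d \<Longrightarrow> dd s t < 1"
  using dd_uniform[of 1] by auto
 obtain m :: nat where m: "T / d < real m" using reals_Archimedean2 by blast
 then have m0: "m > 0" using T d(1) by (cases m) (auto simp: divide_less_0_iff)
 have Tm: "T / real m < d" using m m0 d(1) by (simp add: divide_simps mult.commute)
 define S where "S = (\<lambda>k. T * real k / real m) ` {..m}"
 define n2 where "n2 = (\<lambda>s. LBINT x. (ub s x)\<^sup>2)"
 have n20: "0 \<le> n2 s" for s by (simp add: n2_def)
 show ?thesis
 proof (rule that[of "2 * 1 + 2 * sum n2 S"])
  fix t assume t: "t \<in> {0<..T}"
  define s where "s = \<tau> m t"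
  have s: "s \<in> {0..T}" "s \<in> S" "\<bar>t - s\<bar> < d"
   using \<tau>_props[OF t m0] Tm d(1) by (auto simp: s_def S_def)
  have tt: "t \<in> {0..T}" using t by auto
  have "(LBINT x. (ub t x)\<^sup>2) \<le> (LBINT x. 2 * (ub t x - ub s x)\<^sup>2 + 2 * (ub s x)\<^sup>2)"
  proof (rule integral_mono)
   fix x show "(ub t x)\<^sup>2 \<le> 2 * (ub t x - ub s x)\<^sup>2 + 2 * (ub s x)\<^sup>2"
    using sum_squares_ge_zero[of "ub t x - 2 * ub s x" 0] by (simp add: power2_eq_square algebra_simps)
  qed (use dd_int[OF tt s(1)] ubi[OF tt] ubi[OF s(1)] in auto)
  also have "\<dots> = 2 * dd t s + 2 * n2 s"
   unfolding dd_def n2_def using dd_int[OF tt s(1)] ubi[OF s(1)] by (subst Bochner_Integration.integral_add) auto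
  also have "\<dots> \<le> 2 * 1 + 2 * sum n2 S"
   using d(2)[OF tt s(1,3)] member_le_sum[OF s(2), of n2] n20 by (auto simp: S_def)
  finally show "(LBINT x. (ub t x)\<^sup>2) \<le> 2 * 1 + 2 * sum n2 S" .
 qed
qed

text \<open>Step functions in time are jointly measurable. Squared distances of at most 2^(-n) to
  the path are summable, so for each t the approximations converge for almost every x.\<close>

lemma measurable_version:
 obtains U where "U \<in> Qc 0 l" "\<And>t x. t > T \<Longrightarrow> U x t = 0"
  "\<And>t. t \<in> {0<..T} \<Longrightarrow> AE x in lborel. U x t = ub t x"
proof -
 have "\<exists>m::nat. m > 0 \<and> (\<forall>t\<in>{0<..T}. dd (\<tau> m t) t \<le> (1/2) ^ n)" for n :: nat
 proof -
  obtain d where d: "d > 0" "\<And>s t. s \<in> {0..T} \<Longrightarrow> t \<in> {0..T} \<Longrightarrow> \<bar>s - t\<bar> < d \<Longrightarrow> dd s t < (1/2)^n"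
   using dd_uniform[of "(1/2)^n"] by auto
  obtain m :: nat where m: "T / d < real m" using reals_Archimedean2 by blast
  then have m0: "m > 0" using T d(1) by (cases m) (auto simp: divide_less_0_iff)
  have Tm: "T / real m < d" using m m0 d(1) by (simp add: divide_simps mult.commute)
  have "dd (\<tau> m t) t \<le> (1/2) ^ n" if t: "t \<in> {0<..T}" for t
   using d(2)[of "\<tau> m t" t] \<tau>_props[OF t m0] Tm d(1) t by force
  then show ?thesis using m0 by blast
 qed
 then obtain m where m: "\<And>n. m n > 0" "\<And>n t. t \<in> {0<..T} \<Longrightarrow> dd (\<tau> (m n) t) t \<le> (1/2) ^ n"
  by metis
 define V where "V = (\<lambda>n x t. if 0 < t \<and> t \<le> T then ub (\<tau> (m n) t) x else 0)"
 have Vm: "(\<lambda>(x, t). V n x t) \<in> borel_measurable (borel \<Otimes>\<^sub>M borel)" for n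
 proof -
  \<comment> \<open>Indexed by the grid point, this is measurable in x for each of the countably
    many values of the ceiling.\<close>
  define W where "W = (\<lambda>(i::int) (z::real \<times> real). if 0 \<le> i \<and> i \<le> int (m n) then ub (T * real_of_int i / real (m n)) (fst z) else (0::real))"
  have Wm: "W i \<in> borel_measurable (borel \<Otimes>\<^sub>M borel)" for i
  proof (cases "0 \<le> i \<and> i \<le> int (m n)")
   case True
   then have "real_of_int i \<le> real (m n)" by linarith
   then have "real_of_int i / real (m n) \<le> 1" "0 \<le> real_of_int i / real (m n)" using True m(1)[of n] by (auto simp: divide_simps)
   then have "T * (real_of_int i / real (m n)) \<in> {0..T}"
    using T mult_left_le[of "real_of_int i / real (m n)" T] mult_nonneg_nonneg[of T "real_of_int i / real (m n)"] by auto
   then have "T * real_of_int i / real (m n) \<in> {0..T}" by simp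
   note ubm[OF this, measurable]
   show ?thesis using True unfolding W_def by simp
  next
   case False
   then have "W i = (\<lambda>z. 0)" by (auto simp: W_def fun_eq_iff)
   then show ?thesis by simp
  qed
  have g: "(\<lambda>z. \<lceil>snd z * real (m n) / T\<rceil>) \<in> measurable (borel \<Otimes>\<^sub>M borel) (count_space UNIV)"
   by measurable
  have "(\<lambda>z. W \<lceil>snd z * real (m n) / T\<rceil> z) \<in> borel_measurable (borel \<Otimes>\<^sub>M (borel :: real measure))"
   by (rule measurable_compose_countable[OF Wm g])
  then have "(\<lambda>z. if 0 < snd z \<and> snd z \<le> T then W \<lceil>snd z * real (m n) / T\<rceil> z else 0) \<in> borel_measurable (borel \<Otimes>\<^sub>M (borel :: real measure))"
   by measurable
  also have "(\<lambda>z. if 0 < snd z \<and> snd z \<le> T then W \<lceil>snd z * real (m n) / T\<rceil> z else 0) = (\<lambda>(x, t). V n x t)"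
  proof (rule ext, clarify)
   fix x t :: real
   have "0 \<le> \<lceil>t * real (m n) / T\<rceil> \<and> \<lceil>t * real (m n) / T\<rceil> \<le> int (m n)" if "0 < t" "t \<le> T"
   proof -
    have "0 < t * real (m n) / T" "t * real (m n) / T \<le> real (m n)"
     using that T m(1)[of n] by (auto simp: divide_simps mult_right_mono)
    then show ?thesis by (auto simp: ceiling_le_iff intro: less_imp_le)
   qed
   then show "(if 0 < snd (x, t) \<and> snd (x, t) \<le> T then W \<lceil>snd (x, t) * real (m n) / T\<rceil> (x, t) else 0) = V n x t"
    by (auto simp: W_def V_def \<tau>_def)
  qed
  finally show ?thesis .
 qed
 define U0 where "U0 = (\<lambda>x t. if 0 < t \<and> t \<le> T then lim (\<lambda>n. V n x t) else 0)"
 have U0m: "(\<lambda>(x, t). U0 x t) \<in> borel_measurable (borel \<Otimes>\<^sub>M borel)"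
 proof -
  have [measurable]: "(\<lambda>z. V n (fst z) (snd z)) \<in> borel_measurable (borel \<Otimes>\<^sub>M borel)" for n
   using Vm[of n] by (simp add: case_prod_beta)
  have "(\<lambda>z. if 0 < snd z \<and> snd z \<le> T then lim (\<lambda>n. V n (fst z) (snd z)) else 0) \<in> borel_measurable (borel \<Otimes>\<^sub>M (borel :: real measure))"
   by measurable
  then show ?thesis by (simp add: U0_def case_prod_beta)
 qed
 have U0eq: "AE x in lborel. U0 x t = ub t x" if t: "t \<in> {0<..T}" for t
 proof -
  have tt: "t \<in> {0..T}" using t by auto
  note s = \<tau>_props(1)[OF t m(1)]
  note [measurable] = ubm[OF tt] ubm[OF s]
  have "(\<integral>\<^sup>+x. (\<Sum>n. ennreal ((ub (\<tau> (m n) t) x - ub t x)\<^sup>2)) \<partial>lborel) = (\<Sum>n. \<integral>\<^sup>+x. ennreal ((ub (\<tau> (m n) t) x - ub t x)\<^sup>2) \<partial>lborel)"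
   by (rule nn_integral_suminf) measurable
  also have "\<dots> = (\<Sum>n. ennreal (dd (\<tau> (m n) t) t))"
   by (intro suminf_cong) (simp add: nn_integral_eq_integral[OF dd_int[OF s tt]] dd_def)
  also have "\<dots> \<le> (\<Sum>n. ennreal ((1/2) ^ n))"
   by (intro suminf_le ennreal_leI m(2) t) auto
  also have "\<dots> = ennreal (\<Sum>n. (1/2) ^ n)"
   by (intro suminf_ennreal2) auto
  also have "\<dots> < \<infinity>" by simp
  finally have "AE x in lborel. (\<Sum>n. ennreal ((ub (\<tau> (m n) t) x - ub t x)\<^sup>2)) \<noteq> \<infinity>"
   by (intro nn_integral_noteq_infinite) auto
  then show ?thesis
  proof eventually_elim
   case (elim x)
   then have "summable (\<lambda>n. (ub (\<tau> (m n) t) x - ub t x)\<^sup>2)"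
    by (intro summable_suminf_not_top) auto
   then have "(\<lambda>n. (ub (\<tau> (m n) t) x - ub t x)\<^sup>2) \<longlonglongrightarrow> 0" by (rule summable_LIMSEQ_zero)
   then have "(\<lambda>n. sqrt ((ub (\<tau> (m n) t) x - ub t x)\<^sup>2)) \<longlonglongrightarrow> sqrt 0" by (rule tendsto_real_sqrt)
   then have "(\<lambda>n. ub (\<tau> (m n) t) x - ub t x) \<longlonglongrightarrow> 0" by (simp add: tendsto_rabs_zero_iff)
   then have "(\<lambda>n. ub (\<tau> (m n) t) x) \<longlonglongrightarrow> ub t x" by (simp add: LIM_zero_iff)
   then show ?case using t by (simp add: U0_def V_def limI)
  qed
 qed
 obtain B where B: "\<And>t. t \<in> {0<..T} \<Longrightarrow> (LBINT x. (ub t x)\<^sup>2) \<le> B"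
  by (rule norm_bounded) blast
 have fin0: "(\<integral>\<^sup>+x. \<integral>\<^sup>+t. ennreal ((U0 x t)\<^sup>2) \<partial>lborel \<partial>lborel) < \<infinity>"
 proof -
  note U0m[measurable]
  have [measurable]: "(\<lambda>z. U0 (fst z) (snd z)) \<in> borel_measurable (borel \<Otimes>\<^sub>M borel)"
   using U0m by (simp add: case_prod_beta)
  have "(\<integral>\<^sup>+x. \<integral>\<^sup>+t. ennreal ((U0 x t)\<^sup>2) \<partial>lborel \<partial>lborel) = (\<integral>\<^sup>+t. \<integral>\<^sup>+x. ennreal ((U0 x t)\<^sup>2) \<partial>lborel \<partial>lborel)"
   by (rule lborel_pair.Fubini'[symmetric]) (simp add: case_prod_beta)
  also have "\<dots> \<le> (\<integral>\<^sup>+t. ennreal B * indicator {0..T} t \<partial>lborel)"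
  proof (rule nn_integral_mono)
   fix t show "(\<integral>\<^sup>+x. ennreal ((U0 x t)\<^sup>2) \<partial>lborel) \<le> ennreal B * indicator {0..T} t"
   proof (cases "t \<in> {0<..T}")
    case True
    have "(\<integral>\<^sup>+x. ennreal ((U0 x t)\<^sup>2) \<partial>lborel) = (\<integral>\<^sup>+x. ennreal ((ub t x)\<^sup>2) \<partial>lborel)"
    proof (rule nn_integral_cong_AE)
     show "AE x in lborel. ennreal ((U0 x t)\<^sup>2) = ennreal ((ub t x)\<^sup>2)"
      using U0eq[OF True] by eventually_elim simp
    qed
    also have "\<dots> = ennreal (LBINT x. (ub t x)\<^sup>2)"
     using True by (intro nn_integral_eq_integral ubi) auto
    finally show ?thesis using B[OF True] True by (simp add: ennreal_leI)
   next
    case False then have "U0 x t = 0" for x by (auto simp: U0_def)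
    then show ?thesis by simp
   qed
  qed
  also have "\<dots> = ennreal B * emeasure lborel {0..T}" by (rule nn_integral_cmult_indicator) simp
  also have "\<dots> < \<infinity>" using T by (simp add: ennreal_mult_less_top)
  finally show ?thesis .
 qed
 define I where "I = (\<lambda>x. \<integral>\<^sup>+t. ennreal ((U0 x t)\<^sup>2) \<partial>lborel)"
 have [measurable]: "(\<lambda>z. U0 (fst z) (snd z)) \<in> borel_measurable (borel \<Otimes>\<^sub>M borel)"
  using U0m by (simp add: case_prod_beta)
 have Im [measurable]: "I \<in> borel_measurable borel"
  unfolding I_def by (rule lborel.borel_measurable_nn_integral) (simp add: case_prod_beta)
 \<comment> \<open>The points x whose section is not square integrable form a null set; their
   sections are replaced by 0 because \<open>Qc\<close> speaks about every x.\<close>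
 define U where "U = (\<lambda>x t. if I x < \<infinity> \<and> 0 < x \<and> x < l then U0 x t else 0)"
 have Um: "(\<lambda>(x, t). U x t) \<in> borel_measurable (borel \<Otimes>\<^sub>M borel)"
  unfolding U_def case_prod_beta by measurable
 have Usec: "U x \<in> borel_measurable borel" for x
  using measurable_compose[OF measurable_Pair1'[of x borel borel] Um] by simp
 have sq: "sqn n (U x) \<le> (if I x < \<infinity> then I x else 0)" for n x
 proof (cases "I x < \<infinity>")
  case True
  have "sqn n (U x) \<le> I x"
   unfolding I_def by (intro nn_integral_mono ennreal_leI) (auto simp: U_def indicator_def)
  then show ?thesis using True by simp
 next
  case False
  then have "U x = (\<lambda>t. 0)" by (simp add: U_def)
  then show ?thesis by simp
 qed
 have UL: "U x \<in> L2c" for x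
 proof -
  have "sqn n (U x) < \<infinity>" for n
   using sq[of n x] by (rule le_less_trans) simp
  moreover have "U x t = 0" if "t \<le> 0" for t using that by (simp add: U_def U0_def)
  ultimately show ?thesis using Usec by (simp add: L2c_def)
 qed
 have "(\<integral>\<^sup>+x. sqn n (U x) \<partial>lborel) < \<infinity>" for n
 proof -
  have "(\<integral>\<^sup>+x. sqn n (U x) \<partial>lborel) \<le> (\<integral>\<^sup>+x. I x \<partial>lborel)"
   by (intro nn_integral_mono order_trans[OF sq]) auto
  also have "\<dots> < \<infinity>" using fin0 by (simp add: I_def)
  finally show ?thesis .
 qed
 then have UQ: "U \<in> Qc 0 l" using Um UL by (auto simp: Qc_def U_def)
 have "AE x in lborel. I x \<noteq> \<infinity>"
  by (rule nn_integral_noteq_infinite) (use fin0 in \<open>auto simp: I_def\<close>)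
 then have Ueq: "AE x in lborel. U x t = ub t x" if t: "t \<in> {0<..T}" for t
  using U0eq[OF t]
  by eventually_elim (use ub0[of t] t in \<open>auto simp: U_def less_top\<close>)
 show ?thesis by (rule that[OF UQ _ Ueq]) (auto simp: U_def U0_def)
qed

end

section \<open>The weak equation on one interval\<close>

lemma continuous_rect_bounded:
 fixes k :: "real \<Rightarrow> real \<Rightarrow> real"
 assumes "continuous_on ({\<alpha>..\<beta>} \<times> {0..T}) (\<lambda>(x, t). k x t)"
 shows "\<exists>C\<ge>0. \<forall>x\<in>{\<alpha>..\<beta>}. \<forall>t\<in>{0..T}. \<bar>k x t\<bar> \<le> C"
proof -
 have "bounded ((\<lambda>(x, t). k x t) ` ({\<alpha>..\<beta>} \<times> {0..T}))"
  by (intro compact_imp_bounded compact_continuous_image assms compact_Times compact_Icc)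
 then obtain C where C: "\<forall>y\<in>(\<lambda>(x, t). k x t) ` ({\<alpha>..\<beta>} \<times> {0..T}). norm y \<le> C" unfolding bounded_iff by blast
 have "\<bar>k x t\<bar> \<le> max C 0" if "x \<in> {\<alpha>..\<beta>}" "t \<in> {0..T}" for x t
 proof -
  have "(\<lambda>(x, t). k x t) (x, t) \<in> (\<lambda>(x, t). k x t) ` ({\<alpha>..\<beta>} \<times> {0..T})"
   by (rule imageI) (use that in simp)
  with C have "norm (k x t) \<le> C" by fastforce
  then show ?thesis by simp
 qed
 then show ?thesis by (intro exI[of _ "max C 0"]) simp
qed

lemma continuous_rect_measurable:
 fixes k :: "real \<Rightarrow> real \<Rightarrow> real"
 assumes "continuous_on ({\<alpha>..\<beta>} \<times> {0..T}) (\<lambda>(x, t). k x t)"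
 shows "(\<lambda>z. indicator ({\<alpha>..\<beta>} \<times> {0..T}) z * k (fst z) (snd z)) \<in> borel_measurable (borel \<Otimes>\<^sub>M borel)"
proof -
 have "(\<lambda>z. indicator ({\<alpha>..\<beta>} \<times> {0..T}) z *\<^sub>R k (fst z) (snd z)) \<in> borel_measurable borel"
  by (intro borel_measurable_continuous_on_indicator) (use assms in \<open>auto simp: case_prod_beta intro: borel_closed closed_Times\<close>)
 then show ?thesis by (simp add: borel_prod)
qed

lemma double_integral:
 assumes v: "v \<in> Qc \<alpha> \<beta>" and ab: "\<alpha> \<le> \<beta>"
  and k: "continuous_on ({\<alpha>..\<beta>} \<times> {0..T}) (\<lambda>(x, t). k x t)"
 shows "integrable (lborel \<Otimes>\<^sub>M lborel) (\<lambda>(x, t). indicator {0..T} t * (v x t * k x t))"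
  and "(LBINT t:{0..T}. LBINT x. v x t * k x t) = (LINT z|(lborel \<Otimes>\<^sub>M lborel). (case z of (x, t) \<Rightarrow> indicator {0..T} t * (v x t * k x t)))"
proof -
 note Qc_measurable[OF v, measurable (raw)]
 define k' where "k' = (\<lambda>z. indicator ({\<alpha>..\<beta>} \<times> {0..T}) z * k (fst z) (snd z))"
 have [measurable]: "k' \<in> borel_measurable (borel \<Otimes>\<^sub>M borel)"
  unfolding k'_def by (rule continuous_rect_measurable[OF k])
 obtain C where C: "C \<ge> 0" "\<forall>x\<in>{\<alpha>..\<beta>}. \<forall>t\<in>{0..T}. \<bar>k x t\<bar> \<le> C"
  using continuous_rect_bounded[OF k] by blast
 have e': "indicator {0..T} t * (v x t * k x t) = v x t * k' (x, t)" for x t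
  using QcD(2)[OF v, of x] by (cases "x \<in> {\<alpha>..\<beta>}") (simp_all add: k'_def indicator_def)
 have e: "(\<lambda>(x, t). indicator {0..T} t * (v x t * k x t)) = (\<lambda>(x, t). v x t * k' (x, t))"
  by (simp add: e')
 interpret Z: Pop_data "\<lambda>x. 1" "\<lambda>x. 0" 1 by unfold_locales auto
 have "(\<integral>\<^sup>+x. \<integral>\<^sup>+t. ennreal \<bar>v x t * k' (x, t)\<bar> \<partial>lborel \<partial>lborel) \<le>
   (\<integral>\<^sup>+x. \<integral>\<^sup>+t. ennreal (C * (indicator {..T} t * \<bar>1 * v x (t - 0)\<bar>)) \<partial>lborel \<partial>lborel)"
 proof (intro nn_integral_mono ennreal_leI)
  fix x t show "\<bar>v x t * k' (x, t)\<bar> \<le> C * (indicator {..T} t * \<bar>1 * v x (t - 0)\<bar>)"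
  proof (cases "x \<in> {\<alpha>..\<beta>} \<and> t \<in> {0..T}")
   case True
   then have "\<bar>v x t\<bar> * \<bar>k x t\<bar> \<le> \<bar>v x t\<bar> * C" using C(2) by (intro mult_left_mono) auto
   then show ?thesis using True by (simp add: k'_def abs_mult mult.commute)
  qed (use C(1) in \<open>auto simp: k'_def indicator_def\<close>)
 qed
 also have "\<dots> = (\<integral>\<^sup>+x. \<integral>\<^sup>+t. ennreal C * ennreal (indicator {..T} t * \<bar>1 * v x (t - 0)\<bar>) \<partial>lborel \<partial>lborel)"
  using C(1) by (intro nn_integral_cong) (simp add: ennreal_mult')
 also have "\<dots> = ennreal C * (\<integral>\<^sup>+x. \<integral>\<^sup>+t. ennreal (indicator {..T} t * \<bar>1 * v x (t - 0)\<bar>) \<partial>lborel \<partial>lborel)"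
  by (simp add: nn_integral_cmult)
 also have "\<dots> < \<infinity>" using Z.nn_L1[OF v ab, of T] by (simp add: ennreal_mult_less_top)
 finally have fin: "(\<integral>\<^sup>+x. \<integral>\<^sup>+t. ennreal \<bar>v x t * k' (x, t)\<bar> \<partial>lborel \<partial>lborel) < \<infinity>" .
 have m: "(\<lambda>(x, t). v x t * k' (x, t)) \<in> borel_measurable (lborel \<Otimes>\<^sub>M lborel)" by measurable
 note F = fubini_real[OF m fin]
 show i: "integrable (lborel \<Otimes>\<^sub>M lborel) (\<lambda>(x, t). indicator {0..T} t * (v x t * k x t))"
  unfolding e by (rule F(1))
 have "(LBINT t:{0..T}. LBINT x. v x t * k x t) = (LBINT t. LBINT x. v x t * k' (x, t))"
  unfolding set_lebesgue_integral_def
 proof (intro LBINT_cong)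
  fix t
  have "indicator {0..T} t *\<^sub>R (LBINT x. v x t * k x t) = (LBINT x. indicator {0..T} t * (v x t * k x t))" by simp
  also have "\<dots> = (LBINT x. v x t * k' (x, t))"
   by (simp only: e')
  finally show "indicator {0..T} t *\<^sub>R (LBINT x. v x t * k x t) = (LBINT x. v x t * k' (x, t))" .
 qed
 also have "\<dots> = (LBINT x. LBINT t. v x t * k' (x, t))" by (rule F(2)[symmetric])
 also have "\<dots> = (LINT z|(lborel \<Otimes>\<^sub>M lborel). (case z of (x, t) \<Rightarrow> v x t * k' (x, t)))"
  by (rule lborel_pair.integral_fst) (rule F(1))
 finally show "(LBINT t:{0..T}. LBINT x. v x t * k x t) = (LINT z|(lborel \<Otimes>\<^sub>M lborel). (case z of (x, t) \<Rightarrow> indicator {0..T} t * (v x t * k x t)))"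
  unfolding e .
qed

text \<open>For single t the inner integrals need not converge, so additivity is taken from
  integrability on the product.\<close>

lemma double_integral_lin:
 assumes v: "v \<in> Qc \<alpha> \<beta>" and v': "v' \<in> Qc \<alpha> \<beta>" and ab: "\<alpha> \<le> \<beta>"
  and k: "continuous_on ({\<alpha>..\<beta>} \<times> {0..T}) (\<lambda>(x, t). k x t)"
  and k': "continuous_on ({\<alpha>..\<beta>} \<times> {0..T}) (\<lambda>(x, t). k' x t)"
 shows "(LBINT t:{0..T}. LBINT x. v x t * k x t + v' x t * k' x t) =
   (LBINT t:{0..T}. LBINT x. v x t * k x t) + (LBINT t:{0..T}. LBINT x. v' x t * k' x t)"
proof -
 note i = double_integral(1)[OF v ab k] double_integral(1)[OF v' ab k']
 let ?F = "\<lambda>x t. indicator {0..T} t * (v x t * k x t)" and ?G = "\<lambda>x t. indicator {0..T} t * (v' x t * k' x t)"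
 have s: "integrable (lborel \<Otimes>\<^sub>M lborel) (\<lambda>(x, t). ?F x t + ?G x t)"
  using Bochner_Integration.integrable_add[OF i] by (simp add: case_prod_unfold)
 have "(LBINT t:{0..T}. LBINT x. v x t * k x t + v' x t * k' x t) = (LBINT t. LBINT x. ?F x t + ?G x t)"
  unfolding set_lebesgue_integral_def
  by (intro LBINT_cong) (simp add: distrib_left[symmetric])
 also have "\<dots> = (LINT z|(lborel \<Otimes>\<^sub>M lborel). (case z of (x, t) \<Rightarrow> ?F x t + ?G x t))"
  by (rule lborel_pair.integral_snd[OF s])
 also have "\<dots> = (LINT z|(lborel \<Otimes>\<^sub>M lborel). (case z of (x, t) \<Rightarrow> ?F x t)) + (LINT z|(lborel \<Otimes>\<^sub>M lborel). (case z of (x, t) \<Rightarrow> ?G x t))"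
  using Bochner_Integration.integral_add[OF i] by (simp add: case_prod_unfold)
 finally show ?thesis by (simp add: double_integral(2)[OF v ab k] double_integral(2)[OF v' ab k'])
qed

definition CR :: "real \<Rightarrow> real \<Rightarrow> real \<Rightarrow> (real \<Rightarrow> real \<Rightarrow> real) \<Rightarrow> bool" where
 "CR \<alpha> \<beta> T g \<longleftrightarrow> continuous_on ({\<alpha>..\<beta>} \<times> {0..T}) (\<lambda>(x, t). g x t)"

lemma CR_ops:
 assumes "CR \<alpha> \<beta> T g" "CR \<alpha> \<beta> T h"
 shows "CR \<alpha> \<beta> T (\<lambda>x t. g x t + h x t)" "CR \<alpha> \<beta> T (\<lambda>x t. g x t - h x t)" "CR \<alpha> \<beta> T (\<lambda>x t. g x t * h x t)"
 using assms unfolding CR_def case_prod_unfold by (auto intro!: continuous_intros)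

lemma CR_sec:
 assumes "CR \<alpha> \<beta> T g" "y \<in> {\<alpha>..\<beta>}"
 shows "CR \<alpha> \<beta> T (\<lambda>x. g y)" "continuous_on {0..T} (g y)"
proof -
 have c: "continuous_on A (\<lambda>z. g y (k z))"
  if "continuous_on A k" "\<And>z. z \<in> A \<Longrightarrow> k z \<in> {0..T}" for k and A :: "'z::topological_space set"
 proof -
  have "continuous_on A (\<lambda>z. (\<lambda>(x, t). g x t) (y, k z))"
   by (rule continuous_on_compose2[OF assms(1)[unfolded CR_def]]) (use that assms in \<open>auto intro!: continuous_intros\<close>)
  then show ?thesis by simp
 qed
 show "CR \<alpha> \<beta> T (\<lambda>x. g y)" unfolding CR_def case_prod_unfold by (rule c) (auto intro: continuous_intros)
 show "continuous_on {0..T} (g y)" using c[of "{0..T}" "\<lambda>x. x"] by auto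
qed

lemma CR_fst: "continuous_on {\<alpha>..\<beta>} c \<Longrightarrow> CR \<alpha> \<beta> T (\<lambda>x t. c x)"
 unfolding CR_def case_prod_unfold
 by (rule continuous_on_compose2[of _ c]) (auto intro!: continuous_intros)

text \<open>\<open>N0\<close> and \<open>Nb\<close> are the second primitives in time of the fluxes \<open>v\<^sub>x\<close> at \<open>\<alpha>\<close> and \<open>\<beta>\<close>, obtained by testing
 with the affine functions \<open>chi0\<close> and \<open>chib\<close>.\<close>

locale interval_data =
 fixes \<alpha> \<beta> T K :: real and v :: "real \<Rightarrow> real \<Rightarrow> real" and Q g0 gb :: "real \<Rightarrow> real"
 assumes ab: "\<alpha> < \<beta>" and T: "T > 0" and v: "v \<in> Qc \<alpha> \<beta>"
  and Qm: "Q \<in> borel_measurable borel" and QK: "\<And>x. \<bar>Q x\<bar> \<le> K"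
  and g0: "g0 \<in> L2c" and gb: "gb \<in> L2c"
begin

definition Qv :: "real \<Rightarrow> real \<Rightarrow> real" where "Qv x t = Q x * v x t"
definition b :: real where "b = \<beta> - \<alpha>"
definition chi0 :: "real \<Rightarrow> real" where "chi0 x = indicator {\<alpha>..\<beta>} x * ((\<beta> - x) / b)"
definition chib :: "real \<Rightarrow> real" where "chib x = indicator {\<alpha>..\<beta>} x * ((x - \<alpha>) / b)"
definition flux :: "real \<Rightarrow> real" where "flux = Jt (Jt (\<lambda>t. (g0 t - gb t) / b))"
definition N0 :: "real \<Rightarrow> real" where
 "N0 t = - (Pop chi0 (\<lambda>x. 0) v t + Jt (Jt (Pop chi0 (\<lambda>x. 0) Qv)) t + flux t)"
definition Nb :: "real \<Rightarrow> real" where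
 "Nb t = Pop chib (\<lambda>x. 0) v t + Jt (Jt (Pop chib (\<lambda>x. 0) Qv)) t - flux t"

lemma b0: "b > 0" using ab by (simp add: b_def)

lemma Qv: "Qv \<in> Qc \<alpha> \<beta>" unfolding Qv_def by (rule Qc_mult[OF v Qm QK])

lemma chi_bounds: "\<bar>chi0 x\<bar> \<le> 1" "\<bar>chib x\<bar> \<le> 1"
proof -
 have "(\<beta> - x) / b \<le> 1" "(x - \<alpha>) / b \<le> 1" "0 \<le> (\<beta> - x) / b" "0 \<le> (x - \<alpha>) / b" if "\<alpha> \<le> x" "x \<le> \<beta>"
  using that b0 by (auto simp: divide_le_eq_1 b_def)
 then show "\<bar>chi0 x\<bar> \<le> 1" "\<bar>chib x\<bar> \<le> 1"
  by (auto simp: chi0_def chib_def indicator_def)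
qed

sublocale P0: Pop_data chi0 "\<lambda>x. 0" 1
proof
 show "chi0 \<in> borel_measurable borel" unfolding chi0_def by measurable
qed (auto simp: chi_bounds)

sublocale Pb: Pop_data chib "\<lambda>x. 0" 1
proof
 show "chib \<in> borel_measurable borel" unfolding chib_def by measurable
qed (auto simp: chi_bounds)

lemma flux_L2c: "(\<lambda>t. (g0 t - gb t) / b) \<in> L2c" "flux \<in> L2c"
 unfolding flux_def by (intro Jt_L2c L2c_divide L2c_diff g0 gb)+

lemmas PL = P0.Pop_L2c[OF v less_imp_le[OF ab]] P0.Pop_L2c[OF Qv less_imp_le[OF ab]]
 Pb.Pop_L2c[OF v less_imp_le[OF ab]] Pb.Pop_L2c[OF Qv less_imp_le[OF ab]]

lemma N0_L2c: "N0 \<in> L2c"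
 unfolding N0_def by (intro L2c_uminus L2c_add PL Jt_L2c flux_L2c)

lemma Nb_L2c: "Nb \<in> L2c"
 unfolding Nb_def by (intro L2c_diff L2c_add PL Jt_L2c flux_L2c)

lemma v_chi: "Pop chi0 (\<lambda>x. 0) w t = (LBINT x. w x t * ((\<beta> - x) / b))"
 "Pop chib (\<lambda>x. 0) w t = (LBINT x. w x t * ((x - \<alpha>) / b))" if "w \<in> Qc \<alpha> \<beta>"
proof -
 have "chi0 x * w x (t - 0) = w x t * ((\<beta> - x) / b) \<and> chib x * w x (t - 0) = w x t * ((x - \<alpha>) / b)" for x
  using QcD(2)[OF that, of x] by (cases "x \<in> {\<alpha>..\<beta>}") (auto simp: chi0_def chib_def)
 then show "Pop chi0 (\<lambda>x. 0) w t = (LBINT x. w x t * ((\<beta> - x) / b))"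
  "Pop chib (\<lambda>x. 0) w t = (LBINT x. w x t * ((x - \<alpha>) / b))"
  unfolding Pop_def by auto
qed

lemma L2c_times_cont:
 assumes "g \<in> L2c" "continuous_on {0..T} \<psi>"
 shows "set_integrable lborel {0..T} (\<lambda>t. g t * \<psi> t)"
 by (rule set_integrable_mult_continuous[OF L2c_set_integrable'[OF assms(1), where t=T] assms(2)]) auto

text \<open>A field that is affine in x contributes through its time factor and the second
  derivative of that factor. Integrating by parts twice collects everything on the second
  derivative, and the coefficient found there is \<open>N0\<close> or \<open>Nb\<close> up to
  sign.\<close>

lemma chi_part:
 assumes p1: "\<And>t. t \<in> {0..T} \<Longrightarrow> (\<psi> has_real_derivative \<psi>' t) (at t within {0..T})"
  and p2: "\<And>t. t \<in> {0..T} \<Longrightarrow> (\<psi>' has_real_derivative \<psi>'' t) (at t within {0..T})"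
  and p3: "continuous_on {0..T} \<psi>''" and 0: "\<psi> T = 0" "\<psi>' T = 0"
 shows "(LBINT t:{0..T}. Pop chi0 (\<lambda>x. 0) v t * \<psi>'' t) + (LBINT t:{0..T}. Pop chi0 (\<lambda>x. 0) Qv t * \<psi> t)
   + (LBINT t:{0..T}. ((g0 t - gb t) / b) * \<psi> t) = - (LBINT t:{0..T}. N0 t * \<psi>'' t)" (is ?A)
  and "(LBINT t:{0..T}. Pop chib (\<lambda>x. 0) v t * \<psi>'' t) + (LBINT t:{0..T}. Pop chib (\<lambda>x. 0) Qv t * \<psi> t)
   - (LBINT t:{0..T}. ((g0 t - gb t) / b) * \<psi> t) = (LBINT t:{0..T}. Nb t * \<psi>'' t)" (is ?B)
proof -
 have T0: "0 \<le> T" using T by simp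
 note tw = Jt_twice_by_parts[OF _ T0 p1 p2 p3 0]
 note i = L2c_times_cont[OF _ p3]
 have f: "(LBINT t:{0..T}. ((g0 t - gb t) / b) * \<psi> t) = (LBINT t:{0..T}. flux t * \<psi>'' t)"
  unfolding flux_def by (rule tw[OF flux_L2c(1)])
 have "(LBINT t:{0..T}. N0 t * \<psi>'' t) = (LBINT t:{0..T}. - (Pop chi0 (\<lambda>x. 0) v t * \<psi>'' t + Jt (Jt (Pop chi0 (\<lambda>x. 0) Qv)) t * \<psi>'' t + flux t * \<psi>'' t))"
  by (simp add: N0_def algebra_simps)
 also have "\<dots> = - (LBINT t:{0..T}. Pop chi0 (\<lambda>x. 0) v t * \<psi>'' t + Jt (Jt (Pop chi0 (\<lambda>x. 0) Qv)) t * \<psi>'' t + flux t * \<psi>'' t)"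
  unfolding set_lebesgue_integral_def by (simp only: scaleR_minus_right integral_minus)
 also have "(LBINT t:{0..T}. Pop chi0 (\<lambda>x. 0) v t * \<psi>'' t + Jt (Jt (Pop chi0 (\<lambda>x. 0) Qv)) t * \<psi>'' t + flux t * \<psi>'' t)
   = (LBINT t:{0..T}. Pop chi0 (\<lambda>x. 0) v t * \<psi>'' t) + (LBINT t:{0..T}. Jt (Jt (Pop chi0 (\<lambda>x. 0) Qv)) t * \<psi>'' t) + (LBINT t:{0..T}. flux t * \<psi>'' t)"
  by (simp add: set_integral_add i PL Jt_L2c flux_L2c)
 finally show ?A using tw[OF PL(2)] f by linarith
 have "(LBINT t:{0..T}. Nb t * \<psi>'' t) = (LBINT t:{0..T}. Pop chib (\<lambda>x. 0) v t * \<psi>'' t + Jt (Jt (Pop chib (\<lambda>x. 0) Qv)) t * \<psi>'' t - flux t * \<psi>'' t)"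
  by (simp add: Nb_def algebra_simps)
 also have "\<dots> = (LBINT t:{0..T}. Pop chib (\<lambda>x. 0) v t * \<psi>'' t) + (LBINT t:{0..T}. Jt (Jt (Pop chib (\<lambda>x. 0) Qv)) t * \<psi>'' t) - (LBINT t:{0..T}. flux t * \<psi>'' t)"
  by (simp add: set_integral_add set_integral_diff i PL Jt_L2c flux_L2c)
 finally show ?B using tw[OF PL(4)] f by linarith
qed

end

text \<open>Fields that vanish at both ends see neither the masses nor the neighbouring intervals;
  only their slopes at the ends meet the boundary values \<open>g0\<close> and
  \<open>gb\<close>.\<close>

locale interval_sys = interval_data +
 assumes WI1: "\<And>w wx wt wxx wxt wtt. C2_rect {\<alpha>..\<beta>} {0..T} w wx wt wxx wxt wtt \<Longrightarrow>
   (\<And>t. t \<in> {0..T} \<Longrightarrow> w \<alpha> t = 0 \<and> w \<beta> t = 0 \<and> wtt \<alpha> t = 0 \<and> wtt \<beta> t = 0) \<Longrightarrow>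
   (\<And>x. x \<in> {\<alpha>..\<beta>} \<Longrightarrow> w x T = 0 \<and> wt x T = 0) \<Longrightarrow>
   (LBINT t:{0..T}. LBINT x. v x t * (wtt x t - wxx x t + Q x * w x t)) =
   (LBINT t:{0..T}. g0 t * wx \<alpha> t) - (LBINT t:{0..T}. gb t * wx \<beta> t)"
begin

text \<open>Subtracting the affine interpolation of the end values reduces arbitrary fields to
  \<open>WI1\<close>. By \<open>chi_part\<close> the interpolation contributes pairings of
  \<open>N0\<close> and \<open>Nb\<close> with the second time derivatives at the ends: the missing
  flux terms, integrated by parts twice in time.\<close>

lemma WF:
 assumes w: "C2_rect {\<alpha>..\<beta>} {0..T} w wx wt wxx wxt wtt"
  and wT: "\<And>x. x \<in> {\<alpha>..\<beta>} \<Longrightarrow> w x T = 0 \<and> wt x T = 0"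
 shows "(LBINT t:{0..T}. LBINT x. v x t * (wtt x t - wxx x t)) + (LBINT t:{0..T}. LBINT x. Qv x t * w x t)
   = (LBINT t:{0..T}. g0 t * wx \<alpha> t) - (LBINT t:{0..T}. gb t * wx \<beta> t)
    - (LBINT t:{0..T}. N0 t * wtt \<alpha> t) + (LBINT t:{0..T}. Nb t * wtt \<beta> t)"
proof -
 have in\<alpha>: "\<alpha> \<in> {\<alpha>..\<beta>}" "\<beta> \<in> {\<alpha>..\<beta>}" using ab by auto
 have ab': "\<alpha> \<le> \<beta>" using ab by simp
 have cr: "CR \<alpha> \<beta> T w" "CR \<alpha> \<beta> T wx" "CR \<alpha> \<beta> T wt" "CR \<alpha> \<beta> T wxx" "CR \<alpha> \<beta> T wxt" "CR \<alpha> \<beta> T wtt"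
  using w unfolding C2_rect_def CR_def by blast+
 have D: "((\<lambda>y. w y t) has_real_derivative wx x t) (at x within {\<alpha>..\<beta>})"
   "((\<lambda>s. w x s) has_real_derivative wt x t) (at t within {0..T})"
   "((\<lambda>y. wx y t) has_real_derivative wxx x t) (at x within {\<alpha>..\<beta>})"
   "((\<lambda>s. wx x s) has_real_derivative wxt x t) (at t within {0..T})"
   "((\<lambda>y. wt y t) has_real_derivative wxt x t) (at x within {\<alpha>..\<beta>})"
   "((\<lambda>s. wt x s) has_real_derivative wtt x t) (at t within {0..T})" if "x \<in> {\<alpha>..\<beta>}" "t \<in> {0..T}" for x t
  using w that unfolding C2_rect_def by blast+
 define c0 where "c0 = (\<lambda>x. (\<beta> - x) / b)"
 define cb where "cb = (\<lambda>x. (x - \<alpha>) / b)"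
 have c: "c0 \<alpha> = 1" "c0 \<beta> = 0" "cb \<alpha> = 0" "cb \<beta> = 1" using b0 by (auto simp: c0_def cb_def b_def)
 have cD: "(c0 has_real_derivative - 1 / b) (at x within S)" "(cb has_real_derivative 1 / b) (at x within S)" for x S
  unfolding c0_def cb_def using b0 by (auto intro!: derivative_eq_intros)
 have cc: "CR \<alpha> \<beta> T (\<lambda>x t. c0 x)" "CR \<alpha> \<beta> T (\<lambda>x t. cb x)" "CR \<alpha> \<beta> T (\<lambda>x t. 1 / b)"
  by (intro CR_fst; use b0 in \<open>auto simp: c0_def cb_def intro!: continuous_intros\<close>)+
 \<comment> \<open>\<open>z\<close> subtracts the affine interpolation of the end values and
   \<open>zx\<close> is the matching x-derivative; the second x-derivative does not change.\<close>
 define z where "z = (\<lambda>(g::real \<Rightarrow> real \<Rightarrow> real) x t. g x t - c0 x * g \<alpha> t - cb x * g \<beta> t :: real)"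
 define zx where "zx = (\<lambda>(gx::real \<Rightarrow> real \<Rightarrow> real) (g::real \<Rightarrow> real \<Rightarrow> real) x t. gx x t + 1 / b * g \<alpha> t - 1 / b * g \<beta> t :: real)"
 have zC: "CR \<alpha> \<beta> T (z g)" if "CR \<alpha> \<beta> T g" for g
  unfolding z_def by (rule CR_ops(2) CR_ops(3) cc that CR_sec(1)[OF that] in\<alpha>)+
 have zxC: "CR \<alpha> \<beta> T (zx gx g)" if "CR \<alpha> \<beta> T gx" "CR \<alpha> \<beta> T g" for gx g
  unfolding zx_def by (rule CR_ops(1) CR_ops(2) CR_ops(3) cc that CR_sec(1)[OF that(2)] in\<alpha>)+
 have "C2_rect {\<alpha>..\<beta>} {0..T} (z w) (zx wx w) (z wt) wxx (zx wxt wt) (z wtt)"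
  unfolding C2_rect_def
 proof (intro conjI ballI)
  fix g assume "g \<in> {z w, zx wx w, z wt, wxx, zx wxt wt, z wtt}"
  then have "CR \<alpha> \<beta> T g" using zC cr zxC by (elim insertE emptyE) (simp_all only:)
  then show "continuous_on ({\<alpha>..\<beta>} \<times> {0..T}) (\<lambda>(x, t). g x t)" by (simp add: CR_def)
 next
  fix x t assume xt: "x \<in> {\<alpha>..\<beta>}" "t \<in> {0..T}"
  have e: "zx gx g x t = gx x t - (- 1 / b) * g \<alpha> t - (1 / b) * g \<beta> t" for gx g by (simp add: zx_def)
  show "((\<lambda>y. z w y t) has_real_derivative zx wx w x t) (at x within {\<alpha>..\<beta>})"
   "((\<lambda>y. z wt y t) has_real_derivative zx wxt wt x t) (at x within {\<alpha>..\<beta>})"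
   unfolding e unfolding z_def by (intro DERIV_diff DERIV_cmult_right D cD xt)+
  show "((\<lambda>s. z w x s) has_real_derivative z wt x t) (at t within {0..T})"
   "((\<lambda>s. z wt x s) has_real_derivative z wtt x t) (at t within {0..T})"
   unfolding z_def by (intro DERIV_diff DERIV_cmult D xt in\<alpha>)+
  show "((\<lambda>s. zx wx w x s) has_real_derivative zx wxt wt x t) (at t within {0..T})"
   unfolding zx_def by (intro DERIV_diff DERIV_add DERIV_cmult D xt in\<alpha>)
  have "((\<lambda>y. wx y t + 1 / b * w \<alpha> t - 1 / b * w \<beta> t) has_real_derivative wxx x t + 0 - 0) (at x within {\<alpha>..\<beta>})"
   by (intro DERIV_diff DERIV_add DERIV_const D xt)
  then show "((\<lambda>y. zx wx w y t) has_real_derivative wxx x t) (at x within {\<alpha>..\<beta>})"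
   unfolding zx_def by simp
 qed
 from WI1[OF this] have E: "(LBINT t:{0..T}. LBINT x. v x t * (z wtt x t - wxx x t + Q x * z w x t)) =
   (LBINT t:{0..T}. g0 t * zx wx w \<alpha> t) - (LBINT t:{0..T}. gb t * zx wx w \<beta> t)"
  using wT by (simp add: z_def c in\<alpha>)
 have split: "(LBINT t:{0..T}. LBINT x. y x t * z g x t) = (LBINT t:{0..T}. LBINT x. y x t * g x t)
   - (LBINT t:{0..T}. Pop chi0 (\<lambda>x. 0) y t * g \<alpha> t) - (LBINT t:{0..T}. Pop chib (\<lambda>x. 0) y t * g \<beta> t)"
  if y: "y \<in> Qc \<alpha> \<beta>" and g: "CR \<alpha> \<beta> T g" for y g
 proof -
  note K = CR_ops(3)[OF cc(1) CR_sec(1)[OF g in\<alpha>(1)]] CR_ops(3)[OF cc(2) CR_sec(1)[OF g in\<alpha>(2)]]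
  have "(LBINT t:{0..T}. LBINT x. y x t * g x t) = (LBINT t:{0..T}. LBINT x. y x t * z g x t + y x t * (c0 x * g \<alpha> t + cb x * g \<beta> t))"
   unfolding z_def by (simp add: algebra_simps)
  also have "\<dots> = (LBINT t:{0..T}. LBINT x. y x t * z g x t) + (LBINT t:{0..T}. LBINT x. y x t * (c0 x * g \<alpha> t + cb x * g \<beta> t))"
   by (rule double_integral_lin[OF y y ab' zC[OF g, unfolded CR_def] CR_ops(1)[OF K, unfolded CR_def]])
  also have "(LBINT t:{0..T}. LBINT x. y x t * (c0 x * g \<alpha> t + cb x * g \<beta> t)) = (LBINT t:{0..T}. LBINT x. y x t * (c0 x * g \<alpha> t) + y x t * (cb x * g \<beta> t))"
   by (simp add: distrib_left)
  also have "\<dots> = (LBINT t:{0..T}. LBINT x. y x t * (c0 x * g \<alpha> t)) + (LBINT t:{0..T}. LBINT x. y x t * (cb x * g \<beta> t))"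
   by (rule double_integral_lin[OF y y ab' K[unfolded CR_def]])
  also have "(LBINT t:{0..T}. LBINT x. y x t * (c0 x * g \<alpha> t)) = (LBINT t:{0..T}. Pop chi0 (\<lambda>x. 0) y t * g \<alpha> t)"
   by (simp add: v_chi[OF y] c0_def mult.assoc[symmetric])
  also have "(LBINT t:{0..T}. LBINT x. y x t * (cb x * g \<beta> t)) = (LBINT t:{0..T}. Pop chib (\<lambda>x. 0) y t * g \<beta> t)"
   by (simp add: v_chi[OF y] cb_def mult.assoc[symmetric])
  finally show ?thesis by simp
 qed
 have L: "(LBINT t:{0..T}. LBINT x. v x t * (z wtt x t - wxx x t + Q x * z w x t)) =
   (LBINT t:{0..T}. LBINT x. v x t * z wtt x t) - (LBINT t:{0..T}. LBINT x. v x t * wxx x t)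
   + (LBINT t:{0..T}. LBINT x. Qv x t * z w x t)"
 proof -
  note K = CR_ops(2)[OF zC[OF cr(6)] cr(4)]
  have "(LBINT t:{0..T}. LBINT x. v x t * (z wtt x t - wxx x t + Q x * z w x t)) =
   (LBINT t:{0..T}. LBINT x. v x t * (z wtt x t - wxx x t) + Qv x t * z w x t)"
   by (simp add: Qv_def algebra_simps)
  also have "\<dots> = (LBINT t:{0..T}. LBINT x. v x t * (z wtt x t - wxx x t)) + (LBINT t:{0..T}. LBINT x. Qv x t * z w x t)"
   by (rule double_integral_lin[OF v Qv ab' K[unfolded CR_def] zC[OF cr(1), unfolded CR_def]])
  also have "(LBINT t:{0..T}. LBINT x. v x t * z wtt x t) = (LBINT t:{0..T}. LBINT x. v x t * (z wtt x t - wxx x t) + v x t * wxx x t)"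
   by (simp add: algebra_simps)
  then have "(LBINT t:{0..T}. LBINT x. v x t * (z wtt x t - wxx x t)) = (LBINT t:{0..T}. LBINT x. v x t * z wtt x t) - (LBINT t:{0..T}. LBINT x. v x t * wxx x t)"
   by (subst (asm) double_integral_lin[OF v v ab' K[unfolded CR_def] cr(4)[unfolded CR_def]]) simp
  finally show ?thesis .
 qed
 have L2: "(LBINT t:{0..T}. LBINT x. v x t * (wtt x t - wxx x t)) = (LBINT t:{0..T}. LBINT x. v x t * wtt x t) - (LBINT t:{0..T}. LBINT x. v x t * wxx x t)"
 proof -
  have "(LBINT t:{0..T}. LBINT x. v x t * wtt x t) = (LBINT t:{0..T}. LBINT x. v x t * (wtt x t - wxx x t) + v x t * wxx x t)"
   by (simp add: algebra_simps)
  then show ?thesis by (subst (asm) double_integral_lin[OF v v ab' CR_ops(2)[OF cr(6) cr(4), unfolded CR_def] cr(4)[unfolded CR_def]]) simp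
 qed
 have ct: "continuous_on {0..T} (g y)" if "CR \<alpha> \<beta> T g" "y \<in> {\<alpha>..\<beta>}" for g y
  by (rule CR_sec(2)[OF that])
 have R: "(LBINT t:{0..T}. g0 t * zx wx w \<alpha> t) - (LBINT t:{0..T}. gb t * zx wx w \<beta> t) =
   (LBINT t:{0..T}. g0 t * wx \<alpha> t) - (LBINT t:{0..T}. gb t * wx \<beta> t)
   + (LBINT t:{0..T}. ((g0 t - gb t) / b) * w \<alpha> t) - (LBINT t:{0..T}. ((g0 t - gb t) / b) * w \<beta> t)"
 proof -
  note i = L2c_times_cont[OF g0 ct[OF cr(2) in\<alpha>(1)]] L2c_times_cont[OF gb ct[OF cr(2) in\<alpha>(2)]]
   L2c_times_cont[OF flux_L2c(1) ct[OF cr(1) in\<alpha>(1)]] L2c_times_cont[OF flux_L2c(1) ct[OF cr(1) in\<alpha>(2)]]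
  have "(LBINT t:{0..T}. g0 t * zx wx w \<alpha> t) - (LBINT t:{0..T}. gb t * zx wx w \<beta> t)
    = (LBINT t:{0..T}. g0 t * zx wx w \<alpha> t - gb t * zx wx w \<beta> t)"
   by (rule set_integral_diff(2)[symmetric]) (intro L2c_times_cont g0 gb ct zxC cr in\<alpha>)+
  also have "\<dots> = (LBINT t:{0..T}. g0 t * wx \<alpha> t - gb t * wx \<beta> t + ((g0 t - gb t) / b) * w \<alpha> t - ((g0 t - gb t) / b) * w \<beta> t)"
  proof -
   have "g0 t * zx wx w \<alpha> t - gb t * zx wx w \<beta> t = g0 t * wx \<alpha> t - gb t * wx \<beta> t + ((g0 t - gb t) / b) * w \<alpha> t - ((g0 t - gb t) / b) * w \<beta> t" for t
   proof -
    define r where "r = 1 / b"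
    have e: "(g0 t - gb t) / b = r * (g0 t - gb t)" by (simp add: r_def)
    show ?thesis unfolding zx_def e r_def[symmetric] by (simp add: algebra_simps)
   qed
   then show ?thesis by simp
  qed
  also have "\<dots> = (LBINT t:{0..T}. g0 t * wx \<alpha> t) - (LBINT t:{0..T}. gb t * wx \<beta> t)
   + (LBINT t:{0..T}. ((g0 t - gb t) / b) * w \<alpha> t) - (LBINT t:{0..T}. ((g0 t - gb t) / b) * w \<beta> t)"
   using i by (simp add: set_integral_add set_integral_diff)
  finally show ?thesis .
 qed
 have t: "(LBINT t:{0..T}. Pop chi0 (\<lambda>x. 0) v t * wtt \<alpha> t) + (LBINT t:{0..T}. Pop chi0 (\<lambda>x. 0) Qv t * w \<alpha> t)
   + (LBINT t:{0..T}. ((g0 t - gb t) / b) * w \<alpha> t) = - (LBINT t:{0..T}. N0 t * wtt \<alpha> t)"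
   "(LBINT t:{0..T}. Pop chib (\<lambda>x. 0) v t * wtt \<beta> t) + (LBINT t:{0..T}. Pop chib (\<lambda>x. 0) Qv t * w \<beta> t)
   - (LBINT t:{0..T}. ((g0 t - gb t) / b) * w \<beta> t) = (LBINT t:{0..T}. Nb t * wtt \<beta> t)"
  using D(2,6) wT in\<alpha> ct[OF cr(6)]
  by (intro chi_part(1)[where \<psi>'="wt \<alpha>"] chi_part(2)[where \<psi>'="wt \<beta>"]; blast)+
 show ?thesis
  using E L L2 R t split[OF v cr(6)] split[OF Qv cr(1)] by linarith
qed

end

section \<open>Travelling waves as test fields and the traces at the ends\<close>

lemma pp_DERIV32: "(pp 3 has_real_derivative pp 2 s) (at s)" "(pp 2 has_real_derivative pp 1 s) (at s)"
 using pp_DERIV[of 1 s] pp_DERIV[of 0 s] by (simp_all add: numeral_3_eq_3 numeral_2_eq_2)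

text \<open>The speed is 1 or -1, so both second derivatives coincide and the wave operator
  annihilates the field.\<close>

lemma C2_rect_pp:
 fixes e s :: real
 assumes s: "s * s = 1"
 shows "C2_rect X I (\<lambda>x t. pp 3 (e + s * x - t)) (\<lambda>x t. s * pp 2 (e + s * x - t)) (\<lambda>x t. - pp 2 (e + s * x - t))
  (\<lambda>x t. pp 1 (e + s * x - t)) (\<lambda>x t. - s * pp 1 (e + s * x - t)) (\<lambda>x t. pp 1 (e + s * x - t))"
proof -
 have x: "((\<lambda>y. e + s * y - t) has_real_derivative s) (at x within X)" for x t
  by (auto intro!: derivative_eq_intros)
 have t: "((\<lambda>t. e + s * x - t) has_real_derivative - 1) (at t within I)" for x t
  by (auto intro!: derivative_eq_intros)
 note X3 = DERIV_chain2[where f="pp 3", OF pp_DERIV32(1) x] and X2 = DERIV_chain2[where f="pp 2", OF pp_DERIV32(2) x]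
 note T3 = DERIV_chain2[where f="pp 3", OF pp_DERIV32(1) t] and T2 = DERIV_chain2[where f="pp 2", OF pp_DERIV32(2) t]
 show ?thesis
  unfolding C2_rect_def
 proof (intro conjI ballI)
  fix g :: "real \<Rightarrow> real \<Rightarrow> real"
  assume "g \<in> {\<lambda>x t. pp 3 (e + s * x - t), \<lambda>x t. s * pp 2 (e + s * x - t), \<lambda>x t. - pp 2 (e + s * x - t),
  \<lambda>x t. pp 1 (e + s * x - t), \<lambda>x t. - s * pp 1 (e + s * x - t), \<lambda>x t. pp 1 (e + s * x - t)}"
  then show "continuous_on (X \<times> I) (\<lambda>(x, t). g x t)"
   by (elim insertE emptyE) (simp_all only: case_prod_unfold, (intro continuous_intros)+)
 next
  fix x t
  show "((\<lambda>y. pp 3 (e + s * y - t)) has_real_derivative s * pp 2 (e + s * x - t)) (at x within X)"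
   by (rule DERIV_cong[OF X3]) (rule mult.commute)
  show "((\<lambda>t. pp 3 (e + s * x - t)) has_real_derivative - pp 2 (e + s * x - t)) (at t within I)"
   using T3 by simp
  show "((\<lambda>y. s * pp 2 (e + s * y - t)) has_real_derivative pp 1 (e + s * x - t)) (at x within X)"
   by (rule DERIV_cong[OF DERIV_cmult[OF X2]]) (use s in \<open>simp add: mult.left_commute[of s]\<close>)
  show "((\<lambda>t. s * pp 2 (e + s * x - t)) has_real_derivative - s * pp 1 (e + s * x - t)) (at t within I)"
   using DERIV_cmult[OF T2, of s] by simp
  show "((\<lambda>y. - pp 2 (e + s * y - t)) has_real_derivative - s * pp 1 (e + s * x - t)) (at x within X)"
   by (rule DERIV_cong[OF DERIV_minus[OF X2]]) simp
  show "((\<lambda>t. - pp 2 (e + s * x - t)) has_real_derivative pp 1 (e + s * x - t)) (at t within I)"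
   using DERIV_minus[OF T2] by simp
 qed
qed

lemma Lint_minus: "(LBINT t:A. - f t) = - (LBINT t:A. f t :: real)"
 unfolding set_lebesgue_integral_def by (simp only: scaleR_minus_right integral_minus)

text \<open>The retarded potential: the integral along the two backward characteristics through (z,
  t).\<close>

definition Sop :: "real \<Rightarrow> (real \<Rightarrow> real \<Rightarrow> real) \<Rightarrow> real \<Rightarrow> real" where
 "Sop z = Pop (\<lambda>x. 1) (\<lambda>x. \<bar>x - z\<bar>)"

interpretation Sdata: Pop_data "\<lambda>x. 1" "\<lambda>x. \<bar>x - z\<bar>" 1 for z
 by unfold_locales auto

lemmas Sop_L2c = Sdata.Pop_L2c[folded Sop_def] and Jt_Sop = Sdata.Jt_Pop[folded Sop_def]
 and Jt_pow_Sop = Sdata.Jt_pow_Pop[folded Sop_def] and Sop_cong_AE = Sdata.Pop_cong_AE[folded Sop_def]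

context interval_sys
begin

text \<open>These will turn out to be the primitives \<open>Jt A\<close> and \<open>Jt B\<close> of
  the two waves in d'Alembert's formula; the waves themselves appear once \<open>AB_exist\<close>
  has removed the \<open>Jt\<close>.\<close>

definition AA :: "real \<Rightarrow> real" where "AA t = Jt g0 t - N0 t"
definition BB :: "real \<Rightarrow> real" where "BB t = Jt gb t + Nb t"

lemma AA_L2c: "AA \<in> L2c" and BB_L2c: "BB \<in> L2c"
 unfolding AA_def BB_def by (intro L2c_diff L2c_add Jt_L2c g0 gb N0_L2c Nb_L2c)+

lemma ab': "\<alpha> \<le> \<beta>" using ab by simp

lemma pair_pp: "(LBINT t:{0..T}. LBINT x. Qv x t * pp 3 (\<sigma> - \<bar>x - z\<bar> - t)) = (Jt ^^ 4) (Sop z Qv) \<sigma>"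
 if "\<sigma> \<le> T" for \<sigma> z
 using Sdata.Pop_pp[OF Qv ab' that, of 3 z] by (simp add: Sop_def numeral_eq_Suc)

text \<open>The field is the wave in x + t that has phase \<open>\<sigma> - t\<close> at alpha and
  \<open>\<sigma> - b - t\<close> at beta. The wave operator annihilates it, which leaves the
  potential and the ends, those at beta with delay b. This gives the claim under two integrations at
  every \<open>\<sigma>\<close> up to T, and they are cancelled.\<close>

lemma trace_alpha: "AE t in lborel. t < T \<longrightarrow> AA t = 2 * Jt g0 t - BB (t - b) + Jt (Jt (Sop \<alpha> Qv)) t"
proof -
 have E: "(Jt ^^ 4) (Sop \<alpha> Qv) \<sigma> = - (Jt ^^ 3) g0 \<sigma> + (Jt ^^ 3) gb (\<sigma> - b) - (Jt ^^ 2) N0 \<sigma> + (Jt ^^ 2) Nb (\<sigma> - b)"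
  if s: "\<sigma> \<le> T" for \<sigma>
 proof -
  have sb: "\<sigma> - b \<le> T" using s b0 by simp
  have "C2_rect {\<alpha>..\<beta>} {0..T} (\<lambda>x t. pp 3 ((\<sigma> + \<alpha>) + (-1) * x - t)) (\<lambda>x t. (-1) * pp 2 ((\<sigma> + \<alpha>) + (-1) * x - t)) (\<lambda>x t. - pp 2 ((\<sigma> + \<alpha>) + (-1) * x - t))
  (\<lambda>x t. pp 1 ((\<sigma> + \<alpha>) + (-1) * x - t)) (\<lambda>x t. - (-1) * pp 1 ((\<sigma> + \<alpha>) + (-1) * x - t)) (\<lambda>x t. pp 1 ((\<sigma> + \<alpha>) + (-1) * x - t))"
   by (rule C2_rect_pp) simp
  from WF[OF this] have "(LBINT t:{0..T}. LBINT x. Qv x t * pp 3 (\<sigma> + \<alpha> - x - t))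
    = - (LBINT t:{0..T}. g0 t * pp 2 (\<sigma> - t)) + (LBINT t:{0..T}. gb t * pp 2 (\<sigma> + \<alpha> - \<beta> - t))
    - (LBINT t:{0..T}. N0 t * pp 1 (\<sigma> - t)) + (LBINT t:{0..T}. Nb t * pp 1 (\<sigma> + \<alpha> - \<beta> - t))"
   using s by (simp add: pp_nonpos Lint_minus)
  also have "(LBINT t:{0..T}. LBINT x. Qv x t * pp 3 (\<sigma> + \<alpha> - x - t)) = (LBINT t:{0..T}. LBINT x. Qv x t * pp 3 (\<sigma> - \<bar>x - \<alpha>\<bar> - t))"
  proof -
   have f: "Qv x t * pp 3 (\<sigma> + \<alpha> - x - t) = Qv x t * pp 3 (\<sigma> - \<bar>x - \<alpha>\<bar> - t)" for x t
    using QcD(2)[OF Qv, of x] by (cases "x \<in> {\<alpha>..\<beta>}") (auto simp: algebra_simps)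
   show ?thesis by (simp only: f)
  qed
  also have "\<dots> = (Jt ^^ 4) (Sop \<alpha> Qv) \<sigma>" by (rule pair_pp[OF s])
  also have "\<sigma> + \<alpha> - \<beta> = \<sigma> - b" by (simp add: b_def)
  also have "(LBINT t:{0..T}. g0 t * pp 2 (\<sigma> - t)) = (Jt ^^ 3) g0 \<sigma>" using Jt_pp[OF g0 s, of 2] by (simp add: numeral_eq_Suc)
  also have "(LBINT t:{0..T}. gb t * pp 2 (\<sigma> - b - t)) = (Jt ^^ 3) gb (\<sigma> - b)" using Jt_pp[OF gb sb, of 2] by (simp add: numeral_eq_Suc)
  also have "(LBINT t:{0..T}. N0 t * pp 1 (\<sigma> - t)) = (Jt ^^ 2) N0 \<sigma>" using Jt_pp[OF N0_L2c s, of 1] by (simp add: numeral_eq_Suc)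
  also have "(LBINT t:{0..T}. Nb t * pp 1 (\<sigma> - b - t)) = (Jt ^^ 2) Nb (\<sigma> - b)" using Jt_pp[OF Nb_L2c sb, of 1] by (simp add: numeral_eq_Suc)
  finally show ?thesis .
 qed
 note SL = Sop_L2c[OF Qv ab', of \<alpha>]
 have R: "(\<lambda>t. 2 * Jt g0 t - BB (t - b) + Jt (Jt (Sop \<alpha> Qv)) t) \<in> L2c"
  using b0 by (intro L2c_add L2c_diff L2c_cmult L2c_shift Jt_L2c g0 BB_L2c SL) auto
 show ?thesis
 proof (rule Jt_pow_strip[where k=2, OF AA_L2c R], intro AE_I2 impI)
  fix t assume "t < T"
  then have "(Jt ^^ 4) (Sop \<alpha> Qv) t = - (Jt ^^ 3) g0 t + (Jt ^^ 3) gb (t - b) - (Jt ^^ 2) N0 t + (Jt ^^ 2) Nb (t - b)" by (intro E) simp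
  moreover have "(Jt ^^ 2) AA t = (Jt ^^ 3) g0 t - (Jt ^^ 2) N0 t"
   unfolding AA_def[abs_def] using Jt_pow_diff[OF Jt_L2c[OF g0] N0_L2c, of 2] by (simp add: numeral_eq_Suc)
  moreover have "(Jt ^^ 2) BB = (\<lambda>t. (Jt ^^ 3) gb t + (Jt ^^ 2) Nb t)"
   unfolding BB_def[abs_def] using Jt_pow_add[OF Jt_L2c[OF gb] Nb_L2c, of 2] by (simp add: numeral_eq_Suc)
  moreover have "(Jt ^^ 2) (\<lambda>t. 2 * Jt g0 t - BB (t - b) + Jt (Jt (Sop \<alpha> Qv)) t) t = 2 * (Jt ^^ 3) g0 t - (Jt ^^ 2) BB (t - b) + (Jt ^^ 4) (Sop \<alpha> Qv) t"
   using b0 by (subst Jt_pow_add Jt_pow_diff, (intro L2c_add L2c_diff L2c_cmult L2c_shift Jt_L2c g0 BB_L2c SL; simp)+)+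
    (simp only: Jt_pow_cmult Jt_pow_shift, simp add: numeral_eq_Suc)
  ultimately show "(Jt ^^ 2) AA t = (Jt ^^ 2) (\<lambda>t. 2 * Jt g0 t - BB (t - b) + Jt (Jt (Sop \<alpha> Qv)) t) t"
   by simp
 qed
qed

lemma trace_beta: "AE t in lborel. t < T \<longrightarrow> BB t = 2 * Jt gb t - AA (t - b) + Jt (Jt (Sop \<beta> Qv)) t"
proof -
 have E: "(Jt ^^ 4) (Sop \<beta> Qv) \<sigma> = (Jt ^^ 3) g0 (\<sigma> - b) - (Jt ^^ 3) gb \<sigma> - (Jt ^^ 2) N0 (\<sigma> - b) + (Jt ^^ 2) Nb \<sigma>"
  if s: "\<sigma> \<le> T" for \<sigma>
 proof -
  have sb: "\<sigma> - b \<le> T" using s b0 by simp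
  have "C2_rect {\<alpha>..\<beta>} {0..T} (\<lambda>x t. pp 3 ((\<sigma> - \<beta>) + 1 * x - t)) (\<lambda>x t. 1 * pp 2 ((\<sigma> - \<beta>) + 1 * x - t)) (\<lambda>x t. - pp 2 ((\<sigma> - \<beta>) + 1 * x - t))
  (\<lambda>x t. pp 1 ((\<sigma> - \<beta>) + 1 * x - t)) (\<lambda>x t. - 1 * pp 1 ((\<sigma> - \<beta>) + 1 * x - t)) (\<lambda>x t. pp 1 ((\<sigma> - \<beta>) + 1 * x - t))"
   by (rule C2_rect_pp) simp
  from WF[OF this] have "(LBINT t:{0..T}. LBINT x. Qv x t * pp 3 (\<sigma> - \<beta> + x - t))
    = (LBINT t:{0..T}. g0 t * pp 2 (\<sigma> - \<beta> + \<alpha> - t)) - (LBINT t:{0..T}. gb t * pp 2 (\<sigma> - t))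
    - (LBINT t:{0..T}. N0 t * pp 1 (\<sigma> - \<beta> + \<alpha> - t)) + (LBINT t:{0..T}. Nb t * pp 1 (\<sigma> - t))"
   using s by (simp add: pp_nonpos Lint_minus)
  also have "(LBINT t:{0..T}. LBINT x. Qv x t * pp 3 (\<sigma> - \<beta> + x - t)) = (LBINT t:{0..T}. LBINT x. Qv x t * pp 3 (\<sigma> - \<bar>x - \<beta>\<bar> - t))"
  proof -
   have f: "Qv x t * pp 3 (\<sigma> - \<beta> + x - t) = Qv x t * pp 3 (\<sigma> - \<bar>x - \<beta>\<bar> - t)" for x t
    using QcD(2)[OF Qv, of x] by (cases "x \<in> {\<alpha>..\<beta>}") (auto simp: algebra_simps)
   show ?thesis by (simp only: f)
  qed
  also have "\<dots> = (Jt ^^ 4) (Sop \<beta> Qv) \<sigma>" by (rule pair_pp[OF s])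
  also have "\<sigma> - \<beta> + \<alpha> = \<sigma> - b" by (simp add: b_def)
  also have "(LBINT t:{0..T}. g0 t * pp 2 (\<sigma> - b - t)) = (Jt ^^ 3) g0 (\<sigma> - b)" using Jt_pp[OF g0 sb, of 2] by (simp add: numeral_eq_Suc)
  also have "(LBINT t:{0..T}. gb t * pp 2 (\<sigma> - t)) = (Jt ^^ 3) gb \<sigma>" using Jt_pp[OF gb s, of 2] by (simp add: numeral_eq_Suc)
  also have "(LBINT t:{0..T}. N0 t * pp 1 (\<sigma> - b - t)) = (Jt ^^ 2) N0 (\<sigma> - b)" using Jt_pp[OF N0_L2c sb, of 1] by (simp add: numeral_eq_Suc)
  also have "(LBINT t:{0..T}. Nb t * pp 1 (\<sigma> - t)) = (Jt ^^ 2) Nb \<sigma>" using Jt_pp[OF Nb_L2c s, of 1] by (simp add: numeral_eq_Suc)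
  finally show ?thesis .
 qed
 note SL = Sop_L2c[OF Qv ab', of \<beta>]
 have R: "(\<lambda>t. 2 * Jt gb t - AA (t - b) + Jt (Jt (Sop \<beta> Qv)) t) \<in> L2c"
  using b0 by (intro L2c_add L2c_diff L2c_cmult L2c_shift Jt_L2c gb AA_L2c SL) auto
 show ?thesis
 proof (rule Jt_pow_strip[where k=2, OF BB_L2c R], intro AE_I2 impI)
  fix t assume "t < T"
  then have "(Jt ^^ 4) (Sop \<beta> Qv) t = (Jt ^^ 3) g0 (t - b) - (Jt ^^ 3) gb t - (Jt ^^ 2) N0 (t - b) + (Jt ^^ 2) Nb t" by (intro E) simp
  moreover have "(Jt ^^ 2) AA = (\<lambda>t. (Jt ^^ 3) g0 t - (Jt ^^ 2) N0 t)"
   unfolding AA_def[abs_def] using Jt_pow_diff[OF Jt_L2c[OF g0] N0_L2c, of 2] by (simp add: numeral_eq_Suc)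
  moreover have "(Jt ^^ 2) BB = (\<lambda>t. (Jt ^^ 3) gb t + (Jt ^^ 2) Nb t)"
   unfolding BB_def[abs_def] using Jt_pow_add[OF Jt_L2c[OF gb] Nb_L2c, of 2] by (simp add: numeral_eq_Suc)
  moreover have "(Jt ^^ 2) (\<lambda>t. 2 * Jt gb t - AA (t - b) + Jt (Jt (Sop \<beta> Qv)) t) t = 2 * (Jt ^^ 3) gb t - (Jt ^^ 2) AA (t - b) + (Jt ^^ 4) (Sop \<beta> Qv) t"
   using b0 by (subst Jt_pow_add Jt_pow_diff, (intro L2c_add L2c_diff L2c_cmult L2c_shift Jt_L2c gb AA_L2c SL; simp)+)+
    (simp only: Jt_pow_cmult Jt_pow_shift, simp add: numeral_eq_Suc)
  ultimately show "(Jt ^^ 2) BB t = (Jt ^^ 2) (\<lambda>t. 2 * Jt gb t - AA (t - b) + Jt (Jt (Sop \<beta> Qv)) t) t"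
   by simp
 qed
qed

end

section \<open>Kernels\<close>

text \<open>The parameter space is general: it is the time axis for boundary terms and the plane of
  (x, t) for interior terms.\<close>

lemma fubini_param:
 fixes V :: "'p::euclidean_space \<Rightarrow> real" and kk :: "real \<Rightarrow> 'p \<Rightarrow> real"
 assumes V: "integrable lborel V" and S: "compact S" and V0: "\<And>p. p \<notin> S \<Longrightarrow> V p = 0"
  and k: "continuous_on ({c..d} \<times> S) (\<lambda>(z, p). kk z p)"
 shows "(LBINT p. V p * (LBINT z:{c..d}. kk z p)) = (LBINT z:{c..d}. (LBINT p. V p * kk z p))"
proof -
 define k' where "k' = (\<lambda>z. indicator ({c..d} \<times> S) z *\<^sub>R (case z of (z, p) \<Rightarrow> kk z p))"
 have "k' \<in> borel_measurable borel"
  unfolding k'_def by (intro borel_measurable_continuous_on_indicator k) (intro borel_closed closed_Times closed_atLeastAtMost compact_imp_closed S)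
 then have [measurable]: "k' \<in> borel_measurable (borel \<Otimes>\<^sub>M borel)" by (simp add: borel_prod)
 have [measurable]: "V \<in> borel_measurable borel" using borel_measurable_integrable[OF V] by simp
 have "bounded ((\<lambda>(z, p). kk z p) ` ({c..d} \<times> S))"
  by (intro compact_imp_bounded compact_continuous_image k compact_Times compact_Icc S)
 then obtain C where C: "\<forall>y\<in>(\<lambda>(z, p). kk z p) ` ({c..d} \<times> S). norm y \<le> C" unfolding bounded_iff by blast
 have k'C: "\<bar>k' (z, p)\<bar> \<le> \<bar>C\<bar> * indicator {c..d} z" for z p
 proof (cases "z \<in> {c..d} \<and> p \<in> S")
  case True
  have "(\<lambda>(z, p). kk z p) (z, p) \<in> (\<lambda>(z, p). kk z p) ` ({c..d} \<times> S)"
   by (rule imageI) (use True in simp)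
  with C have "norm (kk z p) \<le> C" by fastforce
  then show ?thesis using True by (simp add: k'_def)
 qed (auto simp: k'_def indicator_def)
 define F where "F = (\<lambda>z p. V p * k' (z, p))"
 have Fm: "(\<lambda>(z, p). F z p) \<in> borel_measurable (lborel \<Otimes>\<^sub>M lborel)" unfolding F_def by measurable
 have i: "integrable (lborel \<Otimes>\<^sub>M lborel) (\<lambda>(z, p). F z p)"
 proof (rule integrableI_bounded[OF Fm])
  have "(\<integral>\<^sup>+x. ennreal (norm (case x of (z, p) \<Rightarrow> F z p)) \<partial>(lborel \<Otimes>\<^sub>M lborel)) = (\<integral>\<^sup>+z. \<integral>\<^sup>+p. ennreal \<bar>F z p\<bar> \<partial>lborel \<partial>lborel)"
   by (subst lborel.nn_integral_fst[symmetric]) (use Fm in auto)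
  also have "\<dots> \<le> (\<integral>\<^sup>+z. \<integral>\<^sup>+p. ennreal (\<bar>C\<bar> * indicator {c..d} z) * ennreal \<bar>V p\<bar> \<partial>lborel \<partial>lborel)"
  proof (intro nn_integral_mono)
   fix z p
   have "\<bar>F z p\<bar> \<le> (\<bar>C\<bar> * indicator {c..d} z) * \<bar>V p\<bar>"
    using mult_right_mono[OF k'C[of z p], of "\<bar>V p\<bar>"] by (simp add: F_def abs_mult mult.commute)
   then have "ennreal \<bar>F z p\<bar> \<le> ennreal ((\<bar>C\<bar> * indicator {c..d} z) * \<bar>V p\<bar>)" by (rule ennreal_leI)
   also have "\<dots> = ennreal (\<bar>C\<bar> * indicator {c..d} z) * ennreal \<bar>V p\<bar>" by (rule ennreal_mult) auto
   finally show "ennreal \<bar>F z p\<bar> \<le> ennreal (\<bar>C\<bar> * indicator {c..d} z) * ennreal \<bar>V p\<bar>" .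
  qed
  also have "\<dots> = (\<integral>\<^sup>+z. ennreal (\<bar>C\<bar> * indicator {c..d} z) \<partial>lborel) * (\<integral>\<^sup>+p. ennreal \<bar>V p\<bar> \<partial>lborel)"
   by (simp add: nn_integral_cmult nn_integral_multc)
  also have "(\<integral>\<^sup>+z. ennreal (\<bar>C\<bar> * indicator {c..d} z) \<partial>lborel) = (\<integral>\<^sup>+z. ennreal \<bar>C\<bar> * indicator {c..d} z \<partial>lborel)"
   by (intro nn_integral_cong) (simp add: indicator_def)
  also have "\<dots> = ennreal \<bar>C\<bar> * emeasure lborel {c..d}" by (rule nn_integral_cmult_indicator) simp
  also have "ennreal \<bar>C\<bar> * emeasure lborel {c..d} * (\<integral>\<^sup>+p. ennreal \<bar>V p\<bar> \<partial>lborel) < \<infinity>"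
   using V by (simp add: integrable_iff_bounded ennreal_mult_less_top emeasure_lborel_Icc_eq)
  finally show "(\<integral>\<^sup>+x. ennreal (norm (case x of (z, p) \<Rightarrow> F z p)) \<partial>(lborel \<Otimes>\<^sub>M lborel)) < \<infinity>" .
 qed
 have e: "indicator {c..d} z *\<^sub>R (V p * kk z p) = F z p" for z p
  using V0[of p] by (cases "p \<in> S") (auto simp: F_def k'_def indicator_def)
 have "(LBINT p. V p * (LBINT z:{c..d}. kk z p)) = (LBINT p. LBINT z. F z p)"
 proof -
  have "V p * (LBINT z:{c..d}. kk z p) = (LBINT z. F z p)" for p
  proof -
   have "V p * (LBINT z:{c..d}. kk z p) = (LBINT z. V p * (indicator {c..d} z *\<^sub>R kk z p))"
    unfolding set_lebesgue_integral_def by simp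
   also have "\<dots> = (LBINT z. F z p)" unfolding e[symmetric] by (simp add: mult.left_commute)
   finally show ?thesis .
  qed
  then show ?thesis by simp
 qed
 also have "\<dots> = (LBINT z. LBINT p. F z p)" by (rule lborel_pair.Fubini_integral[OF i])
 also have "\<dots> = (LBINT z:{c..d}. (LBINT p. V p * kk z p))"
  unfolding set_lebesgue_integral_def e[symmetric] by simp
 finally show ?thesis .
qed

locale kernel =
 fixes \<alpha> \<beta> \<sigma> L :: real and \<eta> :: "real \<Rightarrow> real"
 assumes ab: "\<alpha> < \<beta>" and \<eta>: "\<eta> \<in> test_functions \<alpha> \<beta>" and L0: "0 \<le> L" and L: "\<sigma> \<le> L"
begin

text \<open>The aim is to smear \<open>pp n (\<sigma> - t - \<bar>x - z\<bar>)\<close> over z with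
  weight \<open>\<eta>\<close>. The corner of the modulus prevents differentiation in x, so z is
  replaced by x + r and x - r, and x enters through the smooth weight only. The case s = 1 is this
  kernel, s = -1 arises from an x-derivative, and beyond r = L the truncated power is 0.\<close>

definition Is :: "real \<Rightarrow> (real \<Rightarrow> real) \<Rightarrow> nat \<Rightarrow> real \<Rightarrow> real \<Rightarrow> real" where
 "Is s a n x t = integral {0..L} (\<lambda>r. (a (x + r) + s * a (x - r)) * pp n (\<sigma> - t - r))"

lemma Is_continuous:
 assumes a: "continuous_on UNIV a"
 shows "continuous_on A (\<lambda>(x, t). Is s a n x t)"
proof -
 have "continuous_on (A \<times> cbox 0 L) (\<lambda>(p, r). (a (fst p + r) + s * a (fst p - r)) * pp n (\<sigma> - snd p - r))"
  unfolding case_prod_unfold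
  by (intro continuous_intros continuous_on_compose2[OF a]) auto
 from integral_continuous_on_param[OF this] show ?thesis by (simp add: Is_def case_prod_unfold)
qed

lemma Is_DERIV_t:
 assumes a: "continuous_on UNIV a"
 shows "((\<lambda>t. Is s a (Suc (Suc n)) x t) has_real_derivative - Is s a (Suc n) x t) (at t within I)"
proof -
 have "((\<lambda>t. integral (cbox 0 L) (\<lambda>r. (a (x + r) + s * a (x - r)) * pp (Suc (Suc n)) (\<sigma> - t - r))) has_field_derivative
   integral (cbox 0 L) (\<lambda>r. (a (x + r) + s * a (x - r)) * (- pp (Suc n) (\<sigma> - t - r)))) (at t within UNIV)"
 proof (rule leibniz_rule_field_derivative)
  fix t r
  have "((\<lambda>t. \<sigma> - t - r) has_real_derivative - 1) (at t)" by (auto intro!: derivative_eq_intros)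
  from DERIV_cmult[OF DERIV_chain2[where f="pp (Suc (Suc n))", OF pp_DERIV this], of "a (x + r) + s * a (x - r)"]
  show "((\<lambda>t. (a (x + r) + s * a (x - r)) * pp (Suc (Suc n)) (\<sigma> - t - r)) has_field_derivative (a (x + r) + s * a (x - r)) * (- pp (Suc n) (\<sigma> - t - r))) (at t)"
   by simp
  show "(\<lambda>r. (a (x + r) + s * a (x - r)) * pp (Suc (Suc n)) (\<sigma> - t - r)) integrable_on cbox 0 L"
   by (intro integrable_continuous continuous_intros continuous_on_compose2[OF a]) auto
 next
  show "continuous_on (UNIV \<times> cbox 0 L) (\<lambda>(t, r). (a (x + r) + s * a (x - r)) * - pp (Suc n) (\<sigma> - t - r))"
   unfolding case_prod_unfold by (intro continuous_intros continuous_on_compose2[OF a]) auto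
 qed auto
 then have "((\<lambda>t. Is s a (Suc (Suc n)) x t) has_real_derivative - Is s a (Suc n) x t) (at t)"
  by (simp add: Is_def integral_neg)
 then show ?thesis by (rule has_field_derivative_at_within)
qed

lemma Is_DERIV_x:
 assumes a: "\<And>x. (a has_real_derivative a' x) (at x)" and a': "continuous_on UNIV a'"
 shows "((\<lambda>x. Is s a n x t) has_real_derivative Is s a' n x t) (at x within X)"
proof -
 have ac: "continuous_on UNIV a" using a by (meson DERIV_continuous_on has_field_derivative_at_within)
 have "((\<lambda>x. integral (cbox 0 L) (\<lambda>r. (a (x + r) + s * a (x - r)) * pp n (\<sigma> - t - r))) has_field_derivative
   integral (cbox 0 L) (\<lambda>r. (a' (x + r) + s * a' (x - r)) * pp n (\<sigma> - t - r))) (at x within UNIV)"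
 proof (rule leibniz_rule_field_derivative)
  fix x r
  have d: "((\<lambda>x. x + r) has_real_derivative 1) (at x)" "((\<lambda>x. x - r) has_real_derivative 1) (at x)"
   by (auto intro!: derivative_eq_intros)
  have "((\<lambda>x. a (x + r)) has_real_derivative a' (x + r)) (at x)" "((\<lambda>x. a (x - r)) has_real_derivative a' (x - r)) (at x)"
   using DERIV_chain2[where f=a, OF a d(1)] DERIV_chain2[where f=a, OF a d(2)] by simp_all
  then show "((\<lambda>x. (a (x + r) + s * a (x - r)) * pp n (\<sigma> - t - r)) has_field_derivative (a' (x + r) + s * a' (x - r)) * pp n (\<sigma> - t - r)) (at x)"
   by (intro DERIV_cmult_right DERIV_add DERIV_cmult)
  show "(\<lambda>r. (a (x + r) + s * a (x - r)) * pp n (\<sigma> - t - r)) integrable_on cbox 0 L"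
   by (intro integrable_continuous continuous_intros continuous_on_compose2[OF ac]) auto
 next
  show "continuous_on (UNIV \<times> cbox 0 L) (\<lambda>(x, r). (a' (x + r) + s * a' (x - r)) * pp n (\<sigma> - t - r))"
   unfolding case_prod_unfold by (intro continuous_intros continuous_on_compose2[OF a']) auto
 qed auto
 then have "((\<lambda>x. Is s a n x t) has_real_derivative Is s a' n x t) (at x)" by (simp add: Is_def)
 then show ?thesis by (rule has_field_derivative_at_within)
qed

text \<open>Integration by parts in r trades the derivative of the weight against that of the power
  and flips the sign s. The end r = 0 contributes for s = -1 with factor 2; this local term is what
  isolates \<open>v\<close> in d'Alembert's formula.\<close>

lemma Is_by_parts:
 assumes a: "\<And>x. (a has_real_derivative a' x) (at x)" and a': "continuous_on UNIV a'" and t: "0 \<le> t"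
 shows "Is s a' (Suc (Suc n)) x t = Is (- s) a (Suc n) x t - (1 - s) * a x * pp (Suc (Suc n)) (\<sigma> - t)"
proof -
 have ac: "continuous_on UNIV a" using a by (meson DERIV_continuous_on has_field_derivative_at_within)
 define f where "f = (\<lambda>r. (a (x + r) + (- s) * a (x - r)) * pp (Suc (Suc n)) (\<sigma> - t - r))"
 have D: "(f has_real_derivative (a' (x + r) + s * a' (x - r)) * pp (Suc (Suc n)) (\<sigma> - t - r)
   - (a (x + r) + (- s) * a (x - r)) * pp (Suc n) (\<sigma> - t - r)) (at r within {0..L})" for r
 proof -
  have d: "((\<lambda>r. x + r) has_real_derivative 1) (at r)" "((\<lambda>r. x - r) has_real_derivative - 1) (at r)"
   "((\<lambda>r. \<sigma> - t - r) has_real_derivative - 1) (at r)"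
   by (auto intro!: derivative_eq_intros)
  note 1 = DERIV_chain2[where f=a, OF a d(1)] and 2 = DERIV_chain2[where f=a, OF a d(2)]
   and 3 = DERIV_chain2[where f="pp (Suc (Suc n))", OF pp_DERIV d(3)]
  have "(f has_real_derivative (a' (x + r) * 1 + (- s) * (a' (x - r) * - 1)) * pp (Suc (Suc n)) (\<sigma> - t - r)
    + pp (Suc n) (\<sigma> - t - r) * - 1 * (a (x + r) + (- s) * a (x - r))) (at r)"
   unfolding f_def by (intro DERIV_mult DERIV_add DERIV_cmult 1 2 3)
  then have "(f has_real_derivative (a' (x + r) + s * a' (x - r)) * pp (Suc (Suc n)) (\<sigma> - t - r)
   - (a (x + r) + (- s) * a (x - r)) * pp (Suc n) (\<sigma> - t - r)) (at r)"
   by (rule DERIV_cong) (simp add: algebra_simps)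
  then show ?thesis by (rule has_field_derivative_at_within)
 qed
 have "((\<lambda>r. (a' (x + r) + s * a' (x - r)) * pp (Suc (Suc n)) (\<sigma> - t - r)
   - (a (x + r) + (- s) * a (x - r)) * pp (Suc n) (\<sigma> - t - r)) has_integral f L - f 0) {0..L}"
  using L0 D by (intro fundamental_theorem_of_calculus) (auto simp: has_real_derivative_iff_has_vector_derivative)
 then have "integral {0..L} (\<lambda>r. (a' (x + r) + s * a' (x - r)) * pp (Suc (Suc n)) (\<sigma> - t - r)
   - (a (x + r) + (- s) * a (x - r)) * pp (Suc n) (\<sigma> - t - r)) = f L - f 0"
  by (rule integral_unique)
 moreover have "integral {0..L} (\<lambda>r. (a' (x + r) + s * a' (x - r)) * pp (Suc (Suc n)) (\<sigma> - t - r)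
   - (a (x + r) + (- s) * a (x - r)) * pp (Suc n) (\<sigma> - t - r)) = Is s a' (Suc (Suc n)) x t - Is (- s) a (Suc n) x t"
  unfolding Is_def
  by (intro Henstock_Kurzweil_Integration.integral_diff integrable_continuous_real continuous_intros
    continuous_on_compose2[OF ac] continuous_on_compose2[OF a']) auto
 moreover have "f L = 0" using L t by (simp add: f_def pp_nonpos)
 moreover have "f 0 = (1 - s) * a x * pp (Suc (Suc n)) (\<sigma> - t)" by (simp add: f_def algebra_simps)
 ultimately show ?thesis by simp
qed

definition Kn :: "nat \<Rightarrow> real \<Rightarrow> real \<Rightarrow> real" where
 "Kn n x t = (LBINT z:{\<alpha>..\<beta>}. \<eta> z * pp n (\<sigma> - t - \<bar>x - z\<bar>))"

lemma \<eta>c: "continuous_on A \<eta>" by (rule test_fn_continuous012(1)[OF \<eta>])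
lemma \<eta>0: "z \<notin> {\<alpha><..<\<beta>} \<Longrightarrow> \<eta> z = 0" using test_fn_zero[OF \<eta>, of z 0] by simp

text \<open>The integral over z is split at x and each half is substituted; the point z = x, counted
  twice, is a null set.\<close>

lemma Is_eq_Kn:
 assumes n: "n > 0" and t: "0 \<le> t"
 shows "Is 1 \<eta> n x t = Kn n x t"
proof -
 have [measurable]: "\<eta> \<in> borel_measurable borel" "pp n \<in> borel_measurable borel"
  using \<eta>c[of UNIV] pp_continuous[OF continuous_on_id, of UNIV n] by (simp_all add: borel_measurable_continuous_onI)
 have i: "integrable lborel (\<lambda>z. \<eta> z * pp n (\<sigma> - t - \<bar>x - z\<bar>))"
 proof -
  have "set_integrable lborel {\<alpha>..\<beta>} (\<lambda>z. \<eta> z * pp n (\<sigma> - t - \<bar>x - z\<bar>))"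
   by (intro borel_integrable_atLeastAtMost' continuous_intros \<eta>c)
  moreover have "indicator {\<alpha>..\<beta>} z *\<^sub>R (\<eta> z * pp n (\<sigma> - t - \<bar>x - z\<bar>)) = \<eta> z * pp n (\<sigma> - t - \<bar>x - z\<bar>)" for z
   using \<eta>0[of z] by (cases "z \<in> {\<alpha>..\<beta>}") auto
  ultimately show ?thesis by (simp only: set_integrable_def)
 qed
 define G where "G = (\<lambda>z. \<eta> z * pp n (\<sigma> - t - \<bar>x - z\<bar>))"
 have i1: "integrable lborel (\<lambda>z. indicator {x..} z * G z)" and i2: "integrable lborel (\<lambda>z. indicator {..x} z * G z)"
  using integrable_mult_indicator[OF _ i, of "{x..}"] integrable_mult_indicator[OF _ i, of "{..x}"] by (simp_all add: G_def)
 have j1: "(LBINT z. indicator {x..} z * G z) = (LBINT r. indicator {x..} (x + 1 * r) * G (x + 1 * r))"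
  by (subst lborel_integral_real_affine[where c=1 and t=x]) auto
 have j2: "(LBINT z. indicator {..x} z * G z) = (LBINT r. indicator {..x} (x + (-1) * r) * G (x + (-1) * r))"
  by (subst lborel_integral_real_affine[where c="-1" and t=x]) auto
 have k1: "integrable lborel (\<lambda>r. indicator {x..} (x + 1 * r) * G (x + 1 * r))"
  by (rule lborel_integrable_real_affine[OF i1]) simp
 have k2: "integrable lborel (\<lambda>r. indicator {..x} (x + (-1) * r) * G (x + (-1) * r))"
  by (rule lborel_integrable_real_affine[OF i2]) simp
 have "Is 1 \<eta> n x t = (LBINT r:{0..L}. (\<eta> (x + r) + 1 * \<eta> (x - r)) * pp n (\<sigma> - t - r))"
  unfolding Is_def
  by (intro set_borel_integral_eq_integral(2)[symmetric] borel_integrable_atLeastAtMost' continuous_intros continuous_on_compose2[OF \<eta>c[of UNIV]]) auto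
 also have "\<dots> = (LBINT r. indicator {x..} (x + 1 * r) * G (x + 1 * r) + indicator {..x} (x + (-1) * r) * G (x + (-1) * r))"
  unfolding set_lebesgue_integral_def
 proof (intro LBINT_cong)
  fix r
  show "indicator {0..L} r *\<^sub>R ((\<eta> (x + r) + 1 * \<eta> (x - r)) * pp n (\<sigma> - t - r)) =
   indicator {x..} (x + 1 * r) * G (x + 1 * r) + indicator {..x} (x + (-1) * r) * G (x + (-1) * r)"
  proof (cases "0 \<le> r")
   case True
   then show ?thesis
    using pp_nonpos[OF n, of "\<sigma> - t - r"] L t by (cases "r \<le> L") (auto simp: G_def indicator_def algebra_simps)
  qed (auto simp: indicator_def)
 qed
 also have "\<dots> = (LBINT z. indicator {x..} z * G z) + (LBINT z. indicator {..x} z * G z)"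
  unfolding j1 j2 by (rule Bochner_Integration.integral_add[OF k1 k2])
 also have "\<dots> = (LBINT z. indicator {x..} z * G z + indicator {..x} z * G z)"
  by (rule Bochner_Integration.integral_add[OF i1 i2, symmetric])
 also have "\<dots> = Kn n x t"
  unfolding Kn_def set_lebesgue_integral_def
 proof (rule integral_cong_AE)
  have "AE z in lborel. z \<noteq> x" by (rule AE_lborel_singleton)
  then show "AE z in lborel. indicator {x..} z * G z + indicator {..x} z * G z = indicator {\<alpha>..\<beta>} z *\<^sub>R (\<eta> z * pp n (\<sigma> - t - \<bar>x - z\<bar>))"
  proof eventually_elim
   case (elim z)
   then show ?case using \<eta>0[of z] by (auto simp: indicator_def G_def)
  qed
 qed (simp_all add: G_def)
 finally show ?thesis .
qed

text \<open>At an end one of the two arguments of the weight lies outside its support.\<close>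

lemma Is_end:
 shows "Is s \<eta> n \<alpha> t = Is 1 \<eta> n \<alpha> t" "Is s \<eta> n \<beta> t = s * Is 1 \<eta> n \<beta> t"
proof -
 show "Is s \<eta> n \<alpha> t = Is 1 \<eta> n \<alpha> t"
  unfolding Is_def by (intro Henstock_Kurzweil_Integration.integral_cong) (use \<eta>0 in auto)
 have "Is s \<eta> n \<beta> t = integral {0..L} (\<lambda>r. s * ((\<eta> (\<beta> + r) + 1 * \<eta> (\<beta> - r)) * pp n (\<sigma> - t - r)))"
  unfolding Is_def by (intro Henstock_Kurzweil_Integration.integral_cong) (use \<eta>0 in auto)
 then show "Is s \<eta> n \<beta> t = s * Is 1 \<eta> n \<beta> t" by (simp add: Is_def)
qed

text \<open>A backward solution of the wave equation with source: the second time derivative minus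
  the second x-derivative is \<open>2 * \<eta> x * pp 2 (\<sigma> - t)\<close>.\<close>

lemma C2_rect_kernel:
 "C2_rect X {0..T} (Is 1 \<eta> 3) (Is (-1) \<eta> 2) (\<lambda>x t. - Is 1 \<eta> 2 x t)
   (\<lambda>x t. Is 1 \<eta> 1 x t - 2 * \<eta> x * pp 2 (\<sigma> - t)) (\<lambda>x t. - Is (-1) \<eta> 1 x t) (Is 1 \<eta> 1)"
proof -
 note D = test_fn_DERIV01(1)[OF \<eta>] and c' = test_fn_continuous012(2)[OF \<eta>, of UNIV]
 note c = Is_continuous[OF \<eta>c]
 have cn: "continuous_on A (\<lambda>(x, t). - Is s \<eta> n x t)" for A s n
  using continuous_on_minus[OF c[of A s n]] by (simp add: case_prod_unfold)
 show ?thesis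
  unfolding C2_rect_def
 proof (intro conjI ballI)
  fix g assume "g \<in> {Is 1 \<eta> 3, Is (-1) \<eta> 2, \<lambda>x t. - Is 1 \<eta> 2 x t, \<lambda>x t. Is 1 \<eta> 1 x t - 2 * \<eta> x * pp 2 (\<sigma> - t), \<lambda>x t. - Is (-1) \<eta> 1 x t, Is 1 \<eta> 1}"
  moreover have "continuous_on (X \<times> {0..T}) (\<lambda>(x, t). Is 1 \<eta> 1 x t - 2 * \<eta> x * pp 2 (\<sigma> - t))"
   using c[of "X \<times> {0..T}" 1 1] unfolding case_prod_unfold
   by (intro continuous_intros continuous_on_compose2[OF \<eta>c[of UNIV]]) auto
  ultimately show "continuous_on (X \<times> {0..T}) (\<lambda>(x, t). g x t)"
   using c cn by (elim insertE emptyE) (simp_all only:)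
 next
  fix x t assume t: "t \<in> {0..T}"
  then have t0: "0 \<le> t" by simp
  show "((\<lambda>y. Is 1 \<eta> 3 y t) has_real_derivative Is (-1) \<eta> 2 x t) (at x within X)"
   using Is_DERIV_x[OF D c', of 1 3 t x X] Is_by_parts[OF D c' t0, of 1 1 x] by (simp add: numeral_eq_Suc)
  show "((\<lambda>s. Is 1 \<eta> 3 x s) has_real_derivative - Is 1 \<eta> 2 x t) (at t within {0..T})"
   "((\<lambda>s. Is (-1) \<eta> 2 x s) has_real_derivative - Is (-1) \<eta> 1 x t) (at t within {0..T})"
   using Is_DERIV_t[OF \<eta>c, of 1 1 x t "{0..T}"] Is_DERIV_t[OF \<eta>c, of "-1" 0 x t "{0..T}"] by (simp_all add: numeral_eq_Suc)
  show "((\<lambda>y. Is (-1) \<eta> 2 y t) has_real_derivative Is 1 \<eta> 1 x t - 2 * \<eta> x * pp 2 (\<sigma> - t)) (at x within X)"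
   using Is_DERIV_x[OF D c', of "-1" 2 t x X] Is_by_parts[OF D c' t0, of "-1" 0 x] by (simp add: numeral_eq_Suc)
  show "((\<lambda>y. - Is 1 \<eta> 2 y t) has_real_derivative - Is (-1) \<eta> 1 x t) (at x within X)"
   using DERIV_minus[OF Is_DERIV_x[OF D c', of 1 2 t x X]] Is_by_parts[OF D c' t0, of 1 0 x] by (simp add: numeral_eq_Suc)
  show "((\<lambda>s. - Is 1 \<eta> 2 x s) has_real_derivative Is 1 \<eta> 1 x t) (at t within {0..T})"
   using DERIV_minus[OF Is_DERIV_t[OF \<eta>c, of 1 0 x t "{0..T}"]] by (simp add: numeral_eq_Suc)
 qed
qed

end

section \<open>D'Alembert's formula inside the interval\<close>

lemma Jt_zero_fun [simp]: "Jt (\<lambda>t. 0) = (\<lambda>t. 0)"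
 by (rule ext) simp

text \<open>Membership in \<open>Qc\<close> gives no control of a slice at a single time. One
  integration in time provides it.\<close>

lemma Qc_Jt_integrable:
 assumes w: "w \<in> Qc \<alpha> \<beta>" and ab: "\<alpha> \<le> \<beta>"
 shows "integrable lborel (\<lambda>x. Jt (w x) \<sigma>)"
proof -
 interpret Z: Pop_data "\<lambda>x. 1" "\<lambda>x. 0" 1 by unfold_locales auto
 have "(\<lambda>x. case (x, \<sigma>) of (x, t) \<Rightarrow> Jt (w x) t) \<in> borel_measurable borel"
  by (rule measurable_compose[OF _ Jt_measurable[OF w]]) simp
 then have m: "(\<lambda>x. Jt (w x) \<sigma>) \<in> borel_measurable lborel" by simp
 show ?thesis
 proof (rule integrableI_bounded[OF m])
  have "(\<integral>\<^sup>+x. ennreal (norm (Jt (w x) \<sigma>)) \<partial>lborel) \<le> (\<integral>\<^sup>+x. \<integral>\<^sup>+s. ennreal (indicator {..\<sigma>} s * \<bar>1 * w x (s - 0)\<bar>) \<partial>lborel \<partial>lborel)"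
  proof (rule nn_integral_mono)
   fix x
   show "ennreal (norm (Jt (w x) \<sigma>)) \<le> (\<integral>\<^sup>+s. ennreal (indicator {..\<sigma>} s * \<bar>1 * w x (s - 0)\<bar>) \<partial>lborel)"
    using integral_norm_bound_ennreal[OF L2c_set_integrable[OF QcD(1)[OF w], of \<sigma> x, unfolded set_integrable_def]]
    by (simp add: Jt_def set_lebesgue_integral_def abs_mult)
  qed
  also have "\<dots> < \<infinity>" by (rule Z.nn_L1[OF w ab])
  finally show "(\<integral>\<^sup>+x. ennreal (norm (Jt (w x) \<sigma>)) \<partial>lborel) < \<infinity>" .
 qed
qed

lemma Qc_indicator:
 assumes w: "w \<in> Qc \<alpha> \<beta>" and A: "A \<in> sets borel"
 shows "(\<lambda>x t. indicator A x * w x t) \<in> Qc \<alpha> \<beta>"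
 by (rule Qc_mult[OF w, where K=1]) (use A in \<open>auto simp: indicator_def\<close>)

lemma shift_Qc:
 assumes g: "g \<in> L2c" and ab: "\<alpha> \<le> \<beta>" and d: "d \<in> borel_measurable borel" and d0: "\<And>z. z \<in> {\<alpha>..\<beta>} \<Longrightarrow> 0 \<le> d z"
 shows "(\<lambda>z t. indicator {\<alpha>..\<beta>} z * g (t - d z)) \<in> Qc \<alpha> \<beta>"
proof -
 note [measurable] = d L2cD(1)[OF g]
 have "(\<lambda>(z, t). indicator {\<alpha>..\<beta>} z * g (t - d z)) \<in> borel_measurable (borel \<Otimes>\<^sub>M borel)" by measurable
 moreover have "(\<lambda>t. indicator {\<alpha>..\<beta>} z * g (t - d z)) \<in> L2c" for z
  using L2c_shift[OF g d0, of z] by (cases "z \<in> {\<alpha>..\<beta>}") auto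
 moreover have "(\<integral>\<^sup>+z. sqn n (\<lambda>t. indicator {\<alpha>..\<beta>} z * g (t - d z)) \<partial>lborel) < \<infinity>" for n
 proof -
  have "(\<integral>\<^sup>+z. sqn n (\<lambda>t. indicator {\<alpha>..\<beta>} z * g (t - d z)) \<partial>lborel) \<le> (\<integral>\<^sup>+z. sqn n g * indicator {\<alpha>..\<beta>} z \<partial>lborel)"
  proof (rule nn_integral_mono)
   fix z show "sqn n (\<lambda>t. indicator {\<alpha>..\<beta>} z * g (t - d z)) \<le> sqn n g * indicator {\<alpha>..\<beta>} z"
    using sqn_shift_le[OF L2cD(1)[OF g] d0, of z n] by (cases "z \<in> {\<alpha>..\<beta>}") auto
  qed
  also have "\<dots> = sqn n g * emeasure lborel {\<alpha>..\<beta>}" by (rule nn_integral_cmult_indicator) simp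
  also have "\<dots> < \<infinity>" using L2cD(3)[OF g, of n] ab by (simp add: ennreal_mult_less_top)
  finally show ?thesis .
 qed
 ultimately show ?thesis by (auto simp: Qc_def)
qed

lemma Sop_Qc:
 assumes w: "w \<in> Qc \<alpha> \<beta>" and ab: "\<alpha> \<le> \<beta>"
 shows "(\<lambda>z t. indicator {\<alpha>..\<beta>} z * Sop z w t) \<in> Qc \<alpha> \<beta>"
proof -
 note Qc_measurable[OF w, measurable (raw)]
 have "(\<lambda>(z, t). indicator {\<alpha>..\<beta>} z * Sop z w t) \<in> borel_measurable (borel \<Otimes>\<^sub>M borel)"
  unfolding Sop_def Pop_def by measurable
 moreover have "(\<lambda>t. indicator {\<alpha>..\<beta>} z * Sop z w t) \<in> L2c" for z
  by (rule L2c_cmult[OF Sop_L2c[OF w ab]])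
 moreover have "(\<integral>\<^sup>+z. sqn n (\<lambda>t. indicator {\<alpha>..\<beta>} z * Sop z w t) \<partial>lborel) < \<infinity>" for n
 proof -
  have "(\<integral>\<^sup>+z. sqn n (\<lambda>t. indicator {\<alpha>..\<beta>} z * Sop z w t) \<partial>lborel)
    \<le> (\<integral>\<^sup>+z. ennreal (\<beta> - \<alpha>) * (ennreal (1\<^sup>2) * (\<integral>\<^sup>+x. sqn n (w x) \<partial>lborel)) * indicator {\<alpha>..\<beta>} z \<partial>lborel)"
  proof (rule nn_integral_mono)
   fix z show "sqn n (\<lambda>t. indicator {\<alpha>..\<beta>} z * Sop z w t) \<le> ennreal (\<beta> - \<alpha>) * (ennreal (1\<^sup>2) * (\<integral>\<^sup>+x. sqn n (w x) \<partial>lborel)) * indicator {\<alpha>..\<beta>} z"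
    using Sdata.sqn_Pop_le[OF w ab, of n z] by (cases "z \<in> {\<alpha>..\<beta>}") (auto simp: Sop_def)
  qed
  also have "\<dots> = ennreal (\<beta> - \<alpha>) * (ennreal (1\<^sup>2) * (\<integral>\<^sup>+x. sqn n (w x) \<partial>lborel)) * emeasure lborel {\<alpha>..\<beta>}"
   by (rule nn_integral_cmult_indicator) simp
  also have "\<dots> < \<infinity>" using QcD(3)[OF w, of n] ab by (simp add: ennreal_mult_less_top)
  finally show ?thesis .
 qed
 ultimately show ?thesis by (auto simp: Qc_def)
qed

lemma integrable_test_mult:
 assumes \<eta>: "\<eta> \<in> test_functions a b" and f: "integrable lborel f"
 shows "integrable lborel (\<lambda>z. \<eta> z * f z :: real)"
proof -
 note c = test_fn_continuous012(1)[OF \<eta>]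
 have [measurable]: "\<eta> \<in> borel_measurable borel" using c[of UNIV] by (rule borel_measurable_continuous_onI)
 note borel_measurable_integrable[OF f, measurable]
 have "bounded (\<eta> ` {a..b})" by (intro compact_imp_bounded compact_continuous_image c) simp
 then obtain C where C: "\<forall>y\<in>\<eta> ` {a..b}. norm y \<le> C" unfolding bounded_iff by blast
 have "\<bar>\<eta> z\<bar> \<le> \<bar>C\<bar>" for z
 proof (cases "z \<in> {a..b}")
  case True
  then have "norm (\<eta> z) \<le> C" using C by blast
  then show ?thesis by simp
 next
  case False
  then have "z \<notin> {a<..<b}" by auto
  then have "\<eta> z = 0" using test_fn_zero[OF \<eta>, of z 0] by simp
  then show ?thesis by simp
 qed
 then have le: "\<bar>\<eta> z\<bar> * \<bar>f z\<bar> \<le> \<bar>C\<bar> * \<bar>f z\<bar>" for z by (rule mult_right_mono) simp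
 show ?thesis
 proof (rule Bochner_Integration.integrable_bound)
  show "integrable lborel (\<lambda>z. \<bar>C\<bar> * f z)" using f by simp
  show "(\<lambda>z. \<eta> z * f z) \<in> borel_measurable lborel" by measurable
  show "AE z in lborel. norm (\<eta> z * f z) \<le> norm (\<bar>C\<bar> * f z)"
   using le by (intro AE_I2) (simp add: abs_mult)
 qed
qed

context interval_sys
begin

text \<open>The defect in d'Alembert's formula after one integration in time, with \<open>AA\<close>
  and \<open>BB\<close> in the place of the integrated waves.\<close>

definition Yrep :: "real \<Rightarrow> real \<Rightarrow> real" where
 "Yrep z t = indicator {\<alpha><..<\<beta>} z * (2 * Jt (v z) t + Jt (Jt (Sop z Qv)) t - AA (t - (z - \<alpha>)) - BB (t - (\<beta> - z)))"

lemma Yrep_Qc: "Yrep \<in> Qc \<alpha> \<beta>"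
proof -
 have 1: "(\<lambda>z t. 2 * Jt (v z) t) \<in> Qc \<alpha> \<beta>" by (intro Qc_cmult Jt_Qc v)
 have "(\<lambda>z. Jt (Jt (\<lambda>t. indicator {\<alpha>..\<beta>} z * Sop z Qv t))) \<in> Qc \<alpha> \<beta>"
  by (intro Jt_Qc Sop_Qc Qv ab')
 moreover have "Jt (Jt (\<lambda>t. indicator {\<alpha>..\<beta>} z * Sop z Qv t)) = (\<lambda>t. indicator {\<alpha>..\<beta>} z * Jt (Jt (Sop z Qv)) t)" for z
  using Jt_pow_cmult[of 2 "indicator {\<alpha>..\<beta>} z" "Sop z Qv"] by (simp add: numeral_eq_Suc)
 ultimately have 2: "(\<lambda>z t. indicator {\<alpha>..\<beta>} z * Jt (Jt (Sop z Qv)) t) \<in> Qc \<alpha> \<beta>" by simp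
 have 3: "(\<lambda>z t. indicator {\<alpha>..\<beta>} z * AA (t - (z - \<alpha>))) \<in> Qc \<alpha> \<beta>" by (rule shift_Qc[OF AA_L2c ab']) auto
 have 4: "(\<lambda>z t. indicator {\<alpha>..\<beta>} z * BB (t - (\<beta> - z))) \<in> Qc \<alpha> \<beta>" by (rule shift_Qc[OF BB_L2c ab']) auto
 have "(\<lambda>z t. indicator {\<alpha><..<\<beta>} z * (2 * Jt (v z) t + indicator {\<alpha>..\<beta>} z * Jt (Jt (Sop z Qv)) t
   - indicator {\<alpha>..\<beta>} z * AA (t - (z - \<alpha>)) - indicator {\<alpha>..\<beta>} z * BB (t - (\<beta> - z)))) \<in> Qc \<alpha> \<beta>"
  by (rule Qc_indicator[OF Qc_diff[OF Qc_diff[OF Qc_add[OF 1 2] 3] 4]]) simp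
 also have "(\<lambda>z t. indicator {\<alpha><..<\<beta>} z * (2 * Jt (v z) t + indicator {\<alpha>..\<beta>} z * Jt (Jt (Sop z Qv)) t
   - indicator {\<alpha>..\<beta>} z * AA (t - (z - \<alpha>)) - indicator {\<alpha>..\<beta>} z * BB (t - (\<beta> - z)))) = Yrep"
  by (auto simp: fun_eq_iff Yrep_def indicator_def)
 finally show ?thesis .
qed

lemma Jt2_Yrep:
 "(Jt ^^ 2) (Yrep z) \<sigma> = indicator {\<alpha><..<\<beta>} z * (2 * (Jt ^^ 3) (v z) \<sigma> + (Jt ^^ 4) (Sop z Qv) \<sigma>
   - (Jt ^^ 2) AA (\<sigma> - (z - \<alpha>)) - (Jt ^^ 2) BB (\<sigma> - (\<beta> - z)))"
proof (cases "z \<in> {\<alpha><..<\<beta>}")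
 case True
 have L: "(\<lambda>t. 2 * Jt (v z) t) \<in> L2c" "Jt (Jt (Sop z Qv)) \<in> L2c" "(\<lambda>t. AA (t - (z - \<alpha>))) \<in> L2c" "(\<lambda>t. BB (t - (\<beta> - z))) \<in> L2c"
  using True by (auto intro!: L2c_cmult Jt_L2c QcD(1)[OF v] Sop_L2c[OF Qv ab'] L2c_shift AA_L2c BB_L2c)
 have "Yrep z = (\<lambda>t. 2 * Jt (v z) t + Jt (Jt (Sop z Qv)) t - AA (t - (z - \<alpha>)) - BB (t - (\<beta> - z)))"
  using True by (auto simp: Yrep_def)
 then have "(Jt ^^ 2) (Yrep z) \<sigma> = (Jt ^^ 2) (\<lambda>t. 2 * Jt (v z) t) \<sigma> + (Jt ^^ 2) (Jt (Jt (Sop z Qv))) \<sigma> - (Jt ^^ 2) (\<lambda>t. AA (t - (z - \<alpha>))) \<sigma> - (Jt ^^ 2) (\<lambda>t. BB (t - (\<beta> - z))) \<sigma>"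
  by (simp only: Jt_pow_diff[OF L2c_diff[OF L2c_add[OF L(1,2)] L(3)] L(4)] Jt_pow_diff[OF L2c_add[OF L(1,2)] L(3)] Jt_pow_add[OF L(1,2)])
 moreover have "(Jt ^^ 2) (Jt (v z)) = (Jt ^^ 3) (v z)" "(Jt ^^ 2) (Jt (Jt (Sop z Qv))) = (Jt ^^ 4) (Sop z Qv)"
  by (simp_all add: numeral_eq_Suc)
 moreover have "indicator {\<alpha><..<\<beta>} z = (1::real)" using True by simp
 ultimately show ?thesis by (simp only: Jt_pow_cmult Jt_pow_shift mult_1)
next
 case False
 then have "Yrep z = (\<lambda>t. 0)" by (auto simp: Yrep_def)
 then show ?thesis using False by (simp add: numeral_eq_Suc)
qed

lemma V_lborel:
 assumes w: "w \<in> Qc \<alpha> \<beta>"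
 defines "V \<equiv> (\<lambda>p. indicator {0..T} (snd p) * w (fst p) (snd p))"
 shows "integrable lborel V" "\<And>p. p \<notin> {\<alpha>..\<beta>} \<times> {0..T} \<Longrightarrow> V p = 0"
  "\<And>k. continuous_on ({\<alpha>..\<beta>} \<times> {0..T}) (\<lambda>(x, t). k x t) \<Longrightarrow>
   (LBINT t:{0..T}. LBINT x. w x t * k x t) = (LBINT p. V p * k (fst p) (snd p))"
proof -
 have "continuous_on ({\<alpha>..\<beta>} \<times> {0..T}) (\<lambda>(x, t). 1 :: real)" by (simp add: case_prod_unfold)
 note di = double_integral(1)[OF w ab' this]
 have "(\<lambda>(x, t). indicator {0..T} t * (w x t * 1)) = V" by (auto simp: V_def fun_eq_iff)
 with di show "integrable lborel V" by (simp only: lborel_prod)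
 show "V p = 0" if "p \<notin> {\<alpha>..\<beta>} \<times> {0..T}" for p
 proof (cases "fst p \<in> {\<alpha>..\<beta>}")
  case True
  then have "snd p \<notin> {0..T}" using that by (cases p) auto
  then show ?thesis by (simp add: V_def)
 next
  case False
  then show ?thesis unfolding V_def using QcD(2)[OF w False] by simp
 qed
 show "(LBINT t:{0..T}. LBINT x. w x t * k x t) = (LBINT p. V p * k (fst p) (snd p))"
  if "continuous_on ({\<alpha>..\<beta>} \<times> {0..T}) (\<lambda>(x, t). k x t)" for k
 proof -
  have "(\<lambda>z. case z of (x, t) \<Rightarrow> indicator {0..T} t * (w x t * k x t)) = (\<lambda>p. V p * k (fst p) (snd p))"
   by (auto simp: V_def fun_eq_iff mult.assoc)
  then show ?thesis using double_integral(2)[OF w ab' that] by (simp only: lborel_prod)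
 qed
qed

text \<open>Integrated twice, the defect is orthogonal to all test functions: this is
  \<open>WF\<close> for the kernel field, after the integrals over z and over (x, t) have been
  exchanged in every term. The boundary terms combine to \<open>AA\<close> and
  \<open>BB\<close>.\<close>

lemma kernel_identity:
 assumes \<eta>: "\<eta> \<in> test_functions \<alpha> \<beta>" and s: "\<sigma> \<le> T"
 shows "(LBINT z. (Jt ^^ 2) (Yrep z) \<sigma> * \<eta> z) = 0"
proof -
 interpret k: kernel \<alpha> \<beta> \<sigma> "max \<sigma> 0" \<eta> by unfold_locales (use ab \<eta> in auto)
 note \<eta>c = k.\<eta>c and \<eta>0 = k.\<eta>0
 have [measurable]: "\<eta> \<in> borel_measurable borel" using \<eta>c[of UNIV] by (rule borel_measurable_continuous_onI)
 have K0: "k.Kn n x T = 0" if "n > 0" for n x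
  using pp_nonpos[OF that, of "\<sigma> - T - \<bar>x - z\<bar>" for z] s by (simp add: k.Kn_def)
 \<comment> \<open>Boundary terms: exchanging the integrals over t and z leaves delayed integrals of
   \<open>g\<close> under the weight.\<close>
 have bd: "(LBINT t:{0..T}. g t * k.Is 1 \<eta> n y t) = (LBINT z:{\<alpha>..\<beta>}. \<eta> z * (Jt ^^ Suc n) g (\<sigma> - \<bar>y - z\<bar>))"
  if g: "g \<in> L2c" and n: "n > 0" for g n y
 proof -
  have "set_integrable lborel {0..T} g" by (rule L2c_set_integrable'[OF g, where t=T]) auto
  then have i: "integrable lborel (\<lambda>t. indicator {0..T} t * g t)" by (simp add: set_integrable_def)
  have "(LBINT t:{0..T}. g t * k.Is 1 \<eta> n y t) = (LBINT t. (indicator {0..T} t * g t) * (LBINT z:{\<alpha>..\<beta>}. \<eta> z * pp n (\<sigma> - t - \<bar>y - z\<bar>)))"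
   unfolding set_lebesgue_integral_def[of lborel "{0..T}"]
  proof (intro LBINT_cong)
   fix t show "indicator {0..T} t *\<^sub>R (g t * k.Is 1 \<eta> n y t) = (indicator {0..T} t * g t) * (LBINT z:{\<alpha>..\<beta>}. \<eta> z * pp n (\<sigma> - t - \<bar>y - z\<bar>))"
    using k.Is_eq_Kn[OF n, of t y] by (cases "t \<in> {0..T}") (auto simp: k.Kn_def)
  qed
  also have "\<dots> = (LBINT z:{\<alpha>..\<beta>}. LBINT t. (indicator {0..T} t * g t) * (\<eta> z * pp n (\<sigma> - t - \<bar>y - z\<bar>)))"
  proof (rule fubini_param[OF i compact_Icc[of 0 T]])
   show "continuous_on ({\<alpha>..\<beta>} \<times> {0..T}) (\<lambda>(z, t). \<eta> z * pp n (\<sigma> - t - \<bar>y - z\<bar>))"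
    unfolding case_prod_unfold by (intro continuous_intros continuous_on_compose2[OF \<eta>c[of UNIV]]) auto
  qed auto
  also have "\<dots> = (LBINT z:{\<alpha>..\<beta>}. \<eta> z * (Jt ^^ Suc n) g (\<sigma> - \<bar>y - z\<bar>))"
  proof -
   have "(LBINT t. (indicator {0..T} t * g t) * (\<eta> z * pp n (\<sigma> - t - \<bar>y - z\<bar>))) = \<eta> z * (Jt ^^ Suc n) g (\<sigma> - \<bar>y - z\<bar>)" for z
   proof -
    have "(indicator {0..T} t * g t) * (\<eta> z * pp n (\<sigma> - t - \<bar>y - z\<bar>)) = \<eta> z * (indicator {0..T} t *\<^sub>R (g t * pp n ((\<sigma> - \<bar>y - z\<bar>) - t)))" for t
     by (simp add: algebra_simps)
    then have "(LBINT t. (indicator {0..T} t * g t) * (\<eta> z * pp n (\<sigma> - t - \<bar>y - z\<bar>))) = \<eta> z * (LBINT t:{0..T}. g t * pp n ((\<sigma> - \<bar>y - z\<bar>) - t))"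
     unfolding set_lebesgue_integral_def by (simp only: integral_mult_right_zero)
    then show ?thesis using Jt_pp[OF g _ n, of "\<sigma> - \<bar>y - z\<bar>" T] s by simp
   qed
   then show ?thesis by simp
  qed
  finally show ?thesis .
 qed
 have mid: "(LBINT t:{0..T}. LBINT x. Qv x t * k.Is 1 \<eta> 3 x t) = (LBINT z:{\<alpha>..\<beta>}. \<eta> z * (Jt ^^ 4) (Sop z Qv) \<sigma>)"
 proof -
  note V = V_lborel[OF Qv]
  let ?V = "\<lambda>p. indicator {0..T} (snd p) * Qv (fst p) (snd p)"
  have "(LBINT t:{0..T}. LBINT x. Qv x t * k.Is 1 \<eta> 3 x t) = (LBINT p. ?V p * k.Is 1 \<eta> 3 (fst p) (snd p))"
   by (rule V(3)) (rule k.Is_continuous[OF \<eta>c])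
  also have "\<dots> = (LBINT p. ?V p * (LBINT z:{\<alpha>..\<beta>}. \<eta> z * pp 3 (\<sigma> - snd p - \<bar>fst p - z\<bar>)))"
  proof (intro LBINT_cong)
   fix p :: "real \<times> real"
   show "?V p * k.Is 1 \<eta> 3 (fst p) (snd p) = ?V p * (LBINT z:{\<alpha>..\<beta>}. \<eta> z * pp 3 (\<sigma> - snd p - \<bar>fst p - z\<bar>))"
    using k.Is_eq_Kn[of 3 "snd p" "fst p"] by (cases "snd p \<in> {0..T}") (auto simp: k.Kn_def)
  qed
  also have "\<dots> = (LBINT z:{\<alpha>..\<beta>}. LBINT p. ?V p * (\<eta> z * pp 3 (\<sigma> - snd p - \<bar>fst p - z\<bar>)))"
  proof (rule fubini_param[OF V(1) compact_Times[OF compact_Icc compact_Icc] V(2)])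
   show "continuous_on ({\<alpha>..\<beta>} \<times> {\<alpha>..\<beta>} \<times> {0..T}) (\<lambda>(z, p). \<eta> z * pp 3 (\<sigma> - snd p - \<bar>fst p - z\<bar>))"
    unfolding case_prod_unfold by (intro continuous_intros continuous_on_compose2[OF \<eta>c[of UNIV]]) auto
  qed
  also have "\<dots> = (LBINT z:{\<alpha>..\<beta>}. \<eta> z * (Jt ^^ 4) (Sop z Qv) \<sigma>)"
  proof -
   have "(LBINT p. ?V p * (\<eta> z * pp 3 (\<sigma> - snd p - \<bar>fst p - z\<bar>))) = \<eta> z * (Jt ^^ 4) (Sop z Qv) \<sigma>" for z
   proof -
    have "(LBINT p. ?V p * (\<eta> z * pp 3 (\<sigma> - snd p - \<bar>fst p - z\<bar>))) = \<eta> z * (LBINT p. ?V p * pp 3 (\<sigma> - \<bar>fst p - z\<bar> - snd p))"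
     by (subst integral_mult_right_zero[symmetric]) (simp add: algebra_simps)
    also have "(LBINT p. ?V p * pp 3 (\<sigma> - \<bar>fst p - z\<bar> - snd p)) = (LBINT t:{0..T}. LBINT x. Qv x t * pp 3 (\<sigma> - \<bar>x - z\<bar> - t))"
     by (rule V(3)[symmetric]) (auto simp: case_prod_unfold intro!: continuous_intros)
    finally show ?thesis using pair_pp[OF s] by simp
   qed
   then show ?thesis by simp
  qed
  finally show ?thesis .
 qed
 \<comment> \<open>Of the wave operator only the source term is left, and its factor
   \<open>pp 2\<close> amounts to three integrations of \<open>v\<close>.\<close>
 have first: "(LBINT t:{0..T}. LBINT x. v x t * (k.Is 1 \<eta> 1 x t - (k.Is 1 \<eta> 1 x t - 2 * \<eta> x * pp 2 (\<sigma> - t)))) = 2 * (LBINT z. \<eta> z * (Jt ^^ 3) (v z) \<sigma>)"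
 proof -
  obtain C where "\<And>x. \<bar>\<eta> x\<bar> \<le> C"
  proof -
   have "bounded (\<eta> ` {\<alpha>..\<beta>})" by (intro compact_imp_bounded compact_continuous_image \<eta>c) simp
   then obtain C where C: "\<forall>y\<in>\<eta> ` {\<alpha>..\<beta>}. norm y \<le> C" unfolding bounded_iff by blast
   have "\<bar>\<eta> x\<bar> \<le> \<bar>C\<bar>" for x
   proof (cases "x \<in> {\<alpha>..\<beta>}")
    case True
    then have "norm (\<eta> x) \<le> C" using C by blast
    then show ?thesis by simp
   next
    case False
    then have "x \<notin> {\<alpha><..<\<beta>}" by auto
    then show ?thesis using \<eta>0[of x] by simp
   qed
   then show ?thesis by (rule that)
  qed
  then interpret P: Pop_data \<eta> "\<lambda>x. 0" C by unfold_locales auto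
  have "(LBINT t:{0..T}. LBINT x. v x t * (k.Is 1 \<eta> 1 x t - (k.Is 1 \<eta> 1 x t - 2 * \<eta> x * pp 2 (\<sigma> - t)))) = (LBINT t:{0..T}. LBINT x. 2 * (\<eta> x * v x t * pp 2 (\<sigma> - 0 - t)))"
   by (simp add: algebra_simps)
  also have "\<dots> = 2 * (LBINT t:{0..T}. LBINT x. \<eta> x * v x t * pp 2 (\<sigma> - 0 - t))" by simp
  also have "\<dots> = 2 * (Jt ^^ 3) (Pop \<eta> (\<lambda>x. 0) v) \<sigma>"
   using P.Pop_pp[OF v ab' s, of 2] by (simp add: numeral_eq_Suc)
  also have "(Jt ^^ 3) (Pop \<eta> (\<lambda>x. 0) v) \<sigma> = (LBINT z. \<eta> z * (Jt ^^ 3) (v z) \<sigma>)"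
   by (subst P.Jt_pow_Pop[OF v ab']) (simp add: Pop_def)
  finally show ?thesis .
 qed
 have W: "(LBINT t:{0..T}. LBINT x. v x t * (k.Is 1 \<eta> 1 x t - (k.Is 1 \<eta> 1 x t - 2 * \<eta> x * pp 2 (\<sigma> - t)))) + (LBINT t:{0..T}. LBINT x. Qv x t * k.Is 1 \<eta> 3 x t)
   = (LBINT t:{0..T}. g0 t * k.Is 1 \<eta> 2 \<alpha> t) + (LBINT t:{0..T}. gb t * k.Is 1 \<eta> 2 \<beta> t)
    - (LBINT t:{0..T}. N0 t * k.Is 1 \<eta> 1 \<alpha> t) + (LBINT t:{0..T}. Nb t * k.Is 1 \<eta> 1 \<beta> t)"
 proof -
  have pre: "k.Is 1 \<eta> 3 x T = 0 \<and> - k.Is 1 \<eta> 2 x T = 0" for x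
   using k.Is_eq_Kn[of 3 T x] k.Is_eq_Kn[of 2 T x] K0[of 3 x] K0[of 2 x] T by simp
  have "(LBINT t:{0..T}. gb t * k.Is (-1) \<eta> 2 \<beta> t) = - (LBINT t:{0..T}. gb t * k.Is 1 \<eta> 2 \<beta> t)"
   by (simp only: k.Is_end(2)[of "-1"]) (simp add: Lint_minus)
  with WF[OF k.C2_rect_kernel pre] show ?thesis
   by (simp only: k.Is_end(1)[of "-1"])
 qed
 have L2: "(Jt ^^ 2) AA s = (Jt ^^ 3) g0 s - (Jt ^^ 2) N0 s" "(Jt ^^ 2) BB s = (Jt ^^ 3) gb s + (Jt ^^ 2) Nb s" for s
  unfolding AA_def[abs_def] BB_def[abs_def]
  using Jt_pow_diff[OF Jt_L2c[OF g0] N0_L2c, of 2] Jt_pow_add[OF Jt_L2c[OF gb] Nb_L2c, of 2] by (simp_all add: numeral_eq_Suc)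
 have ci: "set_integrable lborel {\<alpha>..\<beta>} (\<lambda>z. \<eta> z * (Jt ^^ Suc n) g (\<sigma> - \<bar>y - z\<bar>))" if "g \<in> L2c" for g n y
  using Jt_continuous[OF Jt_pow_L2c[OF that, of n]]
  by (intro borel_integrable_atLeastAtMost' continuous_intros \<eta>c) (auto intro!: continuous_on_compose2[of UNIV "Jt ((Jt ^^ n) g)"] continuous_intros)
 have R: "2 * (LBINT z. \<eta> z * (Jt ^^ 3) (v z) \<sigma>) + (LBINT z:{\<alpha>..\<beta>}. \<eta> z * (Jt ^^ 4) (Sop z Qv) \<sigma>)
   = (LBINT z:{\<alpha>..\<beta>}. \<eta> z * (Jt ^^ 2) AA (\<sigma> - \<bar>\<alpha> - z\<bar>)) + (LBINT z:{\<alpha>..\<beta>}. \<eta> z * (Jt ^^ 2) BB (\<sigma> - \<bar>\<beta> - z\<bar>))"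
 proof -
  have "(LBINT z:{\<alpha>..\<beta>}. \<eta> z * (Jt ^^ 2) AA (\<sigma> - \<bar>\<alpha> - z\<bar>)) = (LBINT z:{\<alpha>..\<beta>}. \<eta> z * (Jt ^^ 3) g0 (\<sigma> - \<bar>\<alpha> - z\<bar>)) - (LBINT z:{\<alpha>..\<beta>}. \<eta> z * (Jt ^^ 2) N0 (\<sigma> - \<bar>\<alpha> - z\<bar>))"
   unfolding L2 using ci[OF g0, of 2 \<alpha>] ci[OF N0_L2c, of 1 \<alpha>] by (simp add: right_diff_distrib set_integral_diff numeral_eq_Suc)
  moreover have "(LBINT z:{\<alpha>..\<beta>}. \<eta> z * (Jt ^^ 2) BB (\<sigma> - \<bar>\<beta> - z\<bar>)) = (LBINT z:{\<alpha>..\<beta>}. \<eta> z * (Jt ^^ 3) gb (\<sigma> - \<bar>\<beta> - z\<bar>)) + (LBINT z:{\<alpha>..\<beta>}. \<eta> z * (Jt ^^ 2) Nb (\<sigma> - \<bar>\<beta> - z\<bar>))"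
   unfolding L2 using ci[OF gb, of 2 \<beta>] ci[OF Nb_L2c, of 1 \<beta>] by (simp add: distrib_left set_integral_add numeral_eq_Suc)
  moreover have s23: "Suc 2 = 3" "Suc 1 = 2" by simp_all
  moreover have "(LBINT t:{0..T}. g0 t * k.Is 1 \<eta> 2 \<alpha> t) = (LBINT z:{\<alpha>..\<beta>}. \<eta> z * (Jt ^^ 3) g0 (\<sigma> - \<bar>\<alpha> - z\<bar>))"
   "(LBINT t:{0..T}. gb t * k.Is 1 \<eta> 2 \<beta> t) = (LBINT z:{\<alpha>..\<beta>}. \<eta> z * (Jt ^^ 3) gb (\<sigma> - \<bar>\<beta> - z\<bar>))"
   "(LBINT t:{0..T}. N0 t * k.Is 1 \<eta> 1 \<alpha> t) = (LBINT z:{\<alpha>..\<beta>}. \<eta> z * (Jt ^^ 2) N0 (\<sigma> - \<bar>\<alpha> - z\<bar>))"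
   "(LBINT t:{0..T}. Nb t * k.Is 1 \<eta> 1 \<beta> t) = (LBINT z:{\<alpha>..\<beta>}. \<eta> z * (Jt ^^ 2) Nb (\<sigma> - \<bar>\<beta> - z\<bar>))"
   using bd[OF g0, of 2 \<alpha>] bd[OF gb, of 2 \<beta>] bd[OF N0_L2c, of 1 \<alpha>] bd[OF Nb_L2c, of 1 \<beta>]
   by (simp_all only: s23 zero_less_numeral zero_less_one simp_thms)
  ultimately show ?thesis using W first mid by linarith
 qed
 have i1: "integrable lborel (\<lambda>z. \<eta> z * (Jt ^^ 3) (v z) \<sigma>)"
  using integrable_test_mult[OF \<eta> Qc_Jt_integrable[OF Jt_pow_Qc[OF v, of 2] ab', of \<sigma>]] by (simp add: numeral_eq_Suc)
 have c4: "(Jt ^^ 4) (\<lambda>t. indicator {\<alpha>..\<beta>} z * Sop z Qv t) \<sigma> = indicator {\<alpha>..\<beta>} z * (Jt ^^ 4) (Sop z Qv) \<sigma>" for z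
  by (subst Jt_pow_cmult) simp
 have "integrable lborel (\<lambda>z. \<eta> z * (Jt ^^ 4) (\<lambda>t. indicator {\<alpha>..\<beta>} z * Sop z Qv t) \<sigma>)"
  using integrable_test_mult[OF \<eta> Qc_Jt_integrable[OF Jt_pow_Qc[OF Sop_Qc[OF Qv ab'], of 3] ab', of \<sigma>]] by (simp add: numeral_eq_Suc)
 then have i2: "integrable lborel (\<lambda>z. indicator {\<alpha>..\<beta>} z *\<^sub>R (\<eta> z * (Jt ^^ 4) (Sop z Qv) \<sigma>))"
  unfolding c4 by (simp add: mult.left_commute)
 have i3: "integrable lborel (\<lambda>z. indicator {\<alpha>..\<beta>} z *\<^sub>R (\<eta> z * (Jt ^^ 2) AA (\<sigma> - \<bar>\<alpha> - z\<bar>)))"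
  "integrable lborel (\<lambda>z. indicator {\<alpha>..\<beta>} z *\<^sub>R (\<eta> z * (Jt ^^ 2) BB (\<sigma> - \<bar>\<beta> - z\<bar>)))"
  using ci[OF AA_L2c, of 1 \<alpha>] ci[OF BB_L2c, of 1 \<beta>] by (simp_all add: set_integrable_def numeral_eq_Suc)
 have "(LBINT z. (Jt ^^ 2) (Yrep z) \<sigma> * \<eta> z) = (LBINT z. 2 * (\<eta> z * (Jt ^^ 3) (v z) \<sigma>) + indicator {\<alpha>..\<beta>} z *\<^sub>R (\<eta> z * (Jt ^^ 4) (Sop z Qv) \<sigma>)
   - indicator {\<alpha>..\<beta>} z *\<^sub>R (\<eta> z * (Jt ^^ 2) AA (\<sigma> - \<bar>\<alpha> - z\<bar>)) - indicator {\<alpha>..\<beta>} z *\<^sub>R (\<eta> z * (Jt ^^ 2) BB (\<sigma> - \<bar>\<beta> - z\<bar>)))"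
 proof (intro LBINT_cong)
  fix z
  show "(Jt ^^ 2) (Yrep z) \<sigma> * \<eta> z = 2 * (\<eta> z * (Jt ^^ 3) (v z) \<sigma>) + indicator {\<alpha>..\<beta>} z *\<^sub>R (\<eta> z * (Jt ^^ 4) (Sop z Qv) \<sigma>)
   - indicator {\<alpha>..\<beta>} z *\<^sub>R (\<eta> z * (Jt ^^ 2) AA (\<sigma> - \<bar>\<alpha> - z\<bar>)) - indicator {\<alpha>..\<beta>} z *\<^sub>R (\<eta> z * (Jt ^^ 2) BB (\<sigma> - \<bar>\<beta> - z\<bar>))"
  proof (cases "z \<in> {\<alpha><..<\<beta>}")
   case True
   then have "\<bar>\<alpha> - z\<bar> = z - \<alpha>" "\<bar>\<beta> - z\<bar> = \<beta> - z" "indicator {\<alpha>..\<beta>} z = (1::real)" "indicator {\<alpha><..<\<beta>} z = (1::real)" by auto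
   then show ?thesis by (simp only: Jt2_Yrep) (simp add: algebra_simps)
  next
   case False
   have "\<eta> z = 0" by (rule \<eta>0[OF False])
   then show ?thesis by simp
  qed
 qed
 also have "\<dots> = 2 * (LBINT z. \<eta> z * (Jt ^^ 3) (v z) \<sigma>) + (LBINT z:{\<alpha>..\<beta>}. \<eta> z * (Jt ^^ 4) (Sop z Qv) \<sigma>)
   - (LBINT z:{\<alpha>..\<beta>}. \<eta> z * (Jt ^^ 2) AA (\<sigma> - \<bar>\<alpha> - z\<bar>)) - (LBINT z:{\<alpha>..\<beta>}. \<eta> z * (Jt ^^ 2) BB (\<sigma> - \<bar>\<beta> - z\<bar>))"
 proof -
  have i1': "integrable lborel (\<lambda>z. 2 * (\<eta> z * (Jt ^^ 3) (v z) \<sigma>))" by (rule integrable_mult_right) (rule i1)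
  note A = Bochner_Integration.integrable_add[OF i1' i2]
  note B = Bochner_Integration.integrable_diff[OF A i3(1)]
  show ?thesis
   unfolding set_lebesgue_integral_def
   by (simp only: Bochner_Integration.integral_diff[OF B i3(2)] Bochner_Integration.integral_diff[OF A i3(1)]
     Bochner_Integration.integral_add[OF i1' i2] integral_mult_right_zero)
 qed
 finally show ?thesis using R by linarith
qed

text \<open>At each fixed time the fundamental lemma yields a null set of points z. Exchanging the
  quantifiers yields, for almost every z, a null set of times, and then the two integrations can be
  cancelled.\<close>

lemma Yrep_zero: "AE z in lborel. AE t in lborel. t < T \<longrightarrow> Yrep z t = 0"
proof -
 have Q2: "(\<lambda>z. (Jt ^^ 2) (Yrep z)) \<in> Qc \<alpha> \<beta>" by (rule Jt_pow_Qc[OF Yrep_Qc])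
 note Qc_measurable[OF Q2, measurable (raw)]
 have 1: "AE z in lborel. (Jt ^^ 2) (Yrep z) \<sigma> = 0" if "\<sigma> < T" for \<sigma>
 proof (rule AE_zero_of_test_functions[of _ \<alpha> \<beta>])
  show "integrable lborel (\<lambda>z. (Jt ^^ 2) (Yrep z) \<sigma>)"
   using Qc_Jt_integrable[OF Jt_Qc[OF Yrep_Qc] ab', of \<sigma>] by (simp add: numeral_eq_Suc)
  show "(Jt ^^ 2) (Yrep z) \<sigma> = 0" if "z \<notin> {\<alpha><..<\<beta>}" for z
   using that by (simp only: Jt2_Yrep) simp
  show "(LBINT z. (Jt ^^ 2) (Yrep z) \<sigma> * \<eta> z) = 0" if "\<eta> \<in> test_functions \<alpha> \<beta>" for \<eta>
   by (rule kernel_identity[OF that]) (use \<open>\<sigma> < T\<close> in simp)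
 qed
 have "AE \<sigma> in lborel. AE z in lborel. \<sigma> < T \<longrightarrow> (Jt ^^ 2) (Yrep z) \<sigma> = 0"
 proof (rule AE_I2)
  fix \<sigma> show "AE z in lborel. \<sigma> < T \<longrightarrow> (Jt ^^ 2) (Yrep z) \<sigma> = 0"
   using 1[of \<sigma>] by (cases "\<sigma> < T") auto
 qed
 then have "AE z in lborel. AE \<sigma> in lborel. \<sigma> < T \<longrightarrow> (Jt ^^ 2) (Yrep z) \<sigma> = 0"
  by (subst (asm) lborel_pair.AE_commute) measurable
 then show ?thesis
 proof eventually_elim
  case (elim z)
  have "AE t in lborel. t < T \<longrightarrow> (Jt ^^ 2) (Yrep z) t = (Jt ^^ 2) (\<lambda>t. 0) t"
   using elim by (simp add: numeral_eq_Suc)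
  then show ?case by (rule Jt_pow_strip[OF QcD(1)[OF Yrep_Qc] L2c_zero])
 qed
qed

end

section \<open>Characteristic form of the wave equation\<close>

text \<open>If both waves are k-fold integrals up to some time, the two relations extend this by b,
  since a wave delayed by b only uses the times already treated. The steps start at time 0, before
  which causal functions vanish.\<close>

lemma delay_recursion:
 assumes A: "\<A> \<in> L2c" and B: "\<B> \<in> L2c" and Y: "Y0 \<in> L2c" "Y1 \<in> L2c" and b: "b > 0"
  and eA: "AE t in lborel. t < T \<longrightarrow> \<A> t = (Jt ^^ k) Y0 t - \<B> (t - b)"
  and eB: "AE t in lborel. t < T \<longrightarrow> \<B> t = (Jt ^^ k) Y1 t - \<A> (t - b)"
 obtains A B where "A \<in> L2c" "B \<in> L2c" "AE t in lborel. t < T \<longrightarrow> \<A> t = (Jt ^^ k) A t"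
  "AE t in lborel. t < T \<longrightarrow> \<B> t = (Jt ^^ k) B t"
proof -
 have "\<exists>A\<in>L2c. \<exists>B\<in>L2c. (AE t in lborel. t < T \<longrightarrow> t < real n * b \<longrightarrow> \<A> t = (Jt ^^ k) A t) \<and>
   (AE t in lborel. t < T \<longrightarrow> t < real n * b \<longrightarrow> \<B> t = (Jt ^^ k) B t)" for n :: nat
 proof (induction n)
  case 0
  show ?case
  proof (intro bexI[of _ "\<lambda>t. 0"] conjI)
   show "AE t in lborel. t < T \<longrightarrow> t < real 0 * b \<longrightarrow> \<A> t = (Jt ^^ k) (\<lambda>t. 0) t"
    using L2cD(2)[OF assms(1)] Jt_pow_nonpos[OF L2c_zero, of _ k] by (intro AE_I2) simp
   show "AE t in lborel. t < T \<longrightarrow> t < real 0 * b \<longrightarrow> \<B> t = (Jt ^^ k) (\<lambda>t. 0) t"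
    using L2cD(2)[OF assms(2)] Jt_pow_nonpos[OF L2c_zero, of _ k] by (intro AE_I2) simp
  qed simp_all
 next
  case (Suc n)
  then obtain A B where AB: "A \<in> L2c" "B \<in> L2c"
   "AE t in lborel. t < T \<longrightarrow> t < real n * b \<longrightarrow> \<A> t = (Jt ^^ k) A t"
   "AE t in lborel. t < T \<longrightarrow> t < real n * b \<longrightarrow> \<B> t = (Jt ^^ k) B t" by blast
  have sh: "(\<lambda>t. A (t - b)) \<in> L2c" "(\<lambda>t. B (t - b)) \<in> L2c" using AB b by (auto intro: L2c_shift)
  have J: "(Jt ^^ k) (\<lambda>t. Y0 t - B (t - b)) t = (Jt ^^ k) Y0 t - (Jt ^^ k) B (t - b)"
   "(Jt ^^ k) (\<lambda>t. Y1 t - A (t - b)) t = (Jt ^^ k) Y1 t - (Jt ^^ k) A (t - b)" for t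
   by (simp_all only: Jt_pow_diff[OF Y(1) sh(2)] Jt_pow_diff[OF Y(2) sh(1)] Jt_pow_shift)
  have bT: "t - b < T \<and> t - b < real n * b" if "t < T" "t < real (Suc n) * b" for t
   using that b by (simp add: algebra_simps)
  have "AE t in lborel. t < T \<longrightarrow> t < real (Suc n) * b \<longrightarrow> \<A> t = (Jt ^^ k) (\<lambda>t. Y0 t - B (t - b)) t"
   using eA AE_shift[OF AB(4), of b]
  proof eventually_elim
   case (elim t)
   show ?case using elim bT[of t] by (simp only: J) auto
  qed
  moreover have "AE t in lborel. t < T \<longrightarrow> t < real (Suc n) * b \<longrightarrow> \<B> t = (Jt ^^ k) (\<lambda>t. Y1 t - A (t - b)) t"
   using eB AE_shift[OF AB(3), of b]
  proof eventually_elim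
   case (elim t)
   show ?case using elim bT[of t] by (simp only: J) auto
  qed
  ultimately show ?case using L2c_diff[OF Y(1) sh(2)] L2c_diff[OF Y(2) sh(1)] by blast
 qed
 note ex = this
 \<comment> \<open>Finitely many steps of length b cover all times below T.\<close>
 obtain n :: nat where "T / b < real n" using reals_Archimedean2 by blast
 then have n: "t < real n * b" if "t < T" for t using b that by (simp add: divide_less_eq)
 obtain A B where AB: "A \<in> L2c" "B \<in> L2c"
   "AE t in lborel. t < T \<longrightarrow> t < real n * b \<longrightarrow> \<A> t = (Jt ^^ k) A t"
   "AE t in lborel. t < T \<longrightarrow> t < real n * b \<longrightarrow> \<B> t = (Jt ^^ k) B t" using ex[of n] by blast
 show ?thesis
 proof (rule that[OF AB(1,2)])
  show "AE t in lborel. t < T \<longrightarrow> \<A> t = (Jt ^^ k) A t" using AB(3) by eventually_elim (use n in auto)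
  show "AE t in lborel. t < T \<longrightarrow> \<B> t = (Jt ^^ k) B t" using AB(4) by eventually_elim (use n in auto)
 qed
qed

text \<open>D'Alembert's formula with causal waves \<open>A\<close>, \<open>B\<close> entering at \<open>\<alpha>\<close>, \<open>\<beta>\<close>, where \<open>\<eta>0\<close>, \<open>\<eta>b\<close> are the
 boundary values of \<open>v\<close>.\<close>

locale char_data =
 fixes \<alpha> \<beta> T K :: real and q :: "real \<Rightarrow> real" and v :: "real \<Rightarrow> real \<Rightarrow> real" and \<eta>0 \<eta>b A B :: "real \<Rightarrow> real"
 assumes ab: "\<alpha> < \<beta>" and T: "T > 0" and qm: "q \<in> borel_measurable borel" and qK: "\<And>x. \<bar>q x\<bar> \<le> K"
  and v: "v \<in> Qc \<alpha> \<beta>" and L: "\<eta>0 \<in> L2c" "\<eta>b \<in> L2c" "A \<in> L2c" "B \<in> L2c"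
  and FA: "AE t in lborel. t < T \<longrightarrow> A t = 2 * \<eta>0 t - B (t - (\<beta> - \<alpha>)) + Jt (Sop \<alpha> (\<lambda>x t. q x * v x t)) t"
  and FB: "AE t in lborel. t < T \<longrightarrow> B t = 2 * \<eta>b t - A (t - (\<beta> - \<alpha>)) + Jt (Sop \<beta> (\<lambda>x t. q x * v x t)) t"
  and Fv: "AE z in lborel. AE t in lborel. t < T \<longrightarrow> z \<in> {\<alpha><..<\<beta>} \<longrightarrow>
    2 * v z t = A (t - (z - \<alpha>)) + B (t - (\<beta> - z)) - Jt (Sop z (\<lambda>x t. q x * v x t)) t"

context interval_sys
begin

text \<open>The traces couple \<open>AA\<close> and \<open>BB\<close> with a delay and their
  inhomogeneities are integrals, so \<open>delay_recursion\<close> with k = 1 writes both as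
  integrals of waves. One \<open>Jt\<close> is then cancelled in the two traces and in
  \<open>Yrep_zero\<close>.\<close>

lemma AB_exist:
 obtains A B where "char_data \<alpha> \<beta> T K Q v g0 gb A B"
  "AE t in lborel. t < T \<longrightarrow> N0 t = Jt (\<lambda>t. g0 t - A t) t" "AE t in lborel. t < T \<longrightarrow> Nb t = Jt (\<lambda>t. B t - gb t) t"
proof -
 have SL: "Sop z Qv \<in> L2c" for z by (rule Sop_L2c[OF Qv ab'])
 have Y: "(\<lambda>t. 2 * g t + Jt (Sop z Qv) t) \<in> L2c" if "g \<in> L2c" for g z
  by (intro L2c_add L2c_cmult Jt_L2c SL that)
 have YJ: "Jt (\<lambda>t. 2 * g t + Jt (Sop z Qv) t) t = 2 * Jt g t + Jt (Jt (Sop z Qv)) t" if "g \<in> L2c" for g z t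
  by (subst Jt_add) (auto intro!: L2c_cmult Jt_L2c SL that simp: Jt_cmult)
 have eA: "AE t in lborel. t < T \<longrightarrow> AA t = (Jt ^^ 1) (\<lambda>t. 2 * g0 t + Jt (Sop \<alpha> Qv) t) t - BB (t - b)"
  using trace_alpha by eventually_elim (simp add: YJ[OF g0])
 have eB: "AE t in lborel. t < T \<longrightarrow> BB t = (Jt ^^ 1) (\<lambda>t. 2 * gb t + Jt (Sop \<beta> Qv) t) t - AA (t - b)"
  using trace_beta by eventually_elim (simp add: YJ[OF gb])
 obtain A B where AB: "A \<in> L2c" "B \<in> L2c" and JA: "AE t in lborel. t < T \<longrightarrow> AA t = (Jt ^^ 1) A t"
  and JB: "AE t in lborel. t < T \<longrightarrow> BB t = (Jt ^^ 1) B t"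
  by (rule delay_recursion[OF AA_L2c BB_L2c Y[OF g0] Y[OF gb] b0 eA eB])
 have FA: "AE t in lborel. t < T \<longrightarrow> A t = 2 * g0 t - B (t - b) + Jt (Sop \<alpha> Qv) t"
 proof (rule Jt_strip[OF AB(1)])
  show "(\<lambda>t. 2 * g0 t - B (t - b) + Jt (Sop \<alpha> Qv) t) \<in> L2c"
   using b0 by (intro L2c_add L2c_diff L2c_cmult L2c_shift Jt_L2c SL AB g0) auto
  have e: "Jt (\<lambda>t. 2 * g0 t - B (t - b) + Jt (Sop \<alpha> Qv) t) t = 2 * Jt g0 t - Jt B (t - b) + Jt (Jt (Sop \<alpha> Qv)) t" for t
   using b0 by (subst Jt_add Jt_diff, (intro L2c_add L2c_diff L2c_cmult L2c_shift Jt_L2c SL AB g0; simp)+)+ (simp only: Jt_cmult Jt_shift)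
  show "AE t in lborel. t < T \<longrightarrow> Jt A t = Jt (\<lambda>t. 2 * g0 t - B (t - b) + Jt (Sop \<alpha> Qv) t) t"
   using trace_alpha JA AE_shift[OF JB, of b] by eventually_elim (use b0 in \<open>auto simp: e\<close>)
 qed
 have FB: "AE t in lborel. t < T \<longrightarrow> B t = 2 * gb t - A (t - b) + Jt (Sop \<beta> Qv) t"
 proof (rule Jt_strip[OF AB(2)])
  show "(\<lambda>t. 2 * gb t - A (t - b) + Jt (Sop \<beta> Qv) t) \<in> L2c"
   using b0 by (intro L2c_add L2c_diff L2c_cmult L2c_shift Jt_L2c SL AB gb) auto
  have e: "Jt (\<lambda>t. 2 * gb t - A (t - b) + Jt (Sop \<beta> Qv) t) t = 2 * Jt gb t - Jt A (t - b) + Jt (Jt (Sop \<beta> Qv)) t" for t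
   using b0 by (subst Jt_add Jt_diff, (intro L2c_add L2c_diff L2c_cmult L2c_shift Jt_L2c SL AB gb; simp)+)+ (simp only: Jt_cmult Jt_shift)
  show "AE t in lborel. t < T \<longrightarrow> Jt B t = Jt (\<lambda>t. 2 * gb t - A (t - b) + Jt (Sop \<beta> Qv) t) t"
   using trace_beta JB AE_shift[OF JA, of b] by eventually_elim (use b0 in \<open>auto simp: e\<close>)
 qed
 have Fv: "AE z in lborel. AE t in lborel. t < T \<longrightarrow> z \<in> {\<alpha><..<\<beta>} \<longrightarrow>
    2 * v z t = A (t - (z - \<alpha>)) + B (t - (\<beta> - z)) - Jt (Sop z Qv) t"
  using Yrep_zero
 proof eventually_elim
  case (elim z)
  show ?case
  proof (cases "z \<in> {\<alpha><..<\<beta>}")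
   case True
   have sh: "(\<lambda>t. A (t - (z - \<alpha>))) \<in> L2c" "(\<lambda>t. B (t - (\<beta> - z))) \<in> L2c"
    using True by (auto intro!: L2c_shift AB)
   have R: "(\<lambda>t. A (t - (z - \<alpha>)) + B (t - (\<beta> - z)) - Jt (Sop z Qv) t) \<in> L2c"
    by (intro L2c_add L2c_diff sh Jt_L2c SL)
   have e: "Jt (\<lambda>t. A (t - (z - \<alpha>)) + B (t - (\<beta> - z)) - Jt (Sop z Qv) t) t = Jt A (t - (z - \<alpha>)) + Jt B (t - (\<beta> - z)) - Jt (Jt (Sop z Qv)) t" for t
    by (simp only: Jt_diff[OF L2c_add[OF sh] Jt_L2c[OF SL]] Jt_add[OF sh] Jt_shift)
   have "AE t in lborel. t < T \<longrightarrow> 2 * v z t = A (t - (z - \<alpha>)) + B (t - (\<beta> - z)) - Jt (Sop z Qv) t"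
   proof (rule Jt_strip[OF L2c_cmult[OF QcD(1)[OF v]] R])
    show "AE t in lborel. t < T \<longrightarrow> Jt (\<lambda>t. 2 * v z t) t = Jt (\<lambda>t. A (t - (z - \<alpha>)) + B (t - (\<beta> - z)) - Jt (Sop z Qv) t) t"
     using elim AE_shift[OF JA, of "z - \<alpha>"] AE_shift[OF JB, of "\<beta> - z"]
     by eventually_elim (use True in \<open>auto simp: e Jt_cmult Yrep_def\<close>)
   qed
   then show ?thesis by eventually_elim simp
  qed (auto intro: AE_I2)
 qed
 have "char_data \<alpha> \<beta> T K Q v g0 gb A B"
 proof
  have e: "(\<lambda>x t. Q x * v x t) = Qv" by (simp add: fun_eq_iff Qv_def)
  show "AE t in lborel. t < T \<longrightarrow> A t = 2 * g0 t - B (t - (\<beta> - \<alpha>)) + Jt (Sop \<alpha> (\<lambda>x t. Q x * v x t)) t"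
   using FA unfolding e b_def .
  show "AE t in lborel. t < T \<longrightarrow> B t = 2 * gb t - A (t - (\<beta> - \<alpha>)) + Jt (Sop \<beta> (\<lambda>x t. Q x * v x t)) t"
   using FB unfolding e b_def .
  show "AE z in lborel. AE t in lborel. t < T \<longrightarrow> z \<in> {\<alpha><..<\<beta>} \<longrightarrow>
    2 * v z t = A (t - (z - \<alpha>)) + B (t - (\<beta> - z)) - Jt (Sop z (\<lambda>x t. Q x * v x t)) t"
   using Fv unfolding e .
 qed (fact ab T Qm QK v g0 gb AB)+
 moreover have "AE t in lborel. t < T \<longrightarrow> N0 t = Jt (\<lambda>t. g0 t - A t) t"
  using JA by eventually_elim (auto simp: AA_def Jt_diff[OF g0 AB(1)])
 moreover have "AE t in lborel. t < T \<longrightarrow> Nb t = Jt (\<lambda>t. B t - gb t) t"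
  using JB by eventually_elim (auto simp: BB_def Jt_diff[OF AB(2) gb])
 ultimately show ?thesis using that by blast
qed

end

context char_data
begin

definition qv :: "real \<Rightarrow> real \<Rightarrow> real" where "qv x t = q x * v x t"

lemma qv_eq: "(\<lambda>x t. q x * v x t) = qv" by (simp add: fun_eq_iff qv_def)

lemma qv: "qv \<in> Qc \<alpha> \<beta>" unfolding qv_eq[symmetric] by (rule Qc_mult[OF v qm qK])

lemma ab': "\<alpha> \<le> \<beta>" using ab by simp

text \<open>The potential term of each relation already contains a \<open>Jt\<close>. If the
  boundary values are integrals, then so are the waves by \<open>delay_recursion\<close>, hence also
  \<open>v\<close> by d'Alembert's formula; the new functions satisfy the same relations with one
  \<open>Jt\<close> cancelled.\<close>

lemma lift:
 assumes L': "\<eta>0' \<in> L2c" "\<eta>b' \<in> L2c"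
  and e0: "AE t in lborel. t < T \<longrightarrow> \<eta>0 t = Jt \<eta>0' t" and eb: "AE t in lborel. t < T \<longrightarrow> \<eta>b t = Jt \<eta>b' t"
 obtains v' A' B' where "char_data \<alpha> \<beta> T K q v' \<eta>0' \<eta>b' A' B'"
  "AE t in lborel. t < T \<longrightarrow> A t = Jt A' t" "AE t in lborel. t < T \<longrightarrow> B t = Jt B' t"
  "AE x in lborel. AE t in lborel. t < T \<longrightarrow> v x t = Jt (v' x) t"
proof -
 have b0: "\<beta> - \<alpha> > 0" using ab by simp
 have SL: "Sop z qv \<in> L2c" for z by (rule Sop_L2c[OF qv ab'])
 have Y: "(\<lambda>t. 2 * g t + Sop z qv t) \<in> L2c" if "g \<in> L2c" for g z
  by (intro L2c_add L2c_cmult SL that)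
 have YJ: "Jt (\<lambda>t. 2 * g t + Sop z qv t) t = 2 * Jt g t + Jt (Sop z qv) t" if "g \<in> L2c" for g z t
  by (subst Jt_add) (auto intro!: L2c_cmult SL that simp: Jt_cmult)
 have eA: "AE t in lborel. t < T \<longrightarrow> A t = (Jt ^^ 1) (\<lambda>t. 2 * \<eta>0' t + Sop \<alpha> qv t) t - B (t - (\<beta> - \<alpha>))"
  using FA e0 unfolding qv_eq by eventually_elim (simp add: YJ[OF L'(1)])
 have eB: "AE t in lborel. t < T \<longrightarrow> B t = (Jt ^^ 1) (\<lambda>t. 2 * \<eta>b' t + Sop \<beta> qv t) t - A (t - (\<beta> - \<alpha>))"
  using FB eb unfolding qv_eq by eventually_elim (simp add: YJ[OF L'(2)])
 obtain A' B' where AB: "A' \<in> L2c" "B' \<in> L2c" and JA0: "AE t in lborel. t < T \<longrightarrow> A t = (Jt ^^ 1) A' t"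
  and JB0: "AE t in lborel. t < T \<longrightarrow> B t = (Jt ^^ 1) B' t"
  by (rule delay_recursion[OF L(3,4) Y[OF L'(1)] Y[OF L'(2)] b0 eA eB])
 have JA: "AE t in lborel. t < T \<longrightarrow> A t = Jt A' t" and JB: "AE t in lborel. t < T \<longrightarrow> B t = Jt B' t" using JA0 JB0 by simp_all
 \<comment> \<open>D'Alembert's formula with one \<open>Jt\<close> removed. The potential term keeps
   the known \<open>qv\<close>, so this is an explicit definition and no fixed point is
   involved.\<close>
 define v' where "v' = (\<lambda>z t. indicator {\<alpha><..<\<beta>} z * (1 / 2 * (indicator {\<alpha>..\<beta>} z * A' (t - (z - \<alpha>)) + indicator {\<alpha>..\<beta>} z * B' (t - (\<beta> - z)) - indicator {\<alpha>..\<beta>} z * Sop z qv t)))"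
 have v'Q: "v' \<in> Qc \<alpha> \<beta>"
 proof -
  have 1: "(\<lambda>z t. indicator {\<alpha>..\<beta>} z * A' (t - (z - \<alpha>))) \<in> Qc \<alpha> \<beta>" by (rule shift_Qc[OF AB(1) ab']) auto
  have 2: "(\<lambda>z t. indicator {\<alpha>..\<beta>} z * B' (t - (\<beta> - z))) \<in> Qc \<alpha> \<beta>" by (rule shift_Qc[OF AB(2) ab']) auto
  show ?thesis unfolding v'_def by (rule Qc_indicator[OF Qc_cmult[OF Qc_diff[OF Qc_add[OF 1 2] Sop_Qc[OF qv ab']]]]) simp
 qed
 have v'z: "v' z = (\<lambda>t. 1 / 2 * (A' (t - (z - \<alpha>)) + B' (t - (\<beta> - z)) - Sop z qv t))" if "z \<in> {\<alpha><..<\<beta>}" for z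
 proof -
  have "indicator {\<alpha><..<\<beta>} z = (1::real)" "indicator {\<alpha>..\<beta>} z = (1::real)" using that by auto
  then show ?thesis unfolding v'_def by (simp only: mult_1)
 qed
 have vv': "AE x in lborel. AE t in lborel. t < T \<longrightarrow> v x t = Jt (v' x) t"
 proof -
  have "AE x in lborel. x \<noteq> \<alpha>" "AE x in lborel. x \<noteq> \<beta>" by (rule AE_lborel_singleton)+
  then show ?thesis using Fv
  proof eventually_elim
   case (elim z)
   show ?case
   proof (cases "z \<in> {\<alpha><..<\<beta>}")
    case True
    have sh: "(\<lambda>t. A' (t - (z - \<alpha>))) \<in> L2c" "(\<lambda>t. B' (t - (\<beta> - z))) \<in> L2c"
     using True by (auto intro!: L2c_shift AB)
    have e: "Jt (v' z) t = 1 / 2 * (Jt A' (t - (z - \<alpha>)) + Jt B' (t - (\<beta> - z)) - Jt (Sop z qv) t)" for t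
     unfolding v'z[OF True] by (simp only: Jt_cmult Jt_diff[OF L2c_add[OF sh] SL] Jt_add[OF sh] Jt_shift)
    show ?thesis
     using elim(3) AE_shift[OF JA, of "z - \<alpha>"] AE_shift[OF JB, of "\<beta> - z"] unfolding qv_eq
     by eventually_elim (use True in \<open>auto simp: e\<close>)
   next
    case False
    then have "z \<notin> {\<alpha>..\<beta>}" using elim(1,2) by auto
    then have "v z = (\<lambda>t. 0)" "v' z = (\<lambda>t. 0)" using QcD(2)[OF v] QcD(2)[OF v'Q] by auto
    then show ?thesis by simp
   qed
  qed
 qed
 define qv' where "qv' = (\<lambda>x t. q x * v' x t)"
 have qv'Q: "qv' \<in> Qc \<alpha> \<beta>" unfolding qv'_def by (rule Qc_mult[OF v'Q qm qK])
 have SLt: "Sop z qv' \<in> L2c" for z by (rule Sop_L2c[OF qv'Q ab'])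
 \<comment> \<open>Now \<open>qv\<close> is the integral of \<open>qv'\<close>, which brings the
   potential term into the form required for \<open>v'\<close>.\<close>
 have S: "AE t in lborel. t < T \<longrightarrow> Sop z qv t = Jt (Sop z qv') t" for z
 proof -
  have "AE x in lborel. AE t in lborel. t < T \<longrightarrow> qv x t = Jt (qv' x) t"
   using vv'
  proof eventually_elim
   case (elim x)
   then show ?case by eventually_elim (simp add: qv_def qv'_def Jt_cmult)
  qed
  from Sop_cong_AE[OF qv Jt_Qc[OF qv'Q] this, of z] show ?thesis
   by (simp add: Jt_Sop[OF qv'Q ab'])
 qed
 have JS: "AE t in lborel. t < T \<longrightarrow> Jt (Sop z qv) t = Jt (Jt (Sop z qv')) t" for z
  using Jt_cong_AE[OF SL Jt_L2c[OF SLt] S] by (intro AE_I2) simp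
 have "char_data \<alpha> \<beta> T K q v' \<eta>0' \<eta>b' A' B'"
 proof
  show "AE t in lborel. t < T \<longrightarrow> A' t = 2 * \<eta>0' t - B' (t - (\<beta> - \<alpha>)) + Jt (Sop \<alpha> (\<lambda>x t. q x * v' x t)) t"
   unfolding qv'_def[symmetric]
  proof (rule Jt_strip[OF AB(1)])
   show "(\<lambda>t. 2 * \<eta>0' t - B' (t - (\<beta> - \<alpha>)) + Jt (Sop \<alpha> qv') t) \<in> L2c"
    using b0 by (intro L2c_add L2c_diff L2c_cmult L2c_shift Jt_L2c SLt AB L') auto
   have e: "Jt (\<lambda>t. 2 * \<eta>0' t - B' (t - (\<beta> - \<alpha>)) + Jt (Sop \<alpha> qv') t) t = 2 * Jt \<eta>0' t - Jt B' (t - (\<beta> - \<alpha>)) + Jt (Jt (Sop \<alpha> qv')) t" for t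
    using b0 by (subst Jt_add Jt_diff, (intro L2c_add L2c_diff L2c_cmult L2c_shift Jt_L2c SLt AB L'; simp)+)+ (simp only: Jt_cmult Jt_shift)
   show "AE t in lborel. t < T \<longrightarrow> Jt A' t = Jt (\<lambda>t. 2 * \<eta>0' t - B' (t - (\<beta> - \<alpha>)) + Jt (Sop \<alpha> qv') t) t"
    using FA e0 JA AE_shift[OF JB, of "\<beta> - \<alpha>"] JS[of \<alpha>] unfolding qv_eq by eventually_elim (use b0 in \<open>auto simp: e\<close>)
  qed
  show "AE t in lborel. t < T \<longrightarrow> B' t = 2 * \<eta>b' t - A' (t - (\<beta> - \<alpha>)) + Jt (Sop \<beta> (\<lambda>x t. q x * v' x t)) t"
   unfolding qv'_def[symmetric]
  proof (rule Jt_strip[OF AB(2)])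
   show "(\<lambda>t. 2 * \<eta>b' t - A' (t - (\<beta> - \<alpha>)) + Jt (Sop \<beta> qv') t) \<in> L2c"
    using b0 by (intro L2c_add L2c_diff L2c_cmult L2c_shift Jt_L2c SLt AB L') auto
   have e: "Jt (\<lambda>t. 2 * \<eta>b' t - A' (t - (\<beta> - \<alpha>)) + Jt (Sop \<beta> qv') t) t = 2 * Jt \<eta>b' t - Jt A' (t - (\<beta> - \<alpha>)) + Jt (Jt (Sop \<beta> qv')) t" for t
    using b0 by (subst Jt_add Jt_diff, (intro L2c_add L2c_diff L2c_cmult L2c_shift Jt_L2c SLt AB L'; simp)+)+ (simp only: Jt_cmult Jt_shift)
   show "AE t in lborel. t < T \<longrightarrow> Jt B' t = Jt (\<lambda>t. 2 * \<eta>b' t - A' (t - (\<beta> - \<alpha>)) + Jt (Sop \<beta> qv') t) t"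
    using FB eb JB AE_shift[OF JA, of "\<beta> - \<alpha>"] JS[of \<beta>] unfolding qv_eq by eventually_elim (use b0 in \<open>auto simp: e\<close>)
  qed
  show "AE z in lborel. AE t in lborel. t < T \<longrightarrow> z \<in> {\<alpha><..<\<beta>} \<longrightarrow>
    2 * v' z t = A' (t - (z - \<alpha>)) + B' (t - (\<beta> - z)) - Jt (Sop z (\<lambda>x t. q x * v' x t)) t"
   unfolding qv'_def[symmetric]
  proof (rule AE_I2)
   fix z
   show "AE t in lborel. t < T \<longrightarrow> z \<in> {\<alpha><..<\<beta>} \<longrightarrow> 2 * v' z t = A' (t - (z - \<alpha>)) + B' (t - (\<beta> - z)) - Jt (Sop z qv') t"
    using S[of z] by eventually_elim (auto simp: v'z)
  qed
 qed (fact ab T qm qK v'Q L' AB)+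
 then show ?thesis using that JA JB vv' by blast
qed

end

section \<open>Derivatives of delay integrals at the final time\<close>

lemma Jt_diff_Icc:
 assumes "f \<in> L2c" "a \<le> b"
 shows "Jt f b - Jt f a = (LBINT s:{a..b}. f s)"
proof -
 note [measurable] = L2cD(1)[OF assms(1)]
 have "(LBINT s:{a<..b}. f s) = (LBINT s:{a..b}. f s)"
  unfolding set_lebesgue_integral_def
 proof (rule integral_cong_AE)
  have "AE x in lborel. x \<noteq> a" by (rule AE_lborel_singleton)
  then show "AE x in lborel. indicator {a<..b} x *\<^sub>R f x = indicator {a..b} x *\<^sub>R f x"
   by eventually_elim (auto simp: indicator_def)
 qed auto
 then show ?thesis using Jt_diff_Ioc[OF assms] by simp
qed

lemma Lint_Icc_reflect:
 fixes f :: "real \<Rightarrow> real"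
 shows "(LBINT z:{a..b}. f (c - z)) = (LBINT s:{c - b..c - a}. f s)"
proof -
 have "(LBINT s:{c - b..c - a}. f s) = (LBINT z. indicator {c - b..c - a} (c + (-1) * z) *\<^sub>R f (c + (-1) * z))"
  unfolding set_lebesgue_integral_def by (subst lborel_integral_real_affine[where c="-1" and t=c]) auto
 also have "\<dots> = (LBINT z:{a..b}. f (c - z))"
  unfolding set_lebesgue_integral_def by (intro Bochner_Integration.integral_cong) (auto simp: indicator_def)
 finally show ?thesis by simp
qed

lemma Lint_Icc_translate:
 fixes f :: "real \<Rightarrow> real"
 shows "(LBINT z:{a..b}. f (c + z)) = (LBINT s:{c + a..c + b}. f s)"
proof -
 have "(LBINT s:{c + a..c + b}. f s) = (LBINT z. indicator {c + a..c + b} (c + 1 * z) *\<^sub>R f (c + 1 * z))"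
  unfolding set_lebesgue_integral_def by (subst lborel_integral_real_affine[where c="1" and t=c]) auto
 also have "\<dots> = (LBINT z:{a..b}. f (c + z))"
  unfolding set_lebesgue_integral_def by (intro Bochner_Integration.integral_cong) (auto simp: indicator_def)
 finally show ?thesis by simp
qed

lemma Jt_reflect: "f \<in> L2c \<Longrightarrow> a \<le> b \<Longrightarrow> Jt f (c - b) - Jt f (c - a) = - (LBINT z:{a..b}. f (c - z))"
 using Jt_diff_Icc[of f "c - b" "c - a"] by (simp add: Lint_Icc_reflect)

lemma Jt_translate: "f \<in> L2c \<Longrightarrow> a \<le> b \<Longrightarrow> Jt f (c + b) - Jt f (c + a) = (LBINT z:{a..b}. f (c + z))"
 using Jt_diff_Icc[of f "c + a" "c + b"] by (simp add: Lint_Icc_translate)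

lemma integrable_reflect: "f \<in> L2c \<Longrightarrow> set_integrable lborel {a..b} (\<lambda>z. f (c - z))"
proof -
 assume f: "f \<in> L2c"
 have "integrable lborel (\<lambda>s. indicator {c - b..c - a} s *\<^sub>R f s)"
  unfolding set_integrable_def[symmetric] by (rule L2c_set_integrable'[OF f, where t="c - a"]) auto
 from lborel_integrable_real_affine[OF this, of "-1" c]
 have "integrable lborel (\<lambda>z. indicator {c - b..c - a} (c + (-1) * z) *\<^sub>R f (c + (-1) * z))" by simp
 moreover have "indicator {c - b..c - a} (c + (-1) * z) *\<^sub>R f (c + (-1) * z) = indicator {a..b} z *\<^sub>R f (c - z)" for z
  by (auto simp: indicator_def)
 ultimately show ?thesis unfolding set_integrable_def by (simp only:)
qed

lemma integrable_translate: "f \<in> L2c \<Longrightarrow> set_integrable lborel {a..b} (\<lambda>z. f (c + z))"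
proof -
 assume f: "f \<in> L2c"
 have "integrable lborel (\<lambda>s. indicator {c + a..c + b} s *\<^sub>R f s)"
  unfolding set_integrable_def[symmetric] by (rule L2c_set_integrable'[OF f, where t="c + b"]) auto
 from lborel_integrable_real_affine[OF this, of "1" c]
 have "integrable lborel (\<lambda>z. indicator {c + a..c + b} (c + 1 * z) *\<^sub>R f (c + 1 * z))" by simp
 moreover have "indicator {c + a..c + b} (c + 1 * z) *\<^sub>R f (c + 1 * z) = indicator {a..b} z *\<^sub>R f (c + z)" for z
  by (auto simp: indicator_def)
 ultimately show ?thesis unfolding set_integrable_def by (simp only:)
qed

lemma Lint_Icc_split:
 fixes f :: "real \<Rightarrow> real"
 assumes "set_integrable lborel {a..b} f" "a \<le> c" "c \<le> b"
 shows "(LBINT z:{a..b}. f z) = (LBINT z:{a..c}. f z) + (LBINT z:{c..b}. f z)"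
proof -
 have i: "integrable lborel (\<lambda>z. indicator {a..c} z *\<^sub>R f z)" "integrable lborel (\<lambda>z. indicator {c..b} z *\<^sub>R f z)"
  using set_integrable_subset[OF assms(1), of "{a..c}"] set_integrable_subset[OF assms(1), of "{c..b}"] assms(2,3)
  by (auto simp: set_integrable_def)
 have "(LBINT z:{a..b}. f z) = (LBINT z. indicator {a..c} z *\<^sub>R f z + indicator {c..b} z *\<^sub>R f z)"
  unfolding set_lebesgue_integral_def
 proof (rule integral_cong_AE)
  have "AE x in lborel. x \<noteq> c" by (rule AE_lborel_singleton)
  then show "AE x in lborel. indicator {a..b} x *\<^sub>R f x = indicator {a..c} x *\<^sub>R f x + indicator {c..b} x *\<^sub>R f x"
   by eventually_elim (use assms(2,3) in \<open>auto simp: indicator_def\<close>)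
  show "(\<lambda>z. indicator {a..b} z *\<^sub>R f z) \<in> borel_measurable lborel"
   using assms(1) unfolding set_integrable_def by (rule borel_measurable_integrable)
 qed (use i in auto)
 also have "\<dots> = (LBINT z:{a..c}. f z) + (LBINT z:{c..b}. f z)"
  unfolding set_lebesgue_integral_def by (rule Bochner_Integration.integral_add[OF i])
 finally show ?thesis .
qed

lemma integrable_cone:
 assumes f: "f \<in> L2c"
 shows "set_integrable lborel {a..b} (\<lambda>z. f (T - \<bar>x - z\<bar>))" "set_integrable lborel {a..b} (\<lambda>z. sgn (z - x) * f (T - \<bar>x - z\<bar>))"
proof -
 have le: "set_integrable lborel {a..b} (\<lambda>z. if z \<le> x then f ((T - x) + z) else f ((T + x) - z))"
 proof -
  have "set_integrable lborel ({a..b} \<inter> {..x}) (\<lambda>z. if z \<le> x then f ((T - x) + z) else f ((T + x) - z))"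
   by (subst set_integrable_cong[OF refl refl, of _ _ "\<lambda>z. f ((T - x) + z)"])
    (auto intro: set_integrable_subset[OF integrable_translate[OF f, of a b "T - x"]])
  moreover have "set_integrable lborel ({a..b} \<inter> {x<..}) (\<lambda>z. if z \<le> x then f ((T - x) + z) else f ((T + x) - z))"
   by (subst set_integrable_cong[OF refl refl, of _ _ "\<lambda>z. f ((T + x) - z)"])
    (auto intro: set_integrable_subset[OF integrable_reflect[OF f, of a b "T + x"]])
  moreover have "{a..b} = ({a..b} \<inter> {..x}) \<union> ({a..b} \<inter> {x<..})" by auto
  ultimately show ?thesis
   using set_integrable_Un[of lborel "{a..b} \<inter> {..x}" _ "{a..b} \<inter> {x<..}"] by simp
 qed
 have e: "(if z \<le> x then f ((T - x) + z) else f ((T + x) - z)) = f (T - \<bar>x - z\<bar>)" for z by (simp add: algebra_simps)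
 show 1: "set_integrable lborel {a..b} (\<lambda>z. f (T - \<bar>x - z\<bar>))" using le unfolding e .
 have "set_integrable lborel {a..b} (\<lambda>z. f (T - \<bar>x - z\<bar>) * sgn (z - x))"
  unfolding set_integrable_def
 proof (rule Bochner_Integration.integrable_bound[OF 1[unfolded set_integrable_def]])
  note [measurable] = L2cD(1)[OF f]
  show "(\<lambda>z. indicator {a..b} z *\<^sub>R (f (T - \<bar>x - z\<bar>) * sgn (z - x))) \<in> borel_measurable lborel" by measurable
  show "AE z in lborel. norm (indicator {a..b} z *\<^sub>R (f (T - \<bar>x - z\<bar>) * sgn (z - x))) \<le> norm (indicator {a..b} z *\<^sub>R f (T - \<bar>x - z\<bar>))"
   by (intro AE_I2) (auto simp: indicator_def sgn_real_def)
 qed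
 then show "set_integrable lborel {a..b} (\<lambda>z. sgn (z - x) * f (T - \<bar>x - z\<bar>))" by (simp only: mult.commute)
qed

lemma cone_left: "f \<in> L2c \<Longrightarrow> z1 \<le> z2 \<Longrightarrow> z2 \<le> x \<Longrightarrow>
  (LBINT z:{z1..z2}. f (T - \<bar>x - z\<bar>)) = Jt f (T - \<bar>x - z2\<bar>) - Jt f (T - \<bar>x - z1\<bar>)"
proof -
 assume f: "f \<in> L2c" and z: "z1 \<le> z2" "z2 \<le> x"
 have "(LBINT z:{z1..z2}. f (T - \<bar>x - z\<bar>)) = (LBINT z:{z1..z2}. f ((T - x) + z))"
  unfolding set_lebesgue_integral_def using z by (intro LBINT_cong) (auto simp: indicator_def algebra_simps)
 also have "\<dots> = Jt f ((T - x) + z2) - Jt f ((T - x) + z1)" by (rule Jt_translate[OF f z(1), symmetric])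
 finally show ?thesis using z by (simp add: algebra_simps)
qed

lemma cone_right: "f \<in> L2c \<Longrightarrow> z1 \<le> z2 \<Longrightarrow> x \<le> z1 \<Longrightarrow>
  (LBINT z:{z1..z2}. f (T - \<bar>x - z\<bar>)) = Jt f (T - \<bar>x - z1\<bar>) - Jt f (T - \<bar>x - z2\<bar>)"
proof -
 assume f: "f \<in> L2c" and z: "z1 \<le> z2" "x \<le> z1"
 have "(LBINT z:{z1..z2}. f (T - \<bar>x - z\<bar>)) = (LBINT z:{z1..z2}. f ((T + x) - z))"
  unfolding set_lebesgue_integral_def using z by (intro LBINT_cong) (auto simp: indicator_def algebra_simps)
 also have "\<dots> = Jt f ((T + x) - z1) - Jt f ((T + x) - z2)" using Jt_reflect[OF f z(1), of "T + x"] by simp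
 finally show ?thesis using z by (simp add: algebra_simps)
qed

lemma Lint_sgn:
 "z2 \<le> x \<Longrightarrow> (LBINT z:{z1..z2}. sgn (z - x) * g z) = - (LBINT z:{z1..z2}. g z :: real)" (is "_ \<Longrightarrow> ?A")
 "x \<le> z1 \<Longrightarrow> (LBINT z:{z1..z2}. sgn (z - x) * g z) = (LBINT z:{z1..z2}. g z :: real)" (is "_ \<Longrightarrow> ?B")
 if [measurable]: "g \<in> borel_measurable borel"
proof -
 have ae: "AE z in lborel. z \<noteq> x" by (rule AE_lborel_singleton)
 show ?A if "z2 \<le> x"
 proof -
  have "(LBINT z:{z1..z2}. sgn (z - x) * g z) = (LBINT z:{z1..z2}. - g z)"
   unfolding set_lebesgue_integral_def
  proof (rule integral_cong_AE)
   show "AE z in lborel. indicator {z1..z2} z *\<^sub>R (sgn (z - x) * g z) = indicator {z1..z2} z *\<^sub>R - g z"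
    using ae by eventually_elim (use that in \<open>auto simp: indicator_def sgn_real_def\<close>)
  qed measurable
  then show ?thesis by (simp add: Lint_minus)
 qed
 show ?B if "x \<le> z1"
  unfolding set_lebesgue_integral_def
 proof (rule integral_cong_AE)
  show "AE z in lborel. indicator {z1..z2} z *\<^sub>R (sgn (z - x) * g z) = indicator {z1..z2} z *\<^sub>R g z"
   using ae by eventually_elim (use that in \<open>auto simp: indicator_def sgn_real_def\<close>)
 qed measurable
qed

text \<open>As a function of z the delayed integral has a corner at x, hence the sign in its
  derivative. Multiplied by that sign it jumps by \<open>2 * Jt f T\<close> at z = x; this jump
  later becomes the potential term of the second derivative.\<close>

lemma cone_AC:
 assumes f: "f \<in> L2c" and z: "z1 \<le> z2"
 shows "Jt f (T - \<bar>x - z2\<bar>) - Jt f (T - \<bar>x - z1\<bar>) = - (LBINT z:{z1..z2}. sgn (z - x) * f (T - \<bar>x - z\<bar>))"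
  and "x \<noteq> z1 \<Longrightarrow> x \<noteq> z2 \<Longrightarrow> sgn (z2 - x) * Jt f (T - \<bar>x - z2\<bar>) - sgn (z1 - x) * Jt f (T - \<bar>x - z1\<bar>) =
   2 * (indicator {z1..z2} x * Jt f T) - (LBINT z:{z1..z2}. f (T - \<bar>x - z\<bar>))"
proof -
 note [measurable] = L2cD(1)[OF f]
 have m: "(\<lambda>z. f (T - \<bar>x - z\<bar>)) \<in> borel_measurable borel" by measurable
 consider "z2 \<le> x" | "x \<le> z1" | "z1 < x" "x < z2" by linarith
 then have "Jt f (T - \<bar>x - z2\<bar>) - Jt f (T - \<bar>x - z1\<bar>) = - (LBINT z:{z1..z2}. sgn (z - x) * f (T - \<bar>x - z\<bar>)) \<and>
   (x \<noteq> z1 \<longrightarrow> x \<noteq> z2 \<longrightarrow> sgn (z2 - x) * Jt f (T - \<bar>x - z2\<bar>) - sgn (z1 - x) * Jt f (T - \<bar>x - z1\<bar>) =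
   2 * (indicator {z1..z2} x * Jt f T) - (LBINT z:{z1..z2}. f (T - \<bar>x - z\<bar>)))"
 proof cases
  case 1
  then show ?thesis using cone_left[OF f z 1] Lint_sgn(1)[OF m 1, of z1] z by (auto simp: indicator_def sgn_real_def)
 next
  case 2
  then show ?thesis using cone_right[OF f z 2] Lint_sgn(2)[OF m 2, of z2] z by (auto simp: indicator_def sgn_real_def)
 next
  case 3
  then have le: "z1 \<le> x" "x \<le> z2" by auto
  note s1 = Lint_Icc_split[OF integrable_cone(1)[OF f] le, of T x] and s2 = Lint_Icc_split[OF integrable_cone(2)[OF f] le, of x T]
  show ?thesis
   using s1 s2 cone_left[OF f le(1) order_refl, of T] cone_right[OF f le(2) order_refl, of T]
    Lint_sgn(1)[OF m order_refl[of x], of z1] Lint_sgn(2)[OF m order_refl[of x], of z2] 3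
   by (auto simp: indicator_def sgn_real_def)
 qed
 then show "Jt f (T - \<bar>x - z2\<bar>) - Jt f (T - \<bar>x - z1\<bar>) = - (LBINT z:{z1..z2}. sgn (z - x) * f (T - \<bar>x - z\<bar>))"
  and "x \<noteq> z1 \<Longrightarrow> x \<noteq> z2 \<Longrightarrow> sgn (z2 - x) * Jt f (T - \<bar>x - z2\<bar>) - sgn (z1 - x) * Jt f (T - \<bar>x - z1\<bar>) =
   2 * (indicator {z1..z2} x * Jt f T) - (LBINT z:{z1..z2}. f (T - \<bar>x - z\<bar>))"
  by blast+
qed

text \<open>Up to sign the z-derivative of \<open>Sop\<close>: contributions from the two sides of z
  count with opposite signs.\<close>

definition Top :: "real \<Rightarrow> (real \<Rightarrow> real \<Rightarrow> real) \<Rightarrow> real \<Rightarrow> real" where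
 "Top z = Pop (\<lambda>x. sgn (z - x)) (\<lambda>x. \<bar>x - z\<bar>)"

interpretation Tdata: Pop_data "\<lambda>x. sgn (z - x)" "\<lambda>x. \<bar>x - z\<bar>" 1 for z
 by unfold_locales (auto simp: abs_sgn_eq)

text \<open>The time is fixed at T; the integral over the vertex z takes the place of the integral
  over time in \<open>nn_L1\<close>. The weight \<open>\<kappa>\<close> will be 1 or a sign.\<close>

lemma cone_swap:
 assumes V: "V \<in> Qc \<alpha> \<beta>" and ab: "\<alpha> \<le> \<beta>" and \<kappa>: "(\<lambda>(x, z). \<kappa> x z) \<in> borel_measurable (borel \<Otimes>\<^sub>M borel)" and k1: "\<And>x z. \<bar>\<kappa> x z\<bar> \<le> 1"
 shows "(LBINT x. (LBINT z:{z1..z2}. \<kappa> x z * V x (T - \<bar>x - z\<bar>))) = (LBINT z:{z1..z2}. LBINT x. \<kappa> x z * V x (T - \<bar>x - z\<bar>))"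
  and "integrable lborel (\<lambda>x. LBINT z:{z1..z2}. \<kappa> x z * V x (T - \<bar>x - z\<bar>))"
  and "set_integrable lborel {z1..z2} (\<lambda>z. LBINT x. \<kappa> x z * V x (T - \<bar>x - z\<bar>))"
proof -
 note Qc_measurable[OF V, measurable (raw)]
 have [measurable]: "(\<lambda>p. \<kappa> (fst p) (snd p)) \<in> borel_measurable (borel \<Otimes>\<^sub>M borel)" using \<kappa> by (simp add: case_prod_unfold)
 interpret Z: Pop_data "\<lambda>x. 1" "\<lambda>x. 0" 1 by unfold_locales auto
 define F where "F = (\<lambda>x z. indicator {z1..z2} z * (\<kappa> x z * V x (T - \<bar>x - z\<bar>)))"
 have m: "(\<lambda>(x, z). F x z) \<in> borel_measurable (lborel \<Otimes>\<^sub>M lborel)" unfolding F_def case_prod_unfold by measurable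
 \<comment> \<open>On either side of x the retarded time is a translate or a reflection of z and
   stays below T, hence the factor 2.\<close>
 have c: "(\<integral>\<^sup>+z. ennreal \<bar>F x z\<bar> \<partial>lborel) \<le> 2 * (\<integral>\<^sup>+s. ennreal (indicator {..T} s * \<bar>1 * V x (s - 0)\<bar>) \<partial>lborel)" for x
 proof -
  have [measurable]: "V x \<in> borel_measurable borel" by (rule L2cD(1)[OF QcD(1)[OF V]])
  define N where "N = (\<lambda>s. ennreal (indicator {..T} s * \<bar>V x s\<bar>))"
  have [measurable]: "N \<in> borel_measurable borel" unfolding N_def by measurable
  have "(\<integral>\<^sup>+z. ennreal \<bar>F x z\<bar> \<partial>lborel) \<le> (\<integral>\<^sup>+z. N ((T - x) + 1 * z) + N ((T + x) + (-1) * z) \<partial>lborel)"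
  proof (rule nn_integral_mono)
   fix z
   have "\<bar>F x z\<bar> \<le> \<bar>V x (T - \<bar>x - z\<bar>)\<bar>"
    using mult_right_mono[OF k1[of x z], of "\<bar>V x (T - \<bar>x - z\<bar>)\<bar>"] by (auto simp: F_def indicator_def abs_mult)
   then have "ennreal \<bar>F x z\<bar> \<le> N (T - \<bar>x - z\<bar>)" by (simp add: N_def ennreal_leI)
   moreover have "N (T - \<bar>x - z\<bar>) \<le> N ((T - x) + 1 * z) + N ((T + x) + (-1) * z)"
   proof (cases "z \<le> x")
    case True
    then have "T - \<bar>x - z\<bar> = (T - x) + 1 * z" by simp
    then show ?thesis by (simp only: add_increasing2 zero_le order_refl)
   next
    case False
    then have "T - \<bar>x - z\<bar> = (T + x) + (-1) * z" by simp
    then show ?thesis by (simp only: add_increasing zero_le order_refl)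
   qed
   ultimately show "ennreal \<bar>F x z\<bar> \<le> N ((T - x) + 1 * z) + N ((T + x) + (-1) * z)" by (rule order_trans)
  qed
  also have "\<dots> = (\<integral>\<^sup>+z. N ((T - x) + 1 * z) \<partial>lborel) + (\<integral>\<^sup>+z. N ((T + x) + (-1) * z) \<partial>lborel)"
   by (rule nn_integral_add) auto
  also have "(\<integral>\<^sup>+z. N ((T - x) + 1 * z) \<partial>lborel) = (\<integral>\<^sup>+s. N s \<partial>lborel)"
   using nn_integral_real_affine[of N 1 "T - x"] by simp
  also have "(\<integral>\<^sup>+z. N ((T + x) + (-1) * z) \<partial>lborel) = (\<integral>\<^sup>+s. N s \<partial>lborel)"
   using nn_integral_real_affine[of N "-1" "T + x"] by simp
  finally show ?thesis by (simp add: N_def mult_2)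
 qed
 have "(\<integral>\<^sup>+x. \<integral>\<^sup>+z. ennreal \<bar>F x z\<bar> \<partial>lborel \<partial>lborel) \<le> (\<integral>\<^sup>+x. 2 * (\<integral>\<^sup>+s. ennreal (indicator {..T} s * \<bar>1 * V x (s - 0)\<bar>) \<partial>lborel) \<partial>lborel)"
  by (rule nn_integral_mono) (rule c)
 also have "\<dots> = 2 * (\<integral>\<^sup>+x. \<integral>\<^sup>+s. ennreal (indicator {..T} s * \<bar>1 * V x (s - 0)\<bar>) \<partial>lborel \<partial>lborel)"
  by (rule nn_integral_cmult) measurable
 also have "\<dots> < \<infinity>" using Z.nn_L1[OF V ab, of T] by (simp add: ennreal_mult_less_top)
 finally have fin: "(\<integral>\<^sup>+x. \<integral>\<^sup>+z. ennreal \<bar>F x z\<bar> \<partial>lborel \<partial>lborel) < \<infinity>" .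
 note Fu = fubini_real[OF m fin]
 have e1: "(LBINT z:{z1..z2}. \<kappa> x z * V x (T - \<bar>x - z\<bar>)) = (LBINT z. F x z)" for x
  by (simp add: set_lebesgue_integral_def F_def)
 have e2: "indicator {z1..z2} z *\<^sub>R (LBINT x. \<kappa> x z * V x (T - \<bar>x - z\<bar>)) = (LBINT x. F x z)" for z
  by (simp add: F_def)
 show "(LBINT x. (LBINT z:{z1..z2}. \<kappa> x z * V x (T - \<bar>x - z\<bar>))) = (LBINT z:{z1..z2}. LBINT x. \<kappa> x z * V x (T - \<bar>x - z\<bar>))"
  unfolding e1 unfolding set_lebesgue_integral_def e2 by (rule Fu(2))
 show "integrable lborel (\<lambda>x. LBINT z:{z1..z2}. \<kappa> x z * V x (T - \<bar>x - z\<bar>))"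
  unfolding e1 by (rule lborel_pair.integrable_fst[OF Fu(1)])
 show "set_integrable lborel {z1..z2} (\<lambda>z. LBINT x. \<kappa> x z * V x (T - \<bar>x - z\<bar>))"
  unfolding set_integrable_def e2 by (rule lborel_pair.integrable_snd[OF Fu(1)])
qed

section \<open>Absolutely continuous functions and Sobolev spaces\<close>

text \<open>Absolute continuity in the form of the fundamental theorem. The derivative is an
  argument because it is determined only almost everywhere.\<close>

definition AC :: "real \<Rightarrow> real \<Rightarrow> (real \<Rightarrow> real) \<Rightarrow> (real \<Rightarrow> real) \<Rightarrow> bool" where
 "AC a b g g' \<longleftrightarrow> set_integrable lborel {a..b} g' \<and>
   (\<forall>x y. a \<le> x \<longrightarrow> x \<le> y \<longrightarrow> y \<le> b \<longrightarrow> g y - g x = (LBINT z:{x..y}. g' z))"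

text \<open>Sobolev regularity of a concrete representative: all derivatives but the last are
  continuous, so boundary values are plain values.\<close>

fun Sob :: "nat \<Rightarrow> real \<Rightarrow> real \<Rightarrow> (real \<Rightarrow> real) \<Rightarrow> bool" where
 "Sob 0 a b g \<longleftrightarrow> (\<lambda>x. indicator {a..b} x * g x) \<in> borel_measurable borel \<and>
   (\<integral>\<^sup>+x. ennreal (indicator {a..b} x * (g x)\<^sup>2) \<partial>lborel) < \<infinity>"
| "Sob (Suc k) a b g \<longleftrightarrow> (\<exists>g'. AC a b g g' \<and> Sob k a b g')"

lemma AC_add: "AC a b f f' \<Longrightarrow> AC a b g g' \<Longrightarrow> AC a b (\<lambda>x. f x + g x) (\<lambda>x. f' x + g' x)"
proof -
 assume f: "AC a b f f'" and g: "AC a b g g'"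
 have "(f y + g y) - (f x + g x) = (LBINT z:{x..y}. f' z + g' z)" if "a \<le> x" "x \<le> y" "y \<le> b" for x y
 proof -
  have "set_integrable lborel {x..y} f'" "set_integrable lborel {x..y} g'"
   using f g that by (auto simp: AC_def intro: set_integrable_subset)
  then have "(LBINT z:{x..y}. f' z + g' z) = (LBINT z:{x..y}. f' z) + (LBINT z:{x..y}. g' z)"
   by (rule set_integral_add(2))
  moreover have "f y - f x = (LBINT z:{x..y}. f' z)" "g y - g x = (LBINT z:{x..y}. g' z)"
   using f g that by (auto simp: AC_def)
  ultimately show ?thesis by linarith
 qed
 then show ?thesis using f g by (auto simp: AC_def)
qed

lemma AC_cmult: "AC a b f f' \<Longrightarrow> AC a b (\<lambda>x. c * f x) (\<lambda>x. c * f' x)"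
 by (auto simp: AC_def right_diff_distrib[symmetric])

lemma AC_diff: "AC a b f f' \<Longrightarrow> AC a b g g' \<Longrightarrow> AC a b (\<lambda>x. f x - g x) (\<lambda>x. f' x - g' x)"
 using AC_add[of a b f f' "\<lambda>x. - 1 * g x" "\<lambda>x. - 1 * g' x"] AC_cmult[of a b g g' "- 1"] by simp

lemma AC_continuous:
 assumes "AC a b g g'"
 shows "continuous_on {a..b} g"
proof -
 have "continuous_on {a..b} (\<lambda>x. integral {a..x} g')"
  by (rule indefinite_integral_continuous_1) (use assms in \<open>auto simp: AC_def set_borel_integral_eq_integral\<close>)
 then have "continuous_on {a..b} (\<lambda>x. g a + integral {a..x} g')" by (intro continuous_intros)
 moreover have "g a + integral {a..x} g' = g x" if "x \<in> {a..b}" for x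
 proof -
  have "set_integrable lborel {a..x} g'" using assms that by (auto simp: AC_def intro: set_integrable_subset)
  then have "(LBINT z:{a..x}. g' z) = integral {a..x} g'" by (rule set_borel_integral_eq_integral(2))
  moreover have "g x - g a = (LBINT z:{a..x}. g' z)" using assms that unfolding AC_def by auto
  ultimately show ?thesis by linarith
 qed
 ultimately show ?thesis by (rule continuous_on_eq)
qed

lemma AC_by_parts:
 assumes g: "AC a b g g'" and xy: "a \<le> x" "x \<le> y" "y \<le> b"
  and Q: "\<And>z. z \<in> {a..b} \<Longrightarrow> (Q has_real_derivative Q' z) (at z within {a..b})" and Q': "continuous_on {a..b} Q'"
 shows "(LBINT z:{x..y}. g' z * Q z) = g y * Q y - g x * Q x - (LBINT z:{x..y}. g z * Q' z)"
proof -
 have i: "set_integrable lborel {x..y} g'" using g xy by (auto simp: AC_def intro: set_integrable_subset)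
 have Q1: "(Q has_real_derivative Q' z) (at z within {x..y})" if "z \<in> {x..y}" for z
  by (rule DERIV_subset[OF Q]) (use that xy in auto)
 have Qc: "continuous_on {x..y} Q'" by (rule continuous_on_subset[OF Q']) (use xy in auto)
 have gc: "continuous_on {x..y} g" by (rule continuous_on_subset[OF AC_continuous[OF g]]) (use xy in auto)
 have I: "(LBINT w:{x..z}. g' w) = g z - g x" if "z \<in> {x..y}" for z
  using g that xy by (auto simp: AC_def)
 have "(LBINT z:{x..y}. (LBINT w:{x..z}. g' w) * Q' z) = (LBINT z:{x..y}. g z * Q' z - g x * Q' z)"
 proof (rule set_lebesgue_integral_cong)
  show "\<forall>z. z \<in> {x..y} \<longrightarrow> (LBINT w:{x..z}. g' w) * Q' z = g z * Q' z - g x * Q' z"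
   using I by (auto simp: left_diff_distrib)
 qed simp
 also have "\<dots> = (LBINT z:{x..y}. g z * Q' z) - (LBINT z:{x..y}. g x * Q' z)"
  by (rule set_integral_diff(2)) (intro borel_integrable_atLeastAtMost' continuous_intros gc Qc)+
 also have "(LBINT z:{x..y}. g x * Q' z) = g x * (Q y - Q x)"
  using Lint_FTC[OF xy(2) Q1 Qc] by simp
 finally have "(LBINT z:{x..y}. (LBINT w:{x..z}. g' w) * Q' z) = (LBINT z:{x..y}. g z * Q' z) - g x * (Q y - Q x)" .
 with integration_by_parts_AC[OF i xy(2) Q1 Qc] I[of y] xy show ?thesis by (simp add: algebra_simps)
qed

lemma AC_mult:
 assumes g: "AC a b g g'"
  and Q: "\<And>z. z \<in> {a..b} \<Longrightarrow> (Q has_real_derivative Q' z) (at z within {a..b})" and Q': "continuous_on {a..b} Q'"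
 shows "AC a b (\<lambda>x. Q x * g x) (\<lambda>x. Q' x * g x + Q x * g' x)"
proof -
 have Qc: "continuous_on {a..b} Q" using Q by (meson DERIV_continuous_on)
 note gc = AC_continuous[OF g]
 have i1: "set_integrable lborel {a..b} (\<lambda>x. Q' x * g x)"
  by (intro borel_integrable_atLeastAtMost' continuous_intros gc Q')
 have i2: "set_integrable lborel {a..b} (\<lambda>x. Q x * g' x)"
  using set_integrable_mult_continuous[OF _ Qc, of g'] g by (simp add: AC_def mult.commute)
 have "Q y * g y - Q x * g x = (LBINT z:{x..y}. Q' z * g z + Q z * g' z)" if "a \<le> x" "x \<le> y" "y \<le> b" for x y
 proof -
  have "set_integrable lborel {x..y} (\<lambda>x. Q' x * g x)" "set_integrable lborel {x..y} (\<lambda>x. Q x * g' x)"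
   using i1 i2 that by (auto intro: set_integrable_subset)
  then show ?thesis using AC_by_parts[OF g that Q Q'] by (simp add: set_integral_add mult.commute)
 qed
 then show ?thesis using i1 i2 by (auto simp: AC_def)
qed

lemma continuous_Sob0: "continuous_on {a..b} g \<Longrightarrow> Sob 0 a b g"
proof -
 assume g: "continuous_on {a..b} g"
 have "(\<lambda>x. indicator {a..b} x *\<^sub>R g x) \<in> borel_measurable borel"
  by (intro borel_measurable_continuous_on_indicator g) auto
 moreover have "set_integrable lborel {a..b} (\<lambda>x. (g x)\<^sup>2)"
  by (intro borel_integrable_atLeastAtMost' continuous_intros g)
 then have "(\<integral>\<^sup>+x. ennreal (norm (indicator {a..b} x *\<^sub>R (g x)\<^sup>2)) \<partial>lborel) < \<infinity>"
  unfolding set_integrable_def integrable_iff_bounded by blast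
 ultimately show ?thesis by simp
qed

lemma Sob_Suc_imp: "Sob (Suc k) a b g \<Longrightarrow> Sob k a b g"
proof (induction k arbitrary: g)
 case 0
 then obtain g' where "AC a b g g'" by auto
 then show ?case by (intro continuous_Sob0 AC_continuous)
next
 case (Suc k)
 then obtain g' where "AC a b g g'" "Sob (Suc k) a b g'" by auto
 then show ?case using Suc.IH by auto
qed

lemma Sob_add: "Sob k a b f \<Longrightarrow> Sob k a b g \<Longrightarrow> Sob k a b (\<lambda>x. f x + g x)"
proof (induction k arbitrary: f g)
 case 0
 let ?i = "indicator {a..b} :: real \<Rightarrow> real"
 have m: "(\<lambda>x. ?i x * f x) \<in> borel_measurable borel" "(\<lambda>x. ?i x * g x) \<in> borel_measurable borel" using 0 by auto
 have [measurable]: "(\<lambda>x. ?i x * (f x)\<^sup>2) \<in> borel_measurable borel" "(\<lambda>x. ?i x * (g x)\<^sup>2) \<in> borel_measurable borel"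
 proof -
  have e: "?i x * (h x)\<^sup>2 = (?i x * h x)\<^sup>2" for h x by (auto simp: indicator_def)
  show "(\<lambda>x. ?i x * (f x)\<^sup>2) \<in> borel_measurable borel" "(\<lambda>x. ?i x * (g x)\<^sup>2) \<in> borel_measurable borel" unfolding e using m by measurable
 qed
 have le: "(f x + g x)\<^sup>2 \<le> 2 * (f x)\<^sup>2 + 2 * (g x)\<^sup>2" for x
  using sum_squares_ge_zero[of "f x - g x" 0] by (simp add: power2_eq_square algebra_simps)
 have "(\<integral>\<^sup>+x. ennreal (?i x * (f x + g x)\<^sup>2) \<partial>lborel) \<le> (\<integral>\<^sup>+x. ennreal (2 * (?i x * (f x)\<^sup>2) + 2 * (?i x * (g x)\<^sup>2)) \<partial>lborel)"
  by (intro nn_integral_mono ennreal_leI) (use le in \<open>auto simp: indicator_def\<close>)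
 also have "\<dots> = (\<integral>\<^sup>+x. ennreal 2 * ennreal (?i x * (f x)\<^sup>2) + ennreal 2 * ennreal (?i x * (g x)\<^sup>2) \<partial>lborel)"
  by (intro nn_integral_cong) (simp add: ennreal_plus ennreal_mult' del: ennreal_numeral)
 also have "\<dots> = ennreal 2 * (\<integral>\<^sup>+x. ennreal (?i x * (f x)\<^sup>2) \<partial>lborel) + ennreal 2 * (\<integral>\<^sup>+x. ennreal (?i x * (g x)\<^sup>2) \<partial>lborel)"
  by (simp add: nn_integral_add nn_integral_cmult del: ennreal_numeral)
 also have "\<dots> < \<infinity>" using 0 by (auto simp: ennreal_mult_less_top simp del: ennreal_numeral)
 finally show ?case using borel_measurable_add[OF m] by (simp add: distrib_left)
next
 case (Suc k)
 obtain f' g' where fg: "AC a b f f'" "Sob k a b f'" "AC a b g g'" "Sob k a b g'" using Suc.prems by auto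
 show ?case unfolding Sob.simps by (rule exI[of _ "\<lambda>x. f' x + g' x"]) (intro conjI AC_add[OF fg(1,3)] Suc.IH[OF fg(2,4)])
qed

lemma Sob_cmult: "Sob k a b g \<Longrightarrow> Sob k a b (\<lambda>x. c * g x)"
proof (induction k arbitrary: g)
 case 0
 let ?i = "indicator {a..b} :: real \<Rightarrow> real"
 have m: "(\<lambda>x. ?i x * g x) \<in> borel_measurable borel" using 0 by auto
 have [measurable]: "(\<lambda>x. ?i x * (g x)\<^sup>2) \<in> borel_measurable borel"
 proof -
  have e: "?i x * (g x)\<^sup>2 = (?i x * g x)\<^sup>2" for x by (auto simp: indicator_def)
  show ?thesis unfolding e using m by measurable
 qed
 have "(\<integral>\<^sup>+x. ennreal (?i x * (c * g x)\<^sup>2) \<partial>lborel) = (\<integral>\<^sup>+x. ennreal (c\<^sup>2) * ennreal (?i x * (g x)\<^sup>2) \<partial>lborel)"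
  by (intro nn_integral_cong) (simp add: ennreal_mult'[symmetric] power_mult_distrib mult.left_commute)
 also have "\<dots> = ennreal (c\<^sup>2) * (\<integral>\<^sup>+x. ennreal (?i x * (g x)\<^sup>2) \<partial>lborel)" by (rule nn_integral_cmult) simp
 also have "\<dots> < \<infinity>" using 0 by (auto simp: ennreal_mult_less_top)
 finally show ?case using borel_measurable_times[OF borel_measurable_const[of c] m] by (simp add: mult.left_commute)
next
 case (Suc k)
 obtain g' where g: "AC a b g g'" "Sob k a b g'" using Suc.prems by auto
 show ?case unfolding Sob.simps by (rule exI[of _ "\<lambda>x. c * g' x"]) (intro conjI AC_cmult[OF g(1)] Suc.IH[OF g(2)])
qed

lemma Ck_on_Suc:
 assumes "Ck_on (Suc k) a b Q"
 obtains Q' where "Ck_on k a b Q'" "\<And>x. x \<in> {a..b} \<Longrightarrow> (Q has_real_derivative Q' x) (at x within {a..b})" "continuous_on {a..b} Q'"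
proof -
 obtain D where D: "D 0 = Q" "\<And>i. i \<le> Suc k \<Longrightarrow> continuous_on {a..b} (D i)"
  "\<And>i x. i < Suc k \<Longrightarrow> x \<in> {a..b} \<Longrightarrow> (D i has_real_derivative D (Suc i) x) (at x within {a..b})"
  using assms by (auto simp: Ck_on_def)
 show ?thesis
 proof (rule that[of "D 1"])
  show "Ck_on k a b (D 1)" unfolding Ck_on_def by (rule exI[of _ "\<lambda>i. D (Suc i)"]) (use D in auto)
 qed (use D(1) D(2)[of 1] D(3)[of 0] in auto)
qed

lemma Ck_on_mono: "Ck_on k a b Q \<Longrightarrow> j \<le> k \<Longrightarrow> Ck_on j a b Q"
 unfolding Ck_on_def by (metis less_le_trans order_trans)

lemma Ck_on_continuous: "Ck_on k a b Q \<Longrightarrow> continuous_on {a..b} Q"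
 unfolding Ck_on_def by auto

lemma Sob_mult: "Sob k a b g \<Longrightarrow> Ck_on k a b Q \<Longrightarrow> Sob k a b (\<lambda>x. Q x * g x)"
proof (induction k arbitrary: g Q)
 case 0
 let ?i = "indicator {a..b} :: real \<Rightarrow> real"
 have Qc: "continuous_on {a..b} Q" by (rule Ck_on_continuous[OF 0(2)])
 have m: "(\<lambda>x. ?i x * g x) \<in> borel_measurable borel" using 0 by auto
 have mQ: "(\<lambda>x. ?i x *\<^sub>R Q x) \<in> borel_measurable borel" by (intro borel_measurable_continuous_on_indicator Qc) auto
 have "bounded (Q ` {a..b})" by (intro compact_imp_bounded compact_continuous_image Qc) simp
 then obtain C where C: "\<forall>y\<in>Q ` {a..b}. norm y \<le> C" unfolding bounded_iff by blast
 have [measurable]: "(\<lambda>x. ?i x * (g x)\<^sup>2) \<in> borel_measurable borel"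
 proof -
  have e: "?i x * (g x)\<^sup>2 = (?i x * g x)\<^sup>2" for x by (auto simp: indicator_def)
  show ?thesis unfolding e using m by measurable
 qed
 have "(\<integral>\<^sup>+x. ennreal (?i x * (Q x * g x)\<^sup>2) \<partial>lborel) \<le> (\<integral>\<^sup>+x. ennreal (C\<^sup>2) * ennreal (?i x * (g x)\<^sup>2) \<partial>lborel)"
 proof (rule nn_integral_mono)
  fix x
  have "?i x * (Q x * g x)\<^sup>2 \<le> C\<^sup>2 * (?i x * (g x)\<^sup>2)"
  proof (cases "x \<in> {a..b}")
   case True
   then have "\<bar>Q x\<bar> \<le> C" using C by auto
   then have "(Q x)\<^sup>2 \<le> C\<^sup>2" using power_mono[of "\<bar>Q x\<bar>" C 2] by simp
   then show ?thesis using True by (simp add: power_mult_distrib mult_right_mono)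
  qed simp
  then show "ennreal (?i x * (Q x * g x)\<^sup>2) \<le> ennreal (C\<^sup>2) * ennreal (?i x * (g x)\<^sup>2)"
   by (simp add: ennreal_mult'[symmetric] ennreal_leI)
 qed
 also have "\<dots> = ennreal (C\<^sup>2) * (\<integral>\<^sup>+x. ennreal (?i x * (g x)\<^sup>2) \<partial>lborel)" by (rule nn_integral_cmult) simp
 also have "\<dots> < \<infinity>" using 0 by (auto simp: ennreal_mult_less_top)
 finally have fin: "(\<integral>\<^sup>+x. ennreal (?i x * (Q x * g x)\<^sup>2) \<partial>lborel) < \<infinity>" .
 have e: "(\<lambda>x. ?i x * (Q x * g x)) = (\<lambda>x. (?i x *\<^sub>R Q x) * (?i x * g x))" by (auto simp: indicator_def)
 show ?case unfolding Sob.simps by (intro conjI fin) (unfold e, rule borel_measurable_times[OF mQ m])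
next
 case (Suc k)
 obtain g' where g': "AC a b g g'" "Sob k a b g'" using Suc.prems(1) by auto
 obtain Q' where Q': "Ck_on k a b Q'" "\<And>x. x \<in> {a..b} \<Longrightarrow> (Q has_real_derivative Q' x) (at x within {a..b})" "continuous_on {a..b} Q'"
  by (rule Ck_on_Suc[OF Suc.prems(2)]) blast
 have "Sob k a b (\<lambda>x. Q' x * g x + Q x * g' x)"
  using Suc.IH[OF Sob_Suc_imp[OF Suc.prems(1)] Q'(1)] Suc.IH[OF g'(2) Ck_on_mono[OF Suc.prems(2)]] by (intro Sob_add) auto
 then show ?case using AC_mult[OF g'(1) Q'(2,3)] by auto
qed

lemma Sob0_integrable:
 assumes "Sob 0 a b g" shows "set_integrable lborel {a..b} g"
proof -
 have m: "(\<lambda>x. indicator {a..b} x * g x) \<in> borel_measurable borel" using assms by auto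
 show ?thesis
  unfolding set_integrable_def
 proof (rule integrableI_bounded)
  show "(\<lambda>x. indicator {a..b} x *\<^sub>R g x) \<in> borel_measurable lborel" using m by simp
  show "(\<integral>\<^sup>+x. ennreal (norm (indicator {a..b} x *\<^sub>R g x)) \<partial>lborel) < \<infinity>"
  proof (cases "a \<le> b")
   case True
   have e: "(ennreal \<bar>indicator {a..b} x * g x\<bar>)\<^sup>2 = ennreal (indicator {a..b} x * (g x)\<^sup>2)" for x
    by (auto simp: indicator_def ennreal_power)
   have "(\<integral>\<^sup>+x. ennreal \<bar>indicator {a..b} x * g x\<bar> \<partial>lborel)\<^sup>2 \<le> ennreal (b - a) * (\<integral>\<^sup>+x. ennreal (indicator {a..b} x * (g x)\<^sup>2) \<partial>lborel)"
    unfolding e[symmetric] by (rule Cauchy_Schwarz_Icc[OF _ True]) (use m in auto)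
   also have "\<dots> < \<infinity>" using assms by (auto simp: ennreal_mult_less_top)
   finally show ?thesis by (simp add: power_less_top_ennreal)
  qed simp
 qed
qed

section \<open>Weak derivatives, traces and the operator L for absolutely continuous
  functions\<close>

lemma lebesgue_on_borel:
 fixes f :: "real \<Rightarrow> real"
 assumes m: "(\<lambda>x. indicator S x * f x) \<in> borel_measurable borel" and S: "S \<in> sets borel"
 shows "f \<in> borel_measurable (lebesgue_on S)" "(LINT x|lebesgue_on S. f x) = (LBINT x. indicator S x * f x)"
  "integrable (lebesgue_on S) f \<longleftrightarrow> integrable lborel (\<lambda>x. indicator S x * f x)"
proof -
 have "(\<lambda>x. indicator S x * f x) \<in> borel_measurable lebesgue"
  using measurable_completion[of "\<lambda>x. indicator S x * f x" lborel borel] m by simp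
 then show f: "f \<in> borel_measurable (lebesgue_on S)"
  using S by (subst borel_measurable_restrict_space_iff) auto
 show "(LINT x|lebesgue_on S. f x) = (LBINT x. indicator S x * f x)"
  by (rule lebesgue_on_conv(1)[OF f S m]) simp
 show "integrable (lebesgue_on S) f \<longleftrightarrow> integrable lborel (\<lambda>x. indicator S x * f x)"
  by (rule lebesgue_on_conv(2)[OF f S m]) simp
qed

lemma AE_lebesgue_on:
 "S \<in> sets borel \<Longrightarrow> AE x in lborel. x \<in> S \<longrightarrow> P x \<Longrightarrow> AE x in lebesgue_on S. P x"
 by (subst AE_restrict_space_iff) (auto intro: AE_completion)

lemma indicator_subset_measurable:
 fixes f :: "real \<Rightarrow> real"
 assumes "(\<lambda>x. indicator S x * f x) \<in> borel_measurable borel" "A \<in> sets borel" "A \<subseteq> S"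
 shows "(\<lambda>x. indicator A x * f x) \<in> borel_measurable borel"
proof -
 have e: "(\<lambda>x. indicator A x * f x) = (\<lambda>x. indicator A x * (indicator S x * f x))"
  using assms(3) by (auto simp: indicator_def fun_eq_iff)
 have "indicator A \<in> borel_measurable borel" using assms(2) by simp
 then show ?thesis unfolding e using assms(1) by (rule borel_measurable_times)
qed

lemma set_integrable_borel: "set_integrable lborel S f \<Longrightarrow> (\<lambda>x. indicator S x * f x :: real) \<in> borel_measurable borel"
 unfolding set_integrable_def by (drule borel_measurable_integrable) simp

lemma locally_integrableI:
 assumes "set_integrable lborel {a..b} g"
 shows "locally_integrable a b g"
 unfolding locally_integrable_def
proof (intro allI impI)
 fix c d assume cd: "a < c \<and> d < b"
 have "set_integrable lborel {c..d} g" by (rule set_integrable_subset[OF assms]) (use cd in auto)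
 then show "integrable (lebesgue_on {c..d}) g"
  using lebesgue_on_borel(3)[OF set_integrable_borel, of "{c..d}" g] by (simp add: set_integrable_def)
qed

lemma locally_integrable_cong:
 assumes "locally_integrable a b f" "\<And>x. x \<in> {a<..<b} \<Longrightarrow> g x = f x"
 shows "locally_integrable a b g"
 unfolding locally_integrable_def
proof (intro allI impI)
 fix c d assume cd: "a < c \<and> d < b"
 have "integrable (lebesgue_on {c..d}) f" using assms(1) cd by (auto simp: locally_integrable_def)
 then show "integrable (lebesgue_on {c..d}) g"
  by (subst Bochner_Integration.integrable_cong[OF refl, where g=f]) (use assms(2) cd in auto)
qed

lemma test_fn_zeros:
 assumes "\<eta> \<in> test_functions a b" "x \<notin> {a<..<b}"
 shows "\<eta> x = 0" "deriv \<eta> x = 0" "deriv (deriv \<eta>) x = 0"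
 using test_fn_zero012[OF assms(1)] assms(2) by auto

lemma Lint_test:
 fixes g \<phi> :: "real \<Rightarrow> real"
 assumes m: "(\<lambda>x. indicator {a..b} x * g x) \<in> borel_measurable borel" and \<phi>: "continuous_on UNIV \<phi>"
  and z: "\<And>x. x \<notin> {a<..<b} \<Longrightarrow> \<phi> x = 0"
 shows "(LINT x|lebesgue_on {a<..<b}. g x * \<phi> x) = (LBINT x:{a..b}. g x * \<phi> x)"
proof -
 have m': "(\<lambda>x. indicator {a<..<b} x * g x) \<in> borel_measurable borel"
  by (rule indicator_subset_measurable[OF m]) auto
 have "(\<lambda>x. (indicator {a<..<b} x * g x) * \<phi> x) \<in> borel_measurable borel"
  by (rule borel_measurable_times[OF m' borel_measurable_continuous_onI[OF \<phi>]])
 then have "(LINT x|lebesgue_on {a<..<b}. g x * \<phi> x) = (LBINT x. indicator {a<..<b} x * (g x * \<phi> x))"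
  by (intro lebesgue_on_borel(2)) (simp_all add: mult.assoc)
 also have "\<dots> = (LBINT x:{a..b}. g x * \<phi> x)"
  unfolding set_lebesgue_integral_def
 proof (rule LBINT_cong)
  fix x show "indicator {a<..<b} x * (g x * \<phi> x) = indicator {a..b} x *\<^sub>R (g x * \<phi> x)"
   using z[of x] by (cases "x \<in> {a<..<b}") (auto simp: indicator_def)
 qed
 finally show ?thesis .
qed

lemma AC_integrable: "AC a b g g' \<Longrightarrow> set_integrable lborel {a..b} g" "AC a b g g' \<Longrightarrow> set_integrable lborel {a..b} g'"
 by (blast intro: borel_integrable_atLeastAtMost' AC_continuous) (simp add: AC_def)

lemma AC_test:
 assumes g: "AC a b g g'" and ab: "a \<le> b" and \<eta>: "\<And>x. (\<phi> has_real_derivative \<phi>' x) (at x)" and c: "continuous_on UNIV \<phi>'"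
  and z: "\<phi> a = 0" "\<phi> b = 0"
 shows "(LBINT x:{a..b}. g x * \<phi>' x) = - (LBINT x:{a..b}. g' x * \<phi> x)"
 using AC_by_parts[OF g order_refl ab order_refl, of \<phi> \<phi>'] \<eta> c z
 by (simp add: has_field_derivative_at_within continuous_on_subset[OF c])

lemma AC_weak_derivative:
 assumes g: "AC a b g g'" and ab: "a \<le> b"
 shows "weak_derivative a b g g'"
 unfolding weak_derivative_def
proof (intro conjI ballI locally_integrableI AC_integrable[OF g])
 fix \<eta> assume \<eta>: "\<eta> \<in> test_functions a b"
 have "(LINT x|lebesgue_on {a<..<b}. g x * deriv \<eta> x) = (LBINT x:{a..b}. g x * deriv \<eta> x)"
  by (rule Lint_test[OF set_integrable_borel[OF AC_integrable(1)[OF g]]]) (use test_fn_continuous012(2)[OF \<eta>] test_fn_zero012(2)[OF \<eta>] in auto)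
 also have "\<dots> = - (LBINT x:{a..b}. g' x * \<eta> x)"
  by (rule AC_test[OF g ab test_fn_DERIV01(1)[OF \<eta>] test_fn_continuous012(2)[OF \<eta>]]) (use test_fn_zero012(1)[OF \<eta>] in auto)
 also have "(LBINT x:{a..b}. g' x * \<eta> x) = (LINT x|lebesgue_on {a<..<b}. g' x * \<eta> x)"
  by (rule Lint_test[symmetric, OF set_integrable_borel[OF AC_integrable(2)[OF g]]]) (use test_fn_continuous012(1)[OF \<eta>] test_fn_zero012(1)[OF \<eta>] in auto)
 finally show "(LINT x|lebesgue_on {a<..<b}. g x * deriv \<eta> x) = - (LINT x|lebesgue_on {a<..<b}. g' x * \<eta> x)" .
qed

text \<open>The equation g'' = k + Q g, integrated by parts twice. It serves both
  \<open>is_L\<close> and the pairings at the final time.\<close>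

lemma AC_second_order:
 assumes g: "AC a b g g'" and g': "AC a b g' (\<lambda>x. k x + Q x * g x)" and ab: "a \<le> b"
  and k: "set_integrable lborel {a..b} k" and Q: "continuous_on {a..b} Q" and \<eta>: "\<eta> \<in> test_functions a b"
 shows "(LBINT x:{a..b}. g x * deriv (deriv \<eta>) x) = (LBINT x:{a..b}. k x * \<eta> x) + (LBINT x:{a..b}. Q x * g x * \<eta> x)"
proof -
 note c = test_fn_continuous012[OF \<eta>] and z = test_fn_zeros[OF \<eta>]
 have "(LBINT x:{a..b}. g x * deriv (deriv \<eta>) x) = - (LBINT x:{a..b}. g' x * deriv \<eta> x)"
  by (rule AC_test[OF g ab test_fn_DERIV01(2)[OF \<eta>] c(3)]) (use z(2) in auto)
 also have "(LBINT x:{a..b}. g' x * deriv \<eta> x) = - (LBINT x:{a..b}. (k x + Q x * g x) * \<eta> x)"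
  by (rule AC_test[OF g' ab test_fn_DERIV01(1)[OF \<eta>] c(2)]) (use z(1) in auto)
 also have "(LBINT x:{a..b}. (k x + Q x * g x) * \<eta> x) = (LBINT x:{a..b}. k x * \<eta> x + Q x * g x * \<eta> x)"
  by (simp only: distrib_right)
 also have "\<dots> = (LBINT x:{a..b}. k x * \<eta> x) + (LBINT x:{a..b}. Q x * g x * \<eta> x)"
  by (rule set_integral_add(2)) (intro set_integrable_mult_continuous k borel_integrable_atLeastAtMost' continuous_intros Q AC_continuous[OF g] c(1))+
 finally show ?thesis by simp
qed

lemma AC_is_L:
 assumes g: "AC a b g g'" and g': "AC a b g' (\<lambda>x. k x + Q x * g x)" and ab: "a \<le> b"
  and k: "set_integrable lborel {a..b} k" and Q: "continuous_on {a..b} Q" and qQ: "\<And>x. x \<in> {a<..<b} \<Longrightarrow> q x = Q x"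
 shows "is_L q a b g k"
 unfolding is_L_def
proof (intro conjI ballI)
 note gc = AC_continuous[OF g]
 have iQ: "set_integrable lborel {a..b} (\<lambda>x. Q x * g x)" by (intro borel_integrable_atLeastAtMost' continuous_intros Q gc)
 show "locally_integrable a b g" "locally_integrable a b k" by (rule locally_integrableI[OF AC_integrable(1)[OF g]] locally_integrableI[OF k])+
 show "locally_integrable a b (\<lambda>x. q x * g x)" by (rule locally_integrable_cong[OF locally_integrableI[OF iQ]]) (simp add: qQ)
 fix \<eta> assume \<eta>: "\<eta> \<in> test_functions a b"
 note c = test_fn_continuous012[OF \<eta>] and z = test_fn_zeros[OF \<eta>]
 have "(LINT x|lebesgue_on {a<..<b}. q x * g x * \<eta> x) = (LINT x|lebesgue_on {a<..<b}. Q x * g x * \<eta> x)"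
  by (intro LBINT_cong) (simp add: qQ)
 also have "\<dots> = (LBINT x:{a..b}. Q x * g x * \<eta> x)"
  by (rule Lint_test[OF set_integrable_borel[OF iQ] c(1) z(1)])
 finally have 1: "(LINT x|lebesgue_on {a<..<b}. q x * g x * \<eta> x) = (LBINT x:{a..b}. Q x * g x * \<eta> x)" .
 show "(LINT x|lebesgue_on {a<..<b}. k x * \<eta> x) =
    (LINT x|lebesgue_on {a<..<b}. g x * deriv (deriv \<eta>) x) - (LINT x|lebesgue_on {a<..<b}. q x * g x * \<eta> x)"
  using AC_second_order[OF g g' ab k Q \<eta>] 1 Lint_test[OF set_integrable_borel[OF k] c(1) z(1)]
   Lint_test[OF set_integrable_borel[OF AC_integrable(1)[OF g]] c(3) z(3)] by linarith
qed

lemma continuous_has_trace: "continuous_on {a..b} g \<Longrightarrow> has_trace a b g p (g p)"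
 unfolding has_trace_def by (intro exI[of _ g]) simp

lemma Sob0_L2:
 assumes "Sob 0 a b g" shows "g \<in> L2 a b"
proof -
 have m: "(\<lambda>x. indicator {a..b} x * g x) \<in> borel_measurable borel" using assms by auto
 have m': "(\<lambda>x. indicator {a<..<b} x * g x) \<in> borel_measurable borel"
  by (rule indicator_subset_measurable[OF m]) auto
 have e: "indicator {a<..<b} x * (g x)\<^sup>2 = (indicator {a<..<b} x * g x)\<^sup>2" for x by (auto simp: indicator_def)
 have m2: "(\<lambda>x. indicator {a<..<b} x * (g x)\<^sup>2) \<in> borel_measurable borel" unfolding e using m' by measurable
 have "integrable lborel (\<lambda>x. indicator {a<..<b} x * (g x)\<^sup>2)"
 proof (rule integrableI_bounded)
  have "(\<integral>\<^sup>+x. ennreal (norm (indicator {a<..<b} x * (g x)\<^sup>2)) \<partial>lborel) \<le> (\<integral>\<^sup>+x. ennreal (indicator {a..b} x * (g x)\<^sup>2) \<partial>lborel)"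
   by (intro nn_integral_mono ennreal_leI) (auto simp: indicator_def)
  also have "\<dots> < \<infinity>" using assms by simp
  finally show "(\<integral>\<^sup>+x. ennreal (norm (indicator {a<..<b} x * (g x)\<^sup>2)) \<partial>lborel) < \<infinity>" .
 qed (use m2 in simp)
 then show ?thesis using lebesgue_on_borel(1)[OF m'] lebesgue_on_borel(3)[OF m2] by (simp add: L2_def)
qed

lemma Sob_sobolev: "Sob k a b g \<Longrightarrow> a \<le> b \<Longrightarrow> g \<in> sobolev k a b"
proof (induction k arbitrary: g)
 case 0
 then show ?case using Sob0_L2[of a b g] by (auto simp: sobolev_def intro!: exI[of _ "\<lambda>i. g"])
next
 case (Suc k)
 obtain g' where g': "AC a b g g'" "Sob k a b g'" using Suc.prems by auto
 obtain D where D: "D 0 = g'" "\<And>i. i \<le> k \<Longrightarrow> D i \<in> L2 a b" "\<And>i. i < k \<Longrightarrow> weak_derivative a b (D i) (D (Suc i))"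
  using Suc.IH[OF g'(2) Suc.prems(2)] by (auto simp: sobolev_def)
 have g: "g \<in> L2 a b" by (rule Sob0_L2[OF continuous_Sob0[OF AC_continuous[OF g'(1)]]])
 note w = AC_weak_derivative[OF g'(1) Suc.prems(2)]
 show ?case unfolding sobolev_def
 proof (intro CollectI exI[of _ "case_nat g D"] conjI allI impI)
  fix i assume "i \<le> Suc k" then show "case_nat g D i \<in> L2 a b" using g D(2) by (cases i) auto
 next
  fix i assume "i < Suc k" then show "weak_derivative a b (case_nat g D i) (case_nat g D (Suc i))"
   using w D(1,3) by (cases i) auto
 qed simp
qed

section \<open>Functionals on the dual space of the first interval\<close>

lemma L2_mult_integrable:
 assumes "f \<in> L2 a b" "g \<in> L2 a b"
 shows "integrable (lebesgue_on {a<..<b}) (\<lambda>x. f x * g x)"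
proof (rule Bochner_Integration.integrable_bound)
 show "integrable (lebesgue_on {a<..<b}) (\<lambda>x. (f x)\<^sup>2 + (g x)\<^sup>2)" using assms by (auto simp: L2_def)
 show "(\<lambda>x. f x * g x) \<in> borel_measurable (lebesgue_on {a<..<b})" using assms by (auto simp: L2_def)
 have "\<bar>f x * g x\<bar> \<le> (f x)\<^sup>2 + (g x)\<^sup>2" for x
  using sum_squares_bound[of "\<bar>f x\<bar>" "\<bar>g x\<bar>"] mult_nonneg_nonneg[OF abs_ge_zero[of "f x"] abs_ge_zero[of "g x"]]
  by (simp only: abs_mult power2_abs)
 then show "AE x in lebesgue_on {a<..<b}. norm (f x * g x) \<le> norm ((f x)\<^sup>2 + (g x)\<^sup>2)" by simp
qed

lemma L2_add:
 assumes "f \<in> L2 a b" "g \<in> L2 a b" shows "(\<lambda>x. f x + g x) \<in> L2 a b"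
proof -
 have "integrable (lebesgue_on {a<..<b}) (\<lambda>x. ((f x)\<^sup>2 + (g x)\<^sup>2) + 2 * (f x * g x))"
  using assms L2_mult_integrable[OF assms] by (intro Bochner_Integration.integrable_add Bochner_Integration.integrable_mult_right) (auto simp: L2_def)
 moreover have "((f x)\<^sup>2 + (g x)\<^sup>2) + 2 * (f x * g x) = (f x + g x)\<^sup>2" for x by (simp add: power2_sum)
 ultimately show ?thesis using assms by (auto simp: L2_def)
qed

lemma L2_cmult: "f \<in> L2 a b \<Longrightarrow> (\<lambda>x. c * f x) \<in> L2 a b"
 by (auto simp: L2_def power_mult_distrib)

lemma L2_Cauchy_Schwarz:
 assumes f: "f \<in> L2 a b" and g: "g \<in> L2 a b"
 shows "\<bar>LINT x|lebesgue_on {a<..<b}. f x * g x\<bar> \<le> sqrt (LINT x|lebesgue_on {a<..<b}. (f x)\<^sup>2) * sqrt (LINT x|lebesgue_on {a<..<b}. (g x)\<^sup>2)"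
proof -
 define A B I where "A = (LINT x|lebesgue_on {a<..<b}. (f x)\<^sup>2)" and "B = (LINT x|lebesgue_on {a<..<b}. (g x)\<^sup>2)"
  and "I = (LINT x|lebesgue_on {a<..<b}. f x * g x)"
 have i: "integrable (lebesgue_on {a<..<b}) (\<lambda>x. (f x)\<^sup>2)" "integrable (lebesgue_on {a<..<b}) (\<lambda>x. (g x)\<^sup>2)"
  using f g by (auto simp: L2_def)
 note fg = L2_mult_integrable[OF f g]
 have q: "0 \<le> s\<^sup>2 * A + 2 * s * r * I + r\<^sup>2 * B" for s r
 proof -
  have "0 \<le> (LINT x|lebesgue_on {a<..<b}. (s * f x + r * g x)\<^sup>2)" by simp
  also have "\<dots> = (LINT x|lebesgue_on {a<..<b}. s\<^sup>2 * (f x)\<^sup>2 + 2 * s * r * (f x * g x) + r\<^sup>2 * (g x)\<^sup>2)"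
   by (intro LBINT_cong) (simp add: power2_eq_square algebra_simps)
  also have "\<dots> = s\<^sup>2 * A + 2 * s * r * I + r\<^sup>2 * B" using i fg by (simp add: A_def B_def I_def)
  finally show ?thesis .
 qed
 have AB: "A \<ge> 0" "B \<ge> 0" by (simp_all add: A_def B_def)
 have "I\<^sup>2 \<le> A * B"
 proof (cases "B = 0")
  case True
  have "I = 0"
  proof (rule ccontr)
   assume "I \<noteq> 0"
   \<comment> \<open>At this point the quadratic form takes the value -1.\<close>
   then show False using q[of 1 "- (A + 1) / (2 * I)"] True by (simp add: field_simps)
  qed
  then show ?thesis using AB by simp
 next
  case False
  have "0 \<le> B * (A * B - I\<^sup>2)" using q[of B "- I"] by (simp add: power2_eq_square algebra_simps)
  then show ?thesis using False AB(2) by (simp add: zero_le_mult_iff)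
 qed
 then have "sqrt (I\<^sup>2) \<le> sqrt (A * B)" by (rule real_sqrt_le_mono)
 then show ?thesis by (simp add: real_sqrt_mult A_def B_def I_def)
qed

lemma test_fn_AC: "\<eta> \<in> test_functions a b \<Longrightarrow> AC a b \<eta> (deriv \<eta>)"
proof -
 assume \<eta>: "\<eta> \<in> test_functions a b"
 have "(LBINT z:{x..y}. deriv \<eta> z) = \<eta> y - \<eta> x" if "x \<le> y" for x y
  by (rule Lint_FTC[OF that]) (auto intro: test_fn_DERIV01(1)[OF \<eta>] has_field_derivative_at_within test_fn_continuous012(2)[OF \<eta>])
 then show ?thesis unfolding AC_def by (auto intro: borel_integrable_atLeastAtMost' test_fn_continuous012(2)[OF \<eta>])
qed

lemma test_fn_L2: "\<eta> \<in> test_functions a b \<Longrightarrow> \<eta> \<in> L2 a b" "\<eta> \<in> test_functions a b \<Longrightarrow> deriv \<eta> \<in> L2 a b"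
 "\<eta> \<in> test_functions a b \<Longrightarrow> deriv (deriv \<eta>) \<in> L2 a b"
 by (intro Sob0_L2 continuous_Sob0 test_fn_continuous012; assumption)+

lemma weak_derivative_unique:
 assumes v: "v \<in> L2 a b" "weak_derivative a b g v" and w: "w \<in> L2 a b" "weak_derivative a b g w"
 shows "AE x in lebesgue_on {a<..<b}. v x = w x"
proof -
 have m1: "- 1 * w x = - w x" for x by simp
 have d: "(\<lambda>x. v x - w x) \<in> L2 a b" using L2_add[OF v(1) L2_cmult[OF w(1), of "- 1"]] unfolding m1 by simp
 obtain d' where d': "d' \<in> borel_measurable borel" "\<And>x. x \<notin> {a<..<b} \<Longrightarrow> d' x = 0"
  "AE x in lborel. x \<in> {a<..<b} \<longrightarrow> d' x = v x - w x" "integrable lborel (\<lambda>x. (d' x)\<^sup>2)"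
  by (rule L2_borel_version[OF d]) blast
 have ae: "AE x in lebesgue_on {a<..<b}. d' x = v x - w x" by (rule AE_lebesgue_on[OF _ d'(3)]) simp
 have "AE x in lborel. d' x = 0"
 proof (rule AE_zero_of_test_functions[where a=a and b=b])
  have o: "(\<lambda>x. 1 :: real) \<in> L2 a b" by (intro Sob0_L2 continuous_Sob0) simp
  have m: "(\<lambda>x. indicator {a<..<b} x * d' x) \<in> borel_measurable borel" using d'(1) by simp
  have "integrable (lebesgue_on {a<..<b}) (\<lambda>x. v x - w x)" using L2_mult_integrable[OF d o] by simp
  then have "integrable (lebesgue_on {a<..<b}) d'"
   by (rule Bochner_Integration.integrable_cong_AE_imp) (use ae lebesgue_on_borel(1)[OF m] in auto)
  moreover have "(\<lambda>x. indicator {a<..<b} x * d' x) = d'" using d'(2) by (auto simp: indicator_def fun_eq_iff)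
  ultimately show "integrable lborel d'" using lebesgue_on_borel(3)[OF m] by simp
  fix \<eta> assume \<eta>: "\<eta> \<in> test_functions a b"
  have m2: "(\<lambda>x. indicator {a<..<b} x * (d' x * \<eta> x)) \<in> borel_measurable borel"
   using d'(1) borel_measurable_continuous_onI[OF test_fn_continuous012(1)[OF \<eta>]] by simp
  have "(\<lambda>x. indicator {a<..<b} x * (d' x * \<eta> x)) = (\<lambda>x. d' x * \<eta> x)" using d'(2) by (auto simp: indicator_def fun_eq_iff)
  then have "(LBINT x. d' x * \<eta> x) = (LINT x|lebesgue_on {a<..<b}. d' x * \<eta> x)"
   using lebesgue_on_borel(2)[OF m2] by simp
  also have "\<dots> = (LINT x|lebesgue_on {a<..<b}. v x * \<eta> x - w x * \<eta> x)"
  proof (rule integral_cong_AE)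
   show "AE x in lebesgue_on {a<..<b}. d' x * \<eta> x = v x * \<eta> x - w x * \<eta> x"
    using ae by eventually_elim (simp add: left_diff_distrib)
   show "(\<lambda>x. v x * \<eta> x - w x * \<eta> x) \<in> borel_measurable (lebesgue_on {a<..<b})"
    using v w test_fn_L2(1)[OF \<eta>] by (auto simp: L2_def)
  qed (use lebesgue_on_borel(1)[OF m2] in simp)
  also have "\<dots> = (LINT x|lebesgue_on {a<..<b}. v x * \<eta> x) - (LINT x|lebesgue_on {a<..<b}. w x * \<eta> x)"
   by (intro Bochner_Integration.integral_diff L2_mult_integrable v w test_fn_L2(1)[OF \<eta>])
  also have "\<dots> = 0"
  proof -
   have "(LINT x|lebesgue_on {a<..<b}. g x * deriv \<eta> x) = - (LINT x|lebesgue_on {a<..<b}. v x * \<eta> x)"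
    "(LINT x|lebesgue_on {a<..<b}. g x * deriv \<eta> x) = - (LINT x|lebesgue_on {a<..<b}. w x * \<eta> x)"
    using v(2) w(2) \<eta> unfolding weak_derivative_def by blast+
   then show ?thesis by linarith
  qed
  finally show "(LBINT x. d' x * \<eta> x) = 0" .
 qed (use d'(2) in auto)
 then have "AE x in lborel. x \<in> {a<..<b} \<longrightarrow> d' x = 0" by eventually_elim simp
 then have "AE x in lebesgue_on {a<..<b}. d' x = 0" by (rule AE_lebesgue_on[rotated]) simp
 with ae show ?thesis by eventually_elim simp
qed

lemma weak_derivative_add:
 assumes "v \<in> L2 a b" "v' \<in> L2 a b" "w \<in> L2 a b" "w' \<in> L2 a b" "weak_derivative a b v v'" "weak_derivative a b w w'"
 shows "weak_derivative a b (\<lambda>x. v x + w x) (\<lambda>x. v' x + w' x)"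
 unfolding weak_derivative_def
proof (intro conjI ballI)
 show "locally_integrable a b (\<lambda>x. v x + w x)" "locally_integrable a b (\<lambda>x. v' x + w' x)"
  using assms(5,6) by (auto simp: weak_derivative_def locally_integrable_def)
 fix \<eta> assume \<eta>: "\<eta> \<in> test_functions a b"
 note i = L2_mult_integrable[OF assms(1) test_fn_L2(2)[OF \<eta>]] L2_mult_integrable[OF assms(3) test_fn_L2(2)[OF \<eta>]]
  L2_mult_integrable[OF assms(2) test_fn_L2(1)[OF \<eta>]] L2_mult_integrable[OF assms(4) test_fn_L2(1)[OF \<eta>]]
 show "(LINT x|lebesgue_on {a<..<b}. (v x + w x) * deriv \<eta> x) = - (LINT x|lebesgue_on {a<..<b}. (v' x + w' x) * \<eta> x)"
  using assms(5,6) \<eta> by (simp add: distrib_right i weak_derivative_def)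
qed

lemma weak_derivative_cmult:
 assumes "weak_derivative a b v v'"
 shows "weak_derivative a b (\<lambda>x. c * v x) (\<lambda>x. c * v' x)"
 using assms by (auto simp: weak_derivative_def locally_integrable_def mult.assoc)

text \<open>The distribution g' - p extends from test functions to all functions with a square
  integrable weak derivative, once one derivative is left on the argument. The weak derivative is
  picked by choice; its uniqueness makes the functional linear.\<close>

lemma H1_left_dual_ex:
 assumes g: "g \<in> L2 a b" and p: "p \<in> L2 a b" and ab: "a \<le> b"
 shows "\<exists>F\<in>H1_left_dual a b. \<forall>\<eta>\<in>test_functions a b.
  F \<eta> = - (LINT x|lebesgue_on {a<..<b}. g x * deriv \<eta> x) - (LINT x|lebesgue_on {a<..<b}. p x * \<eta> x)"
proof -
 let ?M = "lebesgue_on {a<..<b}"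
 define D where "D = (\<lambda>w. SOME w'. w' \<in> L2 a b \<and> weak_derivative a b w w')"
 define F where "F = (\<lambda>w. - (LINT x|?M. g x * D w x) - (LINT x|?M. p x * w x))"
 have D: "w \<in> L2 a b" "D w \<in> L2 a b" "weak_derivative a b w (D w)" if "w \<in> H1_left a b" for w
 proof -
  have "w \<in> sobolev 1 a b" using that by (simp only: H1_left_def mem_Collect_eq)
  then have "\<exists>D :: nat \<Rightarrow> real \<Rightarrow> real. D 0 = w \<and> (\<forall>i\<le>1. D i \<in> L2 a b) \<and> (\<forall>i<1. weak_derivative a b (D i) (D (Suc i)))"
   unfolding sobolev_def mem_Collect_eq .
  then obtain E :: "nat \<Rightarrow> real \<Rightarrow> real" where "E 0 = w \<and> (\<forall>i\<le>1. E i \<in> L2 a b) \<and> (\<forall>i<1. weak_derivative a b (E i) (E (Suc i)))"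
   by (rule exE)
  note E = this[THEN conjunct1] this[THEN conjunct2, THEN conjunct1] this[THEN conjunct2, THEN conjunct2]
  have "E 1 \<in> L2 a b \<and> weak_derivative a b w (E 1)" using E(1,2) E(3)[rule_format, of 0] by auto
  then have "D w \<in> L2 a b \<and> weak_derivative a b w (D w)" unfolding D_def by (rule someI[of "\<lambda>w'. w' \<in> L2 a b \<and> weak_derivative a b w w'"])
  then show "D w \<in> L2 a b" "weak_derivative a b w (D w)" by auto
  show "w \<in> L2 a b" using E(1,2) by auto
 qed
 have FD: "F w = - (LINT x|?M. g x * w' x) - (LINT x|?M. p x * w x)"
  if "w' \<in> L2 a b" "weak_derivative a b w w'" for w w'
 proof -
  have "D w \<in> L2 a b \<and> weak_derivative a b w (D w)" unfolding D_def by (rule someI[of _ w']) (use that in simp)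
  then have Dw: "D w \<in> L2 a b" "weak_derivative a b w (D w)" by auto
  have "(LINT x|?M. g x * D w x) = (LINT x|?M. g x * w' x)"
  proof (rule integral_cong_AE)
   show "AE x in ?M. g x * D w x = g x * w' x"
    using weak_derivative_unique[OF Dw that] by eventually_elim simp
  qed (use L2_mult_integrable[OF g] Dw that in auto)
  then show ?thesis by (simp add: F_def)
 qed
 have "F \<in> H1_left_dual a b"
  unfolding H1_left_dual_def
 proof (intro CollectI conjI ballI allI exI impI)
  fix v w assume v: "v \<in> H1_left a b" and w: "w \<in> H1_left a b"
  note i = L2_mult_integrable[OF g D(2)[OF v]] L2_mult_integrable[OF g D(2)[OF w]] L2_mult_integrable[OF p D(1)[OF v]] L2_mult_integrable[OF p D(1)[OF w]]
  show "F (\<lambda>x. v x + w x) = F v + F w"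
   by (subst FD[OF L2_add[OF D(2)[OF v] D(2)[OF w]] weak_derivative_add[OF D(1,2)[OF v] D(1,2)[OF w] D(3)[OF v] D(3)[OF w]]])
    (simp add: F_def distrib_left i)
 next
  fix c v assume v: "v \<in> H1_left a b"
  show "F (\<lambda>x. c * v x) = c * F v"
   by (subst FD[OF L2_cmult[OF D(2)[OF v]] weak_derivative_cmult[OF D(3)[OF v]]])
    (simp add: F_def mult.left_commute right_diff_distrib)
 next
  fix v v' assume v: "v \<in> H1_left a b" and v': "v' \<in> L2 a b" and w: "weak_derivative a b v v'"
  define X Y G P where "X = (LINT x|?M. (v x)\<^sup>2)" and "Y = (LINT x|?M. (v' x)\<^sup>2)"
   and "G = (LINT x|?M. (g x)\<^sup>2)" and "P = (LINT x|?M. (p x)\<^sup>2)"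
  have 0: "X \<ge> 0" "Y \<ge> 0" "G \<ge> 0" "P \<ge> 0" by (simp_all add: X_def Y_def G_def P_def)
  have "\<bar>F v\<bar> \<le> \<bar>LINT x|?M. g x * v' x\<bar> + \<bar>LINT x|?M. p x * v x\<bar>" unfolding FD[OF v' w] by linarith
  also have "\<dots> \<le> sqrt G * sqrt Y + sqrt P * sqrt X"
   unfolding X_def Y_def G_def P_def by (intro add_mono L2_Cauchy_Schwarz g p v' D(1)[OF v])
  also have "\<dots> \<le> sqrt G * sqrt (X + Y) + sqrt P * sqrt (X + Y)"
   using 0 by (intro add_mono mult_left_mono real_sqrt_le_mono) auto
  finally show "\<bar>F v\<bar> \<le> (sqrt G + sqrt P) * sqrt (X + Y)" by (simp add: distrib_right)
 qed
 moreover have "F \<eta> = - (LINT x|?M. g x * deriv \<eta> x) - (LINT x|?M. p x * \<eta> x)" if \<eta>: "\<eta> \<in> test_functions a b" for \<eta>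
  by (rule FD[OF test_fn_L2(2)[OF \<eta>] AC_weak_derivative[OF test_fn_AC[OF \<eta>] ab]])
 ultimately show ?thesis by blast
qed

section \<open>Regularity at the final time\<close>

lemma AC_cong_deriv:
 assumes f: "AC a b g g'" and e: "AE x in lborel. x \<in> {a..b} \<longrightarrow> g' x = h' x"
  and m: "(\<lambda>x. indicator {a..b} x * h' x) \<in> borel_measurable borel"
 shows "AC a b g h'"
proof -
 have eq: "(LBINT z:{x..y}. g' z) = (LBINT z:{x..y}. h' z)" if "a \<le> x" "y \<le> b" for x y
  unfolding set_lebesgue_integral_def real_scaleR_def
 proof (rule integral_cong_AE)
  show "AE z in lborel. indicator {x..y} z * g' z = indicator {x..y} z * h' z"
   using e by eventually_elim (use that in \<open>auto simp: indicator_def\<close>)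
  have "{x..y} \<subseteq> {a..b}" using that by auto
  then show "(\<lambda>z. indicator {x..y} z * g' z) \<in> borel_measurable lborel" "(\<lambda>z. indicator {x..y} z * h' z) \<in> borel_measurable lborel"
   using indicator_subset_measurable[OF m, of "{x..y}"] indicator_subset_measurable[OF set_integrable_borel[OF AC_integrable(2)[OF f]], of "{x..y}"] by simp_all
 qed
 have "integrable lborel (\<lambda>x. indicator {a..b} x * h' x)"
 proof (rule Bochner_Integration.integrable_cong_AE_imp)
  show "integrable lborel (\<lambda>x. indicator {a..b} x * g' x)" using AC_integrable(2)[OF f] by (simp add: set_integrable_def)
  show "AE x in lborel. indicator {a..b} x * g' x = indicator {a..b} x * h' x"
   using e by eventually_elim (auto simp: indicator_def)
 qed (use m in simp)
 then show ?thesis using f eq by (simp add: AC_def set_integrable_def)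
qed

lemma set_integrable_uminus: "set_integrable lborel S f \<Longrightarrow> set_integrable lborel S (\<lambda>x. - f x :: real)"
 unfolding set_integrable_def scaleR_minus_right by (rule Bochner_Integration.integrable_minus)

lemma reflect_AC: "f \<in> L2c \<Longrightarrow> AC a b (\<lambda>z. Jt f (c - z)) (\<lambda>z. - f (c - z))"
 unfolding AC_def
 by (intro conjI allI impI set_integrable_uminus integrable_reflect) (simp_all only: Jt_reflect Lint_minus)

lemma translate_AC: "f \<in> L2c \<Longrightarrow> AC a b (\<lambda>z. Jt f (c + z)) (\<lambda>z. f (c + z))"
 unfolding AC_def by (intro conjI allI impI integrable_translate) (simp_all only: Jt_translate)

lemma Sob0_affine:
 assumes f: "f \<in> L2c" and c: "c = 1 \<or> c = - 1"
 shows "Sob 0 a b (\<lambda>z. f (d + c * z))"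
proof -
 note [measurable] = L2cD(1)[OF f]
 define n where "n = max (d + c * a) (d + c * b)"
 have "(\<integral>\<^sup>+z. ennreal (indicator {a..b} z * (f (d + c * z))\<^sup>2) \<partial>lborel) \<le> (\<integral>\<^sup>+z. ennreal (indicator {..n} (d + c * z) * (f (d + c * z))\<^sup>2) \<partial>lborel)"
  by (intro nn_integral_mono ennreal_leI) (use c in \<open>auto simp: indicator_def n_def\<close>)
 also have "\<dots> = (\<integral>\<^sup>+t. ennreal (indicator {..n} t * (f t)\<^sup>2) \<partial>lborel)"
  using nn_integral_real_affine[of "\<lambda>t. ennreal (indicator {..n} t * (f t)\<^sup>2)" c d] c by auto
 also have "\<dots> < \<infinity>" by (rule L2cD(3)[OF f])
 finally show ?thesis by simp
qed

lemma Qc_J_shift_integrable: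
 assumes W: "W \<in> Qc \<alpha> \<beta>" and ab: "\<alpha> \<le> \<beta>" and k: "\<kappa> \<in> borel_measurable borel" "\<And>x. \<bar>\<kappa> x\<bar> \<le> 1"
 shows "integrable lborel (\<lambda>x. \<kappa> x * Jt (W x) (T - \<bar>x - z\<bar>))"
proof -
 note Qc_measurable[OF Jt_Qc[OF W], measurable (raw)]
 note [measurable] = k(1)
 have m: "(\<lambda>x. \<kappa> x * Jt (W x) (T - \<bar>x - z\<bar>)) \<in> borel_measurable lborel" by measurable
 show ?thesis
 proof (rule integrableI_bounded[OF m])
  have "(\<integral>\<^sup>+x. ennreal (norm (\<kappa> x * Jt (W x) (T - \<bar>x - z\<bar>))) \<partial>lborel) \<le> (\<integral>\<^sup>+x. \<integral>\<^sup>+s. ennreal (indicator {..T} s * \<bar>1 * W x (s - \<bar>x - z\<bar>)\<bar>) \<partial>lborel \<partial>lborel)"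
  proof (rule nn_integral_mono)
   fix x
   have L: "(\<lambda>s. W x (s - \<bar>x - z\<bar>)) \<in> L2c" by (rule L2c_shift[OF QcD(1)[OF W]]) simp
   have "ennreal (norm (\<kappa> x * Jt (W x) (T - \<bar>x - z\<bar>))) \<le> ennreal \<bar>Jt (\<lambda>s. W x (s - \<bar>x - z\<bar>)) T\<bar>"
    using mult_right_mono[OF k(2)[of x], of "\<bar>Jt (W x) (T - \<bar>x - z\<bar>)\<bar>"] by (intro ennreal_leI) (simp add: Jt_shift abs_mult)
   also have "\<dots> \<le> (\<integral>\<^sup>+s. ennreal (indicator {..T} s * \<bar>1 * W x (s - \<bar>x - z\<bar>)\<bar>) \<partial>lborel)"
    using integral_norm_bound_ennreal[OF L2c_set_integrable[OF L, of T, unfolded set_integrable_def]]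
    by (simp add: Jt_def set_lebesgue_integral_def abs_mult)
   finally show "ennreal (norm (\<kappa> x * Jt (W x) (T - \<bar>x - z\<bar>))) \<le> (\<integral>\<^sup>+s. ennreal (indicator {..T} s * \<bar>1 * W x (s - \<bar>x - z\<bar>)\<bar>) \<partial>lborel)" .
  qed
  also have "\<dots> < \<infinity>" by (rule Sdata.nn_L1[OF W ab])
  finally show "(\<integral>\<^sup>+x. ennreal (norm (\<kappa> x * Jt (W x) (T - \<bar>x - z\<bar>))) \<partial>lborel) < \<infinity>" .
 qed
qed

text \<open>Differentiation in the vertex z removes the \<open>Jt\<close> and brings in the sign of
  \<open>cone_AC\<close>.\<close>

lemma Sop_AC:
 assumes W: "W \<in> Qc \<alpha> \<beta>" and ab: "\<alpha> \<le> \<beta>"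
 shows "AC a b (\<lambda>z. Sop z (\<lambda>x. Jt (W x)) T) (\<lambda>z. - Top z W T)"
proof -
 have \<kappa>: "(\<lambda>(x, z). sgn (z - x) :: real) \<in> borel_measurable (borel \<Otimes>\<^sub>M borel)" unfolding case_prod_unfold by measurable
 have k1: "\<bar>sgn (z - x) :: real\<bar> \<le> 1" for x z by (simp add: abs_sgn_eq)
 note sw = cone_swap[OF W ab \<kappa> k1]
 have i: "integrable lborel (\<lambda>x. 1 * Jt (W x) (T - \<bar>x - z\<bar>))" for z
  by (rule Qc_J_shift_integrable[OF W ab]) auto
 have T: "Top z W T = (LBINT x. sgn (z - x) * W x (T - \<bar>x - z\<bar>))" for z by (simp add: Top_def Pop_def)
 have "Sop y (\<lambda>x. Jt (W x)) T - Sop x (\<lambda>x. Jt (W x)) T = (LBINT z:{x..y}. - Top z W T)" if "x \<le> y" for x y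
 proof -
  have "Sop y (\<lambda>x. Jt (W x)) T - Sop x (\<lambda>x. Jt (W x)) T = (LBINT r. 1 * Jt (W r) (T - \<bar>r - y\<bar>) - 1 * Jt (W r) (T - \<bar>r - x\<bar>))"
   unfolding Sop_def Pop_def by (rule Bochner_Integration.integral_diff[OF i i, symmetric])
  also have "\<dots> = (LBINT r. - (LBINT z:{x..y}. sgn (z - r) * W r (T - \<bar>r - z\<bar>)))"
   by (intro LBINT_cong) (simp only: mult_1 cone_AC(1)[OF QcD(1)[OF W] that])
  also have "\<dots> = - (LBINT r. (LBINT z:{x..y}. sgn (z - r) * W r (T - \<bar>r - z\<bar>)))"
   by (rule Bochner_Integration.integral_minus)
  also have "\<dots> = - (LBINT z:{x..y}. Top z W T)" unfolding sw(1) T ..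
  finally show ?thesis by (simp only: Lint_minus)
 qed
 moreover have "set_integrable lborel {a..b} (\<lambda>z. - Top z W T)" unfolding T by (rule set_integrable_uminus[OF sw(3)])
 ultimately show ?thesis by (auto simp: AC_def)
qed

text \<open>When the vertex passes x the sign jumps, which contributes
  \<open>2 * Jt (W z) T\<close>; away from the jump the two signs cancel and \<open>Sop\<close>
  returns.\<close>

lemma Top_AC:
 assumes W: "W \<in> Qc \<alpha> \<beta>" and ab: "\<alpha> \<le> \<beta>"
 shows "AC a b (\<lambda>z. Top z (\<lambda>x. Jt (W x)) T) (\<lambda>z. 2 * Jt (W z) T - Sop z W T)"
proof -
 have \<kappa>: "(\<lambda>(x, z). 1 :: real) \<in> borel_measurable (borel \<Otimes>\<^sub>M borel)" by simp
 have k1: "\<bar>1 :: real\<bar> \<le> 1" by simp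
 note sw = cone_swap[OF W ab \<kappa> k1]
 have i: "integrable lborel (\<lambda>x. sgn (z - x) * Jt (W x) (T - \<bar>x - z\<bar>))" for z
  by (rule Qc_J_shift_integrable[OF W ab]) (auto simp: abs_sgn_eq)
 have S: "Sop z W T = (LBINT x. 1 * W x (T - \<bar>x - z\<bar>))" for z by (simp add: Sop_def Pop_def)
 have iJ: "integrable lborel (\<lambda>x. Jt (W x) T)" by (rule Qc_Jt_integrable[OF W ab])
 have iJs: "set_integrable lborel {x..y} (\<lambda>z. 2 * Jt (W z) T)" for x y
  unfolding set_integrable_def by (rule integrable_mult_indicator) (use iJ in auto)
 have iS: "set_integrable lborel {x..y} (\<lambda>z. Sop z W T)" for x y unfolding S by (rule sw(3))
 have "Top y (\<lambda>x. Jt (W x)) T - Top x (\<lambda>x. Jt (W x)) T = (LBINT z:{x..y}. 2 * Jt (W z) T - Sop z W T)" if "x \<le> y" for x y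
 proof -
  have ij: "integrable lborel (\<lambda>r. 2 * (indicator {x..y} r * Jt (W r) T))"
   using integrable_mult_indicator[of "{x..y}" lborel "\<lambda>r. Jt (W r) T"] iJ by simp
  have "Top y (\<lambda>x. Jt (W x)) T - Top x (\<lambda>x. Jt (W x)) T = (LBINT r. sgn (y - r) * Jt (W r) (T - \<bar>r - y\<bar>) - sgn (x - r) * Jt (W r) (T - \<bar>r - x\<bar>))"
   unfolding Top_def Pop_def by (rule Bochner_Integration.integral_diff[OF i i, symmetric])
  also have "\<dots> = (LBINT r. 2 * (indicator {x..y} r * Jt (W r) T) - (LBINT z:{x..y}. 1 * W r (T - \<bar>r - z\<bar>)))"
  proof (rule integral_cong_AE)
   \<comment> \<open>At these two points a sign is 0, and the jump formula excludes them.\<close>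
   have "AE r in lborel. r \<noteq> x" "AE r in lborel. r \<noteq> y" by (rule AE_lborel_singleton)+
   then show "AE r in lborel. sgn (y - r) * Jt (W r) (T - \<bar>r - y\<bar>) - sgn (x - r) * Jt (W r) (T - \<bar>r - x\<bar>) =
     2 * (indicator {x..y} r * Jt (W r) T) - (LBINT z:{x..y}. 1 * W r (T - \<bar>r - z\<bar>))"
   proof eventually_elim
    case (elim r)
    show ?case using cone_AC(2)[OF QcD(1)[OF W] that elim] by (simp only: mult_1)
   qed
   show "(\<lambda>r. sgn (y - r) * Jt (W r) (T - \<bar>r - y\<bar>) - sgn (x - r) * Jt (W r) (T - \<bar>r - x\<bar>)) \<in> borel_measurable lborel"
    by (intro borel_measurable_diff borel_measurable_integrable i)
   show "(\<lambda>r. 2 * (indicator {x..y} r * Jt (W r) T) - (LBINT z:{x..y}. 1 * W r (T - \<bar>r - z\<bar>))) \<in> borel_measurable lborel"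
    by (intro borel_measurable_diff borel_measurable_integrable ij sw(2))
  qed
  also have "\<dots> = (LBINT r. 2 * (indicator {x..y} r * Jt (W r) T)) - (LBINT r. (LBINT z:{x..y}. 1 * W r (T - \<bar>r - z\<bar>)))"
   by (rule Bochner_Integration.integral_diff[OF ij sw(2)])
  also have "(LBINT r. (LBINT z:{x..y}. 1 * W r (T - \<bar>r - z\<bar>))) = (LBINT z:{x..y}. Sop z W T)"
   unfolding sw(1) S ..
  also have "(LBINT r. 2 * (indicator {x..y} r * Jt (W r) T)) = (LBINT z:{x..y}. 2 * Jt (W z) T)"
   unfolding set_lebesgue_integral_def by (intro LBINT_cong) simp
  also have "(LBINT z:{x..y}. 2 * Jt (W z) T) - (LBINT z:{x..y}. Sop z W T) = (LBINT z:{x..y}. 2 * Jt (W z) T - Sop z W T)"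
   by (rule set_integral_diff(2)[symmetric, OF iJs iS])
  finally show ?thesis .
 qed
 then show ?thesis using set_integral_diff(1)[OF iJs iS] by (auto simp: AC_def)
qed

text \<open>Seen from an end, the whole interval lies on one side, so the sign is constant.\<close>

lemma Top_alpha:
 assumes W: "W \<in> Qc \<alpha> \<beta>"
 shows "Top \<alpha> W T = - Sop \<alpha> W T" "Top \<beta> W T = Sop \<beta> W T"
proof -
 note Qc_measurable[OF W, measurable (raw)]
 have ae: "AE x in lborel. x \<noteq> \<alpha>" "AE x in lborel. x \<noteq> \<beta>" by (rule AE_lborel_singleton)+
 have z: "W x t = 0" if "x \<notin> {\<alpha>..\<beta>}" for x t using QcD(2)[OF W that] by simp
 have "(LBINT x. sgn (\<alpha> - x) * W x (T - \<bar>x - \<alpha>\<bar>)) = (LBINT x. - (1 * W x (T - \<bar>x - \<alpha>\<bar>)))"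
 proof (rule integral_cong_AE)
  show "AE x in lborel. sgn (\<alpha> - x) * W x (T - \<bar>x - \<alpha>\<bar>) = - (1 * W x (T - \<bar>x - \<alpha>\<bar>))"
   using ae(1) by eventually_elim (use z in \<open>auto simp: sgn_real_def\<close>)
 qed measurable
 then show "Top \<alpha> W T = - Sop \<alpha> W T" by (simp add: Top_def Sop_def Pop_def)
 have "(LBINT x. sgn (\<beta> - x) * W x (T - \<bar>x - \<beta>\<bar>)) = (LBINT x. 1 * W x (T - \<bar>x - \<beta>\<bar>))"
 proof (rule integral_cong_AE)
  show "AE x in lborel. sgn (\<beta> - x) * W x (T - \<bar>x - \<beta>\<bar>) = 1 * W x (T - \<bar>x - \<beta>\<bar>)"
   using ae(2) by eventually_elim (use z in \<open>auto simp: sgn_real_def\<close>)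
 qed measurable
 then show "Top \<beta> W T = Sop \<beta> W T" by (simp add: Top_def Sop_def Pop_def)
qed

text \<open>The relation is known for almost every t < T only. At least one further integration
  carries it to T, whence the powers \<open>Suc k\<close>.\<close>

lemma char_at_T:
 assumes L: "f \<in> L2c" "A \<in> L2c" "B \<in> L2c" "S \<in> L2c" and cd: "c \<ge> 0" "d \<ge> 0"
  and e: "AE t in lborel. t < T \<longrightarrow> f t = A (t - c) + B (t - d) - Jt S t"
 shows "(Jt ^^ Suc k) f T = (Jt ^^ Suc k) A (T - c) + (Jt ^^ Suc k) B (T - d) - (Jt ^^ Suc (Suc k)) S T"
proof -
 have sh: "(\<lambda>t. A (t - c)) \<in> L2c" "(\<lambda>t. B (t - d)) \<in> L2c" using cd by (auto intro: L2c_shift L)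
 have R: "(\<lambda>t. A (t - c) + B (t - d) - Jt S t) \<in> L2c" by (intro L2c_diff L2c_add sh Jt_L2c L)
 have "Jt ((Jt ^^ k) f) T = Jt ((Jt ^^ k) (\<lambda>t. A (t - c) + B (t - d) - Jt S t)) T"
  by (rule Jt_cong_AE[OF Jt_pow_L2c[OF L(1)] Jt_pow_L2c[OF R] Jt_pow_cong_AE[OF L(1) R e] order_refl])
 also have "\<dots> = (Jt ^^ Suc k) (\<lambda>t. A (t - c) + B (t - d) - Jt S t) T" by simp
 also have "(Jt ^^ Suc k) (\<lambda>t. A (t - c) + B (t - d) - Jt S t) = (\<lambda>t. (Jt ^^ Suc k) A (t - c) + (Jt ^^ Suc k) B (t - d) - (Jt ^^ Suc k) (Jt S) t)"
  by (simp only: Jt_pow_diff[OF L2c_add[OF sh] Jt_L2c[OF L(4)]] Jt_pow_add[OF sh] Jt_pow_shift)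
 finally show ?thesis by (simp only: funpow.simps o_apply Jt_pow_Suc)
qed

lemma half_eq: "2 * x = y \<Longrightarrow> x = 1 / 2 * (y :: real)"
 by simp

lemma half_eqs:
 fixes h p q s :: real
 shows "2 * h = p + q - s \<Longrightarrow> 1 / 2 * (p + q - s) = h"
  "2 * h = p + q - s \<Longrightarrow> 1 / 2 * (- p + q + - s) = h - p"
  "2 * h = p + q - s \<Longrightarrow> 1 / 2 * (- p + q + s) = q - h"
 by simp_all

context char_data
begin

text \<open>\<open>GG m\<close> is \<open>(Jt ^^ m) v\<close> at time \<open>T\<close> and \<open>gg m\<close> is its derivative: a derivative in space costs one
 integration in time.\<close>

definition GG :: "nat \<Rightarrow> real \<Rightarrow> real" where
 "GG m z = 1 / 2 * ((Jt ^^ m) A ((T + \<alpha>) - z) + (Jt ^^ m) B ((T - \<beta>) + z) - Sop z (\<lambda>x. (Jt ^^ Suc m) (qv x)) T)"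

definition gg :: "nat \<Rightarrow> real \<Rightarrow> real" where
 "gg m z = 1 / 2 * (- (Jt ^^ (m - 1)) A ((T + \<alpha>) - z) + (Jt ^^ (m - 1)) B ((T - \<beta>) + z) + Top z (\<lambda>x. (Jt ^^ m) (qv x)) T)"

lemma SopL: "Sop z qv \<in> L2c"
 by (rule Sop_L2c[OF qv ab'])

lemma Jt_pow_Sopqv: "(Jt ^^ k) (Sop z qv) T = Sop z (\<lambda>x. (Jt ^^ k) (qv x)) T"
 by (simp only: Jt_pow_Sop[OF qv ab'])

lemma GG_AC: "AC \<alpha> \<beta> (GG (Suc k)) (gg (Suc k))"
proof -
 have "AC \<alpha> \<beta> (\<lambda>z. 1 / 2 * (Jt ((Jt ^^ k) A) ((T + \<alpha>) - z) + Jt ((Jt ^^ k) B) ((T - \<beta>) + z) - Sop z (\<lambda>x. Jt ((Jt ^^ Suc k) (qv x))) T))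
   (\<lambda>z. 1 / 2 * (- (Jt ^^ k) A ((T + \<alpha>) - z) + (Jt ^^ k) B ((T - \<beta>) + z) - (- Top z (\<lambda>x. (Jt ^^ Suc k) (qv x)) T)))"
  by (intro AC_cmult AC_diff AC_add reflect_AC translate_AC Jt_pow_L2c L Sop_AC[OF Jt_pow_Qc[OF qv] ab'])
 then show ?thesis by (simp add: GG_def[abs_def] gg_def[abs_def])
qed

lemma v_at_T: "AE z in lborel. z \<in> {\<alpha><..<\<beta>} \<longrightarrow> (Jt ^^ Suc k) (v z) T = GG (Suc k) z"
 using Fv
proof eventually_elim
 case (elim z)
 show ?case
 proof
  assume z: "z \<in> {\<alpha><..<\<beta>}"
  have "AE t in lborel. t < T \<longrightarrow> 2 * v z t = A (t - (z - \<alpha>)) + B (t - (\<beta> - z)) - Jt (Sop z qv) t"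
   using elim unfolding qv_eq by eventually_elim (use z in auto)
  from char_at_T[OF L2c_cmult[OF QcD(1)[OF v]] L(3,4) SopL _ _ this, of k] z
  have "2 * (Jt ^^ Suc k) (v z) T = (Jt ^^ Suc k) A (T - (z - \<alpha>)) + (Jt ^^ Suc k) B (T - (\<beta> - z)) - (Jt ^^ Suc (Suc k)) (Sop z qv) T"
   by (simp only: Jt_pow_cmult) simp
  moreover have "T - (z - \<alpha>) = (T + \<alpha>) - z" "T - (\<beta> - z) = (T - \<beta>) + z" by simp_all
  ultimately show "(Jt ^^ Suc k) (v z) T = GG (Suc k) z" unfolding GG_def by (intro half_eq) (simp only: Jt_pow_Sopqv)
 qed
qed

text \<open>For m = 0 the waves enter without integration and only square integrability is left; for
  larger m the function is continuous.\<close>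

lemma GG_Sob0: "Sob 0 \<alpha> \<beta> (GG m)"
proof (cases m)
 case 0
 have 1: "Sob 0 \<alpha> \<beta> (\<lambda>z. A ((T + \<alpha>) - z))" using Sob0_affine[OF L(3), of "- 1"] by simp
 have 2: "Sob 0 \<alpha> \<beta> (\<lambda>z. B ((T - \<beta>) + z))" using Sob0_affine[OF L(4), of 1] by simp
 have 3: "Sob 0 \<alpha> \<beta> (\<lambda>z. Sop z (\<lambda>x. Jt (qv x)) T)" by (rule continuous_Sob0[OF AC_continuous[OF Sop_AC[OF qv ab']]])
 have "Sob 0 \<alpha> \<beta> (\<lambda>z. 1 / 2 * (A ((T + \<alpha>) - z) + B ((T - \<beta>) + z) + - 1 * Sop z (\<lambda>x. Jt (qv x)) T))"
  by (rule Sob_cmult[OF Sob_add[OF Sob_add[OF 1 2] Sob_cmult[OF 3]]])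
 then show ?thesis using 0 by (simp add: GG_def[abs_def] del: Sob.simps)
qed (use continuous_Sob0[OF AC_continuous[OF GG_AC]] in blast)

text \<open>The wave equation at the final time: two removed integrations play the second time
  derivative, and the jump term of \<open>Top_AC\<close> is the potential times the state, by
  \<open>v_at_T\<close>.\<close>

lemma gg_AC:
 assumes Q: "continuous_on {\<alpha>..\<beta>} Q" and qQ: "\<And>x. x \<in> {\<alpha>..\<beta>} \<Longrightarrow> q x = Q x"
 shows "AC \<alpha> \<beta> (gg (Suc (Suc k))) (\<lambda>z. GG k z + Q z * GG (Suc (Suc k)) z)"
proof (rule AC_cong_deriv)
 let ?d = "\<lambda>z. 1 / 2 * (- (- (Jt ^^ k) A ((T + \<alpha>) - z)) + (Jt ^^ k) B ((T - \<beta>) + z) + (2 * Jt ((Jt ^^ Suc k) (qv z)) T - Sop z (\<lambda>x. (Jt ^^ Suc k) (qv x)) T))"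
 have m1: "AC \<alpha> \<beta> f f' \<Longrightarrow> AC \<alpha> \<beta> (\<lambda>z. - f z) (\<lambda>z. - f' z)" for f f' using AC_cmult[of \<alpha> \<beta> f f' "- 1"] by simp
 have "AC \<alpha> \<beta> (\<lambda>z. 1 / 2 * (- Jt ((Jt ^^ k) A) ((T + \<alpha>) - z) + Jt ((Jt ^^ k) B) ((T - \<beta>) + z) + Top z (\<lambda>x. Jt ((Jt ^^ Suc k) (qv x))) T)) ?d"
  by (intro AC_cmult AC_add m1 reflect_AC translate_AC Jt_pow_L2c L Top_AC[OF Jt_pow_Qc[OF qv] ab'])
 then show "AC \<alpha> \<beta> (gg (Suc (Suc k))) ?d" by (simp add: gg_def[abs_def])
 have "AE z in lborel. z \<noteq> \<alpha>" "AE z in lborel. z \<noteq> \<beta>" by (rule AE_lborel_singleton)+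
 then show "AE z in lborel. z \<in> {\<alpha>..\<beta>} \<longrightarrow> ?d z = GG k z + Q z * GG (Suc (Suc k)) z"
  using v_at_T[of "Suc k"]
 proof eventually_elim
  case (elim z)
  show ?case
  proof
   assume "z \<in> {\<alpha>..\<beta>}"
   then have z: "z \<in> {\<alpha><..<\<beta>}" "q z = Q z" using elim qQ by auto
   have "Jt ((Jt ^^ Suc k) (qv z)) T = (Jt ^^ Suc (Suc k)) (\<lambda>t. q z * v z t) T" by (simp add: qv_def[abs_def])
   also have "\<dots> = Q z * GG (Suc (Suc k)) z" using elim(3) z by (simp only: Jt_pow_cmult)
   finally have e: "Jt ((Jt ^^ Suc k) (qv z)) T = Q z * GG (Suc (Suc k)) z" .
   show "?d z = GG k z + Q z * GG (Suc (Suc k)) z" unfolding e by (simp only: GG_def[of k]) simp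
  qed
 qed
 have "Ck_on 0 \<alpha> \<beta> Q" using Q by (auto simp: Ck_on_def intro!: exI[of _ "\<lambda>i. Q"])
 then have "Sob 0 \<alpha> \<beta> (\<lambda>z. GG k z + Q z * GG (Suc (Suc k)) z)" by (rule Sob_add[OF GG_Sob0 Sob_mult[OF GG_Sob0]])
 then show "(\<lambda>z. indicator {\<alpha>..\<beta>} z * (GG k z + Q z * GG (Suc (Suc k)) z)) \<in> borel_measurable borel" by simp
qed

lemma gg_Sob0:
 assumes "continuous_on {\<alpha>..\<beta>} Q" "\<And>x. x \<in> {\<alpha>..\<beta>} \<Longrightarrow> q x = Q x"
 shows "Sob 0 \<alpha> \<beta> (gg (Suc m))"
proof (cases m)
 case 0
 have 1: "Sob 0 \<alpha> \<beta> (\<lambda>z. A ((T + \<alpha>) - z))" using Sob0_affine[OF L(3), of "- 1"] by simp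
 have 2: "Sob 0 \<alpha> \<beta> (\<lambda>z. B ((T - \<beta>) + z))" using Sob0_affine[OF L(4), of 1] by simp
 have 3: "Sob 0 \<alpha> \<beta> (\<lambda>z. Top z (\<lambda>x. Jt (qv x)) T)" by (rule continuous_Sob0[OF AC_continuous[OF Top_AC[OF qv ab']]])
 have "Sob 0 \<alpha> \<beta> (\<lambda>z. 1 / 2 * (- 1 * A ((T + \<alpha>) - z) + B ((T - \<beta>) + z) + Top z (\<lambda>x. Jt (qv x)) T))"
  by (rule Sob_cmult[OF Sob_add[OF Sob_add[OF Sob_cmult[OF 1] 2] 3]])
 then show ?thesis using 0 by (simp add: gg_def[abs_def] del: Sob.simps)
qed (use continuous_Sob0[OF AC_continuous[OF gg_AC[OF assms]]] in blast)

text \<open>By \<open>gg_AC\<close> two derivatives lower the index by two and add a multiple of Q,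
  so the induction descends in steps of two and asks for n - 2 derivatives of Q. This is where the
  smoothness of the potential is spent.\<close>

lemma GG_Sob:
 assumes "Ck_on (n - 2) \<alpha> \<beta> Q" "\<And>x. x \<in> {\<alpha>..\<beta>} \<Longrightarrow> q x = Q x" "n \<le> m"
 shows "Sob n \<alpha> \<beta> (GG m)"
 using assms(1,3)
proof (induction n arbitrary: m rule: less_induct)
 case (less n)
 note Qc = Ck_on_continuous[OF less.prems(1)]
 consider "n = 0" | "n = 1" | k where "n = Suc (Suc k)" by (metis One_nat_def not0_implies_Suc)
 then show ?case
 proof cases
  case 1
  then show ?thesis using GG_Sob0 by (simp del: Sob.simps)
 next
  case 2
  then obtain m' where m: "m = Suc m'" using less.prems(2) by (cases m) auto
  show ?thesis unfolding 2 m One_nat_def Sob.simps(2)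
   by (intro exI[of _ "gg (Suc m')"] conjI GG_AC gg_Sob0[OF Qc assms(2)])
 next
  case 3
  then obtain j where m: "m = Suc (Suc j)" "k \<le> j" using less.prems(2) by (metis Suc_le_D Suc_le_mono)
  have Ck: "Ck_on k \<alpha> \<beta> Q" using less.prems(1) 3 by simp
  have "Sob k \<alpha> \<beta> (GG j)" "Sob k \<alpha> \<beta> (GG m)"
   using less.IH[of k j] less.IH[of k m] 3 m Ck_on_mono[OF Ck, of "k - 2"] by auto
  then have "Sob k \<alpha> \<beta> (\<lambda>z. GG j z + Q z * GG (Suc (Suc j)) z)" unfolding m by (intro Sob_add Sob_mult Ck)
  then show ?thesis unfolding 3 m Sob.simps(2)
   by (intro exI[of _ "gg (Suc (Suc j))"] exI[of _ "\<lambda>z. GG j z + Q z * GG (Suc (Suc j)) z"] conjI GG_AC gg_AC[OF Qc assms(2)])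
 qed
qed

lemma alpha_at_T: "2 * (Jt ^^ Suc k) \<eta>0 T = (Jt ^^ Suc k) A T + (Jt ^^ Suc k) B ((T - \<beta>) + \<alpha>) - Sop \<alpha> (\<lambda>x. (Jt ^^ Suc (Suc k)) (qv x)) T"
proof -
 have "AE t in lborel. t < T \<longrightarrow> 2 * \<eta>0 t = A (t - 0) + B (t - (\<beta> - \<alpha>)) - Jt (Sop \<alpha> qv) t"
  using FA unfolding qv_eq by eventually_elim auto
 from char_at_T[OF L2c_cmult[OF L(1)] L(3,4) SopL _ _ this, of k] ab
 have "2 * (Jt ^^ Suc k) \<eta>0 T = (Jt ^^ Suc k) A (T - 0) + (Jt ^^ Suc k) B (T - (\<beta> - \<alpha>)) - (Jt ^^ Suc (Suc k)) (Sop \<alpha> qv) T"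
  by (simp only: Jt_pow_cmult)
 moreover have "T - (\<beta> - \<alpha>) = (T - \<beta>) + \<alpha>" by simp
 ultimately show ?thesis by (simp only: Jt_pow_Sopqv diff_zero)
qed

lemma beta_at_T: "2 * (Jt ^^ Suc k) \<eta>b T = (Jt ^^ Suc k) A ((T + \<alpha>) - \<beta>) + (Jt ^^ Suc k) B T - Sop \<beta> (\<lambda>x. (Jt ^^ Suc (Suc k)) (qv x)) T"
proof -
 have "AE t in lborel. t < T \<longrightarrow> 2 * \<eta>b t = A (t - (\<beta> - \<alpha>)) + B (t - 0) - Jt (Sop \<beta> qv) t"
  using FB unfolding qv_eq by eventually_elim auto
 from char_at_T[OF L2c_cmult[OF L(2)] L(3,4) SopL _ _ this, of k] ab
 have "2 * (Jt ^^ Suc k) \<eta>b T = (Jt ^^ Suc k) A (T - (\<beta> - \<alpha>)) + (Jt ^^ Suc k) B (T - 0) - (Jt ^^ Suc (Suc k)) (Sop \<beta> qv) T"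
  by (simp only: Jt_pow_cmult)
 moreover have "T - (\<beta> - \<alpha>) = (T + \<alpha>) - \<beta>" by simp
 ultimately show ?thesis by (simp only: Jt_pow_Sopqv diff_zero)
qed

text \<open>\<open>FA\<close> and \<open>FB\<close> are d'Alembert's formula at the two ends, so the
  representative takes the boundary values of \<open>v\<close> there.\<close>

lemma GG_alpha: "GG (Suc k) \<alpha> = (Jt ^^ Suc k) \<eta>0 T" and GG_beta: "GG (Suc k) \<beta> = (Jt ^^ Suc k) \<eta>b T"
 unfolding GG_def add_diff_cancel_right' diff_add_cancel
 by (rule half_eqs(1)[OF alpha_at_T] half_eqs(1)[OF beta_at_T])+

text \<open>The slope at an end is half a difference of waves plus the potential term. The relation
  for the end value eliminates the wave arriving from the other end together with that term.\<close>

lemma gg_alpha: "gg (Suc (Suc k)) \<alpha> = (Jt ^^ Suc k) (\<lambda>t. \<eta>0 t - A t) T"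
 and gg_beta: "gg (Suc (Suc k)) \<beta> = (Jt ^^ Suc k) (\<lambda>t. B t - \<eta>b t) T"
 unfolding gg_def Jt_pow_diff[OF L(1,3)] Jt_pow_diff[OF L(4,2)] Top_alpha[OF Jt_pow_Qc[OF qv]] diff_Suc_1
  add_diff_cancel_right' diff_add_cancel
 by (rule half_eqs(2)[OF alpha_at_T] half_eqs(3)[OF beta_at_T])+

end

section \<open>Coupling by the masses\<close>

lemma C2_rect_product:
 assumes \<eta>: "\<And>x. (\<eta> has_real_derivative \<eta>' x) (at x)" "\<And>x. (\<eta>' has_real_derivative \<eta>'' x) (at x)" and c\<eta>: "continuous_on UNIV \<eta>''"
  and \<psi>: "\<And>t. (\<psi> has_real_derivative \<psi>' t) (at t)" "\<And>t. (\<psi>' has_real_derivative \<psi>'' t) (at t)" and c\<psi>: "continuous_on UNIV \<psi>''"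
 shows "C2_rect X I (\<lambda>x t. \<eta> x * \<psi> t) (\<lambda>x t. \<eta>' x * \<psi> t) (\<lambda>x t. \<eta> x * \<psi>' t)
  (\<lambda>x t. \<eta>'' x * \<psi> t) (\<lambda>x t. \<eta>' x * \<psi>' t) (\<lambda>x t. \<eta> x * \<psi>'' t)"
proof -
 have c0: "continuous_on UNIV \<psi>" "continuous_on UNIV \<psi>'" "continuous_on UNIV \<eta>" "continuous_on UNIV \<eta>'"
  by (rule DERIV_continuous_on, rule \<psi> \<eta>)+
 have cc: "continuous_on (X \<times> I) (\<lambda>z. g (snd z))" "continuous_on (X \<times> I) (\<lambda>z. g (fst z))" if "continuous_on UNIV g" for g :: "real \<Rightarrow> real"
  by (rule continuous_on_compose2[OF that]; auto intro: continuous_intros)+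
 show ?thesis
  unfolding C2_rect_def
 proof (intro conjI ballI)
  fix g :: "real \<Rightarrow> real \<Rightarrow> real"
  assume "g \<in> {\<lambda>x t. \<eta> x * \<psi> t, \<lambda>x t. \<eta>' x * \<psi> t, \<lambda>x t. \<eta> x * \<psi>' t, \<lambda>x t. \<eta>'' x * \<psi> t, \<lambda>x t. \<eta>' x * \<psi>' t, \<lambda>x t. \<eta> x * \<psi>'' t}"
  then show "continuous_on (X \<times> I) (\<lambda>(x, t). g x t)"
   by (elim insertE emptyE) (simp_all only: case_prod_unfold, (intro continuous_on_mult cc c0 c\<eta> c\<psi>)+)
 next
  fix x t
  note d = has_field_derivative_at_within[OF \<eta>(1)] has_field_derivative_at_within[OF \<eta>(2)]
   has_field_derivative_at_within[OF \<psi>(1)] has_field_derivative_at_within[OF \<psi>(2)]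
  show "((\<lambda>y. \<eta> y * \<psi> t) has_real_derivative \<eta>' x * \<psi> t) (at x within X)"
   "((\<lambda>t. \<eta> x * \<psi> t) has_real_derivative \<eta> x * \<psi>' t) (at t within I)"
   "((\<lambda>y. \<eta>' y * \<psi> t) has_real_derivative \<eta>'' x * \<psi> t) (at x within X)"
   "((\<lambda>t. \<eta>' x * \<psi> t) has_real_derivative \<eta>' x * \<psi>' t) (at t within I)"
   "((\<lambda>y. \<eta> y * \<psi>' t) has_real_derivative \<eta>' x * \<psi>' t) (at x within X)"
   "((\<lambda>t. \<eta> x * \<psi>' t) has_real_derivative \<eta> x * \<psi>'' t) (at t within I)"
   by (intro DERIV_cmult DERIV_cmult_right d)+
 qed
qed

lemma C2_rect_affine:
 assumes \<psi>: "\<And>t. (\<psi> has_real_derivative \<psi>' t) (at t)" "\<And>t. (\<psi>' has_real_derivative \<psi>'' t) (at t)"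
  and c: "continuous_on UNIV \<psi>''"
 shows "C2_rect X I (\<lambda>x t. (p + s * x) * \<psi> t) (\<lambda>x t. s * \<psi> t) (\<lambda>x t. (p + s * x) * \<psi>' t)
  (\<lambda>x t. 0) (\<lambda>x t. s * \<psi>' t) (\<lambda>x t. (p + s * x) * \<psi>'' t)"
proof -
 have l: "((\<lambda>x. p + s * x) has_real_derivative s) (at x)" for x by (auto intro!: derivative_eq_intros)
 show ?thesis using C2_rect_product[OF l DERIV_const continuous_on_const \<psi> c, of X I] by simp
qed

lemma pp_reflect_DERIV:
 "((\<lambda>t. pp 3 (\<sigma> - t)) has_real_derivative - pp 2 (\<sigma> - t)) (at t)"
 "((\<lambda>t. - pp 2 (\<sigma> - t)) has_real_derivative pp 1 (\<sigma> - t)) (at t)"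
proof -
 have t: "((\<lambda>t. \<sigma> - t) has_real_derivative - 1) (at t)" by (auto intro!: derivative_eq_intros)
 show "((\<lambda>t. pp 3 (\<sigma> - t)) has_real_derivative - pp 2 (\<sigma> - t)) (at t)"
  using DERIV_chain2[where f="pp 3", OF pp_DERIV32(1) t] by simp
 show "((\<lambda>t. - pp 2 (\<sigma> - t)) has_real_derivative pp 1 (\<sigma> - t)) (at t)"
  using DERIV_minus[OF DERIV_chain2[where f="pp 2", OF pp_DERIV32(2) t]] by simp
qed

text \<open>The test fields are given interval by interval and only have to match at the masses.\<close>

locale weak_sys =
 fixes T K :: real and N :: nat and a M :: "nat \<Rightarrow> real" and qq :: "nat \<Rightarrow> real \<Rightarrow> real"
  and U :: "nat \<Rightarrow> real \<Rightarrow> real \<Rightarrow> real" and H :: "nat \<Rightarrow> real \<Rightarrow> real"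
 assumes T: "T > 0" and a: "\<And>j. j \<le> N \<Longrightarrow> a j < a (Suc j)" and M: "\<And>j. 1 \<le> j \<Longrightarrow> j \<le> N \<Longrightarrow> M j > 0"
  and qm: "\<And>j. j \<le> N \<Longrightarrow> qq j \<in> borel_measurable borel" and qK: "\<And>j x. j \<le> N \<Longrightarrow> \<bar>qq j x\<bar> \<le> K"
  and U: "\<And>j. j \<le> N \<Longrightarrow> U j \<in> Qc (a j) (a (Suc j))" and H: "\<And>j. H j \<in> L2c" and HN: "H (Suc N) = (\<lambda>t. 0)"
  and WI: "\<And>w wx wt wxx wxt wtt.
   (\<And>k. k \<le> N \<Longrightarrow> C2_rect {a k..a (Suc k)} {0..T} (w k) (wx k) (wt k) (wxx k) (wxt k) (wtt k)) \<Longrightarrow>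
   (\<And>k t. k < N \<Longrightarrow> t \<in> {0..T} \<Longrightarrow> w k (a (Suc k)) t = w (Suc k) (a (Suc k)) t) \<Longrightarrow>
   (\<And>t. t \<in> {0..T} \<Longrightarrow> w 0 (a 0) t = 0 \<and> w N (a (Suc N)) t = 0) \<Longrightarrow>
   (\<And>k x. k \<le> N \<Longrightarrow> x \<in> {a k..a (Suc k)} \<Longrightarrow> w k x T = 0 \<and> wt k x T = 0) \<Longrightarrow>
   (\<Sum>k\<le>N. (LBINT t:{0..T}. LBINT x. U k x t * (wtt k x t - wxx k x t + qq k x * w k x t))) +
   (\<Sum>j=1..N. (LBINT t:{0..T}. H j t * (M j * wtt j (a j) t - wx j (a j) t + wx (j - 1) (a j) t))) =
   (LBINT t:{0..T}. H 0 t * wx 0 (a 0) t)"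
begin

text \<open>The slope at the left end of interval j meets the equation of mass j, that at the right
  end the equation of mass j + 1. For j = 0 the left end is the control on the other side of the
  identity; for j = N the right end is paired with \<open>H (Suc N)\<close>, which is 0.\<close>

lemma interval_sys_at:
 assumes j: "j \<le> N"
 shows "interval_sys (a j) (a (Suc j)) T K (U j) (qq j) (H j) (H (Suc j))"
proof (rule interval_sys.intro)
 show "interval_data (a j) (a (Suc j)) T K (U j) (qq j) (H j) (H (Suc j))"
  by unfold_locales (use a[OF j] T U[OF j] qm[OF j] qK[OF j] H in auto)
 show "interval_sys_axioms (a j) (a (Suc j)) T (U j) (qq j) (H j) (H (Suc j))"
 proof
  fix w wx wt wxx wxt wtt
  assume w: "C2_rect {a j..a (Suc j)} {0..T} w wx wt wxx wxt wtt"
   and w0: "\<And>t. t \<in> {0..T} \<Longrightarrow> w (a j) t = 0 \<and> w (a (Suc j)) t = 0 \<and> wtt (a j) t = 0 \<and> wtt (a (Suc j)) t = 0"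
   and wT: "\<And>x. x \<in> {a j..a (Suc j)} \<Longrightarrow> w x T = 0 \<and> wt x T = 0"
  \<comment> \<open>Extension by zero to the other intervals; it matches at the nodes because the
    field vanishes at both ends.\<close>
  define E where "E = (\<lambda>(g :: real \<Rightarrow> real \<Rightarrow> real) k. if k = j then g else (\<lambda>x t. 0))"
  have E: "E g j = g" "k \<noteq> j \<Longrightarrow> E g k = (\<lambda>x t. 0)" for g k by (simp_all add: E_def)
  have z: "C2_rect X I (\<lambda>x t. 0) (\<lambda>x t. 0) (\<lambda>x t. 0) (\<lambda>x t. 0) (\<lambda>x t. 0) (\<lambda>x t. 0)" for X I
   unfolding C2_rect_def by simp
  define y1 y2 where "y1 = (LBINT t:{0..T}. H j t * wx (a j) t)" and "y2 = (LBINT t:{0..T}. H (Suc j) t * wx (a (Suc j)) t)"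
  define X where "X = (LBINT t:{0..T}. LBINT x. U j x t * (wtt x t - wxx x t + qq j x * w x t))"
  have "(\<Sum>k\<le>N. (LBINT t:{0..T}. LBINT x. U k x t * (E wtt k x t - E wxx k x t + qq k x * E w k x t))) +
   (\<Sum>i=1..N. (LBINT t:{0..T}. H i t * (M i * E wtt i (a i) t - E wx i (a i) t + E wx (i - 1) (a i) t))) =
   (LBINT t:{0..T}. H 0 t * E wx 0 (a 0) t)"
  proof (rule WI[where wt="E wt" and wxt="E wxt"])
   fix k show "C2_rect {a k..a (Suc k)} {0..T} (E w k) (E wx k) (E wt k) (E wxx k) (E wxt k) (E wtt k)"
    using w z by (cases "k = j") (simp_all add: E)
  next
   fix k t assume "t \<in> {0..T}" then show "E w k (a (Suc k)) t = E w (Suc k) (a (Suc k)) t"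
    using w0[of t] by (auto simp: E_def)
  next
   fix t assume "t \<in> {0..T}" then show "E w 0 (a 0) t = 0 \<and> E w N (a (Suc N)) t = 0"
    using w0[of t] by (auto simp: E_def)
  next
   fix k x assume "x \<in> {a k..a (Suc k)}" then show "E w k x T = 0 \<and> E wt k x T = 0"
    using wT[of x] by (auto simp: E_def)
  qed
  moreover have "(\<Sum>k\<le>N. (LBINT t:{0..T}. LBINT x. U k x t * (E wtt k x t - E wxx k x t + qq k x * E w k x t))) = X"
  proof -
   have "(\<Sum>k\<le>N. (LBINT t:{0..T}. LBINT x. U k x t * (E wtt k x t - E wxx k x t + qq k x * E w k x t))) = (\<Sum>k\<le>N. if k = j then X else 0)"
    by (rule sum.cong) (auto simp: E X_def)
   then show ?thesis using j by simp
  qed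
  moreover have "(\<Sum>i=1..N. (LBINT t:{0..T}. H i t * (M i * E wtt i (a i) t - E wx i (a i) t + E wx (i - 1) (a i) t))) = (if j = 0 then 0 else - y1) + y2"
  proof -
   have 1: "(LBINT t:{0..T}. H i t * (M i * E wtt i (a i) t - E wx i (a i) t + E wx (i - 1) (a i) t)) = (if i = j then - y1 else 0) + (if i = Suc j then y2 else 0)"
    if i: "i \<in> {1..N}" for i
   proof -
    consider "i = j" | "i = Suc j" | "i \<noteq> j" "i \<noteq> Suc j" by blast
    then show ?thesis
    proof cases
     case 1
     have n: "i - 1 \<noteq> j" using i 1 by auto
     have e1: "E wtt i = wtt" "E wx i = wx" by (simp_all only: 1 E(1))
     have e3: "E wx (i - 1) = (\<lambda>x t. 0)" by (rule E(2)[OF n])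
     have "(LBINT t:{0..T}. H i t * (M i * E wtt i (a i) t - E wx i (a i) t + E wx (i - 1) (a i) t)) = (LBINT t:{0..T}. - (H j t * wx (a j) t))"
     proof (rule set_lebesgue_integral_cong)
      show "\<forall>t. t \<in> {0..T} \<longrightarrow> H i t * (M i * E wtt i (a i) t - E wx i (a i) t + E wx (i - 1) (a i) t) = - (H j t * wx (a j) t)"
       unfolding e1 e3 using w0 1 by simp
     qed simp
     then show ?thesis using 1 by (simp add: Lint_minus y1_def)
    next
     case 2
     then show ?thesis by (simp add: E y2_def)
    next
     case 3
     then have "i - 1 \<noteq> j" using i by auto
     then show ?thesis using 3 by (simp add: E)
    qed
   qed
   have "(\<Sum>i=1..N. (LBINT t:{0..T}. H i t * (M i * E wtt i (a i) t - E wx i (a i) t + E wx (i - 1) (a i) t))) = (\<Sum>i=1..N. (if i = j then - y1 else 0)) + (\<Sum>i=1..N. (if i = Suc j then y2 else 0))"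
    unfolding sum.distrib[symmetric] by (rule sum.cong[OF refl]) (rule 1)
   moreover have "y2 = 0" if "\<not> Suc j \<le> N"
   proof -
    have "Suc j = Suc N" using that j by simp
    then show ?thesis using HN by (simp add: y2_def)
   qed
   ultimately show ?thesis using j by (auto simp: sum.delta)
  qed
  moreover have "(LBINT t:{0..T}. H 0 t * E wx 0 (a 0) t) = (if j = 0 then y1 else 0)"
   by (cases "j = 0") (simp_all add: E_def y1_def)
  ultimately show "(LBINT t:{0..T}. LBINT x. U j x t * (wtt x t - wxx x t + qq j x * w x t)) =
    (LBINT t:{0..T}. H j t * wx (a j) t) - (LBINT t:{0..T}. H (Suc j) t * wx (a (Suc j)) t)"
   unfolding y1_def[symmetric] y2_def[symmetric] X_def[symmetric] by (auto split: if_splits)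
 qed
qed

text \<open>What a node needs from interval k. \<open>n0\<close> and \<open>nb\<close> stand for
  \<open>N0\<close> and \<open>Nb\<close>, which live in a separate instance of the locale for each
  interval. The last clause is \<open>WF\<close> for fields affine in x with time factor
  \<open>pp 3\<close>; the term \<open>- 0\<close> is their second x-derivative.\<close>

definition flux_data :: "nat \<Rightarrow> (real \<Rightarrow> real) \<Rightarrow> (real \<Rightarrow> real) \<Rightarrow> (real \<Rightarrow> real) \<Rightarrow> (real \<Rightarrow> real) \<Rightarrow> bool" where
 "flux_data k A B n0 nb \<longleftrightarrow> char_data (a k) (a (Suc k)) T K (qq k) (U k) (H k) (H (Suc k)) A B \<and>
   n0 \<in> L2c \<and> nb \<in> L2c \<and> (AE t in lborel. t < T \<longrightarrow> n0 t = Jt (\<lambda>t. H k t - A t) t) \<and>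
   (AE t in lborel. t < T \<longrightarrow> nb t = Jt (\<lambda>t. B t - H (Suc k) t) t) \<and>
   (\<forall>p s \<sigma>. \<sigma> \<le> T \<longrightarrow> (LBINT t:{0..T}. LBINT x. U k x t * ((p + s * x) * pp 1 (\<sigma> - t) - 0 + qq k x * ((p + s * x) * pp 3 (\<sigma> - t)))) =
    s * (Jt ^^ 4) (H k) \<sigma> - s * (Jt ^^ 4) (H (Suc k)) \<sigma> - (p + s * a k) * (Jt ^^ 2) n0 \<sigma> + (p + s * a (Suc k)) * (Jt ^^ 2) nb \<sigma>)"

lemma Lint_pp_cmult:
 assumes "g \<in> L2c" "\<sigma> \<le> T"
 shows "(LBINT t:{0..T}. g t * (c * pp 3 (\<sigma> - t))) = c * (Jt ^^ 4) g \<sigma>"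
  "(LBINT t:{0..T}. g t * (c * pp 1 (\<sigma> - t))) = c * (Jt ^^ 2) g \<sigma>"
 using Jt_pp[OF assms, of 3] Jt_pp[OF assms, of 1] by (simp_all add: mult.left_commute[of _ c] eval_nat_numeral del: funpow.simps)

lemma flux_data_ex:
 assumes k: "k \<le> N"
 shows "\<exists>A B n0 nb. flux_data k A B n0 nb"
proof -
 interpret I: interval_sys "a k" "a (Suc k)" T K "U k" "qq k" "H k" "H (Suc k)" by (rule interval_sys_at[OF k])
 obtain A B where AB: "char_data (a k) (a (Suc k)) T K (qq k) (U k) (H k) (H (Suc k)) A B"
  "AE t in lborel. t < T \<longrightarrow> I.N0 t = Jt (\<lambda>t. H k t - A t) t" "AE t in lborel. t < T \<longrightarrow> I.Nb t = Jt (\<lambda>t. B t - H (Suc k) t) t"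
  by (rule I.AB_exist)
 have "(LBINT t:{0..T}. LBINT x. U k x t * ((p + s * x) * pp 1 (\<sigma> - t) - 0 + qq k x * ((p + s * x) * pp 3 (\<sigma> - t)))) =
    s * (Jt ^^ 4) (H k) \<sigma> - s * (Jt ^^ 4) (H (Suc k)) \<sigma> - (p + s * a k) * (Jt ^^ 2) I.N0 \<sigma> + (p + s * a (Suc k)) * (Jt ^^ 2) I.Nb \<sigma>"
  if \<sigma>: "\<sigma> \<le> T" for p s \<sigma>
 proof -
  have C: "C2_rect X I' (\<lambda>x t. (p + s * x) * pp 3 (\<sigma> - t)) (\<lambda>x t. s * pp 3 (\<sigma> - t)) (\<lambda>x t. (p + s * x) * - pp 2 (\<sigma> - t))
   (\<lambda>x t. 0) (\<lambda>x t. s * - pp 2 (\<sigma> - t)) (\<lambda>x t. (p + s * x) * pp 1 (\<sigma> - t))" for X I'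
   by (rule C2_rect_affine[OF pp_reflect_DERIV]) (intro continuous_intros)
  have 0: "pp 3 (\<sigma> - T) = 0" "pp 2 (\<sigma> - T) = 0" using \<sigma> by (simp_all add: pp_nonpos)
  have "(LBINT t:{0..T}. LBINT x. U k x t * ((p + s * x) * pp 1 (\<sigma> - t) - 0 + qq k x * ((p + s * x) * pp 3 (\<sigma> - t)))) =
   (LBINT t:{0..T}. LBINT x. U k x t * ((p + s * x) * pp 1 (\<sigma> - t) - 0) + I.Qv x t * ((p + s * x) * pp 3 (\<sigma> - t)))"
   by (simp add: I.Qv_def algebra_simps)
  also have "\<dots> = (LBINT t:{0..T}. LBINT x. U k x t * ((p + s * x) * pp 1 (\<sigma> - t) - 0)) + (LBINT t:{0..T}. LBINT x. I.Qv x t * ((p + s * x) * pp 3 (\<sigma> - t)))"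
   by (rule double_integral_lin[OF I.v I.Qv I.ab'], unfold case_prod_unfold) (intro continuous_intros)+
  also have "\<dots> = (LBINT t:{0..T}. H k t * (s * pp 3 (\<sigma> - t))) - (LBINT t:{0..T}. H (Suc k) t * (s * pp 3 (\<sigma> - t)))
    - (LBINT t:{0..T}. I.N0 t * ((p + s * a k) * pp 1 (\<sigma> - t))) + (LBINT t:{0..T}. I.Nb t * ((p + s * a (Suc k)) * pp 1 (\<sigma> - t)))"
   by (rule I.WF[OF C]) (simp add: 0)
  also have "\<dots> = s * (Jt ^^ 4) (H k) \<sigma> - s * (Jt ^^ 4) (H (Suc k)) \<sigma> - (p + s * a k) * (Jt ^^ 2) I.N0 \<sigma> + (p + s * a (Suc k)) * (Jt ^^ 2) I.Nb \<sigma>"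
   by (simp only: Lint_pp_cmult[OF H \<sigma>] Lint_pp_cmult[OF I.N0_L2c \<sigma>] Lint_pp_cmult[OF I.Nb_L2c \<sigma>])
  finally show ?thesis .
 qed
 then have "flux_data k A B I.N0 I.Nb" unfolding flux_data_def using AB I.N0_L2c I.Nb_L2c by blast
 then show ?thesis by blast
qed

text \<open>The test field is the hat function of node j times \<open>pp 3 (\<sigma> - t)\<close>.
  Its node values single out the mass at j and the two fluxes next to it.\<close>

lemma node_balance:
 assumes F: "\<And>k. k \<le> N \<Longrightarrow> flux_data k (A k) (B k) (n0 k) (nb k)" and j: "1 \<le> j" "j \<le> N" and \<sigma>: "\<sigma> \<le> T"
 shows "M j * (Jt ^^ 2) (H j) \<sigma> = (Jt ^^ 2) (n0 j) \<sigma> - (Jt ^^ 2) (nb (j - 1)) \<sigma>"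
proof -
 \<comment> \<open>Node values of the hat function; on interval k the function itself is
   \<open>p k + s k * x\<close>.\<close>
 define e where "e k = (if k = j then 1 else 0 :: real)" for k
 define s where "s k = (e (Suc k) - e k) / (a (Suc k) - a k)" for k
 define p where "p k = e k - s k * a k" for k
 have pa: "p k + s k * a k = e k" for k by (simp add: p_def)
 have pb: "p k + s k * a (Suc k) = e (Suc k)" if "k \<le> N" for k
 proof -
  have "s k * (a (Suc k) - a k) = e (Suc k) - e k" unfolding s_def using a[OF that] by simp
  then show ?thesis unfolding p_def by (simp add: algebra_simps)
 qed
 have 0: "pp 3 (\<sigma> - T) = 0" "pp 2 (\<sigma> - T) = 0" using \<sigma> by (simp_all add: pp_nonpos)
 define h r n m where "h k = (Jt ^^ 4) (H k) \<sigma>" and "r k = (Jt ^^ 2) (H k) \<sigma>" and "n k = (Jt ^^ 2) (n0 k) \<sigma>" and "m k = (Jt ^^ 2) (nb k) \<sigma>" for k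
 have "(\<Sum>k\<le>N. (LBINT t:{0..T}. LBINT x. U k x t * ((p k + s k * x) * pp 1 (\<sigma> - t) - 0 + qq k x * ((p k + s k * x) * pp 3 (\<sigma> - t))))) +
  (\<Sum>i=1..N. (LBINT t:{0..T}. H i t * (M i * ((p i + s i * a i) * pp 1 (\<sigma> - t)) - s i * pp 3 (\<sigma> - t) + s (i - 1) * pp 3 (\<sigma> - t)))) =
  (LBINT t:{0..T}. H 0 t * (s 0 * pp 3 (\<sigma> - t)))"
 proof (rule WI[where wt="\<lambda>k x t. (p k + s k * x) * - pp 2 (\<sigma> - t)" and wxt="\<lambda>k x t. s k * - pp 2 (\<sigma> - t)"])
  fix k show "C2_rect {a k..a (Suc k)} {0..T} (\<lambda>x t. (p k + s k * x) * pp 3 (\<sigma> - t)) (\<lambda>x t. s k * pp 3 (\<sigma> - t)) (\<lambda>x t. (p k + s k * x) * - pp 2 (\<sigma> - t))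
   (\<lambda>x t. 0) (\<lambda>x t. s k * - pp 2 (\<sigma> - t)) (\<lambda>x t. (p k + s k * x) * pp 1 (\<sigma> - t))"
   by (rule C2_rect_affine[OF pp_reflect_DERIV]) (intro continuous_intros)
 next
  fix k t assume "k < N"
  then show "(p k + s k * a (Suc k)) * pp 3 (\<sigma> - t) = (p (Suc k) + s (Suc k) * a (Suc k)) * pp 3 (\<sigma> - t)" by (simp add: pa pb)
 next
  fix t show "(p 0 + s 0 * a 0) * pp 3 (\<sigma> - t) = 0 \<and> (p N + s N * a (Suc N)) * pp 3 (\<sigma> - t) = 0"
   unfolding pa pb[OF order_refl] using j by (simp add: e_def)
 qed (simp add: 0)
 moreover have "(LBINT t:{0..T}. LBINT x. U k x t * ((p k + s k * x) * pp 1 (\<sigma> - t) - 0 + qq k x * ((p k + s k * x) * pp 3 (\<sigma> - t)))) =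
   s k * h k - s k * h (Suc k) - e k * n k + e (Suc k) * m k" if k: "k \<in> {..N}" for k
  using F[of k] k \<sigma> unfolding flux_data_def h_def n_def m_def by (simp add: pa pb)
 moreover have "(LBINT t:{0..T}. H i t * (M i * ((p i + s i * a i) * pp 1 (\<sigma> - t)) - s i * pp 3 (\<sigma> - t) + s (i - 1) * pp 3 (\<sigma> - t))) =
   M i * e i * r i - s i * h i + s (i - 1) * h i" for i
 proof -
  have c: "set_integrable lborel {0..T} (\<lambda>t. H i t * (c * pp 1 (\<sigma> - t)))" "set_integrable lborel {0..T} (\<lambda>t. H i t * (c * pp 3 (\<sigma> - t)))" for c
   by (rule set_integrable_mult_continuous; (rule L2c_set_integrable'[OF H, where t=T] | intro continuous_intros); simp)+
  have "(LBINT t:{0..T}. H i t * (M i * ((p i + s i * a i) * pp 1 (\<sigma> - t)) - s i * pp 3 (\<sigma> - t) + s (i - 1) * pp 3 (\<sigma> - t)))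
   = (LBINT t:{0..T}. H i t * ((M i * e i) * pp 1 (\<sigma> - t)) + H i t * ((s (i - 1) - s i) * pp 3 (\<sigma> - t)))"
   by (simp only: pa) (simp add: algebra_simps)
  also have "\<dots> = (LBINT t:{0..T}. H i t * ((M i * e i) * pp 1 (\<sigma> - t))) + (LBINT t:{0..T}. H i t * ((s (i - 1) - s i) * pp 3 (\<sigma> - t)))"
   by (rule set_integral_add(2)[OF c])
  also have "\<dots> = (M i * e i) * r i + (s (i - 1) - s i) * h i" by (simp only: Lint_pp_cmult[OF H \<sigma>] r_def h_def)
  finally show ?thesis by (simp add: algebra_simps)
 qed
 moreover have "(LBINT t:{0..T}. H 0 t * (s 0 * pp 3 (\<sigma> - t))) = s 0 * h 0" by (simp only: Lint_pp_cmult[OF H \<sigma>] h_def)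
 ultimately have S: "(\<Sum>k\<le>N. s k * h k - s k * h (Suc k) - e k * n k + e (Suc k) * m k) + (\<Sum>i=1..N. M i * e i * r i - s i * h i + s (i - 1) * h i) = s 0 * h 0"
  by simp
 \<comment> \<open>Each \<open>h i\<close> meets the slopes on both sides of its node. After a shift
   of the index these terms cancel: the first one against the control, the last one because
   \<open>H (Suc N)\<close> is 0.\<close>
 have s1: "(\<Sum>k\<le>N. s k * h k) = s 0 * h 0 + (\<Sum>i=1..N. s i * h i)"
  by (simp add: atMost_atLeast0 sum.atLeast_Suc_atMost)
 have hN: "h (Suc N) = 0" unfolding h_def HN by (simp add: numeral_eq_Suc)
 have s2: "(\<Sum>k\<le>N. s k * h (Suc k)) = (\<Sum>i=1..N. s (i - 1) * h i)"
 proof -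
  have "(\<Sum>k\<le>N. s k * h (Suc k)) = (\<Sum>i=1..Suc N. s (i - 1) * h i)"
   unfolding atMost_atLeast0 One_nat_def sum.shift_bounds_cl_Suc_ivl by simp
  then show ?thesis using hN by simp
 qed
 have "e k * n k = (if k = j then n j else 0)" "e (Suc k) * m k = (if k = j - 1 then m (j - 1) else 0)" "M k * e k * r k = (if k = j then M j * r j else 0)" for k
  using j by (auto simp: e_def)
 then have s3: "(\<Sum>k\<le>N. e k * n k) = n j" "(\<Sum>k\<le>N. e (Suc k) * m k) = m (j - 1)" "(\<Sum>i=1..N. M i * e i * r i) = M j * r j"
  using j by (simp_all add: sum.delta)
 have "M j * r j = n j - m (j - 1)"
  using S s1 s2 s3 by (simp add: sum.distrib sum_subtractf)
 then show ?thesis by (simp add: r_def n_def m_def)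
qed

text \<open>The balance holds at every time up to T, so its two integrations can be cancelled; the
  flux primitives are then expressed by the waves.\<close>

lemma mass_equations:
 "\<exists>\<A> \<B>. (\<forall>k\<le>N. char_data (a k) (a (Suc k)) T K (qq k) (U k) (H k) (H (Suc k)) (\<A> k) (\<B> k)) \<and>
  (\<forall>j. 1 \<le> j \<longrightarrow> j \<le> N \<longrightarrow> (AE t in lborel. t < T \<longrightarrow> M j * H j t = Jt (\<lambda>t. H j t - \<A> j t) t - Jt (\<lambda>t. \<B> (j - 1) t - H j t) t))"
proof -
 have "\<forall>k. \<exists>A B n0 nb. k \<le> N \<longrightarrow> flux_data k A B n0 nb" using flux_data_ex by blast
 then obtain A B n0 nb where F: "\<And>k. k \<le> N \<Longrightarrow> flux_data k (A k) (B k) (n0 k) (nb k)" by metis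
 show ?thesis
 proof (intro exI conjI allI impI)
  fix k assume "k \<le> N" then show "char_data (a k) (a (Suc k)) T K (qq k) (U k) (H k) (H (Suc k)) (A k) (B k)"
   using F by (simp add: flux_data_def)
 next
  fix j assume j: "1 \<le> j" "j \<le> N"
  then have j1: "j - 1 \<le> N" "Suc (j - 1) = j" by auto
  have Fj: "n0 j \<in> L2c" "AE t in lborel. t < T \<longrightarrow> n0 j t = Jt (\<lambda>t. H j t - A j t) t" using F[OF j(2)] by (auto simp: flux_data_def)
  have Fj1: "nb (j - 1) \<in> L2c" "AE t in lborel. t < T \<longrightarrow> nb (j - 1) t = Jt (\<lambda>t. B (j - 1) t - H j t) t"
   using F[OF j1(1)] j1(2) by (auto simp: flux_data_def)
  have "AE t in lborel. t < T \<longrightarrow> M j * H j t = n0 j t - nb (j - 1) t"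
  proof (rule Jt_pow_strip[where k=2, OF L2c_cmult[OF H] L2c_diff[OF Fj(1) Fj1(1)]], intro AE_I2 impI)
   fix t assume "t < T"
   then show "(Jt ^^ 2) (\<lambda>t. M j * H j t) t = (Jt ^^ 2) (\<lambda>t. n0 j t - nb (j - 1) t) t"
    using node_balance[OF F j, of t] by (simp only: Jt_pow_cmult Jt_pow_diff[OF Fj(1) Fj1(1)])
  qed
  then show "AE t in lborel. t < T \<longrightarrow> M j * H j t = Jt (\<lambda>t. H j t - A j t) t - Jt (\<lambda>t. B (j - 1) t - H j t) t"
   using Fj(2) Fj1(2) by eventually_elim simp
 qed
qed

text \<open>Induction on the level k, for all intervals j >= k at once. To raise interval j,
  \<open>char_data.lift\<close> asks for both end values to be raised; the mass equation does this
  when the two intervals meeting there are at level k, and j - 1 >= k means j >= k + 1. The right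
  end of the string has value 0.\<close>

lemma causal_chain:
 "\<exists>v \<eta>0 \<eta>b A B.
  (\<forall>j\<le>N. char_data (a j) (a (Suc j)) T K (qq j) (v j) (\<eta>0 j) (\<eta>b j) (A j) (B j)) \<and>
  (\<forall>j\<le>N. AE x in lborel. AE t in lborel. t < T \<longrightarrow> U j x t = (Jt ^^ j) (v j x) t) \<and>
  (\<forall>j. 1 \<le> j \<longrightarrow> j \<le> N \<longrightarrow> (AE t in lborel. t < T \<longrightarrow> \<eta>b (j - 1) t = Jt (\<eta>0 j) t)) \<and>
  (\<forall>j. 1 \<le> j \<longrightarrow> j \<le> N \<longrightarrow> (AE t in lborel. t < T \<longrightarrow> M j * \<eta>0 j t = Jt (\<lambda>t. \<eta>0 j t - A j t) t - (B (j - 1) t - \<eta>b (j - 1) t))) \<and>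
  (AE t in lborel. t < T \<longrightarrow> \<eta>b N t = 0)"
proof -
 from mass_equations obtain \<A> \<B> where C0: "\<forall>k\<le>N. char_data (a k) (a (Suc k)) T K (qq k) (U k) (H k) (H (Suc k)) (\<A> k) (\<B> k)"
  and ME0: "\<forall>j. 1 \<le> j \<longrightarrow> j \<le> N \<longrightarrow> (AE t in lborel. t < T \<longrightarrow> M j * H j t = Jt (\<lambda>t. H j t - \<A> j t) t - Jt (\<lambda>t. \<B> (j - 1) t - H j t) t)"
  by (elim exE conjE)
 note C = C0[rule_format]
 have ME: "AE t in lborel. t < T \<longrightarrow> M j * H j t = Jt (\<lambda>t. H j t - \<A> j t) t - Jt (\<lambda>t. \<B> (j - 1) t - H j t) t" if "1 \<le> j" "j \<le> N" for j
  using ME0 that by blast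
 \<comment> \<open>Level k on interval j: state, end values and waves are all k-fold integrals of
   the data of one system \<open>char_data\<close>.\<close>
 define lv where "lv k j v \<eta>0 \<eta>b A B \<longleftrightarrow> char_data (a j) (a (Suc j)) T K (qq j) v \<eta>0 \<eta>b A B \<and>
   (AE x in lborel. AE t in lborel. t < T \<longrightarrow> U j x t = (Jt ^^ k) (v x) t) \<and>
   (AE t in lborel. t < T \<longrightarrow> H j t = (Jt ^^ k) \<eta>0 t) \<and> (AE t in lborel. t < T \<longrightarrow> H (Suc j) t = (Jt ^^ k) \<eta>b t) \<and>
   (AE t in lborel. t < T \<longrightarrow> \<A> j t = (Jt ^^ k) A t) \<and> (AE t in lborel. t < T \<longrightarrow> \<B> j t = (Jt ^^ k) B t)" for k j v \<eta>0 \<eta>b A B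
 have lvD: "\<eta>0 \<in> L2c" "\<eta>b \<in> L2c" "A \<in> L2c" "B \<in> L2c" "v \<in> Qc (a j) (a (Suc j))"
  "AE x in lborel. AE t in lborel. t < T \<longrightarrow> U j x t = (Jt ^^ k) (v x) t"
  "AE t in lborel. t < T \<longrightarrow> H j t = (Jt ^^ k) \<eta>0 t" "AE t in lborel. t < T \<longrightarrow> H (Suc j) t = (Jt ^^ k) \<eta>b t"
  "AE t in lborel. t < T \<longrightarrow> \<A> j t = (Jt ^^ k) A t" "AE t in lborel. t < T \<longrightarrow> \<B> j t = (Jt ^^ k) B t"
  "char_data (a j) (a (Suc j)) T K (qq j) v \<eta>0 \<eta>b A B"
  if "lv k j v \<eta>0 \<eta>b A B" for k j v \<eta>0 \<eta>b A B
  using that char_data.L[of "a j" "a (Suc j)" T K "qq j" v \<eta>0 \<eta>b A B] char_data.v[of "a j" "a (Suc j)" T K "qq j" v \<eta>0 \<eta>b A B]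
  unfolding lv_def by blast+
 \<comment> \<open>The mass equation with level k to the right and k' to the left of the node. Equal
   levels serve the induction; k = j and k' = j - 1 give the final relation.\<close>
 have balance: "AE t in lborel. t < T \<longrightarrow> (Jt ^^ k) (\<lambda>t. M j * \<eta> t) t = (Jt ^^ k) (\<lambda>t. Jt (\<lambda>t. \<eta> t - A t) t) t - Jt ((Jt ^^ k') (\<lambda>t. B t - \<eta>' t)) t"
  if j: "1 \<le> j" "j \<le> N" and L: "\<eta> \<in> L2c" "A \<in> L2c" "B \<in> L2c" "\<eta>' \<in> L2c"
   and e: "AE t in lborel. t < T \<longrightarrow> H j t = (Jt ^^ k) \<eta> t" "AE t in lborel. t < T \<longrightarrow> \<A> j t = (Jt ^^ k) A t"
    "AE t in lborel. t < T \<longrightarrow> \<B> (j - 1) t = (Jt ^^ k') B t" "AE t in lborel. t < T \<longrightarrow> H j t = (Jt ^^ k') \<eta>' t"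
  for j k k' \<eta> A B \<eta>'
 proof -
  have L\<A>: "\<A> j \<in> L2c" "\<B> (j - 1) \<in> L2c"
   using char_data.L[OF C[OF j(2)]] char_data.L[OF C[of "j - 1"]] j by auto
  have d: "(\<lambda>t. \<eta> t - A t) \<in> L2c" "(\<lambda>t. B t - \<eta>' t) \<in> L2c" by (intro L2c_diff L)+
  have c1: "Jt (\<lambda>t. H j t - \<A> j t) t = Jt ((Jt ^^ k) (\<lambda>t. \<eta> t - A t)) t" if "t < T" for t
  proof (rule Jt_cong_AE[where T=T])
   show "AE t in lborel. t < T \<longrightarrow> H j t - \<A> j t = (Jt ^^ k) (\<lambda>t. \<eta> t - A t) t"
    using e(1,2) by eventually_elim (simp add: Jt_pow_diff[OF L(1,2)])
  qed (use that L2c_diff[OF H L\<A>(1)] Jt_pow_L2c[OF d(1)] in auto)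
  have c2: "Jt (\<lambda>t. \<B> (j - 1) t - H j t) t = Jt ((Jt ^^ k') (\<lambda>t. B t - \<eta>' t)) t" if "t < T" for t
  proof (rule Jt_cong_AE[where T=T])
   show "AE t in lborel. t < T \<longrightarrow> \<B> (j - 1) t - H j t = (Jt ^^ k') (\<lambda>t. B t - \<eta>' t) t"
    using e(3,4) by eventually_elim (simp add: Jt_pow_diff[OF L(3,4)])
  qed (use that L2c_diff[OF L\<A>(2) H] Jt_pow_L2c[OF d(2)] in auto)
  show ?thesis using ME[OF j] e(1)
  proof eventually_elim
   case (elim t)
   show ?case
   proof
    assume t: "t < T"
    have "(Jt ^^ k) (\<lambda>t. M j * \<eta> t) t = M j * H j t" using elim t by (simp add: Jt_pow_cmult)
    also have "\<dots> = Jt ((Jt ^^ k) (\<lambda>t. \<eta> t - A t)) t - Jt ((Jt ^^ k') (\<lambda>t. B t - \<eta>' t)) t"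
     using elim t c1[OF t] c2[OF t] by simp
    finally show "(Jt ^^ k) (\<lambda>t. M j * \<eta> t) t = (Jt ^^ k) (\<lambda>t. Jt (\<lambda>t. \<eta> t - A t) t) t - Jt ((Jt ^^ k') (\<lambda>t. B t - \<eta>' t)) t"
     using Jt_pow_Suc[of k "\<lambda>t. \<eta> t - A t"] by simp
   qed
  qed
 qed
 \<comment> \<open>After cancelling the common level, division by the mass expresses the node value
   as an integral: this is the gain of one level.\<close>
 have node: "\<exists>\<zeta>\<in>L2c. AE t in lborel. t < T \<longrightarrow> \<eta> t = Jt \<zeta> t"
  if j: "1 \<le> j" "j \<le> N" and l: "lv k (j - 1) v1 \<eta>01 \<eta>b1 A1 B1" "lv k j v2 \<eta>02 \<eta>b2 A2 B2"
   and \<eta>: "\<eta> \<in> L2c" "AE t in lborel. t < T \<longrightarrow> H j t = (Jt ^^ k) \<eta> t"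
  for j k v1 \<eta>01 \<eta>b1 A1 B1 v2 \<eta>02 \<eta>b2 A2 B2 \<eta>
 proof -
  note L = lvD(4)[OF l(1)] lvD(3)[OF l(2)]
  note b = balance[OF j \<eta>(1) L(2,1) \<eta>(1) \<eta>(2) lvD(9)[OF l(2)] lvD(10)[OF l(1)] \<eta>(2)]
  define \<zeta> where "\<zeta> = (\<lambda>t. ((\<eta> t - A2 t) - (B1 t - \<eta> t)) / M j)"
  have d: "(\<lambda>t. \<eta> t - A2 t) \<in> L2c" "(\<lambda>t. B1 t - \<eta> t) \<in> L2c" by (intro L2c_diff L \<eta>)+
  have z: "\<zeta> \<in> L2c" unfolding \<zeta>_def by (intro L2c_divide L2c_diff d)
  have "AE t in lborel. t < T \<longrightarrow> M j * \<eta> t = Jt (\<lambda>t. \<eta> t - A2 t) t - Jt (\<lambda>t. B1 t - \<eta> t) t"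
  proof (rule Jt_pow_strip[where k=k])
   show "(\<lambda>t. M j * \<eta> t) \<in> L2c" by (rule L2c_cmult[OF \<eta>(1)])
   show "(\<lambda>t. Jt (\<lambda>t. \<eta> t - A2 t) t - Jt (\<lambda>t. B1 t - \<eta> t) t) \<in> L2c" by (intro L2c_diff Jt_L2c d)
   have e: "(Jt ^^ k) (\<lambda>t. Jt (\<lambda>t. \<eta> t - A2 t) t - Jt (\<lambda>t. B1 t - \<eta> t) t) = (\<lambda>t. (Jt ^^ k) (\<lambda>t. Jt (\<lambda>t. \<eta> t - A2 t) t) t - Jt ((Jt ^^ k) (\<lambda>t. B1 t - \<eta> t)) t)"
    using Jt_pow_diff[OF Jt_L2c[OF d(1)] Jt_L2c[OF d(2)], of k] by (simp add: Jt_pow_Suc)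
   show "AE t in lborel. t < T \<longrightarrow> (Jt ^^ k) (\<lambda>t. M j * \<eta> t) t = (Jt ^^ k) (\<lambda>t. Jt (\<lambda>t. \<eta> t - A2 t) t - Jt (\<lambda>t. B1 t - \<eta> t) t) t"
    unfolding e by (rule b)
  qed
  then have "AE t in lborel. t < T \<longrightarrow> \<eta> t = Jt \<zeta> t"
  proof eventually_elim
   case (elim t)
   have "Jt \<zeta> t = (Jt (\<lambda>t. \<eta> t - A2 t) t - Jt (\<lambda>t. B1 t - \<eta> t) t) / M j"
    unfolding \<zeta>_def Jt_divide Jt_diff[OF d] ..
   then have "M j * Jt \<zeta> t = Jt (\<lambda>t. \<eta> t - A2 t) t - Jt (\<lambda>t. B1 t - \<eta> t) t" using M[OF j] by simp
   then have "M j * \<eta> t = M j * Jt \<zeta> t" if "t < T" using elim that by simp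
   then show ?case using M[OF j] by simp
  qed
  then show ?thesis using z by blast
 qed
 have ex: "\<exists>v \<eta>0 \<eta>b A B. lv k j v \<eta>0 \<eta>b A B" if "k \<le> j" "j \<le> N" for k j
  using that
 proof (induction k arbitrary: j)
  case 0
  then have "lv 0 j (U j) (H j) (H (Suc j)) (\<A> j) (\<B> j)" using C by (simp add: lv_def)
  then show ?case by blast
 next
  case (Suc k)
  have "k \<le> j - 1" "j - 1 \<le> N" using Suc.prems by auto
  from Suc.IH[OF this] obtain v1 \<eta>01 \<eta>b1 A1 B1 where l1: "lv k (j - 1) v1 \<eta>01 \<eta>b1 A1 B1" by blast
  obtain v \<eta>0 \<eta>b A B where l: "lv k j v \<eta>0 \<eta>b A B" using Suc.IH[of j] Suc.prems by auto
  have j1: "1 \<le> j" using Suc.prems by simp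
  obtain \<zeta>0 where z0: "\<zeta>0 \<in> L2c" "AE t in lborel. t < T \<longrightarrow> \<eta>0 t = Jt \<zeta>0 t"
   using node[OF j1 Suc.prems(2) l1 l lvD(1)[OF l] lvD(7)[OF l]] by blast
  \<comment> \<open>At a mass the next interval is at level k by induction; at the end of the string
    the value is 0, which is its own integral.\<close>
  obtain \<zeta>b where zb: "\<zeta>b \<in> L2c" "AE t in lborel. t < T \<longrightarrow> \<eta>b t = Jt \<zeta>b t"
  proof (cases "j = N")
   case True
   have "AE t in lborel. t < T \<longrightarrow> (Jt ^^ k) \<eta>b t = (Jt ^^ k) (\<lambda>t. 0) t"
    using lvD(8)[OF l] Jt_pow_cmult[of k 0 "\<lambda>t. 0"] by (simp add: True HN) 
   then have "AE t in lborel. t < T \<longrightarrow> \<eta>b t = 0" by (rule Jt_pow_strip[OF lvD(2)[OF l] L2c_zero])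
   then show ?thesis using that[OF L2c_zero] by simp
  next
   case False
   then have jN: "Suc j \<le> N" using Suc.prems by simp
   obtain v2 \<eta>02 \<eta>b2 A2 B2 where l2: "lv k (Suc j) v2 \<eta>02 \<eta>b2 A2 B2" using Suc.IH[of "Suc j"] Suc.prems jN by auto
   have l': "lv k (Suc j - 1) v \<eta>0 \<eta>b A B" using l by simp
   show ?thesis using node[OF _ jN l' l2 lvD(2)[OF l] lvD(8)[OF l]] that by auto
  qed
  obtain v' A' B' where n: "char_data (a j) (a (Suc j)) T K (qq j) v' \<zeta>0 \<zeta>b A' B'"
   "AE t in lborel. t < T \<longrightarrow> A t = Jt A' t" "AE t in lborel. t < T \<longrightarrow> B t = Jt B' t"
   "AE x in lborel. AE t in lborel. t < T \<longrightarrow> v x t = Jt (v' x) t"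
   by (rule char_data.lift[OF lvD(11)[OF l] z0(1) zb(1) z0(2) zb(2)])
  have up: "AE t in lborel. t < T \<longrightarrow> f t = (Jt ^^ Suc k) g' t"
   if "AE t in lborel. t < T \<longrightarrow> f t = (Jt ^^ k) g t" "AE t in lborel. t < T \<longrightarrow> g t = Jt g' t" "g \<in> L2c" "g' \<in> L2c" for f g g'
   using that(1) Jt_pow_cong_AE[OF that(3) Jt_L2c[OF that(4)] that(2), of k]
   by eventually_elim (simp add: Jt_pow_Suc)
  note v'Q = char_data.v[OF n(1)] and L' = char_data.L[OF n(1)]
  have "AE x in lborel. AE t in lborel. t < T \<longrightarrow> U j x t = (Jt ^^ Suc k) (v' x) t"
   using lvD(6)[OF l] n(4)
  proof eventually_elim
   case (elim x)
   show ?case by (rule up[OF elim QcD(1)[OF lvD(5)[OF l]] QcD(1)[OF v'Q]])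
  qed
  then have "lv (Suc k) j v' \<zeta>0 \<zeta>b A' B'"
   unfolding lv_def using n(1) up[OF lvD(7)[OF l] z0(2) lvD(1)[OF l] z0(1)] up[OF lvD(8)[OF l] zb(2) lvD(2)[OF l] zb(1)]
    up[OF lvD(9)[OF l] n(2) lvD(3)[OF l] L'(3)] up[OF lvD(10)[OF l] n(3) lvD(4)[OF l] L'(4)] by blast
  then show ?case by blast
 qed
 have "\<forall>j. \<exists>v \<eta>0 \<eta>b A B. j \<le> N \<longrightarrow> lv j j v \<eta>0 \<eta>b A B" using ex by blast
 then obtain v \<eta>0 \<eta>b A B where l: "\<And>j. j \<le> N \<Longrightarrow> lv j j (v j) (\<eta>0 j) (\<eta>b j) (A j) (B j)" by metis
 show ?thesis
 proof (intro exI conjI allI impI)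
  fix j assume "j \<le> N"
  from lvD(11)[OF l[OF this]] lvD(6)[OF l[OF this]]
  show "char_data (a j) (a (Suc j)) T K (qq j) (v j) (\<eta>0 j) (\<eta>b j) (A j) (B j)"
   "AE x in lborel. AE t in lborel. t < T \<longrightarrow> U j x t = (Jt ^^ j) (v j x) t" .
 next
  fix j assume j: "1 \<le> j" "j \<le> N"
  then obtain i where i: "j = Suc i" "i \<le> N" by (cases j) auto
  note lj = l[OF j(2)] and li = l[OF i(2)]
  note d = lvD(8)[OF li] lvD(10)[OF li]
  show b: "AE t in lborel. t < T \<longrightarrow> \<eta>b (j - 1) t = Jt (\<eta>0 j) t"
  proof (rule Jt_pow_strip[where k=i])
   show "\<eta>b (j - 1) \<in> L2c" "Jt (\<eta>0 j) \<in> L2c" using lvD(2)[OF li] Jt_L2c[OF lvD(1)[OF lj]] i by auto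
   show "AE t in lborel. t < T \<longrightarrow> (Jt ^^ i) (\<eta>b (j - 1)) t = (Jt ^^ i) (Jt (\<eta>0 j)) t"
    using d(1) lvD(7)[OF lj] by eventually_elim (simp add: i Jt_pow_Suc)
  qed
  note bal = balance[OF j lvD(1)[OF lj] lvD(3)[OF lj] lvD(4)[OF li] lvD(2)[OF li] lvD(7)[OF lj] lvD(9)[OF lj], of i]
  show "AE t in lborel. t < T \<longrightarrow> M j * \<eta>0 j t = Jt (\<lambda>t. \<eta>0 j t - A j t) t - (B (j - 1) t - \<eta>b (j - 1) t)"
  proof (rule Jt_pow_strip[where k=j])
   have dd: "(\<lambda>t. \<eta>0 j t - A j t) \<in> L2c" "(\<lambda>t. B i t - \<eta>b i t) \<in> L2c"
    by (intro L2c_diff lvD(1,3)[OF lj] lvD(2,4)[OF li])+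
   show "(\<lambda>t. M j * \<eta>0 j t) \<in> L2c" by (rule L2c_cmult[OF lvD(1)[OF lj]])
   show "(\<lambda>t. Jt (\<lambda>t. \<eta>0 j t - A j t) t - (B (j - 1) t - \<eta>b (j - 1) t)) \<in> L2c" using L2c_diff[OF Jt_L2c[OF dd(1)] dd(2)] i by simp
   have e: "(Jt ^^ j) (\<lambda>t. Jt (\<lambda>t. \<eta>0 j t - A j t) t - (B (j - 1) t - \<eta>b (j - 1) t)) = (\<lambda>t. (Jt ^^ j) (\<lambda>t. Jt (\<lambda>t. \<eta>0 j t - A j t) t) t - Jt ((Jt ^^ i) (\<lambda>t. B i t - \<eta>b i t)) t)"
    using Jt_pow_diff[OF Jt_L2c[OF dd(1)] dd(2), of j] i by simp
   show "AE t in lborel. t < T \<longrightarrow> (Jt ^^ j) (\<lambda>t. M j * \<eta>0 j t) t = (Jt ^^ j) (\<lambda>t. Jt (\<lambda>t. \<eta>0 j t - A j t) t - (B (j - 1) t - \<eta>b (j - 1) t)) t"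
    unfolding e by (rule bal) (use d i in auto)
  qed
 next
  note lN = l[OF order_refl]
  have "AE t in lborel. t < T \<longrightarrow> (Jt ^^ N) (\<eta>b N) t = (Jt ^^ N) (\<lambda>t. 0) t"
   using lvD(8)[OF lN] Jt_pow_cmult[of N 0 "\<lambda>t. 0"] by (simp add: HN)
  then show "AE t in lborel. t < T \<longrightarrow> \<eta>b N t = 0" by (rule Jt_pow_strip[OF lvD(2)[OF lN] L2c_zero])
 qed
qed

end

section \<open>Compatibility conditions\<close>

lemma Jt_pow_cong_T:
 assumes "f \<in> L2c" "g \<in> L2c" "AE t in lborel. t < T \<longrightarrow> f t = g t" "p \<ge> 1"
 shows "(Jt ^^ p) f T = (Jt ^^ p) g T"
proof -
 obtain k where p: "p = Suc k" using assms(4) by (cases p) auto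
 have "Jt ((Jt ^^ k) f) T = Jt ((Jt ^^ k) g) T"
  by (rule Jt_cong_AE[OF Jt_pow_L2c[OF assms(1)] Jt_pow_L2c[OF assms(2)] Jt_pow_cong_AE[OF assms(1-3)] order_refl])
 then show ?thesis by (simp add: p)
qed

text \<open>Three forms of the potential: \<open>q\<close> of \<open>char_data\<close> is defined on
  the line and agrees with \<open>Q\<close> on the closed interval, \<open>Q\<close> is continuous
  there, and \<open>q'\<close> is the potential of the statement, known only on the open
  interval.\<close>

locale char_rep = char_data +
 fixes Q q' :: "real \<Rightarrow> real"
 assumes Q: "continuous_on {\<alpha>..\<beta>} Q" and qQ: "\<And>x. x \<in> {\<alpha>..\<beta>} \<Longrightarrow> q x = Q x"
  and q'Q: "\<And>x. x \<in> {\<alpha><..<\<beta>} \<Longrightarrow> q' x = Q x"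
begin

lemma GG_integrable: "set_integrable lborel {\<alpha>..\<beta>} (GG m)"
 by (rule Sob0_integrable[OF GG_Sob0])

text \<open>Relations valid below T reach the final time after one integration, so slices of the
  integrated state can be paired through the representative; the level k is added to its
  index.\<close>

lemma time_slice:
 assumes w: "w \<in> Qc \<alpha> \<beta>" and wv: "AE x in lborel. AE t in lborel. t < T \<longrightarrow> w x t = (Jt ^^ k) (v x) t"
  and \<kappa>: "\<kappa> \<in> borel_measurable borel" and \<kappa>0: "\<And>x. x \<notin> {\<alpha><..<\<beta>} \<Longrightarrow> \<kappa> x = 0"
 shows "(LBINT x. \<kappa> x * (Jt ^^ Suc r) (w x) T) = (LBINT x:{\<alpha>..\<beta>}. GG (Suc (k + r)) x * \<kappa> x)"
 unfolding set_lebesgue_integral_def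
proof (rule integral_cong_AE)
 note Qc_measurable[OF Jt_pow_Qc[OF w], measurable (raw)]
 note [measurable] = \<kappa>
 show "(\<lambda>x. \<kappa> x * (Jt ^^ Suc r) (w x) T) \<in> borel_measurable lborel" by measurable
 have "(\<lambda>x. (indicator {\<alpha>..\<beta>} x * GG (Suc (k + r)) x) * \<kappa> x) \<in> borel_measurable borel"
  by (rule borel_measurable_times[OF set_integrable_borel[OF GG_integrable] \<kappa>])
 then show "(\<lambda>x. indicator {\<alpha>..\<beta>} x *\<^sub>R (GG (Suc (k + r)) x * \<kappa> x)) \<in> borel_measurable lborel" by (simp add: mult.assoc)
 show "AE x in lborel. \<kappa> x * (Jt ^^ Suc r) (w x) T = indicator {\<alpha>..\<beta>} x *\<^sub>R (GG (Suc (k + r)) x * \<kappa> x)"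
  using wv v_at_T[of "k + r"]
 proof eventually_elim
  case (elim x)
  show ?case
  proof (cases "x \<in> {\<alpha><..<\<beta>}")
   case True
   have "(Jt ^^ Suc r) (w x) T = (Jt ^^ Suc r) ((Jt ^^ k) (v x)) T"
    by (rule Jt_pow_cong_T[OF QcD(1)[OF w] Jt_pow_L2c[OF QcD(1)[OF v]] elim(1)]) simp
   also have "\<dots> = (Jt ^^ Suc (k + r)) (v x) T"
    by (simp add: funpow_add[of r k, simplified o_def, THEN fun_cong] add.commute[of k r])
   finally show ?thesis using True elim(2) by simp
  qed (simp add: \<kappa>0)
 qed
qed

text \<open>Moving L from the test function to the representative removes two integrations.\<close>

lemma GG_second_order:
 assumes \<eta>: "\<eta> \<in> test_functions \<alpha> \<beta>"
 shows "(LBINT x:{\<alpha>..\<beta>}. GG (Suc (Suc k)) x * (deriv (deriv \<eta>) x - Q x * \<eta> x)) = (LBINT x:{\<alpha>..\<beta>}. GG k x * \<eta> x)"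
proof -
 note c = test_fn_continuous012[OF \<eta>] and gc = AC_continuous[OF GG_AC[of "Suc k"]]
 have i: "set_integrable lborel {\<alpha>..\<beta>} (\<lambda>x. GG (Suc (Suc k)) x * deriv (deriv \<eta>) x)"
  "set_integrable lborel {\<alpha>..\<beta>} (\<lambda>x. Q x * GG (Suc (Suc k)) x * \<eta> x)"
  by (intro borel_integrable_atLeastAtMost' continuous_intros gc c Q)+
 have "(LBINT x:{\<alpha>..\<beta>}. GG (Suc (Suc k)) x * (deriv (deriv \<eta>) x - Q x * \<eta> x))
  = (LBINT x:{\<alpha>..\<beta>}. GG (Suc (Suc k)) x * deriv (deriv \<eta>) x - Q x * GG (Suc (Suc k)) x * \<eta> x)"
  by (simp only: right_diff_distrib mult.assoc mult.left_commute)
 also have "\<dots> = (LBINT x:{\<alpha>..\<beta>}. GG (Suc (Suc k)) x * deriv (deriv \<eta>) x) - (LBINT x:{\<alpha>..\<beta>}. Q x * GG (Suc (Suc k)) x * \<eta> x)"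
  by (rule set_integral_diff(2)[OF i])
 finally show ?thesis using AC_second_order[OF GG_AC gg_AC[OF Q qQ] ab' GG_integrable Q \<eta>, of k] by linarith
qed

text \<open>With index 1 only one derivative can be moved and the other stays on the test function.
  This is the form of functional provided by \<open>H1_left_dual_ex\<close>.\<close>

lemma GG_first_order:
 assumes \<eta>: "\<eta> \<in> test_functions \<alpha> \<beta>"
 shows "(LBINT x:{\<alpha>..\<beta>}. GG (Suc 0) x * (deriv (deriv \<eta>) x - Q x * \<eta> x)) =
  - (LINT x|lebesgue_on {\<alpha><..<\<beta>}. gg (Suc 0) x * deriv \<eta> x) - (LINT x|lebesgue_on {\<alpha><..<\<beta>}. Q x * GG (Suc 0) x * \<eta> x)"
proof -
 note c = test_fn_continuous012[OF \<eta>] and gc = AC_continuous[OF GG_AC[of 0]] and z = test_fn_zeros[OF \<eta>]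
 have i: "set_integrable lborel {\<alpha>..\<beta>} (\<lambda>x. GG (Suc 0) x * deriv (deriv \<eta>) x)"
  "set_integrable lborel {\<alpha>..\<beta>} (\<lambda>x. Q x * GG (Suc 0) x * \<eta> x)"
  by (intro borel_integrable_atLeastAtMost' continuous_intros gc c Q)+
 have iQ: "set_integrable lborel {\<alpha>..\<beta>} (\<lambda>x. Q x * GG (Suc 0) x)"
  by (intro borel_integrable_atLeastAtMost' continuous_intros gc Q)
 have "(LBINT x:{\<alpha>..\<beta>}. GG (Suc 0) x * (deriv (deriv \<eta>) x - Q x * \<eta> x))
  = (LBINT x:{\<alpha>..\<beta>}. GG (Suc 0) x * deriv (deriv \<eta>) x - Q x * GG (Suc 0) x * \<eta> x)"
  by (simp only: right_diff_distrib mult.assoc mult.left_commute)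
 also have "\<dots> = (LBINT x:{\<alpha>..\<beta>}. GG (Suc 0) x * deriv (deriv \<eta>) x) - (LBINT x:{\<alpha>..\<beta>}. Q x * GG (Suc 0) x * \<eta> x)"
  by (rule set_integral_diff(2)[OF i])
 also have "(LBINT x:{\<alpha>..\<beta>}. GG (Suc 0) x * deriv (deriv \<eta>) x) = - (LBINT x:{\<alpha>..\<beta>}. gg (Suc 0) x * deriv \<eta> x)"
  by (rule AC_test[OF GG_AC ab' test_fn_DERIV01(2)[OF \<eta>] c(3)]) (simp_all add: z)
 finally show ?thesis
  using Lint_test[OF set_integrable_borel[OF AC_integrable(2)[OF GG_AC[of 0]]] c(2) z(2)]
   Lint_test[OF set_integrable_borel[OF iQ] c(1) z(1)] by linarith
qed

lemma represents_GG:
 assumes R: "\<And>\<eta>. \<eta> \<in> test_functions \<alpha> \<beta> \<Longrightarrow> \<Lambda> \<eta> = (LBINT x:{\<alpha>..\<beta>}. GG m x * \<eta> x)"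
 shows "represents \<alpha> \<beta> (GG m) \<Lambda>"
 unfolding represents_def regular_distr_def
proof (intro conjI ballI locally_integrableI GG_integrable)
 fix \<eta> assume \<eta>: "\<eta> \<in> test_functions \<alpha> \<beta>"
 show "\<Lambda> \<eta> = (LINT x|lebesgue_on {\<alpha><..<\<beta>}. GG m x * \<eta> x)"
  unfolding R[OF \<eta>]
  by (rule Lint_test[OF set_integrable_borel[OF GG_integrable] test_fn_continuous012(1)[OF \<eta>] test_fn_zeros(1)[OF \<eta>], symmetric])
qed

text \<open>By \<open>gg_AC\<close>, L acts on the representatives as a removal of two
  integrations.\<close>

lemma is_L_pow_GG:
 assumes R: "\<And>\<eta>. \<eta> \<in> test_functions \<alpha> \<beta> \<Longrightarrow> \<Lambda> \<eta> = (LBINT x:{\<alpha>..\<beta>}. GG m x * \<eta> x)" and n: "2 * n \<le> m"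
 shows "is_L_pow q' \<alpha> \<beta> n \<Lambda> (GG (m - 2 * n))"
 unfolding is_L_pow_def
proof (intro exI[of _ "\<lambda>i. GG (m - 2 * i)"] conjI allI impI)
 show "represents \<alpha> \<beta> (GG (m - 2 * 0)) \<Lambda>" using represents_GG[of \<Lambda> m] R by simp
 fix i assume "i < n"
 then have "m - 2 * i = Suc (Suc (m - 2 * Suc i))" using n by simp
 then show "is_L q' \<alpha> \<beta> (GG (m - 2 * i)) (GG (m - 2 * Suc i))"
  using AC_is_L[OF GG_AC gg_AC[OF Q qQ] ab' GG_integrable Q q'Q, of "m - 2 * Suc i"] by simp
qed simp

lemma L_pow_value_GG:
 assumes R: "\<And>\<eta>. \<eta> \<in> test_functions \<alpha> \<beta> \<Longrightarrow> \<Lambda> \<eta> = (LBINT x:{\<alpha>..\<beta>}. GG m x * \<eta> x)" and n: "2 * n < m"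
 shows "L_pow_value q' \<alpha> \<beta> n \<Lambda> \<alpha> ((Jt ^^ (m - 2 * n)) \<eta>0 T)" "L_pow_value q' \<alpha> \<beta> n \<Lambda> \<beta> ((Jt ^^ (m - 2 * n)) \<eta>b T)"
proof -
 obtain k where k: "m - 2 * n = Suc k" using n by (metis Suc_diff_Suc)
 have p: "is_L_pow q' \<alpha> \<beta> n \<Lambda> (GG (Suc k))" using is_L_pow_GG[of \<Lambda> m n] R n k by simp
 have t: "has_trace \<alpha> \<beta> (GG (Suc k)) x (GG (Suc k) x)" for x
  by (rule continuous_has_trace[OF AC_continuous[OF GG_AC]])
 show "L_pow_value q' \<alpha> \<beta> n \<Lambda> \<alpha> ((Jt ^^ (m - 2 * n)) \<eta>0 T)" "L_pow_value q' \<alpha> \<beta> n \<Lambda> \<beta> ((Jt ^^ (m - 2 * n)) \<eta>b T)"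
  unfolding k GG_alpha[symmetric] GG_beta[symmetric] L_pow_value_def using p t by blast+
qed

lemma L_pow_deriv_value_GG:
 assumes R: "\<And>\<eta>. \<eta> \<in> test_functions \<alpha> \<beta> \<Longrightarrow> \<Lambda> \<eta> = (LBINT x:{\<alpha>..\<beta>}. GG m x * \<eta> x)" and n: "m = 2 * n + Suc (Suc k)"
 shows "L_pow_deriv_value q' \<alpha> \<beta> n \<Lambda> \<alpha> ((Jt ^^ Suc k) (\<lambda>t. \<eta>0 t - A t) T)"
  "L_pow_deriv_value q' \<alpha> \<beta> n \<Lambda> \<beta> ((Jt ^^ Suc k) (\<lambda>t. B t - \<eta>b t) T)"
proof -
 have p: "is_L_pow q' \<alpha> \<beta> n \<Lambda> (GG (Suc (Suc k)))" using is_L_pow_GG[of \<Lambda> m n] R n by simp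
 have t: "has_trace \<alpha> \<beta> (gg (Suc (Suc k))) x (gg (Suc (Suc k)) x)" for x
  by (rule continuous_has_trace[OF AC_continuous[OF gg_AC[OF Q qQ]]])
 have w: "weak_derivative \<alpha> \<beta> (GG (Suc (Suc k))) (gg (Suc (Suc k)))" by (rule AC_weak_derivative[OF GG_AC ab'])
 show "L_pow_deriv_value q' \<alpha> \<beta> n \<Lambda> \<alpha> ((Jt ^^ Suc k) (\<lambda>t. \<eta>0 t - A t) T)"
  "L_pow_deriv_value q' \<alpha> \<beta> n \<Lambda> \<beta> ((Jt ^^ Suc k) (\<lambda>t. B t - \<eta>b t) T)"
  unfolding gg_alpha[symmetric] gg_beta[symmetric] L_pow_deriv_value_def using p t w by blast+
qed

end

text \<open>The ceiling of k/2 is at most (k + 1)/2.\<close>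

lemma ceiling_half_le:
 fixes n c :: nat and k :: int
 assumes "int n \<le> \<lceil>real_of_int k / 2\<rceil> - int c"
 shows "2 * int n + 2 * int c \<le> k + 1"
proof -
 have "int n + int c \<le> \<lceil>real_of_int k / 2\<rceil>" using assms by simp
 then have "real_of_int (int n + int c) - 1 < real_of_int k / 2" by (simp only: le_ceiling_iff)
 then have "real_of_int (2 * int n + 2 * int c) < real_of_int (k + 2)" by simp
 then show ?thesis by (simp only: of_int_less_iff)
qed

locale char_chain =
 fixes N :: nat and T K :: real and a M :: "nat \<Rightarrow> real" and q :: "real \<Rightarrow> real" and qq Q :: "nat \<Rightarrow> real \<Rightarrow> real"
  and v :: "nat \<Rightarrow> real \<Rightarrow> real \<Rightarrow> real" and \<eta>0 \<eta>b A B :: "nat \<Rightarrow> real \<Rightarrow> real"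
 assumes N: "N \<ge> 1"
  and rep: "\<And>j. j \<le> N \<Longrightarrow> char_rep (a j) (a (Suc j)) T K (qq j) (v j) (\<eta>0 j) (\<eta>b j) (A j) (B j) (Q j) q"
  and link: "\<And>j. 1 \<le> j \<Longrightarrow> j \<le> N \<Longrightarrow> AE t in lborel. t < T \<longrightarrow> \<eta>b (j - 1) t = Jt (\<eta>0 j) t"
  and mass: "\<And>j. 1 \<le> j \<Longrightarrow> j \<le> N \<Longrightarrow> AE t in lborel. t < T \<longrightarrow> M j * \<eta>0 j t = Jt (\<lambda>t. \<eta>0 j t - A j t) t - (B (j - 1) t - \<eta>b (j - 1) t)"
  and last: "AE t in lborel. t < T \<longrightarrow> \<eta>b N t = 0"
begin

definition G :: "nat \<Rightarrow> nat \<Rightarrow> real \<Rightarrow> real" where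
 "G j = char_data.GG (a j) (a (Suc j)) T (qq j) (v j) (A j) (B j)"

lemma L: "j \<le> N \<Longrightarrow> \<eta>0 j \<in> L2c" "j \<le> N \<Longrightarrow> \<eta>b j \<in> L2c" "j \<le> N \<Longrightarrow> A j \<in> L2c" "j \<le> N \<Longrightarrow> B j \<in> L2c"
 using char_data.L[OF char_rep.axioms(1)[OF rep]] by blast+

lemma cond_C_star_G:
 assumes R: "\<And>k \<eta>. i \<le> k \<Longrightarrow> k \<le> N \<Longrightarrow> \<eta> \<in> test_functions (a k) (a (Suc k)) \<Longrightarrow> \<phi> k \<eta> = (LBINT x:{a k..a (Suc k)}. G k (k - i) x * \<eta> x)"
 shows "cond_C_star N a M q (- int i) \<phi>"
 unfolding cond_C_star_def
proof (intro conjI ballI)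
 fix j assume "j \<in> {1..N}"
 then obtain k where j: "j = Suc k" "Suc k \<le> N" by (cases j) auto
 then have j': "1 \<le> Suc k" "k \<le> N" by auto
 show "cond_C_mass a M q (int j - 1 + - int i) j \<phi>"
  unfolding cond_C_mass_def j diff_Suc_1 Suc_eq_plus1[symmetric]
 proof (intro conjI allI impI)
  fix n :: nat assume n: "int n \<le> \<lceil>real_of_int (int (Suc k) - 1 + - int i) / 2\<rceil> - 2"
  have "2 * int n + 2 * int 2 \<le> (int (Suc k) - 1 + - int i) + 1" by (rule ceiling_half_le) (use n in simp)
  then have nk: "2 * n + 3 + i \<le> k" by simp
  \<comment> \<open>After L^n, p + 1 integrations remain in the left slope and one more in the right
    slope, as the next interval is one level higher. L^(n+1) brings the value on the right back to p
    + 1.\<close>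
  obtain p where p: "k - i = 2 * n + Suc (Suc p)" "Suc k - i = 2 * n + Suc (Suc (Suc p))" "Suc k - i - 2 * (n + 1) = Suc p" "2 * (n + 1) < Suc k - i"
  proof (rule that[of "k - i - 2 * n - 2"])
  qed (use nk in auto)
  have i: "i \<le> k" "i \<le> Suc k" using nk by auto
  have 1: "L_pow_deriv_value q (a k) (a (Suc k)) n (\<phi> k) (a (Suc k)) ((Jt ^^ Suc p) (\<lambda>t. B k t - \<eta>b k t) T)"
   by (rule char_rep.L_pow_deriv_value_GG(2)[OF rep[OF j'(2)] _ p(1)]) (rule R[OF i(1) j'(2), unfolded G_def])
  have 2: "L_pow_deriv_value q (a (Suc k)) (a (Suc (Suc k))) n (\<phi> (Suc k)) (a (Suc k)) ((Jt ^^ Suc (Suc p)) (\<lambda>t. \<eta>0 (Suc k) t - A (Suc k) t) T)"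
   by (rule char_rep.L_pow_deriv_value_GG(1)[OF rep[OF j(2)] _ p(2)]) (rule R[OF i(2) j(2), unfolded G_def])
  have 3: "L_pow_value q (a (Suc k)) (a (Suc (Suc k))) (n + 1) (\<phi> (Suc k)) (a (Suc k)) ((Jt ^^ (Suc k - i - 2 * (n + 1))) (\<eta>0 (Suc k)) T)"
   by (rule char_rep.L_pow_value_GG(1)[OF rep[OF j(2)] _ p(4)]) (rule R[OF i(2) j(2), unfolded G_def])
  have d: "(\<lambda>t. \<eta>0 (Suc k) t - A (Suc k) t) \<in> L2c" "(\<lambda>t. B k t - \<eta>b k t) \<in> L2c" by (intro L2c_diff L j j')+
  have "(Jt ^^ Suc p) (\<lambda>t. M (Suc k) * \<eta>0 (Suc k) t) T = (Jt ^^ Suc p) (\<lambda>t. Jt (\<lambda>t. \<eta>0 (Suc k) t - A (Suc k) t) t - (B k t - \<eta>b k t)) T"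
   using mass[OF j'(1) j(2)]
   by (intro Jt_pow_cong_T[where T=T] L2c_cmult L2c_diff[OF Jt_L2c[OF d(1)] d(2)] L j) (simp_all del: funpow.simps)
  also have "\<dots> = (Jt ^^ Suc (Suc p)) (\<lambda>t. \<eta>0 (Suc k) t - A (Suc k) t) T - (Jt ^^ Suc p) (\<lambda>t. B k t - \<eta>b k t) T"
   by (subst Jt_pow_diff[OF Jt_L2c[OF d(1)] d(2)]) (simp only: Jt_pow_Suc funpow.simps o_apply)
  finally have e: "(Jt ^^ Suc p) (\<lambda>t. B k t - \<eta>b k t) T = (Jt ^^ Suc (Suc p)) (\<lambda>t. \<eta>0 (Suc k) t - A (Suc k) t) T - M (Suc k) * (Jt ^^ (Suc k - i - 2 * (n + 1))) (\<eta>0 (Suc k)) T"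
   by (simp only: Jt_pow_cmult p(3))
  show "\<exists>\<alpha> \<beta> \<gamma>. L_pow_deriv_value q (a k) (a (Suc k)) n (\<phi> k) (a (Suc k)) \<alpha> \<and>
    L_pow_deriv_value q (a (Suc k)) (a (Suc (Suc k))) n (\<phi> (Suc k)) (a (Suc k)) \<beta> \<and>
    L_pow_value q (a (Suc k)) (a (Suc (Suc k))) (Suc n) (\<phi> (Suc k)) (a (Suc k)) \<gamma> \<and> \<alpha> = \<beta> - M (Suc k) * \<gamma>"
   using 1 2 3 e unfolding Suc_eq_plus1[of n] by blast
 next
  fix n :: nat assume n: "int n \<le> \<lceil>real_of_int (int (Suc k) - 1 + - int i) / 2\<rceil> - 1"
  have "2 * int n + 2 * int 1 \<le> (int (Suc k) - 1 + - int i) + 1" by (rule ceiling_half_le) (use n in simp)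
  then have nk: "2 * n + 1 + i \<le> k" by simp
  then have i: "i \<le> k" "i \<le> Suc k" and m: "2 * n < k - i" "2 * n < Suc k - i" "Suc k - i - 2 * n = Suc (k - i - 2 * n)" "k - i - 2 * n \<ge> 1" by auto
  have 1: "L_pow_value q (a k) (a (Suc k)) n (\<phi> k) (a (Suc k)) ((Jt ^^ (k - i - 2 * n)) (\<eta>b k) T)"
   by (rule char_rep.L_pow_value_GG(2)[OF rep[OF j'(2)] _ m(1)]) (rule R[OF i(1) j'(2), unfolded G_def])
  have 2: "L_pow_value q (a (Suc k)) (a (Suc (Suc k))) n (\<phi> (Suc k)) (a (Suc k)) ((Jt ^^ (Suc k - i - 2 * n)) (\<eta>0 (Suc k)) T)"
   by (rule char_rep.L_pow_value_GG(1)[OF rep[OF j(2)] _ m(2)]) (rule R[OF i(2) j(2), unfolded G_def])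
  \<comment> \<open>The additional integration on the right interval is the one in
    \<open>link\<close>.\<close>
  have "(Jt ^^ (k - i - 2 * n)) (\<eta>b k) T = (Jt ^^ (k - i - 2 * n)) (Jt (\<eta>0 (Suc k))) T"
   using link[OF j'(1) j(2)] by (intro Jt_pow_cong_T[where T=T] Jt_L2c L j j' m(4)) simp
  also have "\<dots> = (Jt ^^ (Suc k - i - 2 * n)) (\<eta>0 (Suc k)) T" by (simp only: m(3) Jt_pow_Suc funpow.simps o_apply)
  finally show "\<exists>\<alpha>. L_pow_value q (a k) (a (Suc k)) n (\<phi> k) (a (Suc k)) \<alpha> \<and> L_pow_value q (a (Suc k)) (a (Suc (Suc k))) n (\<phi> (Suc k)) (a (Suc k)) \<alpha>"
   using 1 2 by auto
 qed
next
 show "cond_C_end N a q (int (N + 1) - 1 + - int i) \<phi>"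
  unfolding cond_C_end_def Suc_eq_plus1[symmetric]
 proof (intro allI impI)
  fix n :: nat assume n: "int n \<le> \<lceil>real_of_int (int (Suc N) - 1 + - int i) / 2\<rceil> - 1"
  have "2 * int n + 2 * int 1 \<le> (int (Suc N) - 1 + - int i) + 1" by (rule ceiling_half_le) (use n in simp)
  then have nk: "2 * n + 1 + i \<le> N" by simp
  then have i: "i \<le> N" and m: "2 * n < N - i" "N - i - 2 * n \<ge> 1" by auto
  have 1: "L_pow_value q (a N) (a (Suc N)) n (\<phi> N) (a (Suc N)) ((Jt ^^ (N - i - 2 * n)) (\<eta>b N) T)"
   by (rule char_rep.L_pow_value_GG(2)[OF rep[OF order_refl] _ m(1)]) (rule R[OF i order_refl, unfolded G_def])
  have "(Jt ^^ (N - i - 2 * n)) (\<eta>b N) T = (Jt ^^ (N - i - 2 * n)) (\<lambda>t. 0) T"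
   using last by (intro Jt_pow_cong_T[where T=T] L2c_zero L m(2)) simp_all
  also have "\<dots> = 0" using Jt_pow_cmult[of "N - i - 2 * n" 0 "\<lambda>t. 0"] by simp
  finally show "L_pow_value q (a N) (a (Suc N)) n (\<phi> N) (a (Suc N)) 0" using 1 by simp
 qed
qed

end

section \<open>The weak solution\<close>

lemma C2_rect_cong:
 assumes C: "C2_rect X I w wx wt wxx wxt wtt" and e: "\<And>x t. x \<in> X \<Longrightarrow> t \<in> I \<Longrightarrow> w x t = w' x t"
 shows "C2_rect X I w' wx wt wxx wxt wtt"
proof -
 have "continuous_on (X \<times> I) (\<lambda>(x, t). w x t)" using C unfolding C2_rect_def by blast
 then have c: "continuous_on (X \<times> I) (\<lambda>(x, t). w' x t)" by (rule continuous_on_eq) (use e in auto)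
 have d: "((\<lambda>y. w' y t) has_real_derivative wx x t) (at x within X)" "((\<lambda>s. w' x s) has_real_derivative wt x t) (at t within I)"
  if "x \<in> X" "t \<in> I" for x t
 proof -
  have D: "((\<lambda>y. w y t) has_real_derivative wx x t) (at x within X)" "((\<lambda>s. w x s) has_real_derivative wt x t) (at t within I)"
   using C that unfolding C2_rect_def by blast+
  show "((\<lambda>y. w' y t) has_real_derivative wx x t) (at x within X)"
   by (rule has_field_derivative_transform_within[OF D(1) zero_less_one that(1)]) (use e that in auto)
  show "((\<lambda>s. w' x s) has_real_derivative wt x t) (at t within I)"
   by (rule has_field_derivative_transform_within[OF D(2) zero_less_one that(2)]) (use e that in auto)
 qed
 show ?thesis using C c d unfolding C2_rect_def by blast
qed

lemma Lint_version:
 fixes g g' C :: "real \<Rightarrow> real"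
 assumes g: "g \<in> borel_measurable (lebesgue_on {a<..<b})" and g': "g' \<in> borel_measurable borel"
  and e: "AE x in lborel. x \<in> {a<..<b} \<longrightarrow> g' x = g x" and C: "continuous_on {a..b} C"
 shows "(LINT x|lebesgue_on {a<..<b}. g x * C x) = (LBINT x. indicator {a<..<b} x * (g' x * C x))"
  and "(LINT x|lebesgue_on {a<..<b}. g x * C x) = (LBINT x:{a..b}. g' x * C x)"
proof -
 have C': "continuous_on {a<..<b} C" by (rule continuous_on_subset[OF C]) auto
 have mC: "(\<lambda>x. indicator {a<..<b} x *\<^sub>R C x) \<in> borel_measurable borel" "(\<lambda>x. indicator {a..b} x *\<^sub>R C x) \<in> borel_measurable borel"
  by (intro borel_measurable_continuous_on_indicator C' C; simp)+
 have m': "(\<lambda>x. indicator S x * (g' x * C x)) \<in> borel_measurable borel" if "(\<lambda>x. indicator S x *\<^sub>R C x) \<in> borel_measurable borel" for S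
  using borel_measurable_times[OF g' that] by (simp add: mult.left_commute)
 have m: "(\<lambda>x. g x * C x) \<in> borel_measurable (lebesgue_on {a<..<b})"
  by (intro borel_measurable_times g continuous_imp_measurable_on_sets_lebesgue C') simp
 show 1: "(LINT x|lebesgue_on {a<..<b}. g x * C x) = (LBINT x. indicator {a<..<b} x * (g' x * C x))"
 proof (rule lebesgue_on_conv(1)[OF m _ m'[OF mC(1)]])
  show "AE x in lborel. x \<in> {a<..<b} \<longrightarrow> g x * C x = g' x * C x" using e by eventually_elim auto
 qed simp
 also have "\<dots> = (LBINT x:{a..b}. g' x * C x)"
  unfolding set_lebesgue_integral_def
 proof (rule integral_cong_AE)
  have "AE x in lborel. x \<noteq> a" "AE x in lborel. x \<noteq> b" by (rule AE_lborel_singleton)+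
  then show "AE x in lborel. indicator {a<..<b} x * (g' x * C x) = indicator {a..b} x *\<^sub>R (g' x * C x)"
   by eventually_elim (auto simp: indicator_def)
 qed (use m'[OF mC(1)] m'[OF mC(2)] in simp_all)
 finally show "(LINT x|lebesgue_on {a<..<b}. g x * C x) = (LBINT x:{a..b}. g' x * C x)" .
qed

lemma Lint_Ioo_Icc:
 fixes \<phi> :: "real \<Rightarrow> real"
 assumes "set_integrable lborel {a..b} \<phi>"
 shows "(LINT x|lebesgue_on {a<..<b}. \<phi> x) = (LBINT x:{a..b}. \<phi> x :: real)"
proof -
 note m = set_integrable_borel[OF assms]
 have m': "(\<lambda>x. indicator {a<..<b} x * \<phi> x) \<in> borel_measurable borel" by (rule indicator_subset_measurable[OF m]) auto
 have "(LINT x|lebesgue_on {a<..<b}. \<phi> x) = (LBINT x. indicator {a<..<b} x * \<phi> x)"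
  by (rule lebesgue_on_borel(2)[OF m']) simp
 also have "\<dots> = (LBINT x:{a..b}. \<phi> x)"
  unfolding set_lebesgue_integral_def
 proof (rule integral_cong_AE)
  have "AE x in lborel. x \<noteq> a" "AE x in lborel. x \<noteq> b" by (rule AE_lborel_singleton)+
  then show "AE x in lborel. indicator {a<..<b} x * \<phi> x = indicator {a..b} x *\<^sub>R \<phi> x"
   by eventually_elim (auto simp: indicator_def)
 qed (use m m' in simp_all)
 finally show ?thesis .
qed

text \<open>A subset of full measure in (0, T) is dense in the closed interval.\<close>

lemma continuous_AE_eq:
 fixes f g :: "real \<Rightarrow> real"
 assumes c: "continuous_on {0..T} f" "continuous_on {0..T} g" and T: "T > 0"
  and e: "AE t in lborel. t \<in> {0<..<T} \<longrightarrow> f t = g t" and t: "t \<in> {0..T}"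
 shows "f t = g t"
proof -
 define S where "S = {s \<in> {0<..<T}. f s - g s = 0}"
 have sub: "{0..T} \<subseteq> closure S"
 proof
  fix t0 assume t0: "t0 \<in> {0..T}"
  show "t0 \<in> closure S"
   unfolding closure_approachable
  proof (intro allI impI)
   fix r :: real assume r: "r > 0"
   define lo hi where "lo = max 0 (t0 - r)" and "hi = min T (t0 + r)"
   define I where "I = {lo<..<hi}"
   have ne: "lo < hi" using t0 r T by (auto simp: lo_def hi_def)
   show "\<exists>y\<in>S. dist y t0 < r"
   proof (rule ccontr)
    assume n: "\<not> (\<exists>y\<in>S. dist y t0 < r)"
    have "AE s in lborel. s \<notin> I"
     using e
    proof eventually_elim
     case (elim s)
     show ?case
     proof
      assume s: "s \<in> I"
      then have "s \<in> S" using elim by (auto simp: S_def I_def lo_def hi_def)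
      moreover have "dist s t0 < r" using s by (auto simp: I_def lo_def hi_def dist_real_def)
      ultimately show False using n by blast
     qed
    qed
    then have "I \<in> null_sets lborel" by (subst (asm) AE_iff_null_sets[symmetric]) (simp_all add: I_def)
    then have "emeasure lborel I = 0" by auto
    then show False using ne by (simp add: I_def)
   qed
  qed
 qed
 have cl: "closure S = {0..T}"
 proof
  show "closure S \<subseteq> {0..T}" by (rule closure_minimal) (auto simp: S_def)
 qed (rule sub)
 have c': "continuous_on (closure S) (\<lambda>t. f t - g t)" unfolding cl by (intro continuous_intros c)
 have tS: "t \<in> closure S" unfolding cl by (rule t)
 have "f t - g t = 0" by (rule continuous_constant_on_closure[OF c' _ tS]) (simp add: S_def)
 then show ?thesis by simp
qed

lemma L2_subset:
 assumes g: "g \<in> L2 a b" and sub: "{c<..<d} \<subseteq> {a<..<b}"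
 shows "g \<in> L2 c d" "(LINT x|lebesgue_on {c<..<d}. (g x)\<^sup>2) \<le> (LINT x|lebesgue_on {a<..<b}. (g x)\<^sup>2)"
proof -
 obtain g' where g': "g' \<in> borel_measurable borel" "\<And>x. x \<notin> {a<..<b} \<Longrightarrow> g' x = 0"
  "AE x in lborel. x \<in> {a<..<b} \<longrightarrow> g' x = g x" "integrable lborel (\<lambda>x. (g' x)\<^sup>2)"
  by (rule L2_borel_version[OF g]) blast
 have m: "g \<in> borel_measurable (lebesgue_on {a<..<b})" using g by (simp add: L2_def)
 have m1: "g \<in> borel_measurable (lebesgue_on {c<..<d})" by (rule measurable_restrict_mono[OF m sub])
 have ae: "AE x in lborel. x \<in> {a<..<b} \<longrightarrow> (g x)\<^sup>2 = (g' x)\<^sup>2" using g'(3) by eventually_elim auto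
 then have ae1: "AE x in lborel. x \<in> {c<..<d} \<longrightarrow> (g x)\<^sup>2 = (g' x)\<^sup>2" by eventually_elim (use sub in auto)
 have i: "integrable lborel (\<lambda>x. indicator {c<..<d} x * (g' x)\<^sup>2)" "integrable lborel (\<lambda>x. indicator {a<..<b} x * (g' x)\<^sup>2)"
  using integrable_mult_indicator[OF _ g'(4), of "{c<..<d}"] integrable_mult_indicator[OF _ g'(4), of "{a<..<b}"] by simp_all
 have b: "(\<lambda>x. indicator S x * (g' x)\<^sup>2) \<in> borel_measurable borel" if "S \<in> sets borel" for S
  using g'(1) that by simp
 note c1 = lebesgue_on_conv[OF borel_measurable_power[OF m1] _ b ae1] and c2 = lebesgue_on_conv[OF borel_measurable_power[OF m] _ b ae]
 show "g \<in> L2 c d" using m1 c1(2) i(1) by (simp add: L2_def)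
 have "(LBINT x. indicator {c<..<d} x * (g' x)\<^sup>2) \<le> (LBINT x. indicator {a<..<b} x * (g' x)\<^sup>2)"
  by (rule integral_mono[OF i]) (use sub in \<open>auto simp: indicator_def\<close>)
 then show "(LINT x|lebesgue_on {c<..<d}. (g x)\<^sup>2) \<le> (LINT x|lebesgue_on {a<..<b}. (g x)\<^sup>2)"
  using c1(1) c2(1) by simp
qed

lemma test_fn_bounded:
 fixes \<phi> :: "real \<Rightarrow> real"
 assumes c: "continuous_on UNIV \<phi>" and z: "\<And>x. x \<notin> {a<..<b} \<Longrightarrow> \<phi> x = 0"
 obtains C where "\<And>x. \<bar>\<phi> x\<bar> \<le> C"
proof -
 have "bounded (\<phi> ` {a..b})" by (intro compact_imp_bounded compact_continuous_image continuous_on_subset[OF c]) auto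
 then obtain C where C: "\<forall>y\<in>\<phi> ` {a..b}. norm y \<le> C" unfolding bounded_iff by blast
 have "\<bar>\<phi> x\<bar> \<le> \<bar>C\<bar>" for x
 proof (cases "x \<in> {a..b}")
  case True
  then have "norm (\<phi> x) \<le> C" using C by blast
  then show ?thesis by simp
 next
  case False
  then have "x \<notin> {a<..<b}" by auto
  then show ?thesis using z by simp
 qed
 then show ?thesis by (rule that)
qed

lemma Jt_has_derivative:
 assumes "k \<in> L2c" "continuous_on {0..T} k" "t \<in> {0..T}"
 shows "(Jt k has_real_derivative k t) (at t within {0..T})"
proof -
 have e: "Jt k s = integral {0..s} k" if "s \<in> {0..T}" for s
 proof -
  have i: "set_integrable lborel {0..s} k" by (rule L2c_set_integrable'[OF assms(1), where t=s]) auto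
  show ?thesis
   using Jt_eq_Icc[OF assms(1) order_refl, of s] set_borel_integral_eq_integral(2)[OF i] by (rule trans)
 qed
 show ?thesis
  by (rule has_field_derivative_transform_within[OF integral_has_real_derivative[OF assms(2,3)] zero_less_one assms(3)]) (simp add: e)
qed

section \<open>From the weak solution to Borel data on the intervals\<close>

locale weak_sol =
 fixes N :: nat and l :: real and a M :: "nat \<Rightarrow> real" and q :: "real \<Rightarrow> real" and T :: real
  and f :: "real \<Rightarrow> real" and u :: "real \<Rightarrow> real \<Rightarrow> real" and h :: "nat \<Rightarrow> real \<Rightarrow> real"
 assumes string: "string_with_masses N l a M q" and T: "T > 0" and f: "f \<in> L2 0 T" and sol: "weak_solution N l a M q T f u h"
begin

lemma N: "N \<ge> 1" and a0: "a 0 = 0" and aN: "a (Suc N) = l" and alt: "j \<le> N \<Longrightarrow> a j < a (Suc j)"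
 and M: "1 \<le> j \<Longrightarrow> j \<le> N \<Longrightarrow> M j > 0" and pot: "potential N a q"
 using string unfolding string_with_masses_def by auto

lemmas sol_conj = sol[unfolded weak_solution_def, THEN conjunct1] sol[unfolded weak_solution_def, THEN conjunct2, THEN conjunct1]
 sol[unfolded weak_solution_def, THEN conjunct2, THEN conjunct2, THEN conjunct1]
 sol[unfolded weak_solution_def, THEN conjunct2, THEN conjunct2, THEN conjunct2]

lemmas u = sol_conj(1)[rule_format] and ucont = sol_conj(2)[rule_format] and h = sol_conj(3)[rule_format]
 and weak_identity = sol_conj(4)[rule_format, unfolded Suc_eq_plus1[symmetric]]

lemma amono: "i \<le> j \<Longrightarrow> j \<le> Suc N \<Longrightarrow> a i \<le> a j"
proof (induction j)
 case (Suc j)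
 show ?case
 proof (cases "i = Suc j")
  case False
  then have "a i \<le> a j" using Suc by simp
  also have "a j < a (Suc j)" using Suc.prems by (intro alt) simp
  finally show ?thesis by simp
 qed simp
qed simp

lemma cover:
 assumes "x \<in> {0..l}" shows "\<exists>k\<le>N. x \<in> {a k..a (Suc k)}"
proof -
 define i where "i = (LEAST j. x \<le> a (Suc j))"
 have 1: "x \<le> a (Suc i)" unfolding i_def by (rule LeastI[of _ N]) (use assms aN in simp)
 have 2: "i \<le> N" unfolding i_def by (rule Least_le) (use assms aN in simp)
 have "a i \<le> x"
 proof (cases i)
  case (Suc n)
  then have "\<not> x \<le> a (Suc n)" using not_less_Least[of n "\<lambda>j. x \<le> a (Suc j)"] by (simp add: i_def)
  then show ?thesis using Suc by simp
 qed (use assms a0 in simp)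
 then show ?thesis using 1 2 by auto
qed

lemma sub: "j \<le> N \<Longrightarrow> {a j<..<a (Suc j)} \<subseteq> {0<..<l}"
 using amono[of 0 j] amono[of "Suc j" "Suc N"] by (auto simp: a0 aN)

lemma potential_ex:
 "\<exists>Q K. \<forall>j\<le>N. Ck_on (j - 2) (a j) (a (Suc j)) (Q j) \<and> (\<forall>x\<in>{a j<..<a (Suc j)}. q x = Q j x) \<and> (\<forall>x\<in>{a j..a (Suc j)}. \<bar>Q j x\<bar> \<le> K)"
proof -
 have "\<forall>j. \<exists>Q. j \<le> N \<longrightarrow> Ck_on (j - 2) (a j) (a (Suc j)) Q \<and> (\<forall>x\<in>{a j<..<a (Suc j)}. q x = Q x)"
  using pot unfolding potential_def Suc_eq_plus1 by blast
 from choice[OF this] obtain Q where Q: "\<forall>j. j \<le> N \<longrightarrow> Ck_on (j - 2) (a j) (a (Suc j)) (Q j) \<and> (\<forall>x\<in>{a j<..<a (Suc j)}. q x = Q j x)" by (rule exE)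
 have "\<forall>j. \<exists>C. j \<le> N \<longrightarrow> (\<forall>x\<in>{a j..a (Suc j)}. \<bar>Q j x\<bar> \<le> C)"
 proof
  fix j
  show "\<exists>C. j \<le> N \<longrightarrow> (\<forall>x\<in>{a j..a (Suc j)}. \<bar>Q j x\<bar> \<le> C)"
  proof (cases "j \<le> N")
   case True
   have "bounded (Q j ` {a j..a (Suc j)})"
    using Q True by (intro compact_imp_bounded compact_continuous_image Ck_on_continuous[of "j - 2"]) auto
   then obtain C where "\<forall>y\<in>Q j ` {a j..a (Suc j)}. norm y \<le> C" unfolding bounded_iff by blast
   then show ?thesis by auto
  qed simp
 qed
 from choice[OF this] obtain C where C: "\<forall>j. j \<le> N \<longrightarrow> (\<forall>x\<in>{a j..a (Suc j)}. \<bar>Q j x\<bar> \<le> C j)" by (rule exE)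
 have "\<bar>Q j x\<bar> \<le> (\<Sum>i\<le>N. \<bar>C i\<bar>)" if "j \<le> N" "x \<in> {a j..a (Suc j)}" for j x
 proof -
  have "\<bar>Q j x\<bar> \<le> C j" using C that by blast
  also have "\<dots> \<le> \<bar>C j\<bar>" by simp
  also have "\<dots> \<le> (\<Sum>i\<le>N. \<bar>C i\<bar>)" by (rule member_le_sum) (use that in auto)
  finally show ?thesis .
 qed
 then show ?thesis using Q by (intro exI[of _ Q] exI[of _ "\<Sum>i\<le>N. \<bar>C i\<bar>"]) blast
qed

lemma state_ex:
 "\<exists>UU. UU \<in> Qc 0 l \<and> (\<forall>t\<in>{0<..T}. AE x in lborel. x \<in> {0<..<l} \<longrightarrow> UU x t = u t x)"
proof -
 have "\<exists>g. g \<in> borel_measurable borel \<and> (\<forall>x. x \<notin> {0<..<l} \<longrightarrow> g x = 0) \<and> (AE x in lborel. x \<in> {0<..<l} \<longrightarrow> g x = u t x) \<and> integrable lborel (\<lambda>x. (g x)\<^sup>2)"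
  if "t \<in> {0..T}" for t
  by (rule L2_borel_version[OF u[OF that]]) blast
 then have "\<forall>t. \<exists>g. t \<in> {0..T} \<longrightarrow> g \<in> borel_measurable borel \<and> (\<forall>x. x \<notin> {0<..<l} \<longrightarrow> g x = 0) \<and> (AE x in lborel. x \<in> {0<..<l} \<longrightarrow> g x = u t x) \<and> integrable lborel (\<lambda>x. (g x)\<^sup>2)"
  by blast
 from choice[OF this] obtain ub where ub0: "\<forall>t. t \<in> {0..T} \<longrightarrow> ub t \<in> borel_measurable borel \<and> (\<forall>x. x \<notin> {0<..<l} \<longrightarrow> ub t x = 0) \<and> (AE x in lborel. x \<in> {0<..<l} \<longrightarrow> ub t x = u t x) \<and> integrable lborel (\<lambda>x. (ub t x)\<^sup>2)"
  by (rule exE)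
 have ub: "ub t \<in> borel_measurable borel" "\<And>x. x \<notin> {0<..<l} \<Longrightarrow> ub t x = 0" "AE x in lborel. x \<in> {0<..<l} \<longrightarrow> ub t x = u t x" "integrable lborel (\<lambda>x. (ub t x)\<^sup>2)"
  if "t \<in> {0..T}" for t using ub0 that by blast+
 have E: "(LBINT x. (ub s x - ub t x)\<^sup>2) = (LINT x|lebesgue_on {0<..<l}. (u s x - u t x)\<^sup>2)" if st: "s \<in> {0..T}" "t \<in> {0..T}" for s t
 proof -
  have "(\<lambda>x. (u s x - u t x)\<^sup>2) \<in> borel_measurable (lebesgue_on {0<..<l})" using u[OF st(1)] u[OF st(2)] by (intro borel_measurable_power borel_measurable_diff) (simp_all add: L2_def)
  moreover have "(\<lambda>x. indicator {0<..<l} x * (ub s x - ub t x)\<^sup>2) \<in> borel_measurable borel" using ub(1)[OF st(1)] ub(1)[OF st(2)] by simp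
  moreover have "AE x in lborel. x \<in> {0<..<l} \<longrightarrow> (u s x - u t x)\<^sup>2 = (ub s x - ub t x)\<^sup>2" using ub(3)[OF st(1)] ub(3)[OF st(2)] by eventually_elim auto
  ultimately have "(LINT x|lebesgue_on {0<..<l}. (u s x - u t x)\<^sup>2) = (LBINT x. indicator {0<..<l} x * (ub s x - ub t x)\<^sup>2)"
   by (intro lebesgue_on_conv(1)) simp_all
  also have "\<dots> = (LBINT x. (ub s x - ub t x)\<^sup>2)"
  proof (rule LBINT_cong)
   fix x show "indicator {0<..<l} x * (ub s x - ub t x)\<^sup>2 = (ub s x - ub t x)\<^sup>2"
    using ub(2)[OF st(1), of x] ub(2)[OF st(2), of x] by (cases "x \<in> {0<..<l}") auto
  qed
  finally show ?thesis by simp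
 qed
 have P: "L2_path l T ub"
 proof
  fix t assume t: "t \<in> {0..T}"
  have "\<forall>\<^sub>F s in at t within {0..T}. (LINT x|lebesgue_on {0<..<l}. (u s x - u t x)\<^sup>2) = (LBINT x. (ub s x - ub t x)\<^sup>2)"
   using E t by (auto simp: eventually_at_filter intro!: always_eventually)
  from Lim_transform_eventually[OF ucont[OF t] this]
  show "((\<lambda>s. LBINT x. (ub s x - ub t x)\<^sup>2) \<longlongrightarrow> 0) (at t within {0..T})" .
 qed (use T ub in auto)
 obtain UU where UU: "UU \<in> Qc 0 l" "\<And>t x. t > T \<Longrightarrow> UU x t = 0" "\<And>t. t \<in> {0<..T} \<Longrightarrow> AE x in lborel. UU x t = ub t x"
  by (rule L2_path.measurable_version[OF P]) blast
 have "AE x in lborel. x \<in> {0<..<l} \<longrightarrow> UU x t = u t x" if "t \<in> {0<..T}" for t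
  using UU(3)[OF that] ub(3)[of t] that by (auto elim!: eventually_elim2)
 then show ?thesis using UU(1) by blast
qed

text \<open>The control, the positions of the masses and the clamped end are put into one sequence,
  so that \<open>H k\<close> and \<open>H (Suc k)\<close> are the boundary values of interval
  k.\<close>

lemma control_ex:
 "\<exists>H. (\<forall>j. H j \<in> L2c) \<and> H (Suc N) = (\<lambda>t. 0) \<and> (AE t in lborel. t \<in> {0<..<T} \<longrightarrow> H 0 t = f t) \<and>
   (\<forall>j\<in>{1..N}. AE t in lborel. t \<in> {0<..<T} \<longrightarrow> H j t = h j t)"
proof -
 obtain F where F: "F \<in> L2c" "AE t in lborel. t \<in> {0<..<T} \<longrightarrow> F t = f t" using L2_L2c_version[OF f] by blast
 have "\<exists>g. g \<in> L2c \<and> (AE t in lborel. t \<in> {0<..<T} \<longrightarrow> g t = h j t)" if "j \<in> {1..N}" for j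
  using L2_L2c_version[OF h[OF that]] by blast
 then have "\<forall>j. \<exists>g. j \<in> {1..N} \<longrightarrow> g \<in> L2c \<and> (AE t in lborel. t \<in> {0<..<T} \<longrightarrow> g t = h j t)" by blast
 from choice[OF this] obtain g where g: "\<forall>j. j \<in> {1..N} \<longrightarrow> g j \<in> L2c \<and> (AE t in lborel. t \<in> {0<..<T} \<longrightarrow> g j t = h j t)" by (rule exE)
 show ?thesis
  by (rule exI[of _ "\<lambda>j. if j = 0 then F else if j \<le> N then g j else (\<lambda>t. 0)"]) (use F g in auto)
qed

end

locale weak_sol_data = weak_sol +
 fixes Q :: "nat \<Rightarrow> real \<Rightarrow> real" and K :: real and UU :: "real \<Rightarrow> real \<Rightarrow> real" and H :: "nat \<Rightarrow> real \<Rightarrow> real"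
 assumes Ck: "\<And>j. j \<le> N \<Longrightarrow> Ck_on (j - 2) (a j) (a (Suc j)) (Q j)"
  and qQ: "\<And>j x. j \<le> N \<Longrightarrow> x \<in> {a j<..<a (Suc j)} \<Longrightarrow> q x = Q j x"
  and QK: "\<And>j x. j \<le> N \<Longrightarrow> x \<in> {a j..a (Suc j)} \<Longrightarrow> \<bar>Q j x\<bar> \<le> K"
  and UU: "UU \<in> Qc 0 l" and UUu: "\<And>t. t \<in> {0<..T} \<Longrightarrow> AE x in lborel. x \<in> {0<..<l} \<longrightarrow> UU x t = u t x"
  and H: "\<And>j. H j \<in> L2c" and HN: "H (Suc N) = (\<lambda>t. 0)" and Hf: "AE t in lborel. t \<in> {0<..<T} \<longrightarrow> H 0 t = f t"
  and Hh: "\<And>j. j \<in> {1..N} \<Longrightarrow> AE t in lborel. t \<in> {0<..<T} \<longrightarrow> H j t = h j t"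
begin

definition qq :: "nat \<Rightarrow> real \<Rightarrow> real" where "qq j x = indicator {a j..a (Suc j)} x * Q j x"
definition U :: "nat \<Rightarrow> real \<Rightarrow> real \<Rightarrow> real" where "U j x t = indicator {a j<..<a (Suc j)} x * UU x t"

lemma Qc: "j \<le> N \<Longrightarrow> continuous_on {a j..a (Suc j)} (Q j)"
 using Ck by (rule Ck_on_continuous)

lemma qq: "x \<in> {a j..a (Suc j)} \<Longrightarrow> qq j x = Q j x" by (simp add: qq_def)

lemma qqm: "j \<le> N \<Longrightarrow> qq j \<in> borel_measurable borel"
 using borel_measurable_continuous_on_indicator[OF _ Qc, of j] by (simp add: qq_def[abs_def])

lemma K0: "K \<ge> 0"
 using QK[of 0 "a 0"] alt[of 0] by auto

lemma qqK: "j \<le> N \<Longrightarrow> \<bar>qq j x\<bar> \<le> K"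
 using QK[of j x] K0 by (auto simp: qq_def indicator_def)

lemma U_zero: "x \<notin> {a j<..<a (Suc j)} \<Longrightarrow> U j x t = 0" by (simp add: U_def)

lemma U: "U j \<in> Qc (a j) (a (Suc j))"
proof -
 have e: "U j = (\<lambda>x t. indicator {a j<..<a (Suc j)} x * UU x t)" by (simp add: U_def fun_eq_iff)
 have "U j \<in> Qc 0 l" unfolding e by (rule Qc_indicator[OF UU]) simp
 moreover have "U j x = (\<lambda>t. 0)" if "x \<notin> {a j..a (Suc j)}" for x
  by (rule ext) (rule U_zero, use that in auto)
 ultimately show ?thesis unfolding Qc_def by blast
qed

lemma U_times: "U j x t * (p + qq j x * w) = U j x t * (p + Q j x * w)"
 by (cases "x \<in> {a j..a (Suc j)}") (auto simp: qq U_zero)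

text \<open>Matching at the nodes makes the pieces one function; finitely many closed rectangles
  then give continuity.\<close>

lemma glue:
 assumes m: "\<And>k t. k < N \<Longrightarrow> t \<in> {0..T} \<Longrightarrow> w k (a (Suc k)) t = w (Suc k) (a (Suc k)) t"
  and c: "\<And>k. k \<le> N \<Longrightarrow> continuous_on ({a k..a (Suc k)} \<times> {0..T}) (\<lambda>(x, t). w k x t)"
 obtains W :: "real \<Rightarrow> real \<Rightarrow> real" where "\<And>k x t. k \<le> N \<Longrightarrow> x \<in> {a k..a (Suc k)} \<Longrightarrow> t \<in> {0..T} \<Longrightarrow> W x t = w k x t"
  "continuous_on ({0..l} \<times> {0..T}) (\<lambda>(x, t). W x t)"
proof -
 \<comment> \<open>A node is assigned to the interval on its left; the matching condition accounts
   for the other side.\<close>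
 define idx where "idx x = (LEAST j. x \<le> a (Suc j))" for x
 define W where "W x t = w (idx x) x t" for x t
 have W: "W x t = w k x t" if k: "k \<le> N" "x \<in> {a k..a (Suc k)}" and t: "t \<in> {0..T}" for k x t
 proof (cases "x = a k \<and> k \<noteq> 0")
  case True
  then obtain i where i: "k = Suc i" by (cases k) auto
  have "idx x = i"
   unfolding idx_def
  proof (rule Least_equality)
   show "x \<le> a (Suc i)" using True i by simp
   fix y assume y: "x \<le> a (Suc y)"
   show "i \<le> y"
   proof (rule ccontr)
    assume "\<not> i \<le> y"
    then have "a (Suc y) \<le> a i" using k i by (intro amono) auto
    moreover have "a i < a k" using alt[of i] k i by simp
    ultimately show False using y True by simp
   qed
  qed
  then show ?thesis using m[of i t] k i t True by (simp add: W_def)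
 next
  case False
  have "idx x = k"
   unfolding idx_def
  proof (rule Least_equality)
   show "x \<le> a (Suc k)" using k by simp
   fix y assume y: "x \<le> a (Suc y)"
   show "k \<le> y"
   proof (rule ccontr)
    assume n: "\<not> k \<le> y"
    then have "a (Suc y) \<le> a k" using k by (intro amono) auto
    then show False using y False k n by auto
   qed
  qed
  then show ?thesis by (simp add: W_def)
 qed
 have "{0..l} \<subseteq> (\<Union>k\<in>{..N}. {a k..a (Suc k)})" by (rule subsetI) (drule cover, blast)
 then have s: "{0..l} \<times> {0..T} \<subseteq> (\<Union>k\<in>{..N}. {a k..a (Suc k)} \<times> {0..T})" by blast
 have "continuous_on (\<Union>k\<in>{..N}. {a k..a (Suc k)} \<times> {0..T}) (\<lambda>(x, t). W x t)"
 proof (rule continuous_on_closed_Union)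
  fix k assume "k \<in> {..N}"
  then show "continuous_on ({a k..a (Suc k)} \<times> {0..T}) (\<lambda>(x, t). W x t)"
   by (intro continuous_on_eq[OF c]) (use W in auto)
 qed (auto intro: closed_Times)
 then have "continuous_on ({0..l} \<times> {0..T}) (\<lambda>(x, t). W x t)" using s by (rule continuous_on_subset)
 then show ?thesis using that[of W] W by blast
qed

text \<open>Fields given interval by interval are glued to a test field, and every integral of the
  definition is rewritten for the Borel versions over closed intervals; null sets absorb the end
  points.\<close>

lemma weak_sys: "weak_sys T K N a M qq U H"
proof
 fix w wx wt wxx wxt wtt :: "nat \<Rightarrow> real \<Rightarrow> real \<Rightarrow> real"
 assume C: "\<And>k. k \<le> N \<Longrightarrow> C2_rect {a k..a (Suc k)} {0..T} (w k) (wx k) (wt k) (wxx k) (wxt k) (wtt k)"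
  and m: "\<And>k t. k < N \<Longrightarrow> t \<in> {0..T} \<Longrightarrow> w k (a (Suc k)) t = w (Suc k) (a (Suc k)) t"
  and e: "\<And>t. t \<in> {0..T} \<Longrightarrow> w 0 (a 0) t = 0 \<and> w N (a (Suc N)) t = 0"
  and wT: "\<And>k x. k \<le> N \<Longrightarrow> x \<in> {a k..a (Suc k)} \<Longrightarrow> w k x T = 0 \<and> wt k x T = 0"
 have cr: "CR (a k) (a (Suc k)) T (w k)" "CR (a k) (a (Suc k)) T (wx k)" "CR (a k) (a (Suc k)) T (wxx k)" "CR (a k) (a (Suc k)) T (wtt k)" if "k \<le> N" for k
  using C[OF that] unfolding C2_rect_def CR_def by blast+
 have cw: "continuous_on ({a k..a (Suc k)} \<times> {0..T}) (\<lambda>(x, t). w k x t)" if "k \<le> N" for k using cr(1)[OF that] by (simp only: CR_def)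
 obtain W where W: "\<And>k x t. k \<le> N \<Longrightarrow> x \<in> {a k..a (Suc k)} \<Longrightarrow> t \<in> {0..T} \<Longrightarrow> W x t = w k x t"
  and Wc: "continuous_on ({0..l} \<times> {0..T}) (\<lambda>(x, t). W x t)"
  using glue[of w, OF m cw] by blast
 have ends: "a k \<in> {a k..a (Suc k)}" "a (Suc k) \<in> {a k..a (Suc k)}" if "k \<le> N" for k using alt[OF that] by auto
 have T0: "T \<in> {0..T}" using T by simp
 have tf: "test_field N l a T W wx wt wxx wxt wtt"
  unfolding test_field_def Suc_eq_plus1[symmetric]
 proof (intro conjI allI impI ballI Wc)
  fix j assume j: "j \<le> N"
  show "C2_rect {a j..a (Suc j)} {0..T} W (wx j) (wt j) (wxx j) (wxt j) (wtt j)"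
   by (rule C2_rect_cong[OF C[OF j]]) (use W j in auto)
  fix x assume "x \<in> {a j..a (Suc j)}" then show "wt j x T = 0" using wT j by blast
 next
  fix t assume t: "t \<in> {0..T}"
  show "W 0 t = 0" using W[OF le0 ends(1)[OF le0] t] e[OF t] by (simp add: a0)
  show "W l t = 0" using W[OF order_refl ends(2)[OF order_refl] t] e[OF t] by (simp add: aN)
 next
  fix x assume "x \<in> {0..l}"
  from cover[OF this] obtain k where "k \<le> N" "x \<in> {a k..a (Suc k)}" by blast
  then show "W x T = 0" using W[OF _ _ T0] wT by simp
 qed
 define \<phi> where "\<phi> j t = (LBINT x. U j x t * (wtt j x t - wxx j x t + qq j x * w j x t))" for j t
 have inner: "(LINT x|lebesgue_on {a j<..<a (Suc j)}. u t x * (wtt j x t - wxx j x t + q x * W x t)) = \<phi> j t"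
  if j: "j \<le> N" and t: "t \<in> {0<..<T}" for j t
 proof -
  define C' where "C' x = wtt j x t - wxx j x t + Q j x * w j x t" for x
  have t': "t \<in> {0..T}" "t \<in> {0<..T}" using t by auto
  have sec: "continuous_on {a j..a (Suc j)} (\<lambda>x. g x t)" if "CR (a j) (a (Suc j)) T g" for g
  proof -
   have "continuous_on {a j..a (Suc j)} (\<lambda>x. (\<lambda>(x, t). g x t) (x, t))"
    by (rule continuous_on_compose2[OF that[unfolded CR_def]]) (use t' in \<open>auto intro: continuous_intros\<close>)
   then show ?thesis by simp
  qed
  have C': "continuous_on {a j..a (Suc j)} C'" unfolding C'_def by (intro continuous_intros sec cr[OF j] Qc[OF j])
  have um: "u t \<in> borel_measurable (lebesgue_on {a j<..<a (Suc j)})"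
   by (rule measurable_restrict_mono[OF _ sub[OF j]]) (use u[OF t'(1)] in \<open>simp add: L2_def\<close>)
  have Um: "(\<lambda>x. UU x t) \<in> borel_measurable borel" by (rule Qc_measurable[OF UU]) simp_all
  have ae: "AE x in lborel. x \<in> {a j<..<a (Suc j)} \<longrightarrow> UU x t = u t x"
   using UUu[OF t'(2)] by eventually_elim (use sub[OF j] in blast)
  have "(LINT x|lebesgue_on {a j<..<a (Suc j)}. u t x * (wtt j x t - wxx j x t + q x * W x t)) = (LINT x|lebesgue_on {a j<..<a (Suc j)}. u t x * C' x)"
   by (intro LBINT_cong) (use W[OF j _ t'(1)] qQ[OF j] in \<open>simp add: C'_def\<close>)
  also have "\<dots> = (LBINT x. indicator {a j<..<a (Suc j)} x * (UU x t * C' x))"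
   by (rule Lint_version(1)[OF um Um ae C'])
  also have "\<dots> = \<phi> j t"
   unfolding \<phi>_def U_times by (intro LBINT_cong) (simp add: U_def C'_def)
  finally show ?thesis .
 qed
 have \<phi>i: "set_integrable lborel {0..T} (\<phi> j)" if j: "j \<le> N" for j
 proof -
  have "CR (a j) (a (Suc j)) T (\<lambda>x t. wtt j x t - wxx j x t + Q j x * w j x t)"
   by (rule CR_ops(1)[OF CR_ops(2)[OF cr(4)[OF j] cr(3)[OF j]] CR_ops(3)[OF CR_fst[OF Qc[OF j]] cr(1)[OF j]]])
  then have i: "integrable (lborel \<Otimes>\<^sub>M lborel) (\<lambda>(x, t). indicator {0..T} t * (U j x t * (wtt j x t - wxx j x t + Q j x * w j x t)))"
   unfolding CR_def by (rule double_integral(1)[OF U less_imp_le[OF alt[OF j]]])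
  have eq: "indicator {0..T} t *\<^sub>R \<phi> j t = (LBINT x. indicator {0..T} t * (U j x t * (wtt j x t - wxx j x t + Q j x * w j x t)))" for t
   unfolding \<phi>_def U_times by simp
  show ?thesis unfolding set_integrable_def eq by (rule lborel_pair.integrable_snd[OF i])
 qed
 have W1: "(LINT t|lebesgue_on {0<..<T}. (\<Sum>j\<le>N. (LINT x|lebesgue_on {a j<..<a (Suc j)}. u t x * (wtt j x t - wxx j x t + q x * W x t)))) = (\<Sum>j\<le>N. (LBINT t:{0..T}. \<phi> j t))"
 proof -
  have i: "integrable lborel (\<lambda>t. indicator {0..T} t *\<^sub>R \<phi> j t)" if "j \<in> {..N}" for j using \<phi>i[of j] that by (simp add: set_integrable_def)
  have si: "set_integrable lborel {0..T} (\<lambda>t. \<Sum>j\<le>N. \<phi> j t)"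
   unfolding set_integrable_def scaleR_sum_right by (rule Bochner_Integration.integrable_sum) (rule i)
  have "(LINT t|lebesgue_on {0<..<T}. (\<Sum>j\<le>N. (LINT x|lebesgue_on {a j<..<a (Suc j)}. u t x * (wtt j x t - wxx j x t + q x * W x t)))) = (LINT t|lebesgue_on {0<..<T}. (\<Sum>j\<le>N. \<phi> j t))"
   by (intro LBINT_cong sum.cong inner) auto
  also have "\<dots> = (LBINT t:{0..T}. (\<Sum>j\<le>N. \<phi> j t))" by (rule Lint_Ioo_Icc[OF si])
  also have "\<dots> = (\<Sum>j\<le>N. (LBINT t:{0..T}. \<phi> j t))"
   unfolding set_lebesgue_integral_def scaleR_sum_right by (rule Bochner_Integration.integral_sum) (rule i)
  finally show ?thesis .
 qed
 have W2: "(LINT t|lebesgue_on {0<..<T}. h j t * (M j * wtt j (a j) t - wx j (a j) t + wx (j - 1) (a j) t)) =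
   (LBINT t:{0..T}. H j t * (M j * wtt j (a j) t - wx j (a j) t + wx (j - 1) (a j) t))" if j: "j \<in> {1..N}" for j
 proof (rule Lint_version(2)[OF _ L2cD(1)[OF H] Hh[OF j]])
  show "h j \<in> borel_measurable (lebesgue_on {0<..<T})" using h[OF j] by (simp add: L2_def)
  obtain i where i: "j = Suc i" "i \<le> N" "j \<le> N" using j by (cases j) auto
  have "continuous_on {0..T} (wx (j - 1) (a j))" using CR_sec(2)[OF cr(2)[OF i(2)] ends(2)[OF i(2)]] i by simp
  then show "continuous_on {0..T} (\<lambda>t. M j * wtt j (a j) t - wx j (a j) t + wx (j - 1) (a j) t)"
   by (intro continuous_intros CR_sec(2)[OF cr(2)[OF i(3)] ends(1)[OF i(3)]] CR_sec(2)[OF cr(4)[OF i(3)] ends(1)[OF i(3)]])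
 qed
 have W2s: "(\<Sum>j=1..N. (LINT t|lebesgue_on {0<..<T}. h j t * (M j * wtt j (a j) t - wx j (a j) t + wx (j - 1) (a j) t))) =
   (\<Sum>j=1..N. (LBINT t:{0..T}. H j t * (M j * wtt j (a j) t - wx j (a j) t + wx (j - 1) (a j) t)))"
  by (rule sum.cong[OF refl W2])
 have e0: "wx 0 0 = wx 0 (a 0)" by (simp add: a0)
 have W3: "(LINT t|lebesgue_on {0<..<T}. f t * wx 0 (a 0) t) = (LBINT t:{0..T}. H 0 t * wx 0 (a 0) t)"
  by (rule Lint_version(2)[OF _ L2cD(1)[OF H] _ CR_sec(2)[OF cr(2)[OF le0] ends(1)[OF le0]]]) (use f Hf in \<open>auto simp: L2_def\<close>)
 have "(LINT t|lebesgue_on {0<..<T}. (\<Sum>j\<le>N. (LINT x|lebesgue_on {a j<..<a (Suc j)}. u t x * (wtt j x t - wxx j x t + q x * W x t)))) +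
   (\<Sum>j=1..N. (LINT t|lebesgue_on {0<..<T}. h j t * (M j * wtt j (a j) t - wx j (a j) t + wx (j - 1) (a j) t))) = (LINT t|lebesgue_on {0<..<T}. f t * wx 0 0 t)"
  by (rule weak_identity[OF tf])
 then show "(\<Sum>k\<le>N. (LBINT t:{0..T}. LBINT x. U k x t * (wtt k x t - wxx k x t + qq k x * w k x t))) +
   (\<Sum>j=1..N. (LBINT t:{0..T}. H j t * (M j * wtt j (a j) t - wx j (a j) t + wx (j - 1) (a j) t))) =
   (LBINT t:{0..T}. H 0 t * wx 0 (a 0) t)"
  unfolding W1 W2s e0 W3 unfolding \<phi>_def .
qed (rule T U H HN | erule alt qqm qqK | erule (1) M)+

end

section \<open>Pairings with test functions and the final state\<close>

context weak_sol_data
begin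

text \<open>The second time derivative, in the weak sense, of the pairing of \<open>U j\<close> with
  the test function: the operator L has been moved onto the latter.\<close>

definition ell :: "nat \<Rightarrow> (real \<Rightarrow> real) \<Rightarrow> real \<Rightarrow> real" where
 "ell j \<eta> = Pop (\<lambda>x. deriv (deriv \<eta>) x - qq j x * \<eta> x) (\<lambda>x. 0) (U j)"

lemma test_Pop_data:
 assumes j: "j \<le> N" and \<eta>: "\<eta> \<in> test_functions (a j) (a (Suc j))"
 obtains C C' where "Pop_data \<eta> (\<lambda>x. 0) C" "Pop_data (\<lambda>x. deriv (deriv \<eta>) x - qq j x * \<eta> x) (\<lambda>x. 0) C'"
proof -
 note c = test_fn_continuous012[OF \<eta>] and z = test_fn_zeros[OF \<eta>]
 obtain C where C: "\<And>x. \<bar>\<eta> x\<bar> \<le> C" by (rule test_fn_bounded[OF c(1) z(1)]) blast+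
 obtain D where D: "\<And>x. \<bar>deriv (deriv \<eta>) x\<bar> \<le> D" by (rule test_fn_bounded[OF c(3) z(3)]) blast+
 note [measurable] = qqm[OF j] borel_measurable_continuous_onI[OF c(1)] borel_measurable_continuous_onI[OF c(3)]
 have b: "\<bar>deriv (deriv \<eta>) x - qq j x * \<eta> x\<bar> \<le> D + K * C" for x
 proof -
  have "\<bar>qq j x\<bar> * \<bar>\<eta> x\<bar> \<le> K * C" by (rule mult_mono[OF qqK[OF j] C K0]) simp
  then have "\<bar>qq j x * \<eta> x\<bar> \<le> K * C" by (simp only: abs_mult)
  then show ?thesis using D[of x] by linarith
 qed
 show ?thesis
 proof (rule that)
  show "Pop_data \<eta> (\<lambda>x. 0) C" by unfold_locales (use C in auto)
  show "Pop_data (\<lambda>x. deriv (deriv \<eta>) x - qq j x * \<eta> x) (\<lambda>x. 0) (D + K * C)" by unfold_locales (use b in auto)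
 qed
qed

lemma ell_L2c:
 assumes j: "j \<le> N" and \<eta>: "\<eta> \<in> test_functions (a j) (a (Suc j))"
 shows "ell j \<eta> \<in> L2c"
proof (rule test_Pop_data[OF assms])
 fix C C' assume "Pop_data (\<lambda>x. deriv (deriv \<eta>) x - qq j x * \<eta> x) (\<lambda>x. 0) C'"
 then show ?thesis unfolding ell_def by (rule Pop_data.Pop_L2c[OF _ U less_imp_le[OF alt[OF j]]])
qed

text \<open>The fields \<open>\<eta> x * pp 3 (\<sigma> - t)\<close> vanish at the ends of the
  interval, so each pairing satisfies a differential equation in time alone. The kernel yields it
  under further integrations, two of which are cancelled.\<close>

lemma pairing_AE:
 assumes j: "j \<le> N" and \<eta>: "\<eta> \<in> test_functions (a j) (a (Suc j))"
 shows "AE t in lborel. t < T \<longrightarrow> Pop \<eta> (\<lambda>x. 0) (U j) t = Jt (Jt (ell j \<eta>)) t"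
proof (rule test_Pop_data[OF assms])
 fix C C' assume P1: "Pop_data \<eta> (\<lambda>x. 0) C" and P2: "Pop_data (\<lambda>x. deriv (deriv \<eta>) x - qq j x * \<eta> x) (\<lambda>x. 0) C'"
 note ab = less_imp_le[OF alt[OF j]] and Uj = U[of j]
 note c = test_fn_continuous012[OF \<eta>] and z = test_fn_zeros[OF \<eta>]
 have int: "interval_sys (a j) (a (Suc j)) T K (U j) (qq j) (H j) (H (Suc j))" by (rule weak_sys.interval_sys_at[OF weak_sys j])
 have e: "a j \<notin> {a j<..<a (Suc j)}" "a (Suc j) \<notin> {a j<..<a (Suc j)}" by auto
 show ?thesis
 proof (rule Jt_pow_strip[where k=2, OF Pop_data.Pop_L2c[OF P1 Uj ab] Jt_L2c[OF Jt_L2c[OF ell_L2c[OF assms]]]], intro AE_I2 impI)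
  fix \<sigma> assume "\<sigma> < T"
  then have \<sigma>: "\<sigma> \<le> T" by simp
  have 0: "pp 3 (\<sigma> - T) = 0" "pp 2 (\<sigma> - T) = 0" using \<sigma> by (simp_all add: pp_nonpos)
  have Crect: "C2_rect X I (\<lambda>x t. \<eta> x * pp 3 (\<sigma> - t)) (\<lambda>x t. deriv \<eta> x * pp 3 (\<sigma> - t)) (\<lambda>x t. \<eta> x * - pp 2 (\<sigma> - t))
   (\<lambda>x t. deriv (deriv \<eta>) x * pp 3 (\<sigma> - t)) (\<lambda>x t. deriv \<eta> x * - pp 2 (\<sigma> - t)) (\<lambda>x t. \<eta> x * pp 1 (\<sigma> - t))" for X I
   by (rule C2_rect_product[OF test_fn_DERIV01[OF \<eta>] c(3) pp_reflect_DERIV]) (intro continuous_intros)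
  have W: "(LBINT t:{0..T}. LBINT x. U j x t * (\<eta> x * pp 1 (\<sigma> - t) - deriv (deriv \<eta>) x * pp 3 (\<sigma> - t) + qq j x * (\<eta> x * pp 3 (\<sigma> - t)))) = 0"
   by (subst interval_sys.WI1[OF int Crect]) (simp_all add: 0 z[OF e(1)] z[OF e(2)])
  have ck: "continuous_on ({a j..a (Suc j)} \<times> {0..T}) (\<lambda>(x, t). \<eta> x * pp 1 (\<sigma> - t))"
   "continuous_on ({a j..a (Suc j)} \<times> {0..T}) (\<lambda>(x, t). - ((deriv (deriv \<eta>) x - Q j x * \<eta> x) * pp 3 (\<sigma> - t)))"
  proof -
   have f: "continuous_on ({a j..a (Suc j)} \<times> {0..T}) (\<lambda>z. g (fst z))" if "continuous_on {a j..a (Suc j)} g" for g :: "real \<Rightarrow> real"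
    by (rule continuous_on_compose2[OF that]) (auto intro: continuous_intros)
   show "continuous_on ({a j..a (Suc j)} \<times> {0..T}) (\<lambda>(x, t). \<eta> x * pp 1 (\<sigma> - t))"
    "continuous_on ({a j..a (Suc j)} \<times> {0..T}) (\<lambda>(x, t). - ((deriv (deriv \<eta>) x - Q j x * \<eta> x) * pp 3 (\<sigma> - t)))"
    unfolding case_prod_unfold by (intro continuous_intros f[OF c(1)] f[OF c(3)] f[OF Qc[OF j]])+
  qed
  have pw: "U j x t * (\<eta> x * pp 1 (\<sigma> - t) - deriv (deriv \<eta>) x * pp 3 (\<sigma> - t) + qq j x * (\<eta> x * pp 3 (\<sigma> - t)))
    = U j x t * (\<eta> x * pp 1 (\<sigma> - t)) + U j x t * - ((deriv (deriv \<eta>) x - Q j x * \<eta> x) * pp 3 (\<sigma> - t))" for x t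
   unfolding U_times by (simp add: algebra_simps)
  have "0 = (LBINT t:{0..T}. LBINT x. U j x t * (\<eta> x * pp 1 (\<sigma> - t)) + U j x t * - ((deriv (deriv \<eta>) x - Q j x * \<eta> x) * pp 3 (\<sigma> - t)))"
   using W unfolding pw by simp
  also have "\<dots> = (LBINT t:{0..T}. LBINT x. U j x t * (\<eta> x * pp 1 (\<sigma> - t))) + (LBINT t:{0..T}. LBINT x. U j x t * - ((deriv (deriv \<eta>) x - Q j x * \<eta> x) * pp 3 (\<sigma> - t)))"
   by (rule double_integral_lin[OF Uj Uj ab ck])
  also have "(LBINT t:{0..T}. LBINT x. U j x t * (\<eta> x * pp 1 (\<sigma> - t))) = (LBINT t:{0..T}. LBINT x. \<eta> x * U j x t * pp 1 (\<sigma> - 0 - t))"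
   by (simp add: mult_ac)
  also have "\<dots> = (Jt ^^ Suc 1) (Pop \<eta> (\<lambda>x. 0) (U j)) \<sigma>"
   by (rule Pop_data.Pop_pp[OF P1 Uj ab \<sigma>]) simp
  also have "(LBINT t:{0..T}. LBINT x. U j x t * - ((deriv (deriv \<eta>) x - Q j x * \<eta> x) * pp 3 (\<sigma> - t))) =
    (LBINT t:{0..T}. - (LBINT x. (deriv (deriv \<eta>) x - qq j x * \<eta> x) * U j x t * pp 3 (\<sigma> - 0 - t)))"
  proof -
   have "U j x t * - ((deriv (deriv \<eta>) x - Q j x * \<eta> x) * pp 3 (\<sigma> - t)) = - ((deriv (deriv \<eta>) x - qq j x * \<eta> x) * U j x t * pp 3 (\<sigma> - 0 - t))" for x t
    by (cases "x \<in> {a j<..<a (Suc j)}") (simp_all add: qq U_zero)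
   then show ?thesis by (simp only: Bochner_Integration.integral_minus)
  qed
  also have "\<dots> = - (Jt ^^ Suc 3) (ell j \<eta>) \<sigma>"
   unfolding Lint_minus ell_def by (subst Pop_data.Pop_pp[OF P2 Uj ab \<sigma>]) simp_all
  finally show "(Jt ^^ 2) (Pop \<eta> (\<lambda>x. 0) (U j)) \<sigma> = (Jt ^^ 2) (Jt (Jt (ell j \<eta>))) \<sigma>"
   by (simp add: eval_nat_numeral)
 qed
qed

lemma displacement_continuous:
 assumes j: "j \<le> N" and \<eta>: "\<eta> \<in> test_functions (a j) (a (Suc j))"
 shows "continuous_on {0..T} (\<lambda>t. displacement a u t j \<eta>)"
 unfolding continuous_on_def
proof
 fix t assume t: "t \<in> {0..T}"
 let ?M = "lebesgue_on {a j<..<a (Suc j)}"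
 define E where "E s = (LINT x|lebesgue_on {0<..<l}. (u s x - u t x)\<^sup>2)" for s
 define D where "D = sqrt (LINT x|?M. (\<eta> x)\<^sup>2)"
 have d: "displacement a u s j \<eta> = (LINT x|?M. u s x * \<eta> x)" for s by (simp add: displacement_def regular_distr_def)
 have b: "norm (displacement a u s j \<eta> - displacement a u t j \<eta>) \<le> sqrt (E s) * D" if s: "s \<in> {0..T}" for s
 proof -
  have m1: "- 1 * y = - y" for y :: real by simp
  have dL: "(\<lambda>x. u s x - u t x) \<in> L2 0 l" using L2_add[OF u[OF s] L2_cmult[OF u[OF t], of "- 1"]] unfolding m1 by simp
  note i = L2_mult_integrable[OF L2_subset(1)[OF u[OF s] sub[OF j]] test_fn_L2(1)[OF \<eta>]] L2_mult_integrable[OF L2_subset(1)[OF u[OF t] sub[OF j]] test_fn_L2(1)[OF \<eta>]]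
  have "displacement a u s j \<eta> - displacement a u t j \<eta> = (LINT x|?M. (u s x - u t x) * \<eta> x)"
   unfolding d left_diff_distrib by (rule Bochner_Integration.integral_diff[OF i, symmetric])
  also have "\<bar>\<dots>\<bar> \<le> sqrt (LINT x|?M. (u s x - u t x)\<^sup>2) * D"
   unfolding D_def by (rule L2_Cauchy_Schwarz[OF L2_subset(1)[OF dL sub[OF j]] test_fn_L2(1)[OF \<eta>]])
  also have "\<dots> \<le> sqrt (E s) * D"
   unfolding E_def D_def by (intro mult_right_mono real_sqrt_le_mono L2_subset(2)[OF dL sub[OF j]]) simp
  finally show ?thesis by simp
 qed
 have "((\<lambda>s. sqrt (E s) * D) \<longlongrightarrow> sqrt 0 * D) (at t within {0..T})"
  unfolding E_def by (intro tendsto_intros ucont[OF t])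
 then have "((\<lambda>s. sqrt (E s) * D) \<longlongrightarrow> 0) (at t within {0..T})" by simp
 moreover have "\<forall>\<^sub>F s in at t within {0..T}. norm (displacement a u s j \<eta> - displacement a u t j \<eta>) \<le> sqrt (E s) * D"
  using b by (auto simp: eventually_at_filter intro!: always_eventually)
 ultimately have "((\<lambda>s. displacement a u s j \<eta> - displacement a u t j \<eta>) \<longlongrightarrow> 0) (at t within {0..T})"
  by (rule Lim_null_comparison[rotated])
 then show "((\<lambda>t. displacement a u t j \<eta>) \<longlongrightarrow> displacement a u t j \<eta>) (at t within {0..T})"
  by (subst Lim_null)
qed

text \<open>Equality at almost every time extends to every time, T included, since both sides are
  continuous.\<close>

lemma displacement_eq:
 assumes j: "j \<le> N" and \<eta>: "\<eta> \<in> test_functions (a j) (a (Suc j))" and t: "t \<in> {0..T}"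
 shows "displacement a u t j \<eta> = Jt (Jt (ell j \<eta>)) t"
proof (rule continuous_AE_eq[OF displacement_continuous[OF j \<eta>] _ T _ t])
 show "continuous_on {0..T} (Jt (Jt (ell j \<eta>)))"
  by (rule continuous_on_subset[OF Jt_continuous[OF Jt_L2c[OF ell_L2c[OF j \<eta>]]]]) simp
 show "AE t in lborel. t \<in> {0<..<T} \<longrightarrow> displacement a u t j \<eta> = Jt (Jt (ell j \<eta>)) t"
  using pairing_AE[OF j \<eta>]
 proof eventually_elim
  case (elim t)
  show ?case
  proof
   assume t: "t \<in> {0<..<T}"
   then have t': "t \<in> {0..T}" "t \<in> {0<..T}" by auto
   have um: "u t \<in> borel_measurable (lebesgue_on {a j<..<a (Suc j)})"
    by (rule measurable_restrict_mono[OF _ sub[OF j]]) (use u[OF t'(1)] in \<open>simp add: L2_def\<close>)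
   have Um: "(\<lambda>x. UU x t) \<in> borel_measurable borel" by (rule Qc_measurable[OF UU]) simp_all
   have ae: "AE x in lborel. x \<in> {a j<..<a (Suc j)} \<longrightarrow> UU x t = u t x"
    using UUu[OF t'(2)] by eventually_elim (use sub[OF j] in blast)
   have "displacement a u t j \<eta> = (LBINT x. indicator {a j<..<a (Suc j)} x * (UU x t * \<eta> x))"
    unfolding displacement_def regular_distr_def Suc_eq_plus1[symmetric]
    by (rule Lint_version(1)[OF um Um ae test_fn_continuous012(1)[OF \<eta>]])
   also have "\<dots> = Pop \<eta> (\<lambda>x. 0) (U j) t"
    unfolding Pop_def by (intro LBINT_cong) (simp add: U_def)
   also have "\<dots> = Jt (Jt (ell j \<eta>)) t" using elim t by simp
   finally show "displacement a u t j \<eta> = Jt (Jt (ell j \<eta>)) t" .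
  qed
 qed
qed

text \<open>Each pairing is the primitive of the continuous function
  \<open>Jt (ell j \<eta>)\<close>, so its one-sided derivative at T exists.\<close>

lemma velocity: "is_velocity N a T u (\<lambda>j \<eta>. Jt (ell j \<eta>) T)"
 unfolding is_velocity_def Suc_eq_plus1[symmetric]
proof (intro allI impI ballI)
 fix j \<eta> assume j: "j \<le> N" and \<eta>: "\<eta> \<in> test_functions (a j) (a (Suc j))"
 have T': "T \<in> {0..T}" using T by simp
 have "(Jt (Jt (ell j \<eta>)) has_real_derivative Jt (ell j \<eta>) T) (at T within {0..T})"
  by (rule Jt_has_derivative[OF Jt_L2c[OF ell_L2c[OF j \<eta>]] continuous_on_subset[OF Jt_continuous[OF ell_L2c[OF j \<eta>]]] T']) simp
 then show "((\<lambda>t. displacement a u t j \<eta>) has_real_derivative Jt (ell j \<eta>) T) (at T within {0..T})"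
  by (rule has_field_derivative_transform_within[OF _ zero_less_one T']) (simp add: displacement_eq[OF j \<eta>])
qed

text \<open>The displacement is represented by \<open>C.G j j\<close> and the velocity by
  \<open>C.G j (j - 1)\<close> for j >= 1. Component 0 of the velocity need not be a function and is
  treated as a functional.\<close>

lemma final_state: "\<exists>v. is_velocity N a T u v \<and> (displacement a u T, v) \<in> W0 N a M q \<times> Wneg1 N a M q"
proof -
 from weak_sys.causal_chain[OF weak_sys] obtain v \<eta>0 \<eta>b A B where
  cd: "\<forall>j\<le>N. char_data (a j) (a (Suc j)) T K (qq j) (v j) (\<eta>0 j) (\<eta>b j) (A j) (B j)"
  and Uv: "\<forall>j\<le>N. AE x in lborel. AE t in lborel. t < T \<longrightarrow> U j x t = (Jt ^^ j) (v j x) t"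
  and link: "\<forall>j. 1 \<le> j \<longrightarrow> j \<le> N \<longrightarrow> (AE t in lborel. t < T \<longrightarrow> \<eta>b (j - 1) t = Jt (\<eta>0 j) t)"
  and mass: "\<forall>j. 1 \<le> j \<longrightarrow> j \<le> N \<longrightarrow> (AE t in lborel. t < T \<longrightarrow> M j * \<eta>0 j t = Jt (\<lambda>t. \<eta>0 j t - A j t) t - (B (j - 1) t - \<eta>b (j - 1) t))"
  and last: "AE t in lborel. t < T \<longrightarrow> \<eta>b N t = 0"
  by (elim exE conjE)
 have rep: "char_rep (a j) (a (Suc j)) T K (qq j) (v j) (\<eta>0 j) (\<eta>b j) (A j) (B j) (Q j) q" if j: "j \<le> N" for j
 proof (rule char_rep.intro)
  show "char_data (a j) (a (Suc j)) T K (qq j) (v j) (\<eta>0 j) (\<eta>b j) (A j) (B j)" using cd j by blast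
  show "char_rep_axioms (a j) (a (Suc j)) (qq j) (Q j) q" by (rule char_rep_axioms.intro) (use Qc[OF j] qq qQ[OF j] in auto)
 qed
 interpret C: char_chain N T K a M q qq Q v \<eta>0 \<eta>b A B
  by (rule char_chain.intro) (use N rep link mass last in blast)+
 \<comment> \<open>Index count: level j of the state plus r + 1 integrations of the pairing.\<close>
 have slice: "(Jt ^^ Suc r) (ell j \<eta>) T = (LBINT x:{a j..a (Suc j)}. C.G j (Suc (j + r)) x * (deriv (deriv \<eta>) x - Q j x * \<eta> x))"
  if j: "j \<le> N" and \<eta>: "\<eta> \<in> test_functions (a j) (a (Suc j))" for j r \<eta>
 proof (rule test_Pop_data[OF that])
  fix D D' assume P2: "Pop_data (\<lambda>x. deriv (deriv \<eta>) x - qq j x * \<eta> x) (\<lambda>x. 0) D'"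
  interpret R: char_rep "a j" "a (Suc j)" T K "qq j" "v j" "\<eta>0 j" "\<eta>b j" "A j" "B j" "Q j" q by (rule rep[OF j])
  have "(Jt ^^ Suc r) (ell j \<eta>) T = (LBINT x. (deriv (deriv \<eta>) x - qq j x * \<eta> x) * (Jt ^^ Suc r) (U j x) T)"
   unfolding ell_def Pop_data.Jt_pow_Pop[OF P2 U less_imp_le[OF alt[OF j]]] Pop_def by simp
  also have "\<dots> = (LBINT x:{a j..a (Suc j)}. R.GG (Suc (j + r)) x * (deriv (deriv \<eta>) x - qq j x * \<eta> x))"
  proof (rule R.time_slice[OF U])
   show "AE x in lborel. AE t in lborel. t < T \<longrightarrow> U j x t = (Jt ^^ j) (v j x) t" using Uv j by blast
   show "(\<lambda>x. deriv (deriv \<eta>) x - qq j x * \<eta> x) \<in> borel_measurable borel" by (rule Pop_data.\<kappa>[OF P2])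
  qed (simp add: test_fn_zeros[OF \<eta>])
  also have "\<dots> = (LBINT x:{a j..a (Suc j)}. R.GG (Suc (j + r)) x * (deriv (deriv \<eta>) x - Q j x * \<eta> x))"
   by (rule set_lebesgue_integral_cong) (simp_all add: qq)
  finally show ?thesis by (simp only: C.G_def)
 qed
 have T': "T \<in> {0..T}" using T by simp
 \<comment> \<open>The pairing is \<open>Jt\<close> applied twice to \<open>ell\<close>; moving L to
   the representative takes these two integrations away again.\<close>
 have disp: "displacement a u T j \<eta> = (LBINT x:{a j..a (Suc j)}. C.G j j x * \<eta> x)"
  if j: "j \<le> N" and \<eta>: "\<eta> \<in> test_functions (a j) (a (Suc j))" for j \<eta>
  using displacement_eq[OF that T'] slice[OF that, of 1] char_rep.GG_second_order[OF rep[OF j] \<eta>, of j] by (simp add: C.G_def)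
 \<comment> \<open>One integration fewer than for the displacement; since j >= 1 the index j + 1
   still allows L to remove two.\<close>
 have vel: "Jt (ell j \<eta>) T = (LBINT x:{a j..a (Suc j)}. C.G j (j - 1) x * \<eta> x)"
  if j: "1 \<le> j" "j \<le> N" and \<eta>: "\<eta> \<in> test_functions (a j) (a (Suc j))" for j \<eta>
  using slice[OF j(2) \<eta>, of 0] char_rep.GG_second_order[OF rep[OF j(2)] \<eta>, of "j - 1"] j(1) by (simp add: C.G_def)
 have GSob: "C.G j m \<in> sobolev m (a j) (a (Suc j))" if j: "j \<le> N" "m \<le> j" for j m
 proof -
  have "Ck_on (m - 2) (a j) (a (Suc j)) (Q j)" by (rule Ck_on_mono[OF Ck[OF j(1)]]) (use j in simp)
  then have "Sob m (a j) (a (Suc j)) (C.G j m)"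
   unfolding C.G_def by (rule char_data.GG_Sob[OF char_rep.axioms(1)[OF rep[OF j(1)]]]) (simp_all add: qq)
  then show ?thesis by (rule Sob_sobolev[OF _ less_imp_le[OF alt[OF j(1)]]])
 qed
 have rp: "represents (a j) (a (Suc j)) (C.G j m) \<Lambda>"
  if j: "j \<le> N" and R: "\<And>\<eta>. \<eta> \<in> test_functions (a j) (a (Suc j)) \<Longrightarrow> \<Lambda> \<eta> = (LBINT x:{a j..a (Suc j)}. C.G j m x * \<eta> x)" for j m \<Lambda>
  unfolding C.G_def by (rule char_rep.represents_GG[OF rep[OF j]]) (rule R[unfolded C.G_def])
 let ?v = "\<lambda>j \<eta>. Jt (ell j \<eta>) T"
 have "displacement a u T \<in> W0 N a M q"
  unfolding W0_def W0_tilde_def mem_Collect_eq sobolev_distr_def Suc_eq_plus1[symmetric]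
 proof (intro conjI allI impI)
  fix j assume j: "j \<le> N"
  have "represents (a j) (a (Suc j)) (C.G j j) (displacement a u T j)" by (rule rp[OF j disp[OF j]])
  then show "\<exists>g\<in>sobolev j (a j) (a (Suc j)). represents (a j) (a (Suc j)) g (displacement a u T j)"
   using GSob[OF j order_refl] by blast
 next
  show "cond_C_star N a M q 0 (displacement a u T)"
   using C.cond_C_star_G[of 0 "displacement a u T"] disp by simp
 qed
 moreover have "?v \<in> Wneg1 N a M q"
  unfolding Wneg1_def Wneg1_tilde_def mem_Collect_eq sobolev_distr_def Suc_eq_plus1[symmetric]
 proof (intro conjI ballI)
  \<comment> \<open>For component 0 the index is 1, so one derivative stays on the test function;
    \<open>R.gg (Suc 0)\<close> and \<open>Q 0\<close> times \<open>R.GG (Suc 0)\<close> are the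
    square integrable data of the functional.\<close>
  interpret R: char_rep "a 0" "a (Suc 0)" T K "qq 0" "v 0" "\<eta>0 0" "\<eta>b 0" "A 0" "B 0" "Q 0" q by (rule rep[OF le0])
  have G1: "C.G 0 = R.GG" by (simp add: C.G_def)
  have g: "R.gg (Suc 0) \<in> L2 (a 0) (a (Suc 0))" by (rule Sob0_L2[OF R.gg_Sob0[OF R.Q R.qQ]])
  have p: "(\<lambda>x. Q 0 x * R.GG (Suc 0) x) \<in> L2 (a 0) (a (Suc 0))"
   by (intro Sob0_L2 continuous_Sob0 continuous_intros R.Q AC_continuous[OF R.GG_AC])
  obtain F where F: "F \<in> H1_left_dual (a 0) (a (Suc 0))" "\<forall>\<eta>\<in>test_functions (a 0) (a (Suc 0)).
   F \<eta> = - (LINT x|lebesgue_on {a 0<..<a (Suc 0)}. R.gg (Suc 0) x * deriv \<eta> x) - (LINT x|lebesgue_on {a 0<..<a (Suc 0)}. Q 0 x * R.GG (Suc 0) x * \<eta> x)"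
   using H1_left_dual_ex[OF g p R.ab'] by blast
  have "Jt (ell 0 \<eta>) T = F \<eta>" if \<eta>: "\<eta> \<in> test_functions (a 0) (a (Suc 0))" for \<eta>
   using slice[OF le0 \<eta>, of 0] R.GG_first_order[OF \<eta>] F(2) \<eta> by (simp add: G1)
  then show "?v 0 \<in> theta_neg1 (a 0) (a 1)" using F(1) unfolding theta_neg1_def by auto
 next
  fix j assume "j \<in> {1..N}"
  then have j: "1 \<le> j" "j \<le> N" by auto
  have "represents (a j) (a (Suc j)) (C.G j (j - 1)) (?v j)" by (rule rp[OF j(2) vel[OF j]])
  then show "\<exists>g\<in>sobolev (j - 1) (a j) (a (Suc j)). represents (a j) (a (Suc j)) g (?v j)"
   using GSob[OF j(2), of "j - 1"] by auto
 next
  show "cond_C_star N a M q (- 1) ?v"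
   using C.cond_C_star_G[of 1 ?v] vel by simp
 qed
 ultimately show ?thesis using velocity by blast
qed

end

theorem theorem1:
  fixes N :: nat and l T :: real and a M :: "nat \<Rightarrow> real" and q :: "real \<Rightarrow> real"
  assumes "string_with_masses N l a M q" and "T > 0"
  shows "\<forall>f\<in>L2 0 T. \<forall>u h. weak_solution N l a M q T f u h \<longrightarrow>
           (\<exists>v. is_velocity N a T u v \<and>
                (displacement a u T, v) \<in> W0 N a M q \<times> Wneg1 N a M q)"
proof (intro ballI allI impI)
 fix f u h assume f: "f \<in> L2 0 T" and sol: "weak_solution N l a M q T f u h"
 interpret S: weak_sol N l a M q T f u h by unfold_locales (fact assms f sol)+
 from S.potential_ex obtain Q K where Q: "\<forall>j\<le>N. Ck_on (j - 2) (a j) (a (Suc j)) (Q j) \<and> (\<forall>x\<in>{a j<..<a (Suc j)}. q x = Q j x) \<and> (\<forall>x\<in>{a j..a (Suc j)}. \<bar>Q j x\<bar> \<le> K)"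
  by (elim exE)
 from S.state_ex obtain UU where UU: "UU \<in> Qc 0 l" "\<forall>t\<in>{0<..T}. AE x in lborel. x \<in> {0<..<l} \<longrightarrow> UU x t = u t x"
  by (elim exE conjE)
 from S.control_ex obtain H where H: "\<forall>j. H j \<in> L2c" "H (Suc N) = (\<lambda>t. 0)" "AE t in lborel. t \<in> {0<..<T} \<longrightarrow> H 0 t = f t"
  "\<forall>j\<in>{1..N}. AE t in lborel. t \<in> {0<..<T} \<longrightarrow> H j t = h j t"
  by (elim exE conjE)
 interpret D: weak_sol_data N l a M q T f u h Q K UU H
  by unfold_locales (use Q UU H in blast)+
 show "\<exists>v. is_velocity N a T u v \<and> (displacement a u T, v) \<in> W0 N a M q \<times> Wneg1 N a M q" by (rule D.final_state)
qed

end
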